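(* Let $X$ be a finite set and $\varphi:\mathcal{P}_{XX}\to\mathcal{P}_{XX}$ be a concurrent quantum non-local game. The following are equivalent for a QNS correlation $\Gamma:M_{XX}\to M_{XX}$: (i) $\Gamma$ is a perfect quantum commuting (resp. quantum, local) strategy for $\varphi$; (ii) there exists a trace $\tau$ of $\mathcal{C}_X$ (resp. a trace $\tau$ of $\mathcal{C}_X$ that factors through a finite dimensional *-representation, a trace $\tau$ of $\mathcal{C}_X$ that factors through an abelian *-representation) such that $$\Gamma(\epsilon_{x,x'}\otimes\epsilon_{y,y'})=\sum_{a,a',b,b'\in X}\tau(p_{x,x',a,a'}p_{y',y,b',b})\,\epsilon_{a,a'}\otimes\epsilon_{b,b'},\qquad x,x',y,y'\in X,$$ and $$\tau\big(\gamma_{P,\varphi(P)^{\perp}}(E\otimes E^{\rm op})\big)=0\quad\text{for all }P\in\mathcal{P}_{XX}.$$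
   Context: For a finite set $X$, $M_X$ is the algebra of complex $X\times X$ matrices with matrix units $\epsilon_{x,x'}$; $M_{XX}=M_X\otimes M_X$; $\mathcal{P}_{XX}$ is the lattice of projections in $M_{XX}$; $P^\perp=I-P$; $J_X=\frac1{|X|}\sum_{x,x'}\epsilon_{x,x'}\otimes\epsilon_{x,x'}$. A quantum non-local game is a join-preserving map $\varphi:\mathcal{P}_{XX}\to\mathcal{P}_{AA}$ with $\varphi(0)=0$; it is concurrent if $\varphi(J_X)=J_A$ (here $A=X$). A QNS (quantum no-signalling) correlation is a completely positive trace preserving map $\Gamma:M_{XX}\to M_{AA}$ such that tracing out the first output factor of $\Gamma(\rho\otimes\sigma)$ gives $0$ whenever $\operatorname{Tr}(\rho)=0$, and tracing out the second output factor gives $0$ whenever $\operatorname{Tr}(\sigma)=0$. It is a perfect strategy for $\varphi$ if $\operatorname{Tr}(\Gamma(P)\varphi(P)^\perp)=0$ for all $P\in\mathcal{P}_{XX}$. A stochastic operator matrix on a Hilbert space $H$ is a positive block operator matrix $(E_{x,x',a,a'})\in M_X\otimes M_A\otimes\mathcal{B}(H)$ with $\sum_aE_{x,x',a,a}=\delta_{x,x'}I$. $\Gamma$ is quantum commuting if $\Gamma(\epsilon_{x,x'}\otimes\epsilon_{y,y'})=\sum_{a,a',b,b'}\langle E_{x,x',a,a'}F_{y,y',b,b'}\xi,\xi\rangle\epsilon_{a,a'}\otimes\epsilon_{b,b'}$ for some unit vector $\xi\in H$ and stochastic operator matrices $(E_{x,x',a,a'})$, $(F_{y,y',b,b'})$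 on $H$ such that every $E_{x,x',a,a'}$ commutes with every $F_{y,y',b,b'}$; quantum if it has this form with $E_{x,x',a,a'}\otimes F_{y,y',b,b'}$ in place of the product, the two matrices acting on finite dimensional spaces $H_1,H_2$ and $\xi\in H_1\otimes H_2$ a unit vector; local if it is a convex combination $\sum_i\lambda_i\Phi_i\otimes\Psi_i$ of tensor products of quantum channels $\Phi_i,\Psi_i:M_X\to M_A$. Let $\mathcal{B}_X$ be the universal unital C*-algebra generated by elements $u_{a,x}$, $a,x\in X$, such that the matrix $(u_{a,x})_{a,x}$ is unitary (Brown algebra), and let $\mathcal{C}_X\subseteq\mathcal{B}_X$ be the C*-subalgebra generated by $p_{x,x',a,a'}=u_{a,x}^*u_{a',x'}$, $x,x',a,a'\in X$. A trace of $\mathcal{C}_X$ means a tracial state. Write $E=(p_{x,x',a,a'})_{x,x',a,a'}=\sum_{x,x',a,a'}\epsilon_{x,x'}\otimes\epsilon_{a,a'}\otimes p_{x,x',a,a'}$ and $E^{\rm op}=(p^{\rm op}_{y',y,b',b})_{y,y',b,b'}=\sum_{y,y',b,b'}\epsilon_{y,y'}\otimes\epsilon_{b,b'}\otimes p_{y',y,b',b}^{\rm op}$, where $z\mapsto z^{\rm op}$ is the identification of $\mathcal{C}_X$ with its opposite algebra. After shuffling tensor factors, $E\otimes E^{\rm op}$ is an element of the algebraic tensor product $M_{XX}\otimes M_{XX}\otimes\mathcal{C}_X\otimes\mathcal{C}_X^{\rm op}$ (the first $M_{XX}$ carries the indices $x,x',y,y'$, the second $a,a',b,b'$). For $P,Q\in\mathcal{P}_{XX}$,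 $\gamma_{P,Q}:M_{XX}\otimes M_{XX}\otimes\mathcal{C}_X\otimes\mathcal{C}_X^{\rm op}\to\mathcal{C}_X$ is the linear map with $$\gamma_{P,Q}(\omega\otimes u\otimes v^{\rm op})=\operatorname{Tr}\big(\omega(P\otimes Q)\big)uv,\qquad \omega\in M_{XX}\otimes M_{XX},\ u,v\in\mathcal{C}_X.$$ A tracial state $\tau$ factors through a finite dimensional (resp. abelian) *-representation if $\tau=\tau_0\circ\pi$ for a unital *-homomorphism $\pi$ into a finite dimensional (resp. abelian) C*-algebra with a tracial state $\tau_0$.
   Formalization: In (ii) the last condition is stated with the transpose of P as first index of γ, i.e. τ(γ_{P^T,φ(P)^⊥}(E⊗E^op))=0 for all P; as printed, with P, the equivalence fails for Γ and φ both the identity and |X|≥2. *)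

theory Defs
  imports "HOL-Analysis.Analysis" "HOL-Algebra.Module" "HOL-Library.Poly_Mapping"
begin

section \<open>Matrices over a finite index type\<close>

type_synonym 'i cmat = "complex^'i^'i"

definition cscale :: "complex \<Rightarrow> 'i::finite cmat \<Rightarrow> 'i cmat" where
  "cscale c A = (\<chi> i j. c * A $ i $ j)"

definition mat_unit :: "'i::finite \<Rightarrow> 'i \<Rightarrow> 'i cmat" where
  "mat_unit k l = (\<chi> i j. if i = k \<and> j = l then 1 else 0)"

definition mat_adj :: "'i::finite cmat \<Rightarrow> 'i cmat" where
  "mat_adj A = (\<chi> i j. cnj (A $ j $ i))"

text \<open>The identification of the tensor product of two matrix algebras with the matrices
  over the product index type.\<close>

definition kron :: "'i::finite cmat \<Rightarrow> 'j::finite cmat \<Rightarrow> ('i \<times> 'j) cmat" where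
  "kron A B = (\<chi> p q. A $ fst p $ fst q * B $ snd p $ snd q)"

definition ptrace_fst :: "('i::finite \<times> 'j::finite) cmat \<Rightarrow> 'j cmat" where
  "ptrace_fst W = (\<chi> b b'. \<Sum>a\<in>UNIV. W $ (a, b) $ (a, b'))"

definition ptrace_snd :: "('i::finite \<times> 'j::finite) cmat \<Rightarrow> 'i cmat" where
  "ptrace_snd W = (\<chi> a a'. \<Sum>b\<in>UNIV. W $ (a, b) $ (a', b))"

definition cinner :: "complex^'i::finite \<Rightarrow> complex^'i \<Rightarrow> complex" where
  "cinner v w = (\<Sum>i\<in>UNIV. v $ i * cnj (w $ i))"

definition psd :: "'i::finite cmat \<Rightarrow> bool" where
  "psd A \<longleftrightarrow> (\<forall>v. cinner (A *v v) v \<in> \<real>\<^sub>\<ge>\<^sub>0)"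

definition projections :: "'i::finite cmat set" where
  "projections = {P. P ** P = P \<and> mat_adj P = P}"

definition proj_lattice :: "'i::finite cmat gorder" where
  "proj_lattice = \<lparr>carrier = projections, eq = (=), le = (\<lambda>P Q. psd (Q - P))\<rparr>"

definition proj_perp :: "'i::finite cmat \<Rightarrow> 'i cmat" where
  "proj_perp P = mat 1 - P"

definition max_ent :: "('i::finite \<times> 'i) cmat" where
  "max_ent = cscale (1 / of_nat CARD('i))
     (\<Sum>x\<in>UNIV. \<Sum>x'\<in>UNIV. kron (mat_unit x x') (mat_unit x x'))"

section \<open>Channels and no-signalling correlations\<close>

definition clinear_mat :: "('i::finite cmat \<Rightarrow> 'j::finite cmat) \<Rightarrow> bool" where
  "clinear_mat \<Phi> \<longleftrightarrow> (\<forall>A B. \<Phi> (A + B) = \<Phi> A + \<Phi> B) \<and> (\<forall>c A. \<Phi> (cscale c A) = cscale c (\<Phi> A))"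

text \<open>Positivity of an \<open>n\<close> by \<open>n\<close> block matrix, as an operator on the direct sum of \<open>n\<close>
  copies of the underlying space.\<close>

definition block_psd :: "nat \<Rightarrow> (nat \<Rightarrow> nat \<Rightarrow> 'i::finite cmat) \<Rightarrow> bool" where
  "block_psd n R \<longleftrightarrow>
     (\<forall>v::nat \<Rightarrow> complex^'i. (\<Sum>i<n. \<Sum>j<n. cinner (R i j *v v j) (v i)) \<in> \<real>\<^sub>\<ge>\<^sub>0)"

definition completely_positive :: "('i::finite cmat \<Rightarrow> 'j::finite cmat) \<Rightarrow> bool" where
  "completely_positive \<Phi> \<longleftrightarrow>
     (\<forall>n R. block_psd n R \<longrightarrow> block_psd n (\<lambda>i j. \<Phi> (R i j)))"

definition quantum_channel :: "('i::finite cmat \<Rightarrow> 'j::finite cmat) \<Rightarrow> bool" where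
  "quantum_channel \<Phi> \<longleftrightarrow>
     clinear_mat \<Phi> \<and> completely_positive \<Phi> \<and> (\<forall>A. trace (\<Phi> A) = trace A)"

definition qns_correlation ::
  "(('x::finite \<times> 'x) cmat \<Rightarrow> ('a::finite \<times> 'a) cmat) \<Rightarrow> bool" where
  "qns_correlation \<Gamma> \<longleftrightarrow> quantum_channel \<Gamma>
     \<and> (\<forall>\<rho> \<sigma>. trace \<rho> = 0 \<longrightarrow> ptrace_fst (\<Gamma> (kron \<rho> \<sigma>)) = 0)
     \<and> (\<forall>\<rho> \<sigma>. trace \<sigma> = 0 \<longrightarrow> ptrace_snd (\<Gamma> (kron \<rho> \<sigma>)) = 0)"

definition channel_tensor ::
  "('i::finite cmat \<Rightarrow> 'j::finite cmat) \<Rightarrow> ('k::finite cmat \<Rightarrow> 'l::finite cmat)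
     \<Rightarrow> ('i \<times> 'k) cmat \<Rightarrow> ('j \<times> 'l) cmat" where
  "channel_tensor \<Phi> \<Psi> W = (\<Sum>x\<in>UNIV. \<Sum>x'\<in>UNIV. \<Sum>y\<in>UNIV. \<Sum>y'\<in>UNIV.
     cscale (W $ (x, y) $ (x', y')) (kron (\<Phi> (mat_unit x x')) (\<Psi> (mat_unit y y'))))"

definition local_correlation ::
  "(('x::finite \<times> 'x) cmat \<Rightarrow> ('a::finite \<times> 'a) cmat) \<Rightarrow> bool" where
  "local_correlation \<Gamma> \<longleftrightarrow>
     (\<exists>(n::nat) (w::nat \<Rightarrow> real) (\<Phi>::nat \<Rightarrow> 'x cmat \<Rightarrow> 'a cmat) (\<Psi>::nat \<Rightarrow> 'x cmat \<Rightarrow> 'a cmat).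
        (\<forall>i<n. 0 \<le> w i \<and> quantum_channel (\<Phi> i) \<and> quantum_channel (\<Psi> i)) \<and> (\<Sum>i<n. w i) = 1 \<and>
        (\<forall>W. \<Gamma> W = (\<Sum>i<n. cscale (of_real (w i)) (channel_tensor (\<Phi> i) (\<Psi> i) W))))"

section \<open>Quantum non-local games\<close>

definition quantum_game ::
  "(('x::finite \<times> 'x) cmat \<Rightarrow> ('a::finite \<times> 'a) cmat) \<Rightarrow> bool" where
  "quantum_game \<phi> \<longleftrightarrow> \<phi> \<in> projections \<rightarrow> projections \<and> \<phi> 0 = 0
     \<and> (\<forall>S Q. S \<subseteq> projections \<longrightarrow> least proj_lattice Q (Upper proj_lattice S)
            \<longrightarrow> least proj_lattice (\<phi> Q) (Upper proj_lattice (\<phi> ` S)))"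

definition concurrent :: "(('x::finite \<times> 'x) cmat \<Rightarrow> ('x \<times> 'x) cmat) \<Rightarrow> bool" where
  "concurrent \<phi> \<longleftrightarrow> \<phi> max_ent = max_ent"

definition perfect_strategy ::
  "(('x::finite \<times> 'x) cmat \<Rightarrow> ('a::finite \<times> 'a) cmat)
     \<Rightarrow> (('x \<times> 'x) cmat \<Rightarrow> ('a \<times> 'a) cmat) \<Rightarrow> bool" where
  "perfect_strategy \<phi> \<Gamma> \<longleftrightarrow> (\<forall>P\<in>projections. trace (\<Gamma> P ** proj_perp (\<phi> P)) = 0)"

section \<open>Complex Hilbert spaces\<close>

definition complex_ring :: "complex ring" where
  "complex_ring = \<lparr>carrier = UNIV, mult = (*), one = 1, zero = 0, add = (+)\<rparr>"

text \<open>Distances are set to 0 outside the carrier because the locale \<open>Metric_space\<close> wants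
  symmetry and nonnegativity on the whole type.\<close>

definition norm_dist ::
  "('a, 'm) ring_scheme \<Rightarrow> ('a \<Rightarrow> real) \<Rightarrow> 'a \<Rightarrow> 'a \<Rightarrow> real" where
  "norm_dist V N x y =
     (if x \<in> carrier V \<and> y \<in> carrier V then N (x \<ominus>\<^bsub>V\<^esub> y) else 0)"

text \<open>As for modules in HOL-Algebra, the fields \<open>mult\<close> and \<open>one\<close> of a Hilbert space
  carry no meaning. The inner product is linear in its first argument.\<close>

record 'h hspace = "(complex, 'h) module" +
  iprod :: "'h \<Rightarrow> 'h \<Rightarrow> complex"

definition hnorm :: "('h, 'm) hspace_scheme \<Rightarrow> 'h \<Rightarrow> real" where
  "hnorm H x = sqrt (Re (iprod H x x))"

locale hilbert_space = module complex_ring H for H (structure) +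
  assumes iprod_add: "\<lbrakk>x \<in> carrier H; y \<in> carrier H; z \<in> carrier H\<rbrakk>
      \<Longrightarrow> iprod H (x \<oplus> y) z = iprod H x z + iprod H y z"
    and iprod_smult: "\<lbrakk>x \<in> carrier H; y \<in> carrier H\<rbrakk>
      \<Longrightarrow> iprod H (c \<odot> x) y = c * iprod H x y"
    and iprod_cnj: "\<lbrakk>x \<in> carrier H; y \<in> carrier H\<rbrakk> \<Longrightarrow> iprod H y x = cnj (iprod H x y)"
    and iprod_nonneg: "x \<in> carrier H \<Longrightarrow> iprod H x x \<in> \<real>\<^sub>\<ge>\<^sub>0"
    and iprod_definite: "\<lbrakk>x \<in> carrier H; iprod H x x = 0\<rbrakk> \<Longrightarrow> x = \<zero>"
    and hnorm_complete: "Metric_space.mcomplete (carrier H) (norm_dist H (hnorm H))"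

definition finite_dimensional :: "(complex, 'v, 'm) module_scheme \<Rightarrow> bool" where
  "finite_dimensional V \<longleftrightarrow> (\<exists>S. finite S \<and> S \<subseteq> carrier V
     \<and> (\<forall>x\<in>carrier V. \<exists>c. x = (\<Oplus>\<^bsub>V\<^esub>s\<in>S. c s \<odot>\<^bsub>V\<^esub> s)))"

text \<open>Operators on \<open>H\<close> are functions of which only the restriction to the carrier matters.\<close>

definition bounded_operator :: "('h, 'm) hspace_scheme \<Rightarrow> ('h \<Rightarrow> 'h) \<Rightarrow> bool" where
  "bounded_operator H T \<longleftrightarrow> T \<in> carrier H \<rightarrow> carrier H
     \<and> (\<forall>x\<in>carrier H. \<forall>y\<in>carrier H. T (x \<oplus>\<^bsub>H\<^esub> y) = T x \<oplus>\<^bsub>H\<^esub> T y)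
     \<and> (\<forall>c. \<forall>x\<in>carrier H. T (c \<odot>\<^bsub>H\<^esub> x) = c \<odot>\<^bsub>H\<^esub> T x)
     \<and> (\<exists>K. \<forall>x\<in>carrier H. hnorm H (T x) \<le> K * hnorm H x)"

text \<open>\<open>E x x' a a'\<close> is the coefficient of the matrix units \<open>(x, x')\<close> and \<open>(a, a')\<close>; the
  second conjunct is positivity as an operator on the direct sum of copies of \<open>H\<close> indexed by
  the pairs \<open>(x, a)\<close>.\<close>

definition stochastic_operator_matrix ::
  "('h, 'm) hspace_scheme \<Rightarrow> ('x::finite \<Rightarrow> 'x \<Rightarrow> 'a::finite \<Rightarrow> 'a \<Rightarrow> 'h \<Rightarrow> 'h) \<Rightarrow> bool" where
  "stochastic_operator_matrix H E \<longleftrightarrow>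
     (\<forall>x x' a a'. bounded_operator H (E x x' a a'))
     \<and> (\<forall>v. (\<forall>x a. v x a \<in> carrier H) \<longrightarrow>
          (\<Sum>x\<in>UNIV. \<Sum>a\<in>UNIV. \<Sum>x'\<in>UNIV. \<Sum>a'\<in>UNIV.
             iprod H (E x x' a a' (v x' a')) (v x a)) \<in> \<real>\<^sub>\<ge>\<^sub>0)
     \<and> (\<forall>x x'. \<forall>h\<in>carrier H.
          (\<Oplus>\<^bsub>H\<^esub>a\<in>UNIV. E x x' a a h) = (if x = x' then h else \<zero>\<^bsub>H\<^esub>))"

text \<open>HOL cannot quantify over types, so the Hilbert spaces in the next definitions have their
  carriers in a type \<open>'h\<close> that is a parameter of the notion.\<close>

definition quantum_commuting ::
  "'h itself \<Rightarrow> (('x::finite \<times> 'x) cmat \<Rightarrow> ('a::finite \<times> 'a) cmat) \<Rightarrow> bool" where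
  "quantum_commuting (_::'h itself) \<Gamma> \<longleftrightarrow>
     (\<exists>(H::'h hspace) (E::'x \<Rightarrow> 'x \<Rightarrow> 'a \<Rightarrow> 'a \<Rightarrow> 'h \<Rightarrow> 'h) (F::'x \<Rightarrow> 'x \<Rightarrow> 'a \<Rightarrow> 'a \<Rightarrow> 'h \<Rightarrow> 'h) \<xi>.
        hilbert_space H \<and> stochastic_operator_matrix H E \<and> stochastic_operator_matrix H F
        \<and> (\<forall>x x' a a' y y' b b'. \<forall>h\<in>carrier H.
             E x x' a a' (F y y' b b' h) = F y y' b b' (E x x' a a' h))
        \<and> \<xi> \<in> carrier H \<and> hnorm H \<xi> = 1
        \<and> (\<forall>x x' y y'. \<Gamma> (kron (mat_unit x x') (mat_unit y y')) =
             (\<Sum>a\<in>UNIV. \<Sum>a'\<in>UNIV. \<Sum>b\<in>UNIV. \<Sum>b'\<in>UNIV.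
                cscale (iprod H (E x x' a a' (F y y' b b' \<xi>)) \<xi>)
                  (kron (mat_unit a a') (mat_unit b b')))))"

text \<open>\<open>K\<close> with \<open>t\<close> is a model of the algebraic tensor product of \<open>H1\<close> and \<open>H2\<close> with its
  inner product; for finite dimensional spaces this is the Hilbert space tensor product.\<close>

definition is_tensor_product ::
  "'h1 hspace \<Rightarrow> 'h2 hspace \<Rightarrow> 'k hspace \<Rightarrow> ('h1 \<Rightarrow> 'h2 \<Rightarrow> 'k) \<Rightarrow> bool" where
  "is_tensor_product H1 H2 K t \<longleftrightarrow>
     hilbert_space H1 \<and> hilbert_space H2 \<and> hilbert_space K
     \<and> (\<forall>h\<in>carrier H1. \<forall>k\<in>carrier H2. t h k \<in> carrier K)
     \<and> (\<forall>h\<in>carrier H1. \<forall>h'\<in>carrier H1. \<forall>k\<in>carrier H2.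
          t (h \<oplus>\<^bsub>H1\<^esub> h') k = t h k \<oplus>\<^bsub>K\<^esub> t h' k)
     \<and> (\<forall>h\<in>carrier H1. \<forall>k\<in>carrier H2. \<forall>k'\<in>carrier H2.
          t h (k \<oplus>\<^bsub>H2\<^esub> k') = t h k \<oplus>\<^bsub>K\<^esub> t h k')
     \<and> (\<forall>c. \<forall>h\<in>carrier H1. \<forall>k\<in>carrier H2.
          t (c \<odot>\<^bsub>H1\<^esub> h) k = c \<odot>\<^bsub>K\<^esub> t h k \<and> t h (c \<odot>\<^bsub>H2\<^esub> k) = c \<odot>\<^bsub>K\<^esub> t h k)
     \<and> (\<forall>h\<in>carrier H1. \<forall>h'\<in>carrier H1. \<forall>k\<in>carrier H2. \<forall>k'\<in>carrier H2.
          iprod K (t h k) (t h' k') = iprod H1 h h' * iprod H2 k k')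
     \<and> (\<forall>z\<in>carrier K. \<exists>(n::nat) f g. f \<in> {..<n} \<rightarrow> carrier H1 \<and> g \<in> {..<n} \<rightarrow> carrier H2
          \<and> z = (\<Oplus>\<^bsub>K\<^esub>i\<in>{..<n}. t (f i) (g i)))"

definition is_operator_tensor ::
  "'h1 hspace \<Rightarrow> 'h2 hspace \<Rightarrow> 'k hspace \<Rightarrow> ('h1 \<Rightarrow> 'h2 \<Rightarrow> 'k)
     \<Rightarrow> ('h1 \<Rightarrow> 'h1) \<Rightarrow> ('h2 \<Rightarrow> 'h2) \<Rightarrow> ('k \<Rightarrow> 'k) \<Rightarrow> bool" where
  "is_operator_tensor H1 H2 K t S T G \<longleftrightarrow> bounded_operator K G
     \<and> (\<forall>h\<in>carrier H1. \<forall>k\<in>carrier H2. G (t h k) = t (S h) (T k))"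

definition quantum_correlation ::
  "'h itself \<Rightarrow> (('x::finite \<times> 'x) cmat \<Rightarrow> ('a::finite \<times> 'a) cmat) \<Rightarrow> bool" where
  "quantum_correlation (_::'h itself) \<Gamma> \<longleftrightarrow>
     (\<exists>(H1::'h hspace) (H2::'h hspace) (K::'h hspace) t
        (E::'x \<Rightarrow> 'x \<Rightarrow> 'a \<Rightarrow> 'a \<Rightarrow> 'h \<Rightarrow> 'h) (F::'x \<Rightarrow> 'x \<Rightarrow> 'a \<Rightarrow> 'a \<Rightarrow> 'h \<Rightarrow> 'h) G \<xi>.
        finite_dimensional H1 \<and> finite_dimensional H2 \<and> is_tensor_product H1 H2 K t
        \<and> stochastic_operator_matrix H1 E \<and> stochastic_operator_matrix H2 F
        \<and> (\<forall>x x' a a' y y' b b'. is_operator_tensor H1 H2 K t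
             (E x x' a a') (F y y' b b') (G x x' a a' y y' b b'))
        \<and> \<xi> \<in> carrier K \<and> hnorm K \<xi> = 1
        \<and> (\<forall>x x' y y'. \<Gamma> (kron (mat_unit x x') (mat_unit y y')) =
             (\<Sum>a\<in>UNIV. \<Sum>a'\<in>UNIV. \<Sum>b\<in>UNIV. \<Sum>b'\<in>UNIV.
                cscale (iprod K (G x x' a a' y y' b b' \<xi>) \<xi>)
                  (kron (mat_unit a a') (mat_unit b b')))))"

section \<open>Unital C*-algebras\<close>

record 'c cstar = "(complex, 'c) module" +
  star :: "'c \<Rightarrow> 'c"
  cnorm :: "'c \<Rightarrow> real"

locale cstar_algebra = module complex_ring A + ring A for A (structure) +
  assumes one_not_zero: "\<one> \<noteq> \<zero>"
    and smult_mult_left: "\<lbrakk>x \<in> carrier A; y \<in> carrier A\<rbrakk> \<Longrightarrow> (c \<odot> x) \<otimes> y = c \<odot> (x \<otimes> y)"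
    and smult_mult_right: "\<lbrakk>x \<in> carrier A; y \<in> carrier A\<rbrakk> \<Longrightarrow> x \<otimes> (c \<odot> y) = c \<odot> (x \<otimes> y)"
    and star_closed: "x \<in> carrier A \<Longrightarrow> star A x \<in> carrier A"
    and star_star: "x \<in> carrier A \<Longrightarrow> star A (star A x) = x"
    and star_add: "\<lbrakk>x \<in> carrier A; y \<in> carrier A\<rbrakk> \<Longrightarrow> star A (x \<oplus> y) = star A x \<oplus> star A y"
    and star_smult: "x \<in> carrier A \<Longrightarrow> star A (c \<odot> x) = cnj c \<odot> star A x"
    and star_mult: "\<lbrakk>x \<in> carrier A; y \<in> carrier A\<rbrakk> \<Longrightarrow> star A (x \<otimes> y) = star A y \<otimes> star A x"
    and cnorm_nonneg: "x \<in> carrier A \<Longrightarrow> 0 \<le> cnorm A x"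
    and cnorm_definite: "\<lbrakk>x \<in> carrier A; cnorm A x = 0\<rbrakk> \<Longrightarrow> x = \<zero>"
    and cnorm_smult: "x \<in> carrier A \<Longrightarrow> cnorm A (c \<odot> x) = cmod c * cnorm A x"
    and cnorm_triangle: "\<lbrakk>x \<in> carrier A; y \<in> carrier A\<rbrakk>
      \<Longrightarrow> cnorm A (x \<oplus> y) \<le> cnorm A x + cnorm A y"
    and cnorm_mult: "\<lbrakk>x \<in> carrier A; y \<in> carrier A\<rbrakk> \<Longrightarrow> cnorm A (x \<otimes> y) \<le> cnorm A x * cnorm A y"
    and cnorm_star: "x \<in> carrier A \<Longrightarrow> cnorm A (star A x \<otimes> x) = (cnorm A x)\<^sup>2"
    and cnorm_complete: "Metric_space.mcomplete (carrier A) (norm_dist A (cnorm A))"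

definition star_hom :: "'c cstar \<Rightarrow> 'd cstar \<Rightarrow> ('c \<Rightarrow> 'd) \<Rightarrow> bool" where
  "star_hom A D \<pi> \<longleftrightarrow> \<pi> \<in> ring_hom A D
     \<and> (\<forall>c. \<forall>x\<in>carrier A. \<pi> (c \<odot>\<^bsub>A\<^esub> x) = c \<odot>\<^bsub>D\<^esub> \<pi> x)
     \<and> (\<forall>x\<in>carrier A. \<pi> (star A x) = star D (\<pi> x))"

definition cstar_subalgebra :: "'c cstar \<Rightarrow> 'c set \<Rightarrow> bool" where
  "cstar_subalgebra A S \<longleftrightarrow> S \<subseteq> carrier A \<and> \<zero>\<^bsub>A\<^esub> \<in> S
     \<and> (\<forall>x\<in>S. \<forall>y\<in>S. x \<oplus>\<^bsub>A\<^esub> y \<in> S \<and> x \<otimes>\<^bsub>A\<^esub> y \<in> S)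
     \<and> (\<forall>c. \<forall>x\<in>S. c \<odot>\<^bsub>A\<^esub> x \<in> S) \<and> (\<forall>x\<in>S. star A x \<in> S)
     \<and> closedin (Metric_space.mtopology (carrier A) (norm_dist A (cnorm A))) S"

definition cstar_generated :: "'c cstar \<Rightarrow> 'c set \<Rightarrow> 'c set" where
  "cstar_generated A G = \<Inter>{S. cstar_subalgebra A S \<and> G \<subseteq> S}"

definition tracial_state :: "'c cstar \<Rightarrow> ('c \<Rightarrow> complex) \<Rightarrow> bool" where
  "tracial_state A \<tau> \<longleftrightarrow>
     (\<forall>x\<in>carrier A. \<forall>y\<in>carrier A. \<tau> (x \<oplus>\<^bsub>A\<^esub> y) = \<tau> x + \<tau> y)
     \<and> (\<forall>c. \<forall>x\<in>carrier A. \<tau> (c \<odot>\<^bsub>A\<^esub> x) = c * \<tau> x)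
     \<and> (\<forall>x\<in>carrier A. \<tau> (star A x \<otimes>\<^bsub>A\<^esub> x) \<in> \<real>\<^sub>\<ge>\<^sub>0) \<and> \<tau> \<one>\<^bsub>A\<^esub> = 1
     \<and> (\<forall>x\<in>carrier A. \<forall>y\<in>carrier A. \<tau> (x \<otimes>\<^bsub>A\<^esub> y) = \<tau> (y \<otimes>\<^bsub>A\<^esub> x))"

definition factors_finite_dim :: "'d itself \<Rightarrow> 'c cstar \<Rightarrow> ('c \<Rightarrow> complex) \<Rightarrow> bool" where
  "factors_finite_dim (_::'d itself) A \<tau> \<longleftrightarrow>
     (\<exists>(D::'d cstar) \<tau>\<^sub>0 \<pi>. cstar_algebra D \<and> finite_dimensional D \<and> tracial_state D \<tau>\<^sub>0
        \<and> star_hom A D \<pi> \<and> (\<forall>x\<in>carrier A. \<tau> x = \<tau>\<^sub>0 (\<pi> x)))"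

definition factors_abelian :: "'d itself \<Rightarrow> 'c cstar \<Rightarrow> ('c \<Rightarrow> complex) \<Rightarrow> bool" where
  "factors_abelian (_::'d itself) A \<tau> \<longleftrightarrow>
     (\<exists>(D::'d cstar) \<tau>\<^sub>0 \<pi>. cstar_algebra D \<and> (\<forall>x\<in>carrier D. \<forall>y\<in>carrier D. x \<otimes>\<^bsub>D\<^esub> y = y \<otimes>\<^bsub>D\<^esub> x)
        \<and> tracial_state D \<tau>\<^sub>0 \<and> star_hom A D \<pi> \<and> (\<forall>x\<in>carrier A. \<tau> x = \<tau>\<^sub>0 (\<pi> x)))"

section \<open>The Brown algebra\<close>

definition unitary_matrix :: "'c cstar \<Rightarrow> ('x::finite \<Rightarrow> 'x \<Rightarrow> 'c) \<Rightarrow> bool" where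
  "unitary_matrix A u \<longleftrightarrow> (\<forall>a x. u a x \<in> carrier A)
     \<and> (\<forall>x x'. (\<Oplus>\<^bsub>A\<^esub>a\<in>UNIV. star A (u a x) \<otimes>\<^bsub>A\<^esub> u a x') = (if x = x' then \<one>\<^bsub>A\<^esub> else \<zero>\<^bsub>A\<^esub>))
     \<and> (\<forall>a a'. (\<Oplus>\<^bsub>A\<^esub>x\<in>UNIV. u a x \<otimes>\<^bsub>A\<^esub> star A (u a' x)) = (if a = a' then \<one>\<^bsub>A\<^esub> else \<zero>\<^bsub>A\<^esub>))"

text \<open>The universal property is tested on C*-algebras with carrier in \<open>'d\<close>. The Brown algebra
  is separable, so this determines it up to isomorphism as soon as \<open>'d\<close> can carry a copy of
  every separable C*-algebra, that is, has at least the cardinality of the continuum.\<close>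

definition brown_algebra :: "'d itself \<Rightarrow> 'c cstar \<Rightarrow> ('x::finite \<Rightarrow> 'x \<Rightarrow> 'c) \<Rightarrow> bool" where
  "brown_algebra (_::'d itself) B u \<longleftrightarrow> cstar_algebra B \<and> unitary_matrix B u
     \<and> cstar_generated B {u a x |a x. True} = carrier B
     \<and> (\<forall>(D::'d cstar) v. cstar_algebra D \<longrightarrow> unitary_matrix D v
          \<longrightarrow> (\<exists>\<pi>. star_hom B D \<pi> \<and> (\<forall>a x. \<pi> (u a x) = v a x)))"

definition brown_p :: "'c cstar \<Rightarrow> ('x \<Rightarrow> 'x \<Rightarrow> 'c) \<Rightarrow> 'x \<Rightarrow> 'x \<Rightarrow> 'x \<Rightarrow> 'x \<Rightarrow> 'c" where
  "brown_p B u x x' a a' = star B (u a x) \<otimes>\<^bsub>B\<^esub> u a' x'"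

text \<open>The unit of the Brown algebra lies in this subalgebra, as the sum over \<open>a\<close> of
  \<open>brown_p B u x x a a\<close>.\<close>

definition brown_sub :: "'c cstar \<Rightarrow> ('x \<Rightarrow> 'x \<Rightarrow> 'c) \<Rightarrow> 'c cstar" where
  "brown_sub B u = B\<lparr>carrier := cstar_generated B {brown_p B u x x' a a' |x x' a a'. True}\<rparr>"

section \<open>The map gamma\<close>

text \<open>Elements of an algebraic tensor product are given by representatives in the free vector
  space on the elementary tensors: \<open>Poly_Mapping.single (\<omega>, u, v) c\<close> represents \<open>c\<close> times the
  tensor of \<open>\<omega>\<close>, \<open>u\<close> and \<open>v\<close>. An algebra and its opposite have the same elements, so \<open>v\<close> also
  denotes its image in the opposite algebra.\<close>

definition tensor_E ::
  "('x::finite \<Rightarrow> 'x \<Rightarrow> 'x \<Rightarrow> 'x \<Rightarrow> 'c) \<Rightarrow> ('x cmat \<times> 'x cmat \<times> 'c) \<Rightarrow>\<^sub>0 complex" where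
  "tensor_E p = (\<Sum>x\<in>UNIV. \<Sum>x'\<in>UNIV. \<Sum>a\<in>UNIV. \<Sum>a'\<in>UNIV.
     Poly_Mapping.single (mat_unit x x', mat_unit a a', p x x' a a') 1)"

definition tensor_E_op ::
  "('x::finite \<Rightarrow> 'x \<Rightarrow> 'x \<Rightarrow> 'x \<Rightarrow> 'c) \<Rightarrow> ('x cmat \<times> 'x cmat \<times> 'c) \<Rightarrow>\<^sub>0 complex" where
  "tensor_E_op p = (\<Sum>y\<in>UNIV. \<Sum>y'\<in>UNIV. \<Sum>b\<in>UNIV. \<Sum>b'\<in>UNIV.
     Poly_Mapping.single (mat_unit y y', mat_unit b b', p y' y b' b) 1)"

text \<open>The tensor product followed by the shuffle that collects the \<open>x, y\<close> factors and the
  \<open>a, b\<close> factors.\<close>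

definition shuffle_tensor ::
  "(('x::finite cmat \<times> 'x cmat \<times> 'c) \<Rightarrow>\<^sub>0 complex) \<Rightarrow> (('x cmat \<times> 'x cmat \<times> 'c) \<Rightarrow>\<^sub>0 complex)
     \<Rightarrow> ((('x \<times> 'x) \<times> ('x \<times> 'x)) cmat \<times> 'c \<times> 'c) \<Rightarrow>\<^sub>0 complex" where
  "shuffle_tensor s r = (\<Sum>(A, C, u)\<in>Poly_Mapping.keys s. \<Sum>(A', C', v)\<in>Poly_Mapping.keys r.
     Poly_Mapping.single (kron (kron A A') (kron C C'), u, v)
       (Poly_Mapping.lookup s (A, C, u) * Poly_Mapping.lookup r (A', C', v)))"

text \<open>The linear extension of \<open>(\<omega>, u, v) \<mapsto> Tr (\<omega> (P \<otimes> Q)) u v\<close>. As that expression is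
  multilinear, the value depends only on the tensor represented.\<close>

definition gamma_map ::
  "'c cstar \<Rightarrow> ('x::finite \<times> 'x) cmat \<Rightarrow> ('x \<times> 'x) cmat
     \<Rightarrow> (((('x \<times> 'x) \<times> ('x \<times> 'x)) cmat \<times> 'c \<times> 'c) \<Rightarrow>\<^sub>0 complex) \<Rightarrow> 'c" where
  "gamma_map C P Q s = (\<Oplus>\<^bsub>C\<^esub>k\<in>Poly_Mapping.keys s. case k of (W, u, v) \<Rightarrow>
     (Poly_Mapping.lookup s k * trace (W ** kron P Q)) \<odot>\<^bsub>C\<^esub> (u \<otimes>\<^bsub>C\<^esub> v))"

section \<open>The representation of a correlation by a trace\<close>

definition trace_represents ::
  "'c cstar \<Rightarrow> ('x::finite \<Rightarrow> 'x \<Rightarrow> 'x \<Rightarrow> 'x \<Rightarrow> 'c) \<Rightarrow> ('c \<Rightarrow> complex)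
     \<Rightarrow> (('x \<times> 'x) cmat \<Rightarrow> ('x \<times> 'x) cmat) \<Rightarrow> bool" where
  "trace_represents C p \<tau> \<Gamma> \<longleftrightarrow>
     (\<forall>x x' y y'. \<Gamma> (kron (mat_unit x x') (mat_unit y y')) =
        (\<Sum>a\<in>UNIV. \<Sum>a'\<in>UNIV. \<Sum>b\<in>UNIV. \<Sum>b'\<in>UNIV.
           cscale (\<tau> (p x x' a a' \<otimes>\<^bsub>C\<^esub> p y' y b' b)) (kron (mat_unit a a') (mat_unit b b'))))"

text \<open>A trace representing \<open>\<Gamma>\<close> satisfies
  \<open>\<tau> (\<gamma>\<^bsub>R,Q\<^esub> (E \<otimes> E\<^sup>o\<^sup>p)) = Tr (\<Gamma> (R\<^sup>T) Q)\<close>, because \<open>Tr (\<epsilon>\<^bsub>x,x'\<^esub> R)\<close> is the entry \<open>(x', x)\<close> of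
  \<open>R\<close>. The condition \<open>Tr (\<Gamma> P (\<phi> P)\<^sup>\<bottom>) = 0\<close> therefore corresponds to \<open>R\<close> being the transpose
  of \<open>P\<close>. With \<open>R = P\<close> the equivalence would fail when \<open>'x\<close> has at least two elements: for
  the identity maps \<open>\<Gamma>\<close> and \<open>\<phi>\<close>, a projection \<open>P\<close> with nonreal entries can have
  \<open>Tr (P\<^sup>T P\<^sup>\<bottom>) \<noteq> 0\<close>.\<close>

definition trace_perfect ::
  "'c cstar \<Rightarrow> ('x::finite \<Rightarrow> 'x \<Rightarrow> 'x \<Rightarrow> 'x \<Rightarrow> 'c) \<Rightarrow> ('c \<Rightarrow> complex)
     \<Rightarrow> (('x \<times> 'x) cmat \<Rightarrow> ('x \<times> 'x) cmat) \<Rightarrow> bool" where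
  "trace_perfect C p \<tau> \<phi> \<longleftrightarrow> (\<forall>P\<in>projections.
     \<tau> (gamma_map C (transpose P) (proj_perp (\<phi> P)) (shuffle_tensor (tensor_E p) (tensor_E_op p))) = 0)"

text \<open>The rest of this theory proves the identity that explains the transpose in
  \<open>trace_perfect\<close>; it is the lemma \<open>state_gamma_map_transpose\<close> at the end.\<close>

definition pairing :: "('k \<Rightarrow> complex) \<Rightarrow> ('k \<Rightarrow>\<^sub>0 complex) \<Rightarrow> complex" where
  "pairing g s = (\<Sum>k\<in>Poly_Mapping.keys s. Poly_Mapping.lookup s k * g k)"

lemma pairing_superset: "finite S \<Longrightarrow> Poly_Mapping.keys s \<subseteq> S \<Longrightarrow> pairing g s = (\<Sum>k\<in>S. Poly_Mapping.lookup s k * g k)"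
  unfolding pairing_def by (rule sum.mono_neutral_left) (auto simp: in_keys_iff)

lemma pairing_add: "pairing g (s+r) = pairing g s + pairing g r"
proof -
  let ?S = "Poly_Mapping.keys s \<union> Poly_Mapping.keys r"
  have "Poly_Mapping.keys (s+r) \<subseteq> ?S" by (rule keys_add)
  then show ?thesis by (simp add: pairing_superset[of ?S] lookup_add algebra_simps sum.distrib)
qed

lemma pairing_zero: "pairing g 0 = 0" by (simp add: pairing_def)

lemma pairing_sum: "pairing g (sum f A) = (\<Sum>a\<in>A. pairing g (f a))"
  by (induct A rule: infinite_finite_induct) (auto simp: pairing_zero pairing_add)

lemma pairing_single: "pairing g (Poly_Mapping.single k c) = c * g k" by (auto simp: pairing_def)

lemma pairing_shuffle: "pairing g (shuffle_tensor s r) = pairing (\<lambda>(A,C,u). pairing (\<lambda>(A',C',v). g (kron (kron A A') (kron C C'), u, v)) r) s"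
  unfolding shuffle_tensor_def
  by (simp add: pairing_sum pairing_single split_def) (simp add: pairing_def sum_distrib_left mult.assoc split_def)

lemma pairing_E: "pairing g (tensor_E p) = (\<Sum>x\<in>UNIV. \<Sum>x'\<in>UNIV. \<Sum>a\<in>UNIV. \<Sum>a'\<in>UNIV. g (mat_unit x x', mat_unit a a', p x x' a a'))"
  by (simp add: tensor_E_def pairing_sum pairing_single)

lemma pairing_E_op: "pairing g (tensor_E_op p) = (\<Sum>x\<in>UNIV. \<Sum>x'\<in>UNIV. \<Sum>a\<in>UNIV. \<Sum>a'\<in>UNIV. g (mat_unit x x', mat_unit a a', p x' x a' a))"
  by (simp add: tensor_E_op_def pairing_sum pairing_single)

lemma keys_sum_subset: "Poly_Mapping.keys (sum f A) \<subseteq> (\<Union>a\<in>A. Poly_Mapping.keys (f a))"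
  by (induct A rule: infinite_finite_induct) (auto dest!: subsetD[OF keys_add])

lemma keys_tensor_E: assumes "\<And>x x' a a'. p x x' a a' \<in> S"
  shows "Poly_Mapping.keys (tensor_E p) \<subseteq> UNIV \<times> UNIV \<times> S" "Poly_Mapping.keys (tensor_E_op p) \<subseteq> UNIV \<times> UNIV \<times> S"
  unfolding tensor_E_def tensor_E_op_def
  by (auto dest!: subsetD[OF keys_sum_subset] split: if_splits simp: assms)

lemma keys_shuffle: assumes "Poly_Mapping.keys s \<subseteq> UNIV \<times> UNIV \<times> S" "Poly_Mapping.keys r \<subseteq> UNIV \<times> UNIV \<times> S"
  shows "Poly_Mapping.keys (shuffle_tensor s r) \<subseteq> UNIV \<times> S \<times> S"
  using assms unfolding shuffle_tensor_def
  by (fastforce dest!: subsetD[OF keys_sum_subset] split: if_splits simp: split_def)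

lemma state_gamma_map:
  assumes C: "cstar_algebra C" and t: "tracial_state C \<tau>"
    and k: "Poly_Mapping.keys s \<subseteq> UNIV \<times> carrier C \<times> carrier C"
  shows "\<tau> (gamma_map C P Q s) = pairing (\<lambda>(W,u,v). trace (W ** kron P Q) * \<tau> (u \<otimes>\<^bsub>C\<^esub> v)) s"
proof -
  interpret cstar_algebra C by fact
  have add: "\<tau> (x \<oplus>\<^bsub>C\<^esub> y) = \<tau> x + \<tau> y" if "x \<in> carrier C" "y \<in> carrier C" for x y
    using t that unfolding tracial_state_def by blast
  have sc: "\<tau> (c \<odot>\<^bsub>C\<^esub> x) = c * \<tau> x" if "x \<in> carrier C" for x c
    using t that unfolding tracial_state_def by blast
  have z: "\<tau> \<zero>\<^bsub>C\<^esub> = 0" using add[of "\<zero>\<^bsub>C\<^esub>" "\<zero>\<^bsub>C\<^esub>"] by simp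
  have fs: "\<tau> (finsum C f A) = (\<Sum>a\<in>A. \<tau> (f a))" if "finite A" "f \<in> A \<rightarrow> carrier C" for f and A :: "'z set"
    using that by (induct A rule: finite_induct) (auto simp: z add finsum_insert)
  have smc: "c \<odot>\<^bsub>C\<^esub> x \<in> carrier C" if "x \<in> carrier C" for c x
    using that smult_closed[of c x] by (simp add: complex_ring_def)
  have "\<tau> (gamma_map C P Q s) = (\<Sum>k\<in>Poly_Mapping.keys s. \<tau> (case k of (W, u, v) \<Rightarrow>
     (Poly_Mapping.lookup s k * trace (W ** kron P Q)) \<odot>\<^bsub>C\<^esub> (u \<otimes>\<^bsub>C\<^esub> v)))"
    unfolding gamma_map_def by (rule fs) (use k in \<open>auto intro!: smc\<close>)
  also have "\<dots> = pairing (\<lambda>(W,u,v). trace (W ** kron P Q) * \<tau> (u \<otimes>\<^bsub>C\<^esub> v)) s"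
    unfolding pairing_def by (rule sum.cong) (use k in \<open>auto simp: sc\<close>)
  finally show ?thesis .
qed

lemma trace_units_kron: "trace (kron (kron (mat_unit x x') (mat_unit y y')) (kron (mat_unit a a') (mat_unit b b')) ** kron P Q)
   = P $ (x',y') $ (x,y) * Q $ (a',b') $ (a,b)"
proof -
  have "trace (kron (kron (mat_unit x x') (mat_unit y y')) (kron (mat_unit a a') (mat_unit b b')) ** kron P Q)
    = (\<Sum>i\<in>UNIV. \<Sum>j\<in>UNIV. if i = ((x,y),(a,b)) \<and> j = ((x',y'),(a',b')) then P $ (x',y') $ (x,y) * Q $ (a',b') $ (a,b) else 0)"
    unfolding trace_def matrix_matrix_mult_def by (auto simp: kron_def mat_unit_def intro!: sum.cong split: if_splits)
  also have "\<dots> = (\<Sum>i\<in>UNIV. if i = ((x,y),(a,b)) then P $ (x',y') $ (x,y) * Q $ (a',b') $ (a,b) else 0)"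
    by (rule sum.cong) auto
  finally show ?thesis by simp
qed

lemma trace_units: "trace (kron (mat_unit a a') (mat_unit b b') ** Q) = Q $ (a',b') $ (a,b)"
proof -
  have "trace (kron (mat_unit a a') (mat_unit b b') ** Q)
    = (\<Sum>i\<in>UNIV. \<Sum>j\<in>UNIV. if i = (a,b) \<and> j = (a',b') then Q $ (a',b') $ (a,b) else 0)"
    unfolding trace_def matrix_matrix_mult_def by (auto simp: kron_def mat_unit_def intro!: sum.cong split: if_splits)
  also have "\<dots> = (\<Sum>i\<in>UNIV. if i = (a,b) then Q $ (a',b') $ (a,b) else 0)"
    by (rule sum.cong) auto
  finally show ?thesis by simp
qed

lemma expand_mat_units: "P = (\<Sum>x\<in>UNIV. \<Sum>x'\<in>UNIV. \<Sum>y\<in>UNIV. \<Sum>y'\<in>UNIV. cscale (P $ (x,y) $ (x',y')) (kron (mat_unit x x') (mat_unit y y')))"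
proof -
  have "(\<Sum>x\<in>UNIV. \<Sum>x'\<in>UNIV. \<Sum>y\<in>UNIV. \<Sum>y'\<in>UNIV. cscale (P $ (x,y) $ (x',y')) (kron (mat_unit x x') (mat_unit y y'))) $ (i,j) $ (k,l) = P $ (i,j) $ (k,l)" for i j k l
  proof -
    have q: "P $ (x,y) $ (x',y') * ((if i = x \<and> k = x' then 1 else 0) * (if j = y \<and> l = y' then 1 else 0))
      = (if y' = l then if y = j then if x' = k then if x = i then P $ (i,j) $ (k,l) else 0 else 0 else 0 else 0)" for x x' y y'
      by auto
    have "?thesis"
      by (simp add: cscale_def kron_def mat_unit_def q)
    then show ?thesis by (simp)
  qed
  then show ?thesis by (simp add: vec_eq_iff)
qed

lemma trace_sum_mult: "trace ((sum f A :: 'i::finite cmat) ** Q) = (\<Sum>a\<in>A. trace (f a ** Q))"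
proof (induct A rule: infinite_finite_induct)
  case (insert x F) then show ?case by (simp add: matrix_matrix_mult_def trace_def algebra_simps sum.distrib)
qed (auto simp: trace_def matrix_matrix_mult_def)

lemma trace_cscale_mult: "trace (cscale c A ** Q) = c * trace (A ** Q)"
  by (simp add: trace_def matrix_matrix_mult_def cscale_def sum_distrib_left mult.assoc)

lemma clinear_mat_sum: assumes "clinear_mat \<Gamma>" shows "\<Gamma> (sum f A) = (\<Sum>a\<in>A. \<Gamma> (f a))"
proof -
  have a: "\<Gamma> (x + y) = \<Gamma> x + \<Gamma> y" for x y using assms by (auto simp: clinear_mat_def)
  have "\<Gamma> 0 = 0" using a[of 0 0] by simp
  then show ?thesis by (induct A rule: infinite_finite_induct) (auto simp: a)
qed

lemma state_gamma_map_transpose: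
  assumes C: "cstar_algebra C" and t: "tracial_state C \<tau>" and p: "\<And>x x' a a'. p x x' a a' \<in> carrier C"
    and lin: "clinear_mat \<Gamma>" and rep: "trace_represents C p \<tau> \<Gamma>"
  shows "\<tau> (gamma_map C (transpose P) Q (shuffle_tensor (tensor_E p) (tensor_E_op p))) = trace (\<Gamma> P ** Q)"
proof -
  have sc: "\<Gamma> (cscale c A) = cscale c (\<Gamma> A)" for c A using lin by (auto simp: clinear_mat_def)
  have "trace (\<Gamma> P ** Q) = (\<Sum>x\<in>UNIV. \<Sum>x'\<in>UNIV. \<Sum>y\<in>UNIV. \<Sum>y'\<in>UNIV. P $ (x,y) $ (x',y') *
    (\<Sum>a\<in>UNIV. \<Sum>a'\<in>UNIV. \<Sum>b\<in>UNIV. \<Sum>b'\<in>UNIV. \<tau> (p x x' a a' \<otimes>\<^bsub>C\<^esub> p y' y b' b) * Q $ (a',b') $ (a,b)))"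
    apply (subst expand_mat_units[of P])
    using rep unfolding trace_represents_def
    by (simp add: clinear_mat_sum[OF lin] sc trace_sum_mult trace_cscale_mult trace_units)
  also have "\<dots> = (\<Sum>x\<in>UNIV. \<Sum>x'\<in>UNIV. \<Sum>y\<in>UNIV. \<Sum>y'\<in>UNIV.
    (\<Sum>a\<in>UNIV. \<Sum>a'\<in>UNIV. \<Sum>b\<in>UNIV. \<Sum>b'\<in>UNIV. P $ (x,y) $ (x',y') * Q $ (a',b') $ (a,b) * \<tau> (p x x' a a' \<otimes>\<^bsub>C\<^esub> p y' y b' b) ))"
    by (simp add: sum_distrib_left mult_ac)
  also have "\<dots> = (\<Sum>x\<in>UNIV. \<Sum>x'\<in>UNIV. \<Sum>a\<in>UNIV. \<Sum>a'\<in>UNIV. \<Sum>y\<in>UNIV. \<Sum>y'\<in>UNIV.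
    (\<Sum>b\<in>UNIV. \<Sum>b'\<in>UNIV. P $ (x,y) $ (x',y') * Q $ (a',b') $ (a,b) * \<tau> (p x x' a a' \<otimes>\<^bsub>C\<^esub> p y' y b' b) ))"
  proof -
    have sw: "(\<Sum>y\<in>UNIV. \<Sum>y'\<in>UNIV. \<Sum>a\<in>UNIV. \<Sum>a'\<in>UNIV. f y y' a a') = (\<Sum>a\<in>UNIV. \<Sum>a'\<in>UNIV. \<Sum>y\<in>UNIV. \<Sum>y'\<in>UNIV. f y y' a a')" for f :: "_ \<Rightarrow> _ \<Rightarrow> _ \<Rightarrow> _ \<Rightarrow> complex"
    proof -
      have "(\<Sum>y\<in>UNIV. \<Sum>y'\<in>UNIV. \<Sum>a\<in>UNIV. \<Sum>a'\<in>UNIV. f y y' a a') = (\<Sum>y\<in>UNIV. \<Sum>a\<in>UNIV. \<Sum>y'\<in>UNIV. \<Sum>a'\<in>UNIV. f y y' a a')"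
        by (rule sum.cong[OF refl]) (rule sum.swap)
      also have "\<dots> = (\<Sum>a\<in>UNIV. \<Sum>y\<in>UNIV. \<Sum>a'\<in>UNIV. \<Sum>y'\<in>UNIV. f y y' a a')"
        by (subst sum.swap) (rule sum.cong[OF refl], rule sum.cong[OF refl], rule sum.swap)
      also have "\<dots> = (\<Sum>a\<in>UNIV. \<Sum>a'\<in>UNIV. \<Sum>y\<in>UNIV. \<Sum>y'\<in>UNIV. f y y' a a')"
        by (rule sum.cong[OF refl]) (rule sum.swap)
      finally show ?thesis .
    qed
    show ?thesis by (rule sum.cong[OF refl], rule sum.cong[OF refl]) (rule sw)
  qed
  also have "\<dots> = \<tau> (gamma_map C (transpose P) Q (shuffle_tensor (tensor_E p) (tensor_E_op p)))"
    by (simp add: state_gamma_map[OF C t keys_shuffle[OF keys_tensor_E[OF p]]] pairing_shuffle pairing_E pairing_E_op trace_units_kron transpose_def)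
  finally show ?thesis by simp
qed

end

theory Submission
  imports Defs
begin

text \<open>Both sides of each equivalence are compared with a function \<open>t\<close> on words in the letters
  \<open>(x, x', a, a')\<close> that behaves like a trace on words in the \<open>p\<^bsub>x,x',a,a'\<^esub>\<close>. Perfectness at \<open>J\<close> makes
  \<open>\<Sum> \<langle>E\<^sub>g F\<^sub>g \<xi>, \<xi>\<rangle>\<close> maximal, and the equality case of Cauchy-Schwarz gives \<open>F\<^sub>g \<xi> = E\<^sub>g\<^sup>* \<xi>\<close>, so that
  \<open>t w = \<langle>E\<^sub>w \<xi>, \<xi>\<rangle>\<close> is tracial. Conversely \<open>t\<close> acts on its kernel Hilbert space by left and right
  multiplication. In the finite rank case the vector state is purified by an inverse square root of a
  central element; in the commutative case the second moments of \<open>t\<close> lie in the convex hull of those of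
  characters, because minimisers of a strictly concave function are characters.\<close>

section \<open>Normed spaces on carriers\<close>

text \<open>Carriers live in fixed types, so every Hilbert space is a space of functions on a
  countable set, moved into \<open>'h\<close> by an injection, and the universal property of the
  Brown algebra is applied to operators on such a space, which have type \<open>'h => 'h\<close>.
  Since \<Gamma> sees only words of two letters, a trace of C_X need only agree with
  \<open>t\<close> on these, and in the commutative case it is enough to locate one point of a
  finite dimensional space of second moments, where hyperplanes separate. Words contain only
  products of an adjoint of some u with some u, so the unitary matrix is recovered up to a unitary
  factor, on |X| copies of the word space. The vector state is shown to be tracial only on the
  commutant of the right multiplications, which contains the image of C_X; so that commutant, and
  not the full operator algebra, carries the trace. Left and right multiplications commute but do
  not act on separate tensor factors. In finite dimension the Hilbert space trace supplies a vector
  in the tensor square; the central element is the density of that trace relative to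
  \<open>t\<close>, and its inverse root corrects the vector.\<close>

lemma complex_ring_simps [simp]:
  "carrier complex_ring = UNIV" "x \<otimes>\<^bsub>complex_ring\<^esub> y = x * y" "x \<oplus>\<^bsub>complex_ring\<^esub> y = x + y"
  "\<one>\<^bsub>complex_ring\<^esub> = 1" "\<zero>\<^bsub>complex_ring\<^esub> = 0"
  by (auto simp: complex_ring_def)

lemma cring_complex_ring: "cring complex_ring"
  by (rule cringI, rule abelian_groupI, auto simp: algebra_simps intro: comm_monoidI exI[of _ "- _"])

locale cmodule = module complex_ring V for V (structure)
begin

lemma csm_closed [simp, intro]: "x \<in> carrier V ==> c \<odot> x \<in> carrier V"
  using smult_closed[of c x] by simp

lemma csm_l: "x \<in> carrier V ==> (a + b) \<odot> x = a \<odot> x \<oplus> b \<odot> x"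
  using smult_l_distr[of a b x] by simp

lemma csm_r: "x \<in> carrier V ==> y \<in> carrier V ==> c \<odot> (x \<oplus> y) = c \<odot> x \<oplus> c \<odot> y"
  using smult_r_distr[of c x y] by simp

lemma csm_assoc: "x \<in> carrier V ==> a \<odot> (b \<odot> x) = (a * b) \<odot> x"
  using smult_assoc1[of a b x] by simp

lemma csm_one [simp]: "x \<in> carrier V ==> 1 \<odot> x = x"
  using smult_one[of x] by simp

lemma csm_zero [simp]: "x \<in> carrier V ==> 0 \<odot> x = \<zero>"
  using smult_l_null[of x] by simp

lemma csm_null [simp]: "c \<odot> \<zero> = \<zero>"
  using smult_r_null[of c] by simp

lemma csm_neg: "x \<in> carrier V ==> (-1) \<odot> x = \<ominus> x"
proof -
  assume x: "x \<in> carrier V"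
  have "(-1) \<odot> x \<oplus> x = \<zero>" using csm_l[of x "-1" 1] x by simp
  then show ?thesis using x by (metis csm_closed M.minus_equality)
qed

lemma minus_csm: "x \<in> carrier V ==> y \<in> carrier V ==> x \<ominus> y = x \<oplus> (-1) \<odot> y"
  by (simp add: a_minus_def csm_neg)

lemma csm_minus: "x \<in> carrier V ==> y \<in> carrier V ==> c \<odot> (x \<ominus> y) = c \<odot> x \<ominus> c \<odot> y"
  by (simp add: minus_csm csm_r csm_assoc)

lemma minus_closed' [simp, intro]: "x \<in> carrier V ==> y \<in> carrier V ==> x \<ominus> y \<in> carrier V"
  by (simp add: minus_csm)

lemma add_minus_cancel: "z \<in> carrier V ==> x \<in> carrier V ==> y \<in> carrier V
    ==> (z \<oplus> x) \<ominus> (z \<oplus> y) = x \<ominus> y"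
proof -
  assume c: "z \<in> carrier V" "x \<in> carrier V" "y \<in> carrier V"
  then have "(z \<oplus> x) \<ominus> (z \<oplus> y) = (x \<oplus> z) \<oplus> (\<ominus> z \<oplus> \<ominus> y)"
    by (simp add: a_minus_def M.minus_add M.a_comm[of z x])
  also have "\<dots> = x \<oplus> (z \<oplus> (\<ominus> z \<oplus> \<ominus> y))" using c by (simp add: M.a_assoc)
  finally show ?thesis using c by (simp add: M.r_neg2 a_minus_def)
qed

lemma minus_telescope: "x \<in> carrier V ==> y \<in> carrier V ==> z \<in> carrier V
    ==> (x \<ominus> y) \<oplus> (y \<ominus> z) = x \<ominus> z"
  by (simp add: a_minus_def M.a_assoc M.r_neg1)

lemma add_minus_self: "x \<in> carrier V ==> y \<in> carrier V ==> (x \<ominus> y) \<oplus> y = x"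
  by (simp add: a_minus_def M.a_assoc M.l_neg)

end

text \<open>Completeness is left out: these facts serve \<open>cnorm\<close>, \<open>hnorm\<close>
  and \<open>op_norm\<close>, and they are already needed while completeness of a subalgebra or of
  an operator algebra is being proved.\<close>

locale cnormed = cmodule V for V (structure) + fixes N :: "'a => real"
  assumes N_nonneg: "x \<in> carrier V ==> 0 <= N x"
    and N_definite: "x \<in> carrier V ==> N x = 0 ==> x = \<zero>"
    and N_smult: "x \<in> carrier V ==> N (c \<odot> x) = cmod c * N x"
    and N_triangle: "x \<in> carrier V ==> y \<in> carrier V ==> N (x \<oplus> y) <= N x + N y"
begin

lemma N_zero [simp]: "N \<zero> = 0"
  using N_smult[of \<zero> 0] by simp

lemma N_commute: "x \<in> carrier V ==> y \<in> carrier V ==> N (x \<ominus> y) = N (y \<ominus> x)"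
proof -
  assume xy: "x \<in> carrier V" "y \<in> carrier V"
  then have "y \<ominus> x = (-1) \<odot> (x \<ominus> y)" by (simp add: minus_csm csm_r csm_assoc M.a_comm)
  then show ?thesis using xy N_smult[of "x \<ominus> y" "-1"] by simp
qed

lemma N_diff_triangle: "x \<in> carrier V ==> y \<in> carrier V ==> z \<in> carrier V
    ==> N (x \<ominus> z) <= N (x \<ominus> y) + N (y \<ominus> z)"
proof -
  assume xyz: "x \<in> carrier V" "y \<in> carrier V" "z \<in> carrier V"
  then have "x \<ominus> z = (x \<ominus> y) \<oplus> (y \<ominus> z)" by (simp add: minus_telescope)
  then show ?thesis using xyz N_triangle[of "x \<ominus> y" "y \<ominus> z"] by simp
qed

lemma N_le_diff: "x \<in> carrier V ==> y \<in> carrier V ==> N x <= N (x \<ominus> y) + N y"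
proof -
  assume xy: "x \<in> carrier V" "y \<in> carrier V"
  then have "x = (x \<ominus> y) \<oplus> y" by (simp add: add_minus_self)
  then show ?thesis using xy N_triangle[of "x \<ominus> y" y] by simp
qed

lemma eq_of_minus: "x \<in> carrier V ==> y \<in> carrier V ==> N (x \<ominus> y) = 0 ==> x = y"
  using N_definite[of "x \<ominus> y"] add_minus_self[of x y] by simp

lemma minus_self [simp]: "x \<in> carrier V ==> x \<ominus> x = \<zero>"
  by (simp add: a_minus_def M.r_neg)

lemma limit_unique:
  assumes "!!n. sg n \<in> carrier V" "x \<in> carrier V" "y \<in> carrier V"
    and "(%n. N (sg n \<ominus> x)) \<longlonglongrightarrow> 0" "(%n. N (sg n \<ominus> y)) \<longlonglongrightarrow> 0"
  shows "x = y"
proof -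
  have "(%n. N (sg n \<ominus> x) + N (sg n \<ominus> y)) \<longlonglongrightarrow> 0" using tendsto_add[OF assms(4,5)] by simp
  moreover have "N (x \<ominus> y) <= N (sg n \<ominus> x) + N (sg n \<ominus> y)" for n
    using N_diff_triangle[of x "sg n" y] N_commute[of x "sg n"] assms by simp
  ultimately have "N (x \<ominus> y) <= 0" by (intro LIMSEQ_le_const) auto
  then show ?thesis using N_nonneg[of "x \<ominus> y"] assms by (intro eq_of_minus) auto
qed

lemma metric: "Metric_space (carrier V) (norm_dist V N)"
proof (rule Metric_space.intro)
  show "0 <= norm_dist V N x y" for x y by (simp add: norm_dist_def N_nonneg)
  show "norm_dist V N x y = norm_dist V N y x" for x y by (simp add: norm_dist_def N_commute)
  show "norm_dist V N x y = 0 \<longleftrightarrow> x = y" if "x \<in> carrier V" "y \<in> carrier V" for x y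
    using that by (auto simp: norm_dist_def intro: eq_of_minus)
  show "norm_dist V N x z <= norm_dist V N x y + norm_dist V N y z"
    if "x \<in> carrier V" "y \<in> carrier V" "z \<in> carrier V" for x y z
    using that N_diff_triangle by (simp add: norm_dist_def)
qed

lemma limitin_iff:
  "limitin (Metric_space.mtopology (carrier V) (norm_dist V N)) sg l sequentially
     \<longleftrightarrow> l \<in> carrier V & (\<forall>\<^sub>F n in sequentially. sg n \<in> carrier V)
         & ((%n. norm_dist V N (sg n) l) \<longlonglongrightarrow> 0)"
  by (rule Metric_space.limitin_metric_dist_null[OF metric])

lemma mcomplete_iff:
  "Metric_space.mcomplete (carrier V) (norm_dist V N) \<longleftrightarrow>
     (\<forall>sg. (ALL n. sg n \<in> carrier V) --> (\<forall>e>0. EX M. \<forall>m\<ge>M. \<forall>n\<ge>M. N (sg m \<ominus> sg n) < e)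
        --> (\<exists>l\<in>carrier V. (%n. N (sg n \<ominus> l)) \<longlonglongrightarrow> 0))"
proof -
  have c: "Metric_space.MCauchy (carrier V) (norm_dist V N) sg \<longleftrightarrow>
      (ALL n. sg n \<in> carrier V) & (\<forall>e>0. EX M. \<forall>m\<ge>M. \<forall>n\<ge>M. N (sg m \<ominus> sg n) < e)" for sg
    unfolding Metric_space.MCauchy_def[OF metric] by (auto simp: norm_dist_def image_subset_iff)
  have l: "limitin (Metric_space.mtopology (carrier V) (norm_dist V N)) sg l sequentially
      \<longleftrightarrow> l \<in> carrier V & (%n. N (sg n \<ominus> l)) \<longlonglongrightarrow> 0" if "ALL n. sg n \<in> carrier V" for sg l
    using that by (auto simp: limitin_iff norm_dist_def)
  show ?thesis unfolding Metric_space.mcomplete_def[OF metric] c using l by (auto simp: Bex_def)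
qed

lemma closedin_iff:
  "closedin (Metric_space.mtopology (carrier V) (norm_dist V N)) S \<longleftrightarrow>
     S \<subseteq> carrier V & (\<forall>sg l. (ALL n. sg n \<in> S) --> l \<in> carrier V --> (%n. N (sg n \<ominus> l)) \<longlonglongrightarrow> 0 --> l \<in> S)"
proof -
  have l: "limitin (Metric_space.mtopology (carrier V) (norm_dist V N)) sg l sequentially
      \<longleftrightarrow> l \<in> carrier V & (%n. N (sg n \<ominus> l)) \<longlonglongrightarrow> 0" if "ALL n. sg n \<in> carrier V" for sg l
    using that by (auto simp: limitin_iff norm_dist_def)
  show ?thesis
    unfolding Metric_space.metric_closedin_iff_sequentially_closed[OF metric]
    using l by (smt (verit, best) image_subset_iff rangeI range_subsetD subsetD)
qed

text \<open>Banach's fixed point theorem on a sequentially closed subset. It stands in for power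
  series and functional calculus: square roots and inverses in a C*-algebra are obtained as fixed
  points.\<close>

lemma fixed_point:
  assumes comp: "Metric_space.mcomplete (carrier V) (norm_dist V N)"
    and S: "S \<subseteq> carrier V" "S ~= {}"
    and cl: "!!sg l. (!!n. sg n \<in> S) ==> l \<in> carrier V ==> (%n. N (sg n \<ominus> l)) \<longlonglongrightarrow> 0 ==> l \<in> S"
    and f: "!!x. x \<in> S ==> f x \<in> S"
    and k: "k < 1" "!!x y. x \<in> S ==> y \<in> S ==> N (f x \<ominus> f y) <= k * N (x \<ominus> y)"
  obtains x where "x \<in> S" "f x = x"
proof -
  interpret Metric_space "carrier V" "norm_dist V N" by (rule metric)
  interpret Submetric "carrier V" "norm_dist V N" S by unfold_locales (rule S)
  have "closedin mtopology S" using S cl by (auto simp: closedin_iff)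
  then have "sub.mcomplete" using comp by (rule closedin_mcomplete_imp_mcomplete)
  moreover have "norm_dist V N (f x) (f y) <= k * norm_dist V N x y" if "x \<in> S" "y \<in> S" for x y
    using that S f k by (auto simp: norm_dist_def subset_iff)
  ultimately show ?thesis
    using sub.Banach_fixedpoint_thm[of f k] S f k that by (metis funcsetI)
qed

end

section \<open>C*-algebras\<close>

sublocale cstar_algebra \<subseteq> cmodule A by unfold_locales
sublocale cstar_algebra \<subseteq> cnormed A "cnorm A"
  by unfold_locales (auto simp: cnorm_nonneg cnorm_definite cnorm_smult cnorm_triangle)

context cstar_algebra
begin

lemma star_zero [simp]: "star A \<zero> = \<zero>"
  using star_smult[of \<zero> 0] star_closed[of \<zero>] by simp

lemma star_one [simp]: "star A \<one> = \<one>"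
  by (metis star_mult star_star star_closed one_closed l_one r_one)

lemma star_minus: "x \<in> carrier A ==> y \<in> carrier A ==> star A (x \<ominus> y) = star A x \<ominus> star A y"
  by (simp add: minus_csm star_add star_smult star_closed)

lemma cnorm_star_le: "x \<in> carrier A ==> cnorm A x <= cnorm A (star A x)"
proof -
  assume x: "x \<in> carrier A"
  have "cnorm A x * cnorm A x <= cnorm A (star A x) * cnorm A x"
    using cnorm_star[OF x] cnorm_mult[of "star A x" x] x star_closed by (simp add: power2_eq_square)
  then show ?thesis
    using cnorm_nonneg[OF x] cnorm_nonneg[of "star A x"] x star_closed
    by (metis mult_le_cancel_right order_le_less not_le)
qed

lemma cnorm_star_eq [simp]: "x \<in> carrier A ==> cnorm A (star A x) = cnorm A x"
  using cnorm_star_le[of x] cnorm_star_le[of "star A x"] by (simp add: star_closed star_star)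

lemma cnorm_one [simp]: "cnorm A \<one> = 1"
proof -
  have "(cnorm A \<one>)\<^sup>2 = cnorm A \<one>" using cnorm_star[of \<one>] by simp
  moreover have "cnorm A \<one> ~= 0" using cnorm_definite[of \<one>] one_not_zero by auto
  ultimately show ?thesis by (simp add: power2_eq_square)
qed

lemma minus_mult_distr: "x \<in> carrier A ==> y \<in> carrier A ==> z \<in> carrier A
    ==> x \<otimes> (y \<ominus> z) = x \<otimes> y \<ominus> x \<otimes> z" "x \<in> carrier A ==> y \<in> carrier A ==> z \<in> carrier A
    ==> (y \<ominus> z) \<otimes> x = y \<otimes> x \<ominus> z \<otimes> x"
  by (auto simp: minus_csm r_distr l_distr smult_mult_left smult_mult_right)

text \<open>With \<open>b = 1 - x\<close> the equation \<open>b b = 1 - a\<close> becomes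
  \<open>x = (a + x x) / 2\<close>. The self-adjoint elements of norm at most \<open>r\<close> form
  a closed set, which this map preserves and contracts by the factor \<open>r\<close>.\<close>

lemma sqrt_one_minus:
  assumes a: "a \<in> carrier A" "star A a = a" "cnorm A a < 1"
  obtains b where "b \<in> carrier A" "star A b = b" "b \<otimes> b = \<one> \<ominus> a"
proof -
  \<comment> \<open>The smaller root of \<open>r^2 - 2 r + cnorm A a = 0\<close>, so that the ball
    of radius \<open>r\<close> is mapped into itself; it is below 1 because
    \<open>cnorm A a < 1\<close>.\<close>
  define r where "r = 1 - sqrt (1 - cnorm A a)"
  have r: "0 <= r" "r < 1" "r\<^sup>2 + cnorm A a = 2 * r"
    using a cnorm_nonneg[OF a(1)] by (auto simp: r_def power2_diff)
  define S where "S = {x \<in> carrier A. star A x = x & cnorm A x <= r}"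
  define f where "f x = (1/2) \<odot> (a \<oplus> x \<otimes> x)" for x
  obtain x where x: "x \<in> S" "f x = x"
  proof (rule fixed_point[OF cnorm_complete, of S f r])
    show "S \<subseteq> carrier A" "S ~= {}" "r < 1" using r by (auto simp: S_def intro!: exI[of _ \<zero>])
    show "l \<in> S" if s: "!!n. sg n \<in> S" "l \<in> carrier A" "(%n. cnorm A (sg n \<ominus> l)) \<longlonglongrightarrow> 0" for sg l
    proof -
      have c: "sg n \<in> carrier A" "star A (sg n) = sg n" "cnorm A (sg n) <= r" for n using s(1)[of n] by (auto simp: S_def)
      have "cnorm A (sg n \<ominus> star A l) = cnorm A (sg n \<ominus> l)" for n
        using c s(2) cnorm_star_eq[of "sg n \<ominus> l"] by (simp add: star_minus)
      then have "(%n. cnorm A (sg n \<ominus> star A l)) \<longlonglongrightarrow> 0" using s(3) by simp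
      then have "star A l = l" using limit_unique[of sg "star A l" l] c s star_closed by auto
      moreover have "cnorm A l <= r"
      proof -
        have "cnorm A l <= cnorm A (sg n \<ominus> l) + r" for n
          using N_le_diff[of l "sg n"] N_commute[of l "sg n"] c[of n] s(2) by simp
        moreover have "(%n. cnorm A (sg n \<ominus> l) + r) \<longlonglongrightarrow> 0 + r" by (intro tendsto_intros s(3))
        ultimately have "cnorm A l <= 0 + r" by (intro LIMSEQ_le_const) auto
        then show ?thesis by simp
      qed
      ultimately show ?thesis using s(2) by (simp add: S_def)
    qed
    show "f x \<in> S" if "x \<in> S" for x
    proof -
      have x: "x \<in> carrier A" "star A x = x" "cnorm A x <= r" using that by (auto simp: S_def)
      have "cnorm A (a \<oplus> x \<otimes> x) <= cnorm A a + cnorm A x * cnorm A x"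
        using cnorm_triangle[of a "x \<otimes> x"] cnorm_mult[of x x] a x by simp
      also have "\<dots> <= cnorm A a + r * r" using x cnorm_nonneg[of x] r by (simp add: mult_mono)
      also have "\<dots> = 2 * r" using r by (simp add: power2_eq_square)
      finally show ?thesis
        using x a by (simp add: S_def f_def star_smult star_add star_mult cnorm_smult)
    qed
    show "cnorm A (f x \<ominus> f y) <= r * cnorm A (x \<ominus> y)" if "x \<in> S" "y \<in> S" for x y
    proof -
      have xy: "x \<in> carrier A" "y \<in> carrier A" "cnorm A x <= r" "cnorm A y <= r" using that by (auto simp: S_def)
      have "(a \<oplus> x \<otimes> x) \<ominus> (a \<oplus> y \<otimes> y) = x \<otimes> (x \<ominus> y) \<oplus> (x \<ominus> y) \<otimes> y"
      proof -
        have "(a \<oplus> x \<otimes> x) \<ominus> (a \<oplus> y \<otimes> y) = x \<otimes> x \<ominus> y \<otimes> y"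
          using xy a(1) by (intro add_minus_cancel) auto
        also have "\<dots> = (x \<otimes> x \<ominus> x \<otimes> y) \<oplus> (x \<otimes> y \<ominus> y \<otimes> y)"
          using xy by (intro minus_telescope[symmetric]) auto
        also have "\<dots> = x \<otimes> (x \<ominus> y) \<oplus> (x \<ominus> y) \<otimes> y"
          using xy by (simp add: minus_mult_distr)
        finally show ?thesis .
      qed
      moreover have "f x \<ominus> f y = (1/2) \<odot> ((a \<oplus> x \<otimes> x) \<ominus> (a \<oplus> y \<otimes> y))"
        unfolding f_def using xy a(1) by (intro csm_minus[symmetric]) auto
      ultimately have "f x \<ominus> f y = (1/2) \<odot> (x \<otimes> (x \<ominus> y) \<oplus> (x \<ominus> y) \<otimes> y)" by metis
      then have "cnorm A (f x \<ominus> f y) = 1/2 * cnorm A (x \<otimes> (x \<ominus> y) \<oplus> (x \<ominus> y) \<otimes> y)"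
        using xy by (simp add: cnorm_smult)
      also have "\<dots> <= 1/2 * (cnorm A x * cnorm A (x \<ominus> y) + cnorm A (x \<ominus> y) * cnorm A y)"
        using xy cnorm_triangle[of "x \<otimes> (x \<ominus> y)" "(x \<ominus> y) \<otimes> y"]
          cnorm_mult[of x "x \<ominus> y"] cnorm_mult[of "x \<ominus> y" y] by simp
      also have "\<dots> <= 1/2 * (r * cnorm A (x \<ominus> y) + cnorm A (x \<ominus> y) * r)"
        using xy cnorm_nonneg[of "x \<ominus> y"] by (intro mult_left_mono add_mono mult_right_mono) auto
      finally show ?thesis by simp
    qed
  qed (use that in auto)
  have xc: "x \<in> carrier A" "star A x = x" using x by (auto simp: S_def)
  have "x \<oplus> x = 2 \<odot> x" using csm_l[of x 1 1] xc by simp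
  also have "\<dots> = 2 \<odot> f x" using x by simp
  also have "\<dots> = a \<oplus> x \<otimes> x" unfolding f_def using a xc by (simp add: csm_assoc)
  finally have e: "x \<oplus> x = a \<oplus> x \<otimes> x" .
  have "(\<one> \<ominus> x) \<otimes> (\<one> \<ominus> x) = \<one> \<ominus> (x \<oplus> x) \<oplus> x \<otimes> x"
    using xc by (simp add: a_minus_def l_distr r_distr l_minus r_minus minus_add a_ac)
  also have "\<dots> = \<one> \<ominus> a" unfolding e using xc a(1) by (simp add: a_minus_def minus_add a_assoc l_neg)
  finally have "(\<one> \<ominus> x) \<otimes> (\<one> \<ominus> x) = \<one> \<ominus> a" .
  then show ?thesis using that[of "\<one> \<ominus> x"] xc by (simp add: star_minus)
qed

text \<open>The fixed points of \<open>y -> 1 + a y\<close> and of \<open>z -> 1 + z a\<close> are a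
  right and a left inverse, and the two coincide.\<close>

lemma inv_one_minus:
  assumes a: "a \<in> carrier A" "cnorm A a < 1"
  obtains y where "y \<in> carrier A" "(\<one> \<ominus> a) \<otimes> y = \<one>" "y \<otimes> (\<one> \<ominus> a) = \<one>"
proof -
  obtain y where y: "y \<in> carrier A" "\<one> \<oplus> a \<otimes> y = y"
  proof (rule fixed_point[OF cnorm_complete, of "carrier A" "%y. \<one> \<oplus> a \<otimes> y" "cnorm A a"])
    show "cnorm A ((\<one> \<oplus> a \<otimes> x) \<ominus> (\<one> \<oplus> a \<otimes> y)) <= cnorm A a * cnorm A (x \<ominus> y)" if "x \<in> carrier A" "y \<in> carrier A" for x y
      using that a by (subst add_minus_cancel) (auto simp: minus_mult_distr[symmetric] intro: cnorm_mult)
  qed (use a in auto)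
  obtain z where z: "z \<in> carrier A" "\<one> \<oplus> z \<otimes> a = z"
  proof (rule fixed_point[OF cnorm_complete, of "carrier A" "%y. \<one> \<oplus> y \<otimes> a" "cnorm A a"])
    show "cnorm A ((\<one> \<oplus> x \<otimes> a) \<ominus> (\<one> \<oplus> y \<otimes> a)) <= cnorm A a * cnorm A (x \<ominus> y)" if "x \<in> carrier A" "y \<in> carrier A" for x y
      using that a by (subst add_minus_cancel) (auto simp: minus_mult_distr[symmetric] mult.commute[of "cnorm A a"] intro: cnorm_mult)
  qed (use a in auto)
  have 1: "(\<one> \<ominus> a) \<otimes> y = \<one>"
  proof -
    have "(\<one> \<ominus> a) \<otimes> y = y \<ominus> a \<otimes> y" using y(1) a by (simp add: minus_mult_distr)
    also have "\<dots> = (\<one> \<oplus> a \<otimes> y) \<ominus> a \<otimes> y" using y(2) by simp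
    also have "\<dots> = \<one>" using y(1) a by (simp add: a_minus_def a_assoc r_neg)
    finally show ?thesis .
  qed
  have 2: "z \<otimes> (\<one> \<ominus> a) = \<one>"
  proof -
    have "z \<otimes> (\<one> \<ominus> a) = z \<ominus> z \<otimes> a" using z(1) a by (simp add: minus_mult_distr)
    also have "\<dots> = (\<one> \<oplus> z \<otimes> a) \<ominus> z \<otimes> a" using z(2) by simp
    also have "\<dots> = \<one>" using z(1) a by (simp add: a_minus_def a_assoc r_neg)
    finally show ?thesis .
  qed
  have "z = z \<otimes> ((\<one> \<ominus> a) \<otimes> y)" using 1 z by simp
  also have "\<dots> = y" using 2 y z a by (simp add: m_assoc[symmetric])
  finally show ?thesis using that 1 2 y by blast
qed

text \<open>If \<open>b\<close> is a root of \<open>1 - a\<close> and \<open>y\<close> is the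
  inverse of \<open>1 - a\<close>, then \<open>b y\<close> is the inverse of \<open>b\<close>. It is
  self-adjoint because \<open>y\<close> is, and because \<open>b\<close> commutes with the inverse
  of its own square.\<close>

lemma inv_sqrt_one_minus:
  assumes a: "a \<in> carrier A" "star A a = a" "cnorm A a < 1"
  obtains c where "c \<in> carrier A" "star A c = c" "c \<otimes> c \<otimes> (\<one> \<ominus> a) = \<one>"
proof -
  obtain b where b: "b \<in> carrier A" "star A b = b" "b \<otimes> b = \<one> \<ominus> a" using sqrt_one_minus[OF a] .
  obtain y where y: "y \<in> carrier A" "(\<one> \<ominus> a) \<otimes> y = \<one>" "y \<otimes> (\<one> \<ominus> a) = \<one>" using inv_one_minus[OF a(1,3)] .
  have by1: "b \<otimes> b \<otimes> y = \<one>" "y \<otimes> (b \<otimes> b) = \<one>" using b y by auto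
  have "b \<otimes> y = (y \<otimes> (b \<otimes> b)) \<otimes> (b \<otimes> y)" using by1 b y by simp
  also have "\<dots> = y \<otimes> b \<otimes> (b \<otimes> b \<otimes> y)" using b(1) y(1) by (simp add: m_assoc)
  also have "\<dots> = y \<otimes> b" using by1 b y by simp
  finally have comm: "b \<otimes> y = y \<otimes> b" .
  have "star A (b \<otimes> b \<otimes> y) = \<one>" using by1 by simp
  then have 1: "star A y \<otimes> (b \<otimes> b) = \<one>" using b(1,2) y(1) by (simp add: star_mult star_closed)
  have "star A y = star A y \<otimes> (b \<otimes> b \<otimes> y)" using by1(1) y(1) star_closed by simp
  also have "\<dots> = star A y \<otimes> (b \<otimes> b) \<otimes> y" using b(1) y(1) star_closed by (simp add: m_assoc)
  also have "\<dots> = y" using 1 y(1) by simp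
  finally have "star A y = y" .
  then have s: "star A (b \<otimes> y) = b \<otimes> y" using b y comm by (simp add: star_mult)
  have "(b \<otimes> y) \<otimes> (b \<otimes> y) \<otimes> (b \<otimes> b) = (y \<otimes> b) \<otimes> (b \<otimes> y) \<otimes> (b \<otimes> b)" using comm by simp
  also have "\<dots> = y \<otimes> (b \<otimes> b) \<otimes> (y \<otimes> (b \<otimes> b))" using b(1) y(1) by (simp add: m_assoc)
  also have "\<dots> = \<one>" using by1 by simp
  finally show ?thesis using that[of "b \<otimes> y"] s b y by simp
qed

text \<open>For \<open>z\<close> of norm below 1, \<open>1 - z* z\<close> is the square of a
  self-adjoint element, so the functional is nonnegative on it; scaling gives the general case. This
  makes representations contractive without spectral theory.\<close>

lemma positive_functional_bound:
  assumes add: "!!x y. x \<in> carrier A ==> y \<in> carrier A ==> \<omega> (x \<oplus> y) = \<omega> x + \<omega> y"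
    and sm: "!!c x. x \<in> carrier A ==> \<omega> (c \<odot> x) = c * \<omega> x"
    and pos: "!!x. x \<in> carrier A ==> \<omega> (star A x \<otimes> x) \<in> \<real>\<^sub>\<ge>\<^sub>0"
    and x: "x \<in> carrier A"
  shows "Re (\<omega> (star A x \<otimes> x)) <= (cnorm A x)\<^sup>2 * Re (\<omega> \<one>)"
proof -
  have 1: "Re (\<omega> (star A z \<otimes> z)) <= Re (\<omega> \<one>)" if z: "z \<in> carrier A" "cnorm A z < 1" for z
  proof -
    let ?a = "star A z \<otimes> z"
    have "cnorm A ?a < 1" using z by (simp add: cnorm_star power_less_one_iff cnorm_nonneg)
    moreover have "star A ?a = ?a" using z by (simp add: star_mult star_closed star_star)
    ultimately obtain b where b: "b \<in> carrier A" "star A b = b" "b \<otimes> b = \<one> \<ominus> ?a"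
      using sqrt_one_minus[of ?a] z star_closed by auto
    have "\<omega> (\<one> \<ominus> ?a) \<in> \<real>\<^sub>\<ge>\<^sub>0" using pos[of b] b by simp
    moreover have "\<omega> (\<one> \<ominus> ?a) = \<omega> \<one> - \<omega> ?a" using z star_closed by (simp add: minus_csm add sm)
    ultimately show ?thesis by (auto simp: complex_nonneg_Reals_iff)
  qed
  have p1: "0 <= Re (\<omega> \<one>)" using pos[of \<one>] by (auto simp: complex_nonneg_Reals_iff)
  have 2: "Re (\<omega> (star A x \<otimes> x)) <= r\<^sup>2 * Re (\<omega> \<one>)" if r: "r > cnorm A x" for r
  proof -
    have r0: "r > 0" using r cnorm_nonneg[OF x] by simp
    let ?z = "of_real (1/r) \<odot> x"
    have "cnorm A ?z = cnorm A x / r" using r0 x by (simp add: cnorm_smult norm_divide)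
    then have "cnorm A ?z < 1" using r r0 by simp
    then have "Re (\<omega> (star A ?z \<otimes> ?z)) <= Re (\<omega> \<one>)" using 1 x by simp
    moreover have "star A ?z \<otimes> ?z = of_real (1/r\<^sup>2) \<odot> (star A x \<otimes> x)"
      using x star_closed by (simp add: star_smult smult_mult_left smult_mult_right csm_assoc power2_eq_square)
    ultimately have "Re (\<omega> (star A x \<otimes> x)) / r\<^sup>2 <= Re (\<omega> \<one>)"
      using x star_closed by (simp add: sm del: of_real_divide)
    then show ?thesis using r0 by (simp add: field_simps)
  qed
  \<comment> \<open>Scaling reaches only radii above \<open>cnorm A x\<close>, because the root
    exists for norms strictly below 1; the radius now tends to the norm.\<close>
  have "(%n. (cnorm A x + 1 / real (Suc n))\<^sup>2 * Re (\<omega> \<one>)) \<longlonglongrightarrow> (cnorm A x + 0)\<^sup>2 * Re (\<omega> \<one>)"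
    by (intro tendsto_intros lim_1_over_n[THEN LIMSEQ_Suc])
  moreover have "Re (\<omega> (star A x \<otimes> x)) <= (cnorm A x + 1 / real (Suc n))\<^sup>2 * Re (\<omega> \<one>)" for n by (rule 2) simp
  ultimately have "Re (\<omega> (star A x \<otimes> x)) <= (cnorm A x + 0)\<^sup>2 * Re (\<omega> \<one>)" by (intro LIMSEQ_le_const) auto
  then show ?thesis by simp
qed

end

lemma cstar_subalgebra_algebra:
  assumes A: "cstar_algebra A" and S: "cstar_subalgebra A S" and one: "\<one>\<^bsub>A\<^esub> \<in> S"
  shows "cstar_algebra (A\<lparr>carrier := S\<rparr>)"
proof -
  interpret cstar_algebra A by fact
  let ?B = "A\<lparr>carrier := S\<rparr>"
  have sub: "x \<in> S ==> x \<in> carrier A" for x using S by (auto simp: cstar_subalgebra_def)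
  have cl: "\<zero>\<^bsub>A\<^esub> \<in> S" "x \<in> S ==> y \<in> S ==> x \<oplus>\<^bsub>A\<^esub> y \<in> S" "x \<in> S ==> y \<in> S ==> x \<otimes>\<^bsub>A\<^esub> y \<in> S"
    "x \<in> S ==> c \<odot>\<^bsub>A\<^esub> x \<in> S" "x \<in> S ==> star A x \<in> S" for x y c
    using S by (auto simp: cstar_subalgebra_def)
  have ag: "abelian_group ?B"
  proof (rule abelian_groupI)
    show "\<exists>y\<in>carrier ?B. y \<oplus>\<^bsub>?B\<^esub> x = \<zero>\<^bsub>?B\<^esub>" if "x \<in> carrier ?B" for x
      using that sub csm_l[of x "-1" 1] by (auto intro!: bexI[of _ "(-1) \<odot>\<^bsub>A\<^esub> x"] cl)
  qed (auto simp: sub cl a_ac)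
  have mon: "monoid ?B" by (rule monoidI) (auto simp: sub cl one m_assoc)
  have rg: "ring ?B" by (rule ringI[OF ag mon]) (auto simp: sub l_distr r_distr)
  have md: "module complex_ring ?B"
    by (rule moduleI[OF cring_complex_ring ag]) (auto simp: sub cl csm_l csm_r csm_assoc)
  have "cnormed ?B (cnorm A)"
    unfolding cnormed_def cmodule_def cnormed_axioms_def
    using md by (auto simp: sub cl cnorm_nonneg cnorm_definite cnorm_smult cnorm_triangle)
  then interpret B: cnormed ?B "cnorm A" .
  have min: "x \<ominus>\<^bsub>?B\<^esub> y = x \<ominus>\<^bsub>A\<^esub> y" if "x \<in> S" "y \<in> S" for x y
    using that B.minus_csm[of x y] minus_csm[of x y] sub by simp
  have "Metric_space.mcomplete (carrier ?B) (norm_dist ?B (cnorm A))"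
    unfolding B.mcomplete_iff
  proof (intro allI impI)
    fix sg :: "nat => 'a" assume s: "ALL n. sg n \<in> carrier ?B" and c: "\<forall>e>0. EX M. \<forall>m\<ge>M. \<forall>n\<ge>M. cnorm A (sg m \<ominus>\<^bsub>?B\<^esub> sg n) < e"
    have sS: "sg n \<in> S" for n using s by simp
    have "\<forall>e>0. EX M. \<forall>m\<ge>M. \<forall>n\<ge>M. cnorm A (sg m \<ominus>\<^bsub>A\<^esub> sg n) < e" using c min[OF sS sS] by simp
    then obtain l where l: "l \<in> carrier A" "(%n. cnorm A (sg n \<ominus>\<^bsub>A\<^esub> l)) \<longlonglongrightarrow> 0"
      using cnorm_complete sub[OF sS] unfolding mcomplete_iff by blast
    have "closedin (Metric_space.mtopology (carrier A) (norm_dist A (cnorm A))) S"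
      using S by (auto simp: cstar_subalgebra_def)
    then have lS: "l \<in> S" using l sS unfolding closedin_iff by blast
    then show "\<exists>l\<in>carrier ?B. (%n. cnorm A (sg n \<ominus>\<^bsub>?B\<^esub> l)) \<longlonglongrightarrow> 0"
      using l min[OF sS lS] by (intro bexI[of _ l]) auto
  qed
  then show ?thesis
    unfolding cstar_algebra_def cstar_algebra_axioms_def
    using md rg one_not_zero
    by (auto simp: sub cl smult_mult_left smult_mult_right star_star star_add star_smult star_mult
      cnorm_nonneg cnorm_definite cnorm_smult cnorm_triangle cnorm_mult cnorm_star)
qed

lemma cstar_generated_subalgebra:
  assumes A: "cstar_algebra A" and G: "G \<subseteq> carrier A"
  shows "cstar_subalgebra A (cstar_generated A G)" "G \<subseteq> cstar_generated A G"
proof -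
  interpret cstar_algebra A by fact
  have "cstar_subalgebra A (carrier A)"
    by (auto simp: cstar_subalgebra_def star_closed closedin_iff)
  then have "cstar_generated A G \<subseteq> carrier A" "{S. cstar_subalgebra A S & G \<subseteq> S} ~= {}" using G by (auto simp: cstar_generated_def)
  moreover from this have "closedin (Metric_space.mtopology (carrier A) (norm_dist A (cnorm A))) (cstar_generated A G)"
    unfolding cstar_generated_def by (intro closedin_Inter) (auto simp: cstar_subalgebra_def)
  ultimately show "cstar_subalgebra A (cstar_generated A G)"
    unfolding cstar_subalgebra_def by (auto simp: cstar_generated_def cstar_subalgebra_def)
  show "G \<subseteq> cstar_generated A G" by (auto simp: cstar_generated_def)
qed

section \<open>Hilbert spaces\<close>

text \<open>The scalar core of the Cauchy-Schwarz inequalities below, including those for degenerate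
  forms, where \<open>c = 0\<close> does not make a vector vanish. The substitution
  \<open>z = -s cnj b\<close> leaves a real quadratic in \<open>s\<close>.\<close>

lemma quadratic_discriminant:
  fixes a c :: real and b :: complex
  assumes "!!z::complex. 0 <= a + 2 * Re (z * b) + (cmod z)\<^sup>2 * c" and "0 <= c"
  shows "(cmod b)\<^sup>2 <= a * c"
proof -
  have q: "0 <= a - 2 * s * (cmod b)\<^sup>2 + s\<^sup>2 * (cmod b)\<^sup>2 * c" for s :: real
  proof -
    have "cnj b * b = of_real ((cmod b)\<^sup>2)" by (metis complex_norm_square mult.commute)
    then have "- of_real s * cnj b * b = of_real (- s * (cmod b)\<^sup>2)" by simp
    then have "Re (- of_real s * cnj b * b) = - s * (cmod b)\<^sup>2" by (simp only: Re_complex_of_real)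
    then show ?thesis
      using assms(1)[of "- of_real s * cnj b"]
      by (simp only: norm_mult norm_minus_cancel norm_of_real complex_mod_cnj power_mult_distrib power2_abs mult.assoc)
  qed
  show ?thesis
  proof (cases "c = 0")
    case True
    show ?thesis
    proof (cases "b = 0")
      case False
      then have "0 < (cmod b)\<^sup>2" by simp
      \<comment> \<open>This value of \<open>s\<close> turns the bound into
        \<open>0 <= -1\<close>.\<close>
      then show ?thesis using q[of "(a + 1) / (2 * (cmod b)\<^sup>2)"] True by (simp add: field_simps)
    qed (use True in simp)
  next
    case False
    then have "0 < c" using assms by simp
    then show ?thesis using q[of "1 / c"] by (simp add: field_simps power2_eq_square)
  qed
qed

lemma nonneg_Reals_square: "z * cnj z \<in> \<real>\<^sub>\<ge>\<^sub>0"
  by (simp add: complex_nonneg_Reals_iff complex_mult_cnj)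

sublocale hilbert_space \<subseteq> cmodule H by unfold_locales

context hilbert_space
begin

lemmas ip_add_left = iprod_add and ip_smult_left = iprod_smult

lemma ip_cnj: "\<lbrakk>x \<in> carrier H; y \<in> carrier H\<rbrakk> \<Longrightarrow> cnj (iprod H x y) = iprod H y x"
  using iprod_cnj[of x y] by metis

lemma ip_add_right: "\<lbrakk>x \<in> carrier H; y \<in> carrier H; z \<in> carrier H\<rbrakk>
    \<Longrightarrow> iprod H x (y \<oplus> z) = iprod H x y + iprod H x z"
  using iprod_cnj[of "y \<oplus> z" x] iprod_cnj[of y x] iprod_cnj[of z x] by (simp add: iprod_add)

lemma ip_smult_right: "\<lbrakk>x \<in> carrier H; y \<in> carrier H\<rbrakk> \<Longrightarrow> iprod H x (c \<odot> y) = cnj c * iprod H x y"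
  using iprod_cnj[of "c \<odot> y" x] iprod_cnj[of y x] by (simp add: iprod_smult)

lemma ip_zero_left [simp]: "x \<in> carrier H ==> iprod H \<zero> x = 0"
  using iprod_smult[of \<zero> x 0] by simp

lemma ip_zero_right [simp]: "x \<in> carrier H ==> iprod H x \<zero> = 0"
  using ip_smult_right[of x \<zero> 0] by simp

lemma ip_minus_left: "\<lbrakk>x \<in> carrier H; y \<in> carrier H; z \<in> carrier H\<rbrakk>
    \<Longrightarrow> iprod H (x \<ominus> y) z = iprod H x z - iprod H y z"
  by (simp add: minus_csm iprod_add iprod_smult)

lemma ip_minus_right: "\<lbrakk>x \<in> carrier H; y \<in> carrier H; z \<in> carrier H\<rbrakk>
    \<Longrightarrow> iprod H z (x \<ominus> y) = iprod H z x - iprod H z y"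
  by (simp add: minus_csm ip_add_right ip_smult_right)

lemmas ip_simps = ip_add_left ip_smult_left ip_add_right ip_smult_right ip_minus_left ip_minus_right

lemma ip_finsum_left: "\<lbrakk>f \<in> A \<rightarrow> carrier H; y \<in> carrier H\<rbrakk> \<Longrightarrow> iprod H (finsum H f A) y = (\<Sum>i\<in>A. iprod H (f i) y)"
proof (induct A rule: infinite_finite_induct)
  case (insert x F)
  then have "f \<in> F \<rightarrow> carrier H" "f x \<in> carrier H" by auto
  then show ?case using insert by (simp add: M.finsum_insert iprod_add)
qed auto

lemma ip_finsum_right: "\<lbrakk>f \<in> A \<rightarrow> carrier H; y \<in> carrier H\<rbrakk> \<Longrightarrow> iprod H y (finsum H f A) = (\<Sum>i\<in>A. iprod H y (f i))"
proof (induct A rule: infinite_finite_induct)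
  case (insert x F)
  then have "f \<in> F \<rightarrow> carrier H" "f x \<in> carrier H" by auto
  then show ?case using insert by (simp add: M.finsum_insert ip_add_right)
qed auto

lemma ip_self: "x \<in> carrier H ==> iprod H x x = of_real ((hnorm H x)\<^sup>2)"
  using iprod_nonneg[of x] by (auto simp: hnorm_def complex_nonneg_Reals_iff complex_eq_iff)

lemma hnorm_sq: "x \<in> carrier H ==> (hnorm H x)\<^sup>2 = Re (iprod H x x)"
  using iprod_nonneg[of x] by (auto simp: hnorm_def complex_nonneg_Reals_iff)

lemma hnorm_nonneg: "x \<in> carrier H ==> 0 <= hnorm H x"
  using iprod_nonneg[of x] by (auto simp: hnorm_def complex_nonneg_Reals_iff)

lemma Cauchy_Schwarz: assumes x: "x \<in> carrier H" and y: "y \<in> carrier H"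
  shows "cmod (iprod H x y) <= hnorm H x * hnorm H y"
proof -
  have "(cmod (iprod H y x))\<^sup>2 <= (hnorm H x)\<^sup>2 * (hnorm H y)\<^sup>2"
  proof (rule quadratic_discriminant)
    fix z
    have "0 <= (hnorm H (x \<oplus> z \<odot> y))\<^sup>2" by simp
    also have "\<dots> = Re (iprod H x x + cnj z * iprod H x y + (z * iprod H y x + z * cnj z * iprod H y y))"
      using x y by (simp only: hnorm_sq M.add.m_closed csm_closed) (simp add: ip_simps algebra_simps)
    also have "cnj z * iprod H x y = cnj (z * iprod H y x)" using x y by (simp add: ip_cnj)
    also have "z * cnj z = of_real ((cmod z)\<^sup>2)" by (rule complex_norm_square[symmetric])
    finally show "0 <= (hnorm H x)\<^sup>2 + 2 * Re (z * iprod H y x) + (cmod z)\<^sup>2 * (hnorm H y)\<^sup>2"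
      using x y by (simp add: hnorm_sq)
  qed simp
  then have "(cmod (iprod H x y))\<^sup>2 <= (hnorm H x * hnorm H y)\<^sup>2"
    using ip_cnj[OF y x] by (metis complex_mod_cnj power_mult_distrib)
  then show ?thesis by (rule power2_le_imp_le) (use x y hnorm_nonneg in simp)
qed

end

sublocale hilbert_space \<subseteq> cnormed H "hnorm H"
proof
  show "hnorm H (c \<odot> x) = cmod c * hnorm H x" if "x \<in> carrier H" for c x
  proof -
    have "(hnorm H (c \<odot> x))\<^sup>2 = Re ((c * cnj c) * iprod H x x)"
      using that by (simp only: hnorm_sq csm_closed) (simp add: ip_simps algebra_simps)
    also have "\<dots> = (cmod c * hnorm H x)\<^sup>2"
      using that by (simp add: complex_mult_cnj cmod_power2 power_mult_distrib hnorm_sq)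
    finally show ?thesis by (rule power2_eq_imp_eq) (use that hnorm_nonneg in simp_all)
  qed
  show "hnorm H (x \<oplus> y) <= hnorm H x + hnorm H y" if xy: "x \<in> carrier H" "y \<in> carrier H" for x y
  proof -
    have "(hnorm H (x \<oplus> y))\<^sup>2 = (hnorm H x)\<^sup>2 + (hnorm H y)\<^sup>2 + Re (iprod H x y) + Re (cnj (iprod H x y))"
      using xy by (simp only: hnorm_sq M.add.m_closed ip_cnj) (simp add: ip_simps algebra_simps)
    also have "\<dots> <= (hnorm H x + hnorm H y)\<^sup>2"
      using Cauchy_Schwarz[OF xy] complex_Re_le_cmod[of "iprod H x y"] by (simp add: power2_sum)
    finally show ?thesis by (rule power2_le_imp_le) (use xy hnorm_nonneg in simp)
  qed
qed (use hnorm_nonneg ip_self iprod_definite in auto)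

context hilbert_space
begin

lemma hilbert_eqI: "\<lbrakk>x \<in> carrier H; y \<in> carrier H; !!z. z \<in> carrier H ==> iprod H x z = iprod H y z\<rbrakk> \<Longrightarrow> x = y"
  using ip_self[of "x \<ominus> y"] by (intro eq_of_minus) (auto simp: ip_minus_left)

lemma iprod_lim:
  assumes "!!n. sg n \<in> carrier H" "l \<in> carrier H" "y \<in> carrier H" "(%n. hnorm H (sg n \<ominus> l)) \<longlonglongrightarrow> 0"
  shows "(%n. iprod H (sg n) y) \<longlonglongrightarrow> iprod H l y" "(%n. iprod H y (sg n)) \<longlonglongrightarrow> iprod H y l"
proof -
  have "cmod (iprod H (sg n) y - iprod H l y) <= hnorm H (sg n \<ominus> l) * hnorm H y" for n
    using Cauchy_Schwarz[of "sg n \<ominus> l" y] assms by (simp add: ip_minus_left)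
  moreover have "(%n. hnorm H (sg n \<ominus> l) * hnorm H y) \<longlonglongrightarrow> 0" using assms(4) by (rule tendsto_mult_left_zero)
  ultimately have "(%n. iprod H (sg n) y - iprod H l y) \<longlonglongrightarrow> 0" by (rule Lim_null_comparison[OF always_eventually[OF allI]])
  then show *: "(%n. iprod H (sg n) y) \<longlonglongrightarrow> iprod H l y" by (simp add: LIM_zero_iff)
  have "(%n. cnj (iprod H (sg n) y)) \<longlonglongrightarrow> cnj (iprod H l y)" by (intro tendsto_intros *)
  then show "(%n. iprod H y (sg n)) \<longlonglongrightarrow> iprod H y l" using assms by (simp add: ip_cnj)
qed

lemma hnorm_lim_le:
  assumes "!!n. sg n \<in> carrier H" "l \<in> carrier H" "(%n. hnorm H (sg n \<ominus> l)) \<longlonglongrightarrow> 0"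
    and "!!n. n \<ge> n0 ==> hnorm H (sg n) <= K"
  shows "hnorm H l <= K"
proof -
  have "hnorm H l <= hnorm H (sg n \<ominus> l) + K" if "n \<ge> n0" for n
    using N_le_diff[of l "sg n"] N_commute[of l "sg n"] assms(1)[of n] assms(2) assms(4)[OF that] by simp
  moreover have "(%n. hnorm H (sg n \<ominus> l) + K) \<longlonglongrightarrow> 0 + K" by (intro tendsto_intros assms)
  ultimately have "hnorm H l <= 0 + K" by (intro LIMSEQ_le_const) auto
  then show ?thesis by simp
qed

end

section \<open>Algebras of operators\<close>

text \<open>Adjoints are carried as explicit pairs, which spares the Riesz representation theorem:
  each operator constructed below comes with a candidate for its adjoint. Both members of a pair are
  automatically linear on the carrier.\<close>

definition adj_pair :: "('h, 'm) hspace_scheme => ('h => 'h) => ('h => 'h) => bool" where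
  "adj_pair H T S \<longleftrightarrow> T \<in> carrier H \<rightarrow> carrier H & S \<in> carrier H \<rightarrow> carrier H
     & (\<forall>x\<in>carrier H. \<forall>y\<in>carrier H. iprod H (T x) y = iprod H x (S y))"

definition op_bound :: "('h, 'm) hspace_scheme => ('h => 'h) => real => bool" where
  "op_bound H T K \<longleftrightarrow> 0 <= K & (\<forall>x\<in>carrier H. hnorm H (T x) <= K * hnorm H x)"

definition op_norm :: "('h, 'm) hspace_scheme => ('h => 'h) => real" where
  "op_norm H T = Inf {K. op_bound H T K}"

definition hadjoint :: "('h, 'm) hspace_scheme => ('h => 'h) => 'h => 'h" where
  "hadjoint H T = (\<lambda>x\<in>carrier H. THE y. y \<in> carrier H & (\<forall>z\<in>carrier H. iprod H (T z) x = iprod H z y))"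

text \<open>The operators commuting with \<open>Z\<close>, extensional so that equality of operators is equality of functions.\<close>

definition commutant :: "('h, 'm) hspace_scheme => ('h => 'h) set => ('h => 'h) set" where
  "commutant H Z = {T \<in> extensional (carrier H). (EX K. op_bound H T K) & (EX S. adj_pair H T S)
     & (\<forall>Q\<in>Z. \<forall>x\<in>carrier H. T (Q x) = Q (T x))}"

text \<open>The condition on \<open>Z\<close> that makes its commutant closed under adjoints; it
  also makes the members of \<open>Z\<close> linear on the carrier.\<close>

definition self_adjoint_set :: "('h, 'm) hspace_scheme => ('h => 'h) set => bool" where
  "self_adjoint_set H Z \<longleftrightarrow> (\<forall>Q\<in>Z. \<exists>Q'\<in>Z. adj_pair H Q Q')"

definition op_algebra :: "('h, 'm) hspace_scheme => ('h => 'h) set => ('h => 'h) cstar" where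
  "op_algebra H Z = \<lparr>carrier = commutant H Z, mult = (%S T. \<lambda>x\<in>carrier H. S (T x)),
     one = (\<lambda>x\<in>carrier H. x), zero = (\<lambda>x\<in>carrier H. \<zero>\<^bsub>H\<^esub>),
     add = (%S T. \<lambda>x\<in>carrier H. S x \<oplus>\<^bsub>H\<^esub> T x), smult = (%c T. \<lambda>x\<in>carrier H. c \<odot>\<^bsub>H\<^esub> T x),
     star = hadjoint H, cnorm = op_norm H\<rparr>"

lemma op_algebra_simps [simp]:
  "carrier (op_algebra H Z) = commutant H Z"
  "S \<otimes>\<^bsub>op_algebra H Z\<^esub> T = (\<lambda>x\<in>carrier H. S (T x))"
  "\<one>\<^bsub>op_algebra H Z\<^esub> = (\<lambda>x\<in>carrier H. x)"
  "\<zero>\<^bsub>op_algebra H Z\<^esub> = (\<lambda>x\<in>carrier H. \<zero>\<^bsub>H\<^esub>)"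
  "S \<oplus>\<^bsub>op_algebra H Z\<^esub> T = (\<lambda>x\<in>carrier H. S x \<oplus>\<^bsub>H\<^esub> T x)"
  "c \<odot>\<^bsub>op_algebra H Z\<^esub> T = (\<lambda>x\<in>carrier H. c \<odot>\<^bsub>H\<^esub> T x)"
  "star (op_algebra H Z) = hadjoint H" "cnorm (op_algebra H Z) = op_norm H"
  by (auto simp: op_algebra_def)

context hilbert_space
begin

lemma adj_pair_closed: "adj_pair H T S ==> x \<in> carrier H ==> T x \<in> carrier H"
  "adj_pair H T S ==> x \<in> carrier H ==> S x \<in> carrier H"
  by (auto simp: adj_pair_def)

lemma adj_pair_iprod: "adj_pair H T S ==> x \<in> carrier H ==> y \<in> carrier H ==> iprod H (T x) y = iprod H x (S y)"
  by (auto simp: adj_pair_def)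

lemma adj_pair_sym: "adj_pair H T S ==> adj_pair H S T"
proof -
  assume p: "adj_pair H T S"
  have "iprod H (S x) y = iprod H x (T y)" if "x \<in> carrier H" "y \<in> carrier H" for x y
    using adj_pair_iprod[OF p that(2,1)] ip_cnj[of y "S x"] ip_cnj[of "T y" x] that adj_pair_closed[OF p] by simp
  then show ?thesis using p by (auto simp: adj_pair_def)
qed

lemma adj_pair_add: "adj_pair H T S ==> x \<in> carrier H ==> y \<in> carrier H ==> T (x \<oplus> y) = T x \<oplus> T y"
  by (rule hilbert_eqI) (auto simp: adj_pair_closed adj_pair_iprod ip_simps)

lemma adj_pair_smult: "adj_pair H T S ==> x \<in> carrier H ==> T (c \<odot> x) = c \<odot> T x"
  by (rule hilbert_eqI) (auto simp: adj_pair_closed adj_pair_iprod ip_simps)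

lemma adj_pair_zero: "adj_pair H T S ==> T \<zero> = \<zero>"
  by (rule hilbert_eqI) (auto simp: adj_pair_closed adj_pair_iprod ip_simps)

lemma adj_pair_comp: "adj_pair H T S ==> adj_pair H T' S' ==> adj_pair H (\<lambda>x\<in>carrier H. T (T' x)) (\<lambda>x\<in>carrier H. S' (S x))"
  by (auto simp: adj_pair_def Pi_iff)

lemma adj_pair_bound: assumes "adj_pair H T S" "op_bound H T K" shows "op_bound H S K"
  unfolding op_bound_def
proof (intro conjI ballI)
  show "0 <= K" using assms by (simp add: op_bound_def)
  fix x assume x: "x \<in> carrier H"
  have S: "S x \<in> carrier H" "T (S x) \<in> carrier H" using assms x by (auto simp: adj_pair_closed)
  have "(hnorm H (S x))\<^sup>2 = Re (iprod H (T (S x)) x)" using S x assms by (simp add: hnorm_sq adj_pair_iprod)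
  also have "\<dots> <= hnorm H (T (S x)) * hnorm H x" using Cauchy_Schwarz[OF S(2) x] complex_Re_le_cmod[of "iprod H (T (S x)) x"] by linarith
  also have "\<dots> <= (K * hnorm H (S x)) * hnorm H x" using assms S x by (intro mult_right_mono) (auto simp: op_bound_def N_nonneg)
  finally have "hnorm H (S x) * hnorm H (S x) <= (K * hnorm H x) * hnorm H (S x)" by (simp add: power2_eq_square mult_ac)
  then show "hnorm H (S x) <= K * hnorm H x"
    using N_nonneg[OF S(1)] N_nonneg[OF x] \<open>0 <= K\<close> by (cases "hnorm H (S x) = 0") auto
qed

lemma op_bound_norm: assumes "op_bound H T K" shows "op_bound H T (op_norm H T)" "op_norm H T <= K" "0 <= op_norm H T"
proof -
  let ?B = "{K. op_bound H T K}"
  have ne: "?B ~= {}" "bdd_below ?B" using assms by (auto intro!: bdd_belowI[of _ 0] simp: op_bound_def)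
  show "op_norm H T <= K" unfolding op_norm_def using ne assms by (intro cInf_lower) auto
  show 0: "0 <= op_norm H T" unfolding op_norm_def using ne by (intro cInf_greatest) (auto simp: op_bound_def)
  show "op_bound H T (op_norm H T)" unfolding op_bound_def
  proof (intro conjI ballI 0)
    fix x assume x: "x \<in> carrier H"
    show "hnorm H (T x) <= op_norm H T * hnorm H x"
    proof (cases "hnorm H x = 0")
      case True then show ?thesis using assms x by (auto simp: op_bound_def)
    next
      case False
      then have p: "hnorm H x > 0" using N_nonneg[OF x] by simp
      have "hnorm H (T x) / hnorm H x <= op_norm H T" unfolding op_norm_def
        using ne x p by (intro cInf_greatest) (auto simp: op_bound_def field_simps)
      then show ?thesis using p by (simp add: field_simps)
    qed
  qed
qed

lemma commutantD:
  assumes "T \<in> commutant H Z"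
  shows "T \<in> extensional (carrier H)" "x \<in> carrier H ==> T x \<in> carrier H"
    "op_bound H T (op_norm H T)" "0 <= op_norm H T"
    "x \<in> carrier H ==> hnorm H (T x) <= op_norm H T * hnorm H x"
    "Q \<in> Z ==> x \<in> carrier H ==> T (Q x) = Q (T x)"
  using assms op_bound_norm by (auto simp: commutant_def adj_pair_closed op_bound_def)

lemma commutantI:
  assumes "T \<in> extensional (carrier H)" "op_bound H T K" "adj_pair H T S"
    "!!Q x. Q \<in> Z ==> x \<in> carrier H ==> T (Q x) = Q (T x)"
  shows "T \<in> commutant H Z"
  using assms by (auto simp: commutant_def)

lemma hadjoint_eqI: assumes "adj_pair H T S" "S \<in> extensional (carrier H)" shows "hadjoint H T = S"
proof (rule extensionalityI[of _ "carrier H"])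
  fix x assume x: "x \<in> carrier H"
  have "(THE y. y \<in> carrier H & (\<forall>z\<in>carrier H. iprod H (T z) x = iprod H z y)) = S x"
  proof (rule the_equality)
    show "S x \<in> carrier H & (\<forall>z\<in>carrier H. iprod H (T z) x = iprod H z (S x))" using assms x by (auto simp: adj_pair_def)
    fix y assume y: "y \<in> carrier H & (\<forall>z\<in>carrier H. iprod H (T z) x = iprod H z y)"
    then have "iprod H z y = iprod H z (S x)" if "z \<in> carrier H" for z using that assms x by (auto simp: adj_pair_def)
    then have "iprod H y z = iprod H (S x) z" if "z \<in> carrier H" for z
      using that y assms x iprod_cnj[of z y] iprod_cnj[of z "S x"] adj_pair_closed by simp
    then show "y = S x" using y assms x by (intro hilbert_eqI) (auto simp: adj_pair_closed)
  qed
  then show "hadjoint H T x = S x" using x by (simp add: hadjoint_def)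
qed (auto simp: hadjoint_def assms)

lemma hadjoint_pair: assumes "T \<in> commutant H Z" shows "adj_pair H T (hadjoint H T)"
proof -
  obtain S where S: "adj_pair H T S" using assms by (auto simp: commutant_def)
  then have p: "adj_pair H T (restrict S (carrier H))" by (auto simp: adj_pair_def)
  then have "hadjoint H T = restrict S (carrier H)" by (intro hadjoint_eqI) auto
  then show ?thesis using p by simp
qed

lemma hadjoint_commutant: assumes T: "T \<in> commutant H Z" and Z: "self_adjoint_set H Z"
  shows "hadjoint H T \<in> commutant H Z"
proof (rule commutantI)
  have p: "adj_pair H T (hadjoint H T)" using T by (rule hadjoint_pair)
  show "hadjoint H T \<in> extensional (carrier H)" by (simp add: hadjoint_def)
  show "op_bound H (hadjoint H T) (op_norm H T)" by (rule adj_pair_bound[OF p]) (use T commutantD in auto)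
  show "adj_pair H (hadjoint H T) T" by (rule adj_pair_sym[OF p])
  fix Q x assume Q: "Q \<in> Z" and x: "x \<in> carrier H"
  obtain Q' where Q': "Q' \<in> Z" "adj_pair H Q Q'" using Q Z by (auto simp: self_adjoint_set_def)
  show "hadjoint H T (Q x) = Q (hadjoint H T x)"
  proof (rule hilbert_eqI)
    fix z assume z: "z \<in> carrier H"
    have "iprod H (hadjoint H T (Q x)) z = iprod H x (Q' (T z))"
      using x z Q' adj_pair_sym[OF p] T by (simp add: adj_pair_iprod[of "hadjoint H T" T] adj_pair_iprod[of Q Q'] adj_pair_closed[OF Q'(2)] commutantD)
    also have "\<dots> = iprod H x (T (Q' z))" using commutantD(6)[OF T Q'(1) z] by simp
    also have "\<dots> = iprod H (Q (hadjoint H T x)) z"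
      using x z adj_pair_sym[OF p] by (simp add: adj_pair_iprod[of "hadjoint H T" T] adj_pair_iprod[OF Q'(2)] adj_pair_closed[OF Q'(2)] adj_pair_closed[OF p])
    finally show "iprod H (hadjoint H T (Q x)) z = iprod H (Q (hadjoint H T x)) z" .
  qed (use x p Q' in \<open>auto simp: adj_pair_closed\<close>)
qed

lemma op_norm_hadjoint: assumes T: "T \<in> commutant H Z" shows "op_norm H (hadjoint H T) <= op_norm H T"
  using op_bound_norm(2)[OF adj_pair_bound[OF hadjoint_pair[OF T] commutantD(3)[OF T]]] .

lemma hadjoint_hadjoint: assumes T: "T \<in> commutant H Z" shows "hadjoint H (hadjoint H T) = T"
  by (rule hadjoint_eqI[OF adj_pair_sym[OF hadjoint_pair[OF T]]]) (use T commutantD in auto)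

lemma commutant_ops:
  assumes Z: "self_adjoint_set H Z"
  shows "S \<in> commutant H Z ==> T \<in> commutant H Z ==> (\<lambda>x\<in>carrier H. S (T x)) \<in> commutant H Z"
    "S \<in> commutant H Z ==> T \<in> commutant H Z ==> (\<lambda>x\<in>carrier H. S x \<oplus> T x) \<in> commutant H Z"
    "T \<in> commutant H Z ==> (\<lambda>x\<in>carrier H. c \<odot> T x) \<in> commutant H Z"
    "(\<lambda>x\<in>carrier H. x) \<in> commutant H Z" "(\<lambda>x\<in>carrier H. \<zero>) \<in> commutant H Z"
    "S \<in> commutant H Z ==> T \<in> commutant H Z ==> op_norm H (\<lambda>x\<in>carrier H. S (T x)) <= op_norm H S * op_norm H T"
    "S \<in> commutant H Z ==> T \<in> commutant H Z ==> op_norm H (\<lambda>x\<in>carrier H. S x \<oplus> T x) <= op_norm H S + op_norm H T"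
proof -
  have Q: "Q x \<in> carrier H" "Q (x \<oplus> y) = Q x \<oplus> Q y" "Q (c \<odot> x) = c \<odot> Q x" "Q \<zero> = \<zero>"
    if "Q \<in> Z" "x \<in> carrier H" "y \<in> carrier H" for Q x y c
  proof -
    obtain Q' where "adj_pair H Q Q'" using \<open>Q \<in> Z\<close> Z by (auto simp: self_adjoint_set_def)
    then show "Q x \<in> carrier H" "Q (x \<oplus> y) = Q x \<oplus> Q y" "Q (c \<odot> x) = c \<odot> Q x" "Q \<zero> = \<zero>"
      using that by (auto simp: adj_pair_closed adj_pair_add adj_pair_smult adj_pair_zero)
  qed
  { assume S: "S \<in> commutant H Z" and T: "T \<in> commutant H Z"
    note cS = commutantD[OF S] and cT = commutantD[OF T]
    have b: "op_bound H (\<lambda>x\<in>carrier H. S (T x)) (op_norm H S * op_norm H T)"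
      unfolding op_bound_def
    proof (intro conjI ballI)
      fix x assume x: "x \<in> carrier H"
      have "hnorm H (S (T x)) <= op_norm H S * hnorm H (T x)" using x cS cT by simp
      also have "\<dots> <= op_norm H S * (op_norm H T * hnorm H x)" using x cS cT by (intro mult_left_mono) auto
      finally show "hnorm H ((\<lambda>x\<in>carrier H. S (T x)) x) <= op_norm H S * op_norm H T * hnorm H x" using x by simp
    qed (use cS cT in auto)
    show "(\<lambda>x\<in>carrier H. S (T x)) \<in> commutant H Z"
      by (rule commutantI[OF _ b adj_pair_comp[OF hadjoint_pair[OF S] hadjoint_pair[OF T]]]) (auto simp: Q cS(6) cT)
    show "op_norm H (\<lambda>x\<in>carrier H. S (T x)) <= op_norm H S * op_norm H T" by (rule op_bound_norm(2)[OF b])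
    have b: "op_bound H (\<lambda>x\<in>carrier H. S x \<oplus> T x) (op_norm H S + op_norm H T)"
      unfolding op_bound_def
    proof (intro conjI ballI)
      fix x assume x: "x \<in> carrier H"
      have "hnorm H (S x \<oplus> T x) <= hnorm H (S x) + hnorm H (T x)" using x cS cT by (simp add: N_triangle)
      also have "\<dots> <= op_norm H S * hnorm H x + op_norm H T * hnorm H x" using x cS cT by (intro add_mono) auto
      finally show "hnorm H ((\<lambda>x\<in>carrier H. S x \<oplus> T x) x) <= (op_norm H S + op_norm H T) * hnorm H x" using x by (simp add: distrib_right)
    qed (use cS cT in auto)
    have a: "adj_pair H (\<lambda>x\<in>carrier H. S x \<oplus> T x) (\<lambda>x\<in>carrier H. hadjoint H S x \<oplus> hadjoint H T x)"
      using hadjoint_pair[OF S] hadjoint_pair[OF T] by (auto simp: adj_pair_def Pi_iff ip_simps)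
    show "(\<lambda>x\<in>carrier H. S x \<oplus> T x) \<in> commutant H Z"
      by (rule commutantI[OF _ b a]) (auto simp: Q cS(2,6) cT(2,6))
    show "op_norm H (\<lambda>x\<in>carrier H. S x \<oplus> T x) <= op_norm H S + op_norm H T" by (rule op_bound_norm(2)[OF b]) }
  { assume T: "T \<in> commutant H Z"
    note cT = commutantD[OF T]
    have b: "op_bound H (\<lambda>x\<in>carrier H. c \<odot> T x) (cmod c * op_norm H T)"
      using cT by (auto simp: op_bound_def N_smult mult.assoc intro!: mult_left_mono)
    have a: "adj_pair H (\<lambda>x\<in>carrier H. c \<odot> T x) (\<lambda>x\<in>carrier H. cnj c \<odot> hadjoint H T x)"
      using hadjoint_pair[OF T] by (auto simp: adj_pair_def Pi_iff ip_simps)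
    show "(\<lambda>x\<in>carrier H. c \<odot> T x) \<in> commutant H Z"
      by (rule commutantI[OF _ b a]) (auto simp: Q cT(2,6)) }
  show "(\<lambda>x\<in>carrier H. x) \<in> commutant H Z"
    by (rule commutantI[of _ 1 "\<lambda>x\<in>carrier H. x"]) (auto simp: op_bound_def adj_pair_def Q)
  show "(\<lambda>x\<in>carrier H. \<zero>) \<in> commutant H Z"
    by (rule commutantI[of _ 0 "\<lambda>x\<in>carrier H. \<zero>"]) (auto simp: op_bound_def adj_pair_def Q)
qed

lemma op_norm_smult: assumes Z: "self_adjoint_set H Z" and T: "T \<in> commutant H Z"
  shows "op_norm H (\<lambda>x\<in>carrier H. c \<odot> T x) = cmod c * op_norm H T"
proof (rule antisym)
  note cT = commutantD[OF T]
  have "op_bound H (\<lambda>x\<in>carrier H. c \<odot> T x) (cmod c * op_norm H T)"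
    using cT by (auto simp: op_bound_def N_smult mult.assoc intro!: mult_left_mono)
  then show "op_norm H (\<lambda>x\<in>carrier H. c \<odot> T x) <= cmod c * op_norm H T" by (rule op_bound_norm(2))
  note c' = commutantD[OF commutant_ops(3)[OF Z T, of c]]
  show "cmod c * op_norm H T <= op_norm H (\<lambda>x\<in>carrier H. c \<odot> T x)"
  proof (cases "c = 0")
    case False
    have "op_bound H T (op_norm H (\<lambda>x\<in>carrier H. c \<odot> T x) / cmod c)"
      using c'(4,5) cT False by (auto simp: op_bound_def N_smult field_simps)
    then have "op_norm H T <= op_norm H (\<lambda>x\<in>carrier H. c \<odot> T x) / cmod c" by (rule op_bound_norm(2))
    then show ?thesis using False by (simp add: field_simps)
  qed (use c' in auto)
qed

lemma op_norm_star: assumes Z: "self_adjoint_set H Z" and T: "T \<in> commutant H Z"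
  shows "op_norm H (\<lambda>x\<in>carrier H. hadjoint H T (T x)) = (op_norm H T)\<^sup>2"
proof (rule antisym)
  note T' = hadjoint_commutant[OF T Z]
  have "op_norm H (\<lambda>x\<in>carrier H. hadjoint H T (T x)) <= op_norm H (hadjoint H T) * op_norm H T"
    by (rule commutant_ops(6)[OF Z T' T])
  also have "\<dots> <= op_norm H T * op_norm H T" by (rule mult_right_mono[OF op_norm_hadjoint[OF T] commutantD(4)[OF T]])
  finally show "op_norm H (\<lambda>x\<in>carrier H. hadjoint H T (T x)) <= (op_norm H T)\<^sup>2" by (simp add: power2_eq_square)
  let ?n = "op_norm H (\<lambda>x\<in>carrier H. hadjoint H T (T x))"
  note c = commutantD[OF commutant_ops(1)[OF Z T' T]]
  have "op_bound H T (sqrt ?n)" unfolding op_bound_def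
  proof (intro conjI ballI)
    fix x assume x: "x \<in> carrier H"
    have m: "T x \<in> carrier H" "hadjoint H T (T x) \<in> carrier H" using x T T' commutantD by auto
    have "(hnorm H (T x))\<^sup>2 = Re (iprod H x (hadjoint H T (T x)))"
      using m x by (simp add: hnorm_sq adj_pair_iprod[OF hadjoint_pair[OF T]])
    also have "\<dots> <= hnorm H x * hnorm H (hadjoint H T (T x))"
      using Cauchy_Schwarz[OF x m(2)] complex_Re_le_cmod[of "iprod H x (hadjoint H T (T x))"] by linarith
    also have "\<dots> <= hnorm H x * (?n * hnorm H x)" using c(5)[OF x] x N_nonneg by (intro mult_left_mono) auto
    also have "\<dots> = (sqrt ?n * hnorm H x)\<^sup>2" using c(4) by (simp add: power2_eq_square mult_ac)
    finally show "hnorm H (T x) <= sqrt ?n * hnorm H x" by (rule power2_le_imp_le) (use c(4) N_nonneg[OF x] in simp)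
  qed (use c(4) in auto)
  then have "op_norm H T <= sqrt ?n" by (rule op_bound_norm(2))
  then have "(op_norm H T)\<^sup>2 <= (sqrt ?n)\<^sup>2" using commutantD(4)[OF T] by (intro power_mono) auto
  then show "(op_norm H T)\<^sup>2 <= ?n" using c(4) by simp
qed

lemma op_cnormed: assumes Z: "self_adjoint_set H Z" shows "cnormed (op_algebra H Z) (op_norm H)"
  "abelian_group (op_algebra H Z)" "module complex_ring (op_algebra H Z)"
proof -
  let ?A = "op_algebra H Z"
  have ag: "abelian_group ?A"
  proof (rule abelian_groupI)
    show "\<exists>y\<in>carrier ?A. y \<oplus>\<^bsub>?A\<^esub> x = \<zero>\<^bsub>?A\<^esub>" if "x \<in> carrier ?A" for x
    proof (rule bexI[of _ "(-1) \<odot>\<^bsub>?A\<^esub> x"])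
      show "(-1) \<odot>\<^bsub>?A\<^esub> x \<oplus>\<^bsub>?A\<^esub> x = \<zero>\<^bsub>?A\<^esub>"
        using that by (auto simp: csm_neg commutantD M.l_neg restrict_def fun_eq_iff)
    qed (use that commutant_ops(3)[OF Z] in auto)
    show "\<zero>\<^bsub>?A\<^esub> \<oplus>\<^bsub>?A\<^esub> x = x" if "x \<in> carrier ?A" for x
      using that commutantD[of x Z] by (intro extensionalityI[of _ "carrier H"]) auto
  qed (auto simp: commutant_ops[OF Z] commutantD M.a_ac intro!: restrict_ext)
  show "abelian_group ?A" by fact
  show md: "module complex_ring ?A"
  proof (rule moduleI[OF cring_complex_ring ag])
    show "\<one>\<^bsub>complex_ring\<^esub> \<odot>\<^bsub>?A\<^esub> x = x" if "x \<in> carrier ?A" for x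
      using that commutantD[of x Z] by (intro extensionalityI[of _ "carrier H"]) auto
  qed (auto simp: commutant_ops[OF Z] commutantD csm_l csm_r csm_assoc intro!: restrict_ext)
  have d: "T = (\<lambda>x\<in>carrier H. \<zero>)" if T: "T \<in> commutant H Z" and 0: "op_norm H T = 0" for T
  proof (rule extensionalityI[of _ "carrier H"])
    fix x assume x: "x \<in> carrier H"
    have "hnorm H (T x) = 0" using commutantD(5)[OF T x] commutantD(2)[OF T x] N_nonneg[of "T x"] 0 by simp
    then show "T x = (\<lambda>x\<in>carrier H. \<zero>) x" using x commutantD(2)[OF T x] N_definite by simp
  qed (use T commutantD in auto)
  show "cnormed ?A (op_norm H)" unfolding cnormed_def cmodule_def cnormed_axioms_def
    using md d by (auto simp: commutantD(4) op_norm_smult[OF Z] commutant_ops(7)[OF Z])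
qed

text \<open>Pointwise limits of the operators and of their adjoints are taken together, since
  membership in \<open>commutant\<close> demands an adjoint of the limit.\<close>

lemma op_complete: assumes Z: "self_adjoint_set H Z"
  shows "Metric_space.mcomplete (carrier (op_algebra H Z)) (norm_dist (op_algebra H Z) (op_norm H))"
proof -
  let ?A = "op_algebra H Z"
  interpret A: cnormed ?A "op_norm H" by (rule op_cnormed[OF Z])
  have min: "(S \<ominus>\<^bsub>?A\<^esub> T) x = S x \<ominus> T x" if "S \<in> commutant H Z" "T \<in> commutant H Z" "x \<in> carrier H" for S T x
    using that A.minus_csm[of S T] by (simp add: minus_csm commutantD)
  have minc: "S \<ominus>\<^bsub>?A\<^esub> T \<in> commutant H Z" if "S \<in> commutant H Z" "T \<in> commutant H Z" for S T
    using that A.minus_closed'[of S T] by simp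
  show ?thesis unfolding A.mcomplete_iff
  proof (intro allI impI)
    fix sg :: "nat => 'a => 'a" assume s0: "ALL n. sg n \<in> carrier ?A" and c: "\<forall>e>0. EX M. \<forall>m\<ge>M. \<forall>n\<ge>M. op_norm H (sg m \<ominus>\<^bsub>?A\<^esub> sg n) < e"
    have s: "sg n \<in> commutant H Z" for n using s0 by simp
    have dif: "hnorm H (sg m x \<ominus> sg n x) <= op_norm H (sg m \<ominus>\<^bsub>?A\<^esub> sg n) * hnorm H x" if "x \<in> carrier H" for m n x
      using commutantD(5)[OF minc[OF s s] that] min[OF s s that] by simp
    have adif: "hnorm H (hadjoint H (sg m) x \<ominus> hadjoint H (sg n) x) <= op_norm H (sg m \<ominus>\<^bsub>?A\<^esub> sg n) * hnorm H x" if "x \<in> carrier H" for m n x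
    proof -
      have "adj_pair H (sg m \<ominus>\<^bsub>?A\<^esub> sg n) (\<lambda>x\<in>carrier H. hadjoint H (sg m) x \<ominus> hadjoint H (sg n) x)"
        using hadjoint_pair[OF s[of m]] hadjoint_pair[OF s[of n]] commutantD(2)[OF s]
        by (auto simp: adj_pair_def Pi_iff min[OF s s] ip_simps)
      from adj_pair_bound[OF this commutantD(3)[OF minc[OF s s]]] show ?thesis
        using that by (auto simp: op_bound_def)
    qed
    have lim: "\<exists>l\<in>carrier H. (%n. hnorm H (f n \<ominus> l)) \<longlonglongrightarrow> 0"
      if f: "!!n. f n \<in> carrier H" and d: "!!m n. hnorm H (f m \<ominus> f n) <= op_norm H (sg m \<ominus>\<^bsub>?A\<^esub> sg n) * r" and r: "0 <= r" for f :: "nat => 'a" and r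
    proof -
      have "EX M. \<forall>m\<ge>M. \<forall>n\<ge>M. hnorm H (f m \<ominus> f n) < e" if e: "e > 0" for e
      proof -
        obtain M where M: "\<forall>m\<ge>M. \<forall>n\<ge>M. op_norm H (sg m \<ominus>\<^bsub>?A\<^esub> sg n) < e / (r + 1)" using c e r by (metis add_nonneg_pos divide_pos_pos zero_less_one)
        have "hnorm H (f m \<ominus> f n) < e" if mn: "m \<ge> M" "n \<ge> M" for m n
        proof -
          have "hnorm H (f m \<ominus> f n) <= e / (r + 1) * r" using d[of m n] M mn r by (meson less_imp_le mult_right_mono order_trans)
          also have "\<dots> < e" using e r by (simp add: field_simps)
          finally show ?thesis .
        qed
        then show ?thesis by blast
      qed
      then show ?thesis using hnorm_complete f unfolding mcomplete_iff by blast
    qed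
    have "\<forall>x\<in>carrier H. \<exists>l\<in>carrier H. (%n. hnorm H (sg n x \<ominus> l)) \<longlonglongrightarrow> 0"
      using lim[of "%n. sg n _"] dif commutantD(2)[OF s] N_nonneg by blast
    then obtain T where T: "!!x. x \<in> carrier H ==> T x \<in> carrier H" "!!x. x \<in> carrier H ==> (%n. hnorm H (sg n x \<ominus> T x)) \<longlonglongrightarrow> 0"
      by metis
    have as: "hadjoint H (sg n) x \<in> carrier H" if "x \<in> carrier H" for n x
      using adj_pair_closed(2)[OF hadjoint_pair[OF s] that] .
    have "\<forall>x\<in>carrier H. \<exists>l\<in>carrier H. (%n. hnorm H (hadjoint H (sg n) x \<ominus> l)) \<longlonglongrightarrow> 0"
      using lim[of "%n. hadjoint H (sg n) _"] adif as N_nonneg by blast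
    then obtain T' where T': "!!x. x \<in> carrier H ==> T' x \<in> carrier H" "!!x. x \<in> carrier H ==> (%n. hnorm H (hadjoint H (sg n) x \<ominus> T' x)) \<longlonglongrightarrow> 0"
      by metis
    define R where "R = restrict T (carrier H)"
    have Rx: "x \<in> carrier H ==> R x = T x" for x by (simp add: R_def)
    have pair: "adj_pair H R T'"
      unfolding adj_pair_def
    proof (intro conjI ballI)
      fix x y assume xy: "x \<in> carrier H" "y \<in> carrier H"
      have "(%n. iprod H (sg n x) y) \<longlonglongrightarrow> iprod H (T x) y"
        by (rule iprod_lim(1)) (use xy T commutantD(2)[OF s] in auto)
      moreover have "(%n. iprod H x (hadjoint H (sg n) y)) \<longlonglongrightarrow> iprod H x (T' y)"
        by (rule iprod_lim(2)) (use xy T' as in auto)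
      ultimately show "iprod H (R x) y = iprod H x (T' y)"
        using xy adj_pair_iprod[OF hadjoint_pair[OF s]] by (simp add: Rx LIMSEQ_unique)
    qed (use T T' in \<open>auto simp: Rx\<close>)
    have bnd: "hnorm H (sg n x \<ominus> R x) <= e * hnorm H x"
      if e: "\<forall>m\<ge>M. \<forall>n\<ge>M. op_norm H (sg m \<ominus>\<^bsub>?A\<^esub> sg n) < e" and n: "n \<ge> M" and x: "x \<in> carrier H" for e M n x
    proof -
      have "(%m. hnorm H ((sg n x \<ominus> sg m x) \<ominus> (sg n x \<ominus> T x))) \<longlonglongrightarrow> 0"
      proof -
        have "hnorm H ((sg n x \<ominus> sg m x) \<ominus> (sg n x \<ominus> T x)) = hnorm H (sg m x \<ominus> T x)" for m
        proof -
          have "(sg n x \<ominus> sg m x) \<ominus> (sg n x \<ominus> T x) = T x \<ominus> sg m x"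
            by (rule hilbert_eqI) (use x T(1) commutantD(2)[OF s] in \<open>auto simp: ip_simps\<close>)
          then show ?thesis using x T(1) commutantD(2)[OF s] by (simp add: N_commute)
        qed
        then show ?thesis using T(2)[OF x] by simp
      qed
      moreover have "hnorm H (sg n x \<ominus> sg m x) <= e * hnorm H x" if "m \<ge> M" for m
        using dif[OF x, of n m] e n that N_nonneg[OF x] by (meson less_imp_le mult_right_mono order_trans)
      ultimately show ?thesis
        using hnorm_lim_le[of "%m. sg n x \<ominus> sg m x" "sg n x \<ominus> T x" M] x T(1) commutantD(2)[OF s] by (simp add: Rx)
    qed
    \<comment> \<open>From the index \<open>?M\<close> on, the sequence varies by less than 1 in
      norm, so the limit differs from \<open>sg ?M\<close> by at most 1.\<close>
    have "op_bound H R (1 + op_norm H (sg (SOME M. \<forall>m\<ge>M. \<forall>n\<ge>M. op_norm H (sg m \<ominus>\<^bsub>?A\<^esub> sg n) < 1)))" (is "op_bound H R (1 + op_norm H (sg ?M))")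
    proof -
      have M: "\<forall>m\<ge>?M. \<forall>n\<ge>?M. op_norm H (sg m \<ominus>\<^bsub>?A\<^esub> sg n) < 1" using someI_ex[OF c[rule_format, of 1]] by simp
      show ?thesis unfolding op_bound_def
      proof (intro conjI ballI)
        fix x assume x: "x \<in> carrier H"
        have "hnorm H (R x) <= hnorm H (sg ?M x \<ominus> R x) + hnorm H (sg ?M x)"
          using N_le_diff[of "R x" "sg ?M x"] N_commute[of "R x" "sg ?M x"] x T(1) commutantD(2)[OF s] by (simp add: Rx)
        also have "\<dots> <= 1 * hnorm H x + op_norm H (sg ?M) * hnorm H x"
          using bnd[OF M _ x, of ?M] commutantD(5)[OF s x, of ?M] by (intro add_mono) auto
        finally show "hnorm H (R x) <= (1 + op_norm H (sg ?M)) * hnorm H x" by (simp add: distrib_right)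
      qed (use commutantD(4)[OF s] in auto)
    qed
    moreover have "R (Q x) = Q (R x)" if Q: "Q \<in> Z" and x: "x \<in> carrier H" for Q x
    proof (rule hilbert_eqI)
      obtain Q' where Q': "adj_pair H Q Q'" using Q Z by (auto simp: self_adjoint_set_def)
      note q = adj_pair_closed[OF Q']
      show "R (Q x) \<in> carrier H" "Q (R x) \<in> carrier H" using q x T by (auto simp: Rx)
      fix z assume z: "z \<in> carrier H"
      have "(%n. iprod H (sg n (Q x)) z) \<longlonglongrightarrow> iprod H (T (Q x)) z"
        by (rule iprod_lim(1)) (use x z q T commutantD(2)[OF s] in auto)
      moreover have "(%n. iprod H (sg n x) (Q' z)) \<longlonglongrightarrow> iprod H (T x) (Q' z)"
        by (rule iprod_lim(1)) (use x z q T commutantD(2)[OF s] in auto)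
      moreover have "iprod H (sg n (Q x)) z = iprod H (sg n x) (Q' z)" for n
        using commutantD(6)[OF s Q x] adj_pair_iprod[OF Q' commutantD(2)[OF s x] z] by simp
      ultimately have "iprod H (T (Q x)) z = iprod H (T x) (Q' z)" by (simp add: LIMSEQ_unique)
      then show "iprod H (R (Q x)) z = iprod H (Q (R x)) z"
        using x z q T by (simp add: Rx adj_pair_iprod[OF Q'])
    qed
    ultimately have R: "R \<in> commutant H Z" using pair by (intro commutantI) (auto simp: R_def)
    moreover have "(%n. op_norm H (sg n \<ominus>\<^bsub>?A\<^esub> R)) \<longlonglongrightarrow> 0"
    proof (rule LIMSEQ_I)
      fix e :: real assume e: "e > 0"
      obtain M where M: "\<forall>m\<ge>M. \<forall>n\<ge>M. op_norm H (sg m \<ominus>\<^bsub>?A\<^esub> sg n) < e / 2" using c e by (meson half_gt_zero)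
      have "norm (op_norm H (sg n \<ominus>\<^bsub>?A\<^esub> R) - 0) < e" if n: "n \<ge> M" for n
      proof -
        have "op_bound H (sg n \<ominus>\<^bsub>?A\<^esub> R) (e / 2)" using e bnd[OF M n] by (auto simp: op_bound_def min[OF s R])
        then show ?thesis using e op_bound_norm(2,3) by fastforce
      qed
      then show "EX M. \<forall>n\<ge>M. norm (op_norm H (sg n \<ominus>\<^bsub>?A\<^esub> R) - 0) < e" by blast
    qed
    ultimately show "\<exists>l\<in>carrier ?A. (%n. op_norm H (sg n \<ominus>\<^bsub>?A\<^esub> l)) \<longlonglongrightarrow> 0" by auto
  qed
qed

lemma cstar_op_algebra:
  assumes Z: "self_adjoint_set H Z" and ne: "\<exists>x\<in>carrier H. x ~= \<zero>"
  shows "cstar_algebra (op_algebra H Z)"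
proof -
  let ?A = "op_algebra H Z"
  note ag = op_cnormed(2)[OF Z] and md = op_cnormed(3)[OF Z]
  interpret A: cnormed ?A "op_norm H" by (rule op_cnormed[OF Z])
  have lin: "T (x \<oplus> y) = T x \<oplus> T y" "T (c \<odot> x) = c \<odot> T x" if "T \<in> commutant H Z" "x \<in> carrier H" "y \<in> carrier H" for T x y c
    using hadjoint_pair[OF that(1)] that by (auto simp: adj_pair_add adj_pair_smult)
  have mon: "Group.monoid ?A"
  proof (rule monoidI)
    show "\<one>\<^bsub>?A\<^esub> \<otimes>\<^bsub>?A\<^esub> x = x" "x \<otimes>\<^bsub>?A\<^esub> \<one>\<^bsub>?A\<^esub> = x" if "x \<in> carrier ?A" for x
      using that commutantD[of x Z] by (auto intro!: extensionalityI[of _ "carrier H"])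
  qed (auto simp: commutant_ops[OF Z] commutantD intro!: restrict_ext)
  have rg: "ring ?A" by (rule ringI[OF ag mon]) (auto simp: commutantD lin intro!: restrict_ext)
  note p = hadjoint_pair
  have st: "hadjoint H (\<lambda>x\<in>carrier H. S x \<oplus> T x) = (\<lambda>x\<in>carrier H. hadjoint H S x \<oplus> hadjoint H T x)"
    "hadjoint H (\<lambda>x\<in>carrier H. S (T x)) = (\<lambda>x\<in>carrier H. hadjoint H T (hadjoint H S x))"
    if S: "S \<in> commutant H Z" and T: "T \<in> commutant H Z" for S T
  proof -
    show "hadjoint H (\<lambda>x\<in>carrier H. S (T x)) = (\<lambda>x\<in>carrier H. hadjoint H T (hadjoint H S x))"
      by (rule hadjoint_eqI[OF adj_pair_comp[OF p[OF S] p[OF T]]]) simp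
    show "hadjoint H (\<lambda>x\<in>carrier H. S x \<oplus> T x) = (\<lambda>x\<in>carrier H. hadjoint H S x \<oplus> hadjoint H T x)"
      by (rule hadjoint_eqI) (use p[OF S] p[OF T] in \<open>auto simp: adj_pair_def Pi_iff ip_simps\<close>)
  qed
  have st': "hadjoint H (\<lambda>x\<in>carrier H. c \<odot> T x) = (\<lambda>x\<in>carrier H. cnj c \<odot> hadjoint H T x)"
    if T: "T \<in> commutant H Z" for T c
    by (rule hadjoint_eqI) (use p[OF T] in \<open>auto simp: adj_pair_def Pi_iff ip_simps\<close>)
  have on: "(\<lambda>x\<in>carrier H. x) ~= (\<lambda>x\<in>carrier H. \<zero>)" using ne by (metis restrict_apply')
  show ?thesis
    unfolding cstar_algebra_def cstar_algebra_axioms_def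
    using md rg on op_complete[OF Z]
    by (auto simp: commutant_ops[OF Z] hadjoint_commutant Z hadjoint_hadjoint st st' op_norm_star[OF Z] op_norm_smult[OF Z] commutantD(2,4)
      lin A.N_definite[simplified] intro!: restrict_ext)
qed

text \<open>Apply \<open>positive_functional_bound\<close> to the functional that sends
  \<open>y\<close> to the inner product of \<open>\<pi> y v\<close> with \<open>v\<close>.\<close>

lemma star_hom_contractive:
  assumes B: "cstar_algebra B" and Z: "self_adjoint_set H Z" and h: "star_hom B (op_algebra H Z) \<pi>"
    and x: "x \<in> carrier B" and v: "v \<in> carrier H"
  shows "hnorm H (\<pi> x v) <= cnorm B x * hnorm H v"
proof -
  interpret B: cstar_algebra B by fact
  have pc: "\<pi> y \<in> commutant H Z" if "y \<in> carrier B" for y using h that by (auto simp: star_hom_def ring_hom_def)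
  have pv: "\<pi> y v \<in> carrier H" if "y \<in> carrier B" for y using commutantD(2)[OF pc[OF that] v] .
  have hm: "\<pi> (y \<otimes>\<^bsub>B\<^esub> z) = (\<lambda>x\<in>carrier H. \<pi> y (\<pi> z x))" "\<pi> (y \<oplus>\<^bsub>B\<^esub> z) = (\<lambda>x\<in>carrier H. \<pi> y x \<oplus> \<pi> z x)"
    "\<pi> (c \<odot>\<^bsub>B\<^esub> y) = (\<lambda>x\<in>carrier H. c \<odot> \<pi> y x)" "\<pi> (star B y) = hadjoint H (\<pi> y)" "\<pi> \<one>\<^bsub>B\<^esub> = (\<lambda>x\<in>carrier H. x)"
    if "y \<in> carrier B" "z \<in> carrier B" for y z c
    using h that by (auto simp: star_hom_def ring_hom_def)
  have sq: "iprod H (\<pi> (star B y \<otimes>\<^bsub>B\<^esub> y) v) v = iprod H (\<pi> y v) (\<pi> y v)" if "y \<in> carrier B" for y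
    using that v pv[OF that] adj_pair_iprod[OF adj_pair_sym[OF hadjoint_pair[OF pc[OF that]]]]
    by (simp add: hm B.star_closed)
  have "Re (iprod H (\<pi> (star B x \<otimes>\<^bsub>B\<^esub> x) v) v) <= (cnorm B x)\<^sup>2 * Re (iprod H (\<pi> \<one>\<^bsub>B\<^esub> v) v)"
    by (rule B.positive_functional_bound) (use v pv x sq in \<open>auto simp: hm ip_simps iprod_nonneg\<close>)
  then have "(hnorm H (\<pi> x v))\<^sup>2 <= (cnorm B x * hnorm H v)\<^sup>2"
    using hm(5)[OF x x] by (simp add: sq[OF x] hnorm_sq pv[OF x] v power_mult_distrib)
  then show ?thesis by (rule power2_le_imp_le) (use B.cnorm_nonneg[OF x] N_nonneg[OF v] in simp)
qed

text \<open>The elements with image in the commutant of \<open>Z'\<close> form a C*-subalgebra,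
  closed because the homomorphism is contractive. It will be applied to the generators p of
  \<open>brown_sub\<close>, whose images are left multiplications and commute with the right
  ones.\<close>

lemma star_hom_generated_commutant:
  assumes B: "cstar_algebra B" and Z: "self_adjoint_set H Z" and h: "star_hom B (op_algebra H Z) \<pi>"
    and Z': "self_adjoint_set H Z'" and G: "G \<subseteq> carrier B" "!!g. g \<in> G ==> \<pi> g \<in> commutant H Z'"
    and x: "x \<in> cstar_generated B G"
  shows "\<pi> x \<in> commutant H Z'"
proof -
  interpret B: cstar_algebra B by fact
  have pc: "\<pi> y \<in> commutant H Z" if "y \<in> carrier B" for y using h that by (auto simp: star_hom_def ring_hom_def)
  have hm: "\<pi> (y \<otimes>\<^bsub>B\<^esub> z) = (\<lambda>x\<in>carrier H. \<pi> y (\<pi> z x))" "\<pi> (y \<oplus>\<^bsub>B\<^esub> z) = (\<lambda>x\<in>carrier H. \<pi> y x \<oplus> \<pi> z x)"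
    "\<pi> (c \<odot>\<^bsub>B\<^esub> y) = (\<lambda>x\<in>carrier H. c \<odot> \<pi> y x)" "\<pi> (star B y) = hadjoint H (\<pi> y)" "\<pi> \<one>\<^bsub>B\<^esub> = (\<lambda>x\<in>carrier H. x)"
    if "y \<in> carrier B" "z \<in> carrier B" for y z c
    using h that by (auto simp: star_hom_def ring_hom_def)
  have hz: "\<pi> \<zero>\<^bsub>B\<^esub> = (\<lambda>x\<in>carrier H. \<zero>)"
  proof -
    have e: "\<pi> \<zero>\<^bsub>B\<^esub> = (\<lambda>x\<in>carrier H. 0 \<odot> \<pi> \<zero>\<^bsub>B\<^esub> x)" using hm(3)[of "\<zero>\<^bsub>B\<^esub>" "\<zero>\<^bsub>B\<^esub>" 0] by simp
    show ?thesis by (subst e) (auto intro!: restrict_ext simp: commutantD(2)[OF pc])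
  qed
  define S where "S = {y \<in> carrier B. \<pi> y \<in> commutant H Z'}"
  have "cstar_subalgebra B S"
    unfolding cstar_subalgebra_def
  proof (intro conjI)
    show "closedin (Metric_space.mtopology (carrier B) (norm_dist B (cnorm B))) S"
      unfolding B.closedin_iff
    proof (intro conjI allI impI)
      fix sg l assume s: "ALL n. sg n \<in> S" and l: "l \<in> carrier B" and c: "(%n. cnorm B (sg n \<ominus>\<^bsub>B\<^esub> l)) \<longlonglongrightarrow> 0"
      have sB: "sg n \<in> carrier B" and sZ: "\<pi> (sg n) \<in> commutant H Z'" for n using s by (auto simp: S_def)
      have lim: "(%n. hnorm H (\<pi> (sg n) v \<ominus> \<pi> l v)) \<longlonglongrightarrow> 0" if v: "v \<in> carrier H" for v
      proof (rule tendsto_sandwich[of "%_. 0" _ _ "%n. cnorm B (sg n \<ominus>\<^bsub>B\<^esub> l) * hnorm H v"])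
        have "\<pi> (sg n \<ominus>\<^bsub>B\<^esub> l) v = \<pi> (sg n) v \<ominus> \<pi> l v" for n
          using sB[of n] l v commutantD(2)[OF pc] by (simp add: B.minus_csm minus_csm hm)
        then show "\<forall>\<^sub>F n in sequentially. hnorm H (\<pi> (sg n) v \<ominus> \<pi> l v) <= cnorm B (sg n \<ominus>\<^bsub>B\<^esub> l) * hnorm H v"
          using star_hom_contractive[OF B Z h _ v] sB l by (metis (no_types, lifting) B.minus_closed' always_eventually)
        show "(%n. cnorm B (sg n \<ominus>\<^bsub>B\<^esub> l) * hnorm H v) \<longlonglongrightarrow> 0" by (rule tendsto_mult_left_zero[OF c])
      qed (use commutantD(2)[OF pc] sB l v in \<open>auto intro!: always_eventually N_nonneg\<close>)
      have "\<pi> l (Q v) = Q (\<pi> l v)" if Q: "Q \<in> Z'" and v: "v \<in> carrier H" for Q v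
      proof (rule hilbert_eqI)
        obtain Q' where Q': "adj_pair H Q Q'" using Q Z' by (auto simp: self_adjoint_set_def)
        note q = adj_pair_closed[OF Q'] and cl = commutantD(2)[OF pc]
        show "\<pi> l (Q v) \<in> carrier H" "Q (\<pi> l v) \<in> carrier H" using q v cl l by auto
        fix z assume z: "z \<in> carrier H"
        have "(%n. iprod H (\<pi> (sg n) (Q v)) z) \<longlonglongrightarrow> iprod H (\<pi> l (Q v)) z"
          by (rule iprod_lim(1)) (use v z q cl sB l lim in auto)
        moreover have "(%n. iprod H (\<pi> (sg n) v) (Q' z)) \<longlonglongrightarrow> iprod H (\<pi> l v) (Q' z)"
          by (rule iprod_lim(1)) (use v z q cl sB l lim in auto)
        moreover have "iprod H (\<pi> (sg n) (Q v)) z = iprod H (\<pi> (sg n) v) (Q' z)" for n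
          using commutantD(6)[OF sZ Q v] adj_pair_iprod[OF Q' commutantD(2)[OF sZ v] z] by simp
        ultimately have "iprod H (\<pi> l (Q v)) z = iprod H (\<pi> l v) (Q' z)" by (simp add: LIMSEQ_unique)
        then show "iprod H (\<pi> l (Q v)) z = iprod H (Q (\<pi> l v)) z"
          using v z q cl l by (simp add: adj_pair_iprod[OF Q'])
      qed
      then have "\<pi> l \<in> commutant H Z'"
        using commutantD(1,3)[OF pc[OF l]] hadjoint_pair[OF pc[OF l]] by (intro commutantI) auto
      then show "l \<in> S" using l by (simp add: S_def)
    qed (auto simp: S_def)
  qed (auto simp: S_def hm hz commutant_ops[OF Z'] B.star_closed hadjoint_commutant[OF _ Z'])
  then show ?thesis using x G by (auto simp: cstar_generated_def S_def)
qed

end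

section \<open>Hilbert spaces of functions\<close>

abbreviation dec :: "('a => 'h) => 'h => 'a" where
  "dec e \<equiv> inv_into UNIV e"

text \<open>The notions of correlation fix the carrier type, so a space \<open>F\<close> of
  functions is transported into \<open>'h\<close> along an injection \<open>e\<close>, and
  \<open>dec e\<close> undoes it.\<close>

definition fun_hspace :: "(('i => complex) => 'h) => ('i => complex) set
    => (('i => complex) => ('i => complex) => complex) => 'h hspace" where
  "fun_hspace e F ip = \<lparr>carrier = e ` F, mult = undefined, one = undefined, zero = e (%_. 0),
     add = (%x y. e (%i. dec e x i + dec e y i)), smult = (%c x. e (%i. c * dec e x i)),
     iprod = (%x y. ip (dec e x) (dec e y))\<rparr>"

lemma fun_hspace_simps [simp]:
  "carrier (fun_hspace e F ip) = e ` F" "\<zero>\<^bsub>fun_hspace e F ip\<^esub> = e (%_. 0)"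
  "x \<oplus>\<^bsub>fun_hspace e F ip\<^esub> y = e (%i. dec e x i + dec e y i)"
  "c \<odot>\<^bsub>fun_hspace e F ip\<^esub> x = e (%i. c * dec e x i)"
  "iprod (fun_hspace e F ip) x y = ip (dec e x) (dec e y)"
  by (auto simp: fun_hspace_def)

definition nrm :: "('v => 'v => complex) => 'v => real" where
  "nrm ip x = sqrt (Re (ip x x))"

lemma hnorm_fun_hspace [simp]: "hnorm (fun_hspace e F ip) x = nrm ip (dec e x)"
  by (simp add: hnorm_def nrm_def)

locale fun_hilbert =
  fixes F :: "('i => complex) set" and ip :: "('i => complex) => ('i => complex) => complex"
  assumes F_zero: "(%_. 0) \<in> F"
    and F_add: "f \<in> F ==> g \<in> F ==> (%i. f i + g i) \<in> F"
    and F_smult: "f \<in> F ==> (%i. c * f i) \<in> F"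
    and F_ip_add: "f \<in> F ==> g \<in> F ==> h \<in> F ==> ip (%i. f i + g i) h = ip f h + ip g h"
    and F_ip_smult: "f \<in> F ==> g \<in> F ==> ip (%i. c * f i) g = c * ip f g"
    and F_ip_cnj: "f \<in> F ==> g \<in> F ==> ip g f = cnj (ip f g)"
    and F_ip_nonneg: "f \<in> F ==> ip f f \<in> \<real>\<^sub>\<ge>\<^sub>0"
    and F_ip_definite: "f \<in> F ==> ip f f = 0 ==> f = (%_. 0)"
    and F_complete: "(!!n. sg n \<in> F) ==> (!!e. e > 0 ==> EX M. \<forall>m\<ge>M. \<forall>n\<ge>M. nrm ip (%i. sg m i - sg n i) < e)
      ==> \<exists>l\<in>F. (%n. nrm ip (%i. sg n i - l i)) \<longlonglongrightarrow> 0"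
begin

lemma F_ip_add_right: "f \<in> F ==> g \<in> F ==> h \<in> F ==> ip h (%i. f i + g i) = ip h f + ip h g"
  by (simp add: F_add F_ip_add F_ip_cnj[of "%i. f i + g i" h] F_ip_cnj[of f h] F_ip_cnj[of g h])

lemma F_ip_smult_right: "f \<in> F ==> h \<in> F ==> ip h (%i. c * f i) = cnj c * ip h f"
  by (simp add: F_smult F_ip_smult F_ip_cnj[of "%i. c * f i" h] F_ip_cnj[of f h])

lemma hilbert:
  fixes e :: "('i => complex) => 'h"
  assumes e: "inj e" shows "hilbert_space (fun_hspace e F ip)"
proof -
  let ?H = "fun_hspace e F ip"
  note ie [simp] = inv_f_f[OF e]
  have ag: "abelian_group ?H"
  proof (rule abelian_groupI)
    show "\<exists>y\<in>carrier ?H. y \<oplus>\<^bsub>?H\<^esub> x = \<zero>\<^bsub>?H\<^esub>" if x: "x \<in> carrier ?H" for x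
    proof -
      obtain f where f: "f \<in> F" "x = e f" using x by auto
      then show ?thesis using F_smult[of f "-1"] by (intro bexI[of _ "e (%i. (-1) * f i)"]) auto
    qed
  qed (auto simp: F_zero F_add add_ac)
  have md: "module complex_ring ?H"
    by (rule moduleI[OF cring_complex_ring ag]) (auto simp: F_smult algebra_simps)
  interpret cmodule ?H using md by (simp add: cmodule_def)
  have "x \<ominus>\<^bsub>?H\<^esub> y = e (%i. dec e x i - dec e y i)" if "x \<in> carrier ?H" "y \<in> carrier ?H" for x y
    using minus_csm[OF that] by simp
  then have min: "e f \<ominus>\<^bsub>?H\<^esub> e g = e (%i. f i - g i)" if "f \<in> F" "g \<in> F" for f g using that by simp
  have ax: "(ALL x y z. x \<in> carrier ?H --> y \<in> carrier ?H --> z \<in> carrier ?H --> iprod ?H (x \<oplus>\<^bsub>?H\<^esub> y) z = iprod ?H x z + iprod ?H y z)"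
    "(ALL x y c. x \<in> carrier ?H --> y \<in> carrier ?H --> iprod ?H (c \<odot>\<^bsub>?H\<^esub> x) y = c * iprod ?H x y)"
    "(ALL x y. x \<in> carrier ?H --> y \<in> carrier ?H --> iprod ?H y x = cnj (iprod ?H x y))"
    "(ALL x. x \<in> carrier ?H --> iprod ?H x x \<in> \<real>\<^sub>\<ge>\<^sub>0)" "(ALL x. x \<in> carrier ?H --> iprod ?H x x = 0 --> x = \<zero>\<^bsub>?H\<^esub>)"
    by (auto simp: F_ip_add F_ip_smult F_ip_nonneg intro: F_ip_cnj dest: F_ip_definite)
  have d: "norm_dist ?H (hnorm ?H) x y = (if x \<in> e ` F & y \<in> e ` F then nrm ip (%i. dec e x i - dec e y i) else 0)" for x y
    by (auto simp: norm_dist_def min)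
  have sip: "nrm ip (%i. c * f i) = cmod c * nrm ip f" if "f \<in> F" for c f
  proof -
    have "ip (%i. c * f i) (%i. c * f i) = c * cnj c * ip f f"
      using that by (simp add: F_ip_smult F_ip_smult_right F_smult)
    then show ?thesis by (simp add: nrm_def complex_mult_cnj cmod_def real_sqrt_mult)
  qed
  show ?thesis
  proof -
    have mc: "Metric_space.mcomplete (carrier ?H) (norm_dist ?H (hnorm ?H))"
    proof -
      \<comment> \<open>The norm axioms do not depend on completeness, so they are derived here from the inner product.\<close>
      have cs: "(cmod (ip f g))\<^sup>2 <= (nrm ip f)\<^sup>2 * (nrm ip g)\<^sup>2" if fg: "f \<in> F" "g \<in> F" for f g
      proof -
        have r: "(nrm ip f)\<^sup>2 = Re (ip f f)" if "f \<in> F" for f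
          using F_ip_nonneg[OF that] by (simp add: nrm_def complex_nonneg_Reals_iff)
        have "(cmod (ip g f))\<^sup>2 <= (nrm ip f)\<^sup>2 * (nrm ip g)\<^sup>2"
        proof (rule quadratic_discriminant)
          fix z
          let ?zg = "%i. z * g i"
          have zg: "?zg \<in> F" and s: "(%i. f i + z * g i) \<in> F" using F_add[OF fg(1) F_smult[OF fg(2)]] fg F_smult by auto
          have "ip (%i. f i + z * g i) (%i. f i + z * g i) = ip f f + cnj z * ip f g + (z * ip g f + z * cnj z * ip g g)"
            using fg zg s by (simp add: F_ip_add F_ip_add_right F_ip_smult F_ip_smult_right algebra_simps)
          also have "cnj z * ip f g = cnj (z * ip g f)" using F_ip_cnj[OF fg(2,1)] by simp
          also have "z * cnj z = of_real ((cmod z)\<^sup>2)" by (rule complex_norm_square[symmetric])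
          finally have "Re (ip (%i. f i + z * g i) (%i. f i + z * g i)) = Re (ip f f) + 2 * Re (z * ip g f) + (cmod z)\<^sup>2 * Re (ip g g)" by simp
          then show "0 <= (nrm ip f)\<^sup>2 + 2 * Re (z * ip g f) + (cmod z)\<^sup>2 * (nrm ip g)\<^sup>2"
            using F_ip_nonneg[OF s] fg by (simp add: r complex_nonneg_Reals_iff)
        qed simp
        then show ?thesis using F_ip_cnj[OF fg(2,1)] by simp
      qed
      have tri: "nrm ip (%i. f i + g i) <= nrm ip f + nrm ip g" if fg: "f \<in> F" "g \<in> F" for f g
      proof -
        have p: "0 <= nrm ip h" "(nrm ip h)\<^sup>2 = Re (ip h h)" if "h \<in> F" for h
          using F_ip_nonneg[OF that] by (simp_all add: nrm_def complex_nonneg_Reals_iff)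
        have c: "cmod (ip f g) <= nrm ip f * nrm ip g"
          by (rule power2_le_imp_le) (use cs[OF fg] p fg in \<open>simp_all add: power_mult_distrib\<close>)
        note s = F_add[OF fg]
        have "ip (%i. f i + g i) (%i. f i + g i) = ip f f + ip f g + (cnj (ip f g) + ip g g)"
          using fg s F_ip_cnj[OF fg] by (simp add: F_ip_add F_ip_add_right)
        then have "(nrm ip (%i. f i + g i))\<^sup>2 = (nrm ip f)\<^sup>2 + 2 * Re (ip f g) + (nrm ip g)\<^sup>2"
          using p fg s by simp
        also have "\<dots> <= (nrm ip f + nrm ip g)\<^sup>2" using c complex_Re_le_cmod[of "ip f g"] by (simp add: power2_sum)
        finally show ?thesis by (rule power2_le_imp_le) (use p fg in simp)
      qed
      have "cnormed ?H (hnorm ?H)"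
      proof
        show "x = \<zero>\<^bsub>?H\<^esub>" if "x \<in> carrier ?H" "hnorm ?H x = 0" for x
        proof -
          have "x \<in> e ` F" using that(1) by simp
          then obtain f where f: "f \<in> F" "x = e f" by blast
          then have "ip f f = 0" using that(2) F_ip_nonneg[OF f(1)] by (auto simp: nrm_def complex_nonneg_Reals_iff complex_eq_iff)
          then show ?thesis using f F_ip_definite by auto
        qed
        show "0 <= hnorm ?H x" if "x \<in> carrier ?H" for x
          using that F_ip_nonneg by (auto simp: nrm_def complex_nonneg_Reals_iff)
      qed (auto simp: sip tri)
      then interpret C: cnormed ?H "hnorm ?H" .
      show ?thesis unfolding C.mcomplete_iff
      proof (intro allI impI)
        fix sg :: "nat => 'h" assume s: "ALL n. sg n \<in> carrier ?H" and c: "\<forall>\<epsilon>>0. EX M. \<forall>m\<ge>M. \<forall>n\<ge>M. hnorm ?H (sg m \<ominus>\<^bsub>?H\<^esub> sg n) < \<epsilon>"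
        obtain f where f: "!!n. f n \<in> F" "!!n. sg n = e (f n)" using s by (simp add: image_iff) metis
        obtain l where l: "l \<in> F" "(%n. nrm ip (%i. f n i - l i)) \<longlonglongrightarrow> 0"
          using F_complete[of f] f c by (auto simp: min)
        then show "\<exists>l\<in>carrier ?H. (%n. hnorm ?H (sg n \<ominus>\<^bsub>?H\<^esub> l)) \<longlonglongrightarrow> 0"
          by (intro bexI[of _ "e l"]) (auto simp: f min)
      qed
    qed
    show ?thesis
      by (intro hilbert_space.intro md hilbert_space_axioms.intro mc)
        (rule ax(1)[rule_format] ax(2)[rule_format] ax(3)[rule_format] ax(4)[rule_format] ax(5)[rule_format]; assumption)+
  qed
qed

end

definition fun_op :: "(('i => complex) => 'h) => ('i => complex) set
    => (('i => complex) => 'i => complex) => 'h => 'h" where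
  "fun_op e F T = (\<lambda>h\<in>e ` F. e (T (dec e h)))"

lemma fun_op_apply [simp]: "inj e ==> f \<in> F ==> fun_op e F T (e f) = e (T f)"
  by (simp add: fun_op_def)

lemma adj_pair_fun_op:
  assumes "inj e" "!!f. f \<in> F ==> T f \<in> F" "!!f. f \<in> F ==> S f \<in> F"
    "!!f g. f \<in> F ==> g \<in> F ==> ip (T f) g = ip f (S g)"
  shows "adj_pair (fun_hspace e F ip) (fun_op e F T) (fun_op e F S)"
  using assms by (auto simp: adj_pair_def)

lemma op_bound_fun_op:
  assumes "inj e" "0 <= C" "!!f. f \<in> F ==> nrm ip (T f) <= C * nrm ip f"
  shows "op_bound (fun_hspace e F ip) (fun_op e F T) C"
  using assms by (auto simp: op_bound_def)

section \<open>The Hilbert space of a positive definite kernel\<close>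

text \<open>A list of pairs \<open>(a, j)\<close> stands for the formal linear combination \<open>\<Sum> a \<delta>\<^sub>j\<close>, and
  \<open>K j i\<close> is the inner product of \<open>\<delta>\<^sub>j\<close> and \<open>\<delta>\<^sub>i\<close>.\<close>

definition lscale :: "complex => (complex \<times> 'i) list => (complex \<times> 'i) list" where
  "lscale c v = map (%(a, j). (c * a, j)) v"

definition ldiff :: "(complex \<times> 'i) list => (complex \<times> 'i) list => (complex \<times> 'i) list" where
  "ldiff v w = v @ lscale (-1) w"

definition kfun :: "('i => 'i => complex) => (complex \<times> 'i) list => 'i => complex" where
  "kfun K v = (%i. \<Sum>(a, j)\<leftarrow>v. a * K j i)"

definition lip :: "('i => 'i => complex) => (complex \<times> 'i) list => (complex \<times> 'i) list => complex" where
  "lip K v w = (\<Sum>(b, i)\<leftarrow>w. cnj b * kfun K v i)"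

text \<open>The completion is realised without equivalence classes: a Cauchy sequence of formal
  combinations is represented by the pointwise limit of its kernel functions. Completed vectors are
  thus again functions on the index set, which is what the coding into \<open>'h\<close>
  needs.\<close>

definition approximates :: "('i => 'i => complex) => (nat => (complex \<times> 'i) list) => ('i => complex) => bool" where
  "approximates K sg f \<longleftrightarrow> (\<forall>e>0. EX M. \<forall>m\<ge>M. \<forall>n\<ge>M. nrm (lip K) (ldiff (sg m) (sg n)) < e)
     & (ALL i. (%n. kfun K (sg n) i) \<longlonglongrightarrow> f i)"

definition kspace :: "('i => 'i => complex) => ('i => complex) set" where
  "kspace K = {f. \<exists>sg. approximates K sg f}"

text \<open>The chosen approximating sequences do not matter, by \<open>kip_lim\<close>.\<close>

definition kip :: "('i => 'i => complex) => ('i => complex) => ('i => complex) => complex" where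
  "kip K f g = lim (%n. lip K ((SOME sg. approximates K sg f) n) ((SOME sg. approximates K sg g) n))"

lemma kfun_append [simp]: "kfun K (v @ w) i = kfun K v i + kfun K w i" by (simp add: kfun_def)
lemma kfun_Nil [simp]: "kfun K [] i = 0" by (simp add: kfun_def)
lemma kfun_Cons [simp]: "kfun K ((a, j) # v) i = a * K j i + kfun K v i" by (simp add: kfun_def)
lemma kfun_lscale [simp]: "kfun K (lscale c v) i = c * kfun K v i"
  by (induct v) (auto simp: lscale_def kfun_def algebra_simps)
lemma kfun_ldiff [simp]: "kfun K (ldiff v w) i = kfun K v i - kfun K w i" by (simp add: ldiff_def)

lemma lip_append_left [simp]: "lip K (v @ v') w = lip K v w + lip K v' w"
  by (induct w) (auto simp: lip_def algebra_simps)
lemma lip_append_right [simp]: "lip K v (w @ w') = lip K v w + lip K v w'" by (simp add: lip_def)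
lemma lip_scale_left [simp]: "lip K (lscale c v) w = c * lip K v w"
  by (induct w) (auto simp: lip_def algebra_simps)
lemma lip_scale_right [simp]: "lip K v (lscale c w) = cnj c * lip K v w"
  by (induct w) (auto simp: lip_def lscale_def algebra_simps)
lemma lip_ldiff [simp]: "lip K (ldiff v v') w = lip K v w - lip K v' w" "lip K v (ldiff w w') = lip K v w - lip K v w'"
  by (auto simp: ldiff_def)
lemma lip_Nil [simp]: "lip K v [] = 0" by (simp add: lip_def)
lemma lip_Cons [simp]: "lip K v ((b, i) # w) = cnj b * kfun K v i + lip K v w" by (simp add: lip_def)
lemma lip_cong_left: "kfun K v = kfun K v' ==> lip K v w = lip K v' w" by (simp add: lip_def)

locale pd_kernel =
  fixes K :: "'i => 'i => complex"
  assumes pd: "lip K v v \<in> \<real>\<^sub>\<ge>\<^sub>0"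
begin

abbreviation "vn \<equiv> nrm (lip K)"

text \<open>Polarisation: the form is real at \<open>v @ w\<close> and at
  \<open>v @ lscale \<i> w\<close>.\<close>

lemma lip_herm: "lip K w v = cnj (lip K v w)"
proof -
  have r: "Im (lip K u u) = 0" for u using pd[of u] by (auto simp: complex_nonneg_Reals_iff)
  have "Im (lip K v w + lip K w v) = 0" using r[of "v @ w"] r[of v] r[of w] by simp
  moreover have "Im (- \<i> * lip K v w + \<i> * lip K w v) = 0" using r[of "v @ lscale \<i> w"] r[of v] r[of w] by simp
  ultimately show ?thesis by (simp add: complex_eq_iff)
qed

lemma lip_cong: "kfun K v = kfun K v' ==> kfun K w = kfun K w' ==> lip K v w = lip K v' w'"
  using lip_cong_left lip_herm by metis

lemma vn_cong: "kfun K v = kfun K v' ==> vn v = vn v'"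
  using lip_cong[of v v' v v'] by (simp add: nrm_def)

lemma vn_nonneg: "0 <= vn v" and vn_sq: "(vn v)\<^sup>2 = Re (lip K v v)"
  using pd[of v] by (simp_all add: nrm_def complex_nonneg_Reals_iff)

lemma lip_Cauchy_Schwarz: "cmod (lip K v w) <= vn v * vn w"
proof (rule power2_le_imp_le)
  have "(cmod (lip K w v))\<^sup>2 <= (vn v)\<^sup>2 * (vn w)\<^sup>2"
  proof (rule quadratic_discriminant)
    fix z
    have "0 <= Re (lip K (v @ lscale z w) (v @ lscale z w))" using vn_sq[of "v @ lscale z w"] by (metis zero_le_power2)
    also have "lip K (v @ lscale z w) (v @ lscale z w) = lip K v v + cnj z * lip K v w + (z * lip K w v + (z * cnj z) * lip K w w)"
      by (simp add: algebra_simps)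
    also have "cnj z * lip K v w = cnj (z * lip K w v)" using lip_herm[of v w] by simp
    also have "z * cnj z = of_real ((cmod z)\<^sup>2)" by (rule complex_norm_square[symmetric])
    finally show "0 <= (vn v)\<^sup>2 + 2 * Re (z * lip K w v) + (cmod z)\<^sup>2 * (vn w)\<^sup>2" by (simp add: vn_sq)
  qed simp
  then show "(cmod (lip K v w))\<^sup>2 <= (vn v * vn w)\<^sup>2" using lip_herm[of w v] by (simp add: power_mult_distrib)
qed (simp add: vn_nonneg)

lemma vn_append: "vn (v @ w) <= vn v + vn w"
proof (rule power2_le_imp_le)
  have "lip K (v @ w) (v @ w) = lip K v v + lip K v w + (cnj (lip K v w) + lip K w w)"
    using lip_herm[of w v] by simp
  then have "(vn (v @ w))\<^sup>2 = (vn v)\<^sup>2 + 2 * Re (lip K v w) + (vn w)\<^sup>2" by (simp add: vn_sq)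
  also have "\<dots> <= (vn v + vn w)\<^sup>2"
    using lip_Cauchy_Schwarz[of v w] complex_Re_le_cmod[of "lip K v w"] by (simp add: power2_sum)
  finally show "(vn (v @ w))\<^sup>2 <= (vn v + vn w)\<^sup>2" .
qed (simp add: vn_nonneg)

lemma vn_lscale: "vn (lscale c v) = cmod c * vn v"
proof (rule power2_eq_imp_eq)
  have "lip K (lscale c v) (lscale c v) = (c * cnj c) * lip K v v" by simp
  then have "lip K (lscale c v) (lscale c v) = of_real ((cmod c)\<^sup>2) * lip K v v" by (simp only: complex_norm_square)
  moreover have "Re (of_real r * z) = r * Re z" for r z by simp
  ultimately have "Re (lip K (lscale c v) (lscale c v)) = (cmod c)\<^sup>2 * Re (lip K v v)" by metis
  then show "(vn (lscale c v))\<^sup>2 = (cmod c * vn v)\<^sup>2"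
    by (simp only: vn_sq power_mult_distrib)
qed (simp_all add: vn_nonneg)

lemma vn_le_ldiff: "vn u <= vn (ldiff u v) + vn v"
proof -
  have "vn u = vn (ldiff u v @ v)" by (rule vn_cong) (auto simp: fun_eq_iff)
  then show ?thesis using vn_append[of "ldiff u v" v] by simp
qed

lemma vn_ldiff_le: "vn (ldiff u v) <= vn u + vn v"
  using vn_append[of u "lscale (-1) v"] by (simp add: ldiff_def vn_lscale)

abbreviation vcauchy :: "(nat => (complex \<times> 'i) list) => bool" where
  "vcauchy sg \<equiv> (\<forall>e>0. EX M. \<forall>m\<ge>M. \<forall>n\<ge>M. vn (ldiff (sg m) (sg n)) < e)"

lemma vcauchy_bounded: assumes "vcauchy sg" obtains B where "B > 0" "!!n. vn (sg n) <= B"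
proof -
  obtain M where M: "!!m n. m \<ge> M ==> n \<ge> M ==> vn (ldiff (sg m) (sg n)) < 1" using assms by (meson zero_less_one)
  define B where "B = 1 + vn (sg M) + (\<Sum>n\<le>M. vn (sg n))"
  have "vn (sg n) <= B" for n
  proof (cases "n <= M")
    case True
    then have "vn (sg n) <= (\<Sum>n\<le>M. vn (sg n))" by (intro member_le_sum) (auto simp: vn_nonneg)
    then show ?thesis using vn_nonneg[of "sg M"] by (simp add: B_def)
  next
    case False
    then have "vn (sg n) <= 1 + vn (sg M)" using M[of n M] vn_le_ldiff[of "sg n" "sg M"] by simp
    moreover have "0 <= (\<Sum>n\<le>M. vn (sg n))" by (intro sum_nonneg) (simp add: vn_nonneg)
    ultimately show ?thesis by (simp add: B_def)
  qed
  moreover have "B > 0" unfolding B_def by (intro add_pos_nonneg sum_nonneg) (auto simp: vn_nonneg)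
  ultimately show ?thesis using that by blast
qed

lemma vcauchy_ldiff: assumes "vcauchy sg" "vcauchy \<rho>" shows "vcauchy (%n. ldiff (sg n) (\<rho> n))"
proof (intro allI impI)
  fix e :: real assume "e > 0"
  then obtain M N where M: "!!m n. m \<ge> M ==> n \<ge> M ==> vn (ldiff (sg m) (sg n)) < e / 2"
    and N: "!!m n. m \<ge> N ==> n \<ge> N ==> vn (ldiff (\<rho> m) (\<rho> n)) < e / 2"
    using assms by (meson half_gt_zero)
  have "vn (ldiff (ldiff (sg m) (\<rho> m)) (ldiff (sg n) (\<rho> n))) < e" if "m \<ge> max M N" "n \<ge> max M N" for m n
  proof -
    have "vn (ldiff (ldiff (sg m) (\<rho> m)) (ldiff (sg n) (\<rho> n))) = vn (ldiff (ldiff (sg m) (sg n)) (ldiff (\<rho> m) (\<rho> n)))"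
      by (rule vn_cong) (auto simp: fun_eq_iff)
    also have "\<dots> <= vn (ldiff (sg m) (sg n)) + vn (ldiff (\<rho> m) (\<rho> n))" by (rule vn_ldiff_le)
    also have "\<dots> < e" using M[of m n] N[of m n] that by simp
    finally show ?thesis .
  qed
  then show "EX M. \<forall>m\<ge>M. \<forall>n\<ge>M. vn (ldiff (ldiff (sg m) (\<rho> m)) (ldiff (sg n) (\<rho> n))) < e" by blast
qed

text \<open>Split \<open>lip K (sg n) (sg n)\<close> at a fixed late \<open>sg M\<close>: the part
  against \<open>ldiff (sg n) (sg M)\<close> is small by the Cauchy property, the part against
  \<open>sg M\<close> by pointwise convergence. Hence a function in \<open>kspace\<close> stands for
  exactly one vector of the completion.\<close>

lemma null_sequence:
  assumes c: "vcauchy sg" and z: "!!i. (%n. kfun K (sg n) i) \<longlonglongrightarrow> 0"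
  shows "(%n. vn (sg n)) \<longlonglongrightarrow> 0"
proof -
  obtain B where B: "B > 0" "!!n. vn (sg n) <= B" using vcauchy_bounded[OF c] by blast
  have z': "(%n. lip K (sg n) w) \<longlonglongrightarrow> 0" for w
  proof (induct w)
    case (Cons p w)
    obtain b i where p: "p = (b, i)" by force
    have "(%n. cnj b * kfun K (sg n) i + lip K (sg n) w) \<longlonglongrightarrow> cnj b * 0 + 0" by (intro tendsto_intros z Cons)
    then show ?case by (simp add: p)
  qed simp
  have "(%n. (vn (sg n))\<^sup>2) \<longlonglongrightarrow> 0"
  proof (rule LIMSEQ_I)
    fix e :: real assume e: "e > 0"
    obtain M where M: "!!m n. m \<ge> M ==> n \<ge> M ==> vn (ldiff (sg m) (sg n)) < e / (2 * B)" using c e B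
      by (meson divide_pos_pos mult_pos_pos zero_less_numeral)
    obtain N where N: "!!n. n \<ge> N ==> cmod (lip K (sg n) (sg M)) < e / 2"
      using LIMSEQ_D[OF z'[of "sg M"], of "e / 2"] e by auto
    have "norm ((vn (sg n))\<^sup>2 - 0) < e" if n: "n \<ge> max M N" for n
    proof -
      have "lip K (sg n) (sg n) = lip K (sg n) (ldiff (sg n) (sg M)) + lip K (sg n) (sg M)" by simp
      then have "(vn (sg n))\<^sup>2 <= cmod (lip K (sg n) (ldiff (sg n) (sg M))) + cmod (lip K (sg n) (sg M))"
        unfolding vn_sq by (metis complex_Re_le_cmod norm_triangle_ineq order_trans)
      also have "cmod (lip K (sg n) (ldiff (sg n) (sg M))) <= vn (sg n) * vn (ldiff (sg n) (sg M))" by (rule lip_Cauchy_Schwarz)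
      also have "\<dots> <= B * (e / (2 * B))" using B M[of n M] n vn_nonneg by (intro mult_mono) (auto simp: less_imp_le)
      also have "B * (e / (2 * B)) = e / 2" using B by simp
      finally show ?thesis using N[of n] n by simp
    qed
    then show "EX N. \<forall>n\<ge>N. norm ((vn (sg n))\<^sup>2 - 0) < e" by blast
  qed
  then have "(%n. sqrt ((vn (sg n))\<^sup>2)) \<longlonglongrightarrow> sqrt 0" by (rule tendsto_real_sqrt)
  then show ?thesis by (simp add: vn_nonneg)
qed

lemma approximates_lip_Cauchy:
  assumes "vcauchy sg" "vcauchy \<rho>" shows "convergent (%n. lip K (sg n) (\<rho> n))"
proof -
  obtain B where B: "B > 0" "!!n. vn (sg n) <= B" using vcauchy_bounded[OF assms(1)] by blast
  obtain C where C: "C > 0" "!!n. vn (\<rho> n) <= C" using vcauchy_bounded[OF assms(2)] by blast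
  have "Cauchy (%n. lip K (sg n) (\<rho> n))"
  proof (rule CauchyI)
    fix e :: real assume e: "e > 0"
    obtain M where M: "!!m n. m \<ge> M ==> n \<ge> M ==> vn (ldiff (sg m) (sg n)) < e / (2 * C)"
      using assms(1) e C by (meson divide_pos_pos mult_pos_pos zero_less_numeral)
    obtain N where N: "!!m n. m \<ge> N ==> n \<ge> N ==> vn (ldiff (\<rho> m) (\<rho> n)) < e / (2 * B)"
      using assms(2) e B by (meson divide_pos_pos mult_pos_pos zero_less_numeral)
    have "norm (lip K (sg m) (\<rho> m) - lip K (sg n) (\<rho> n)) < e" if mn: "m \<ge> max M N" "n \<ge> max M N" for m n
    proof -
      have "lip K (sg m) (\<rho> m) - lip K (sg n) (\<rho> n) = lip K (ldiff (sg m) (sg n)) (\<rho> m) + lip K (sg n) (ldiff (\<rho> m) (\<rho> n))" by simp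
      also have "norm \<dots> <= vn (ldiff (sg m) (sg n)) * vn (\<rho> m) + vn (sg n) * vn (ldiff (\<rho> m) (\<rho> n))"
        by (rule order_trans[OF norm_triangle_ineq add_mono[OF lip_Cauchy_Schwarz lip_Cauchy_Schwarz]])
      also have "\<dots> <= vn (ldiff (sg m) (sg n)) * C + B * vn (ldiff (\<rho> m) (\<rho> n))"
        using B C by (intro add_mono mult_left_mono mult_right_mono) (auto simp: vn_nonneg)
      also have "\<dots> < e / (2 * C) * C + B * (e / (2 * B))"
        using M[of m n] N[of m n] mn B C by (intro add_strict_mono mult_strict_left_mono mult_strict_right_mono) auto
      also have "\<dots> = e" using B C by simp
      finally show ?thesis .
    qed
    then show "EX M. \<forall>m\<ge>M. \<forall>n\<ge>M. norm (lip K (sg m) (\<rho> m) - lip K (sg n) (\<rho> n)) < e" by blast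
  qed
  then show ?thesis by (rule Cauchy_convergent)
qed

lemma approximates_null:
  assumes "approximates K sg f" "approximates K sg' f" shows "(%n. vn (ldiff (sg n) (sg' n))) \<longlonglongrightarrow> 0"
proof (rule null_sequence)
  show "vcauchy (%n. ldiff (sg n) (sg' n))" using assms by (intro vcauchy_ldiff) (auto simp: approximates_def)
  show "(%n. kfun K (ldiff (sg n) (sg' n)) i) \<longlonglongrightarrow> 0" for i
    using assms tendsto_diff[of "%n. kfun K (sg n) i" "f i" sequentially "%n. kfun K (sg' n) i" "f i"] by (simp add: approximates_def)
qed

text \<open>Two sequences for the same function differ by a null sequence in norm, and Cauchy
  sequences are bounded, so Cauchy-Schwarz makes the inner products agree in the limit.\<close>

lemma kip_lim: assumes s: "approximates K sg f" and r: "approximates K \<rho> g"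
  shows "(%n. lip K (sg n) (\<rho> n)) \<longlonglongrightarrow> kip K f g"
proof -
  define s0 where "s0 = (SOME sg. approximates K sg f)"
  define r0 where "r0 = (SOME sg. approximates K sg g)"
  have s': "approximates K s0 f" unfolding s0_def by (rule someI[of "%sg. approximates K sg f", OF s])
  have r': "approximates K r0 g" unfolding r0_def by (rule someI[of "%sg. approximates K sg g", OF r])
  have vc: "vcauchy s0" "vcauchy r0" "vcauchy sg" "vcauchy \<rho>" using s r s' r' by (auto simp: approximates_def)
  obtain B where B: "B > 0" "!!n. vn (s0 n) <= B" using vcauchy_bounded[OF vc(1)] by blast
  obtain C where C: "C > 0" "!!n. vn (\<rho> n) <= C" using vcauchy_bounded[OF vc(4)] by blast
  have l: "(%n. lip K (s0 n) (r0 n)) \<longlonglongrightarrow> kip K f g"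
    unfolding kip_def s0_def[symmetric] r0_def[symmetric] using approximates_lip_Cauchy[OF vc(1,2)] by (rule convergent_LIMSEQ_iff[THEN iffD1])
  have "(%n. lip K (sg n) (\<rho> n) - lip K (s0 n) (r0 n)) \<longlonglongrightarrow> 0"
  proof (rule Lim_null_comparison[OF always_eventually[OF allI]])
    fix n
    have "lip K (sg n) (\<rho> n) - lip K (s0 n) (r0 n) = lip K (ldiff (sg n) (s0 n)) (\<rho> n) + lip K (s0 n) (ldiff (\<rho> n) (r0 n))" by simp
    also have "norm \<dots> <= vn (ldiff (sg n) (s0 n)) * vn (\<rho> n) + vn (s0 n) * vn (ldiff (\<rho> n) (r0 n))"
      by (rule order_trans[OF norm_triangle_ineq add_mono[OF lip_Cauchy_Schwarz lip_Cauchy_Schwarz]])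
    also have "\<dots> <= vn (ldiff (sg n) (s0 n)) * C + B * vn (ldiff (\<rho> n) (r0 n))"
      using B C by (intro add_mono mult_left_mono mult_right_mono) (auto simp: vn_nonneg)
    finally show "norm (lip K (sg n) (\<rho> n) - lip K (s0 n) (r0 n)) <= vn (ldiff (sg n) (s0 n)) * C + B * vn (ldiff (\<rho> n) (r0 n))" .
  next
    have "(%n. vn (ldiff (sg n) (s0 n)) * C + B * vn (ldiff (\<rho> n) (r0 n))) \<longlonglongrightarrow> 0 * C + B * 0"
      by (intro tendsto_intros approximates_null[OF s s'] approximates_null[OF r r'])
    then show "(%n. vn (ldiff (sg n) (s0 n)) * C + B * vn (ldiff (\<rho> n) (r0 n))) \<longlonglongrightarrow> 0" by simp
  qed
  from tendsto_add[OF this l] show ?thesis by simp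
qed

lemma approximates_const: "approximates K (%_. v) (kfun K v)"
proof -
  have "vn (ldiff v v) = vn []" by (rule vn_cong) (auto simp: fun_eq_iff)
  then show ?thesis by (simp add: approximates_def nrm_def)
qed

lemma kfun_in [simp, intro]: "kfun K v \<in> kspace K"
  using approximates_const by (auto simp: kspace_def)

lemma K_in [simp, intro]: "K i \<in> kspace K"
  using kfun_in[of "[(1, i)]"] by (simp add: kfun_def)

lemma kip_kfun: "kip K (kfun K v) (kfun K w) = lip K v w"
  using kip_lim[OF approximates_const approximates_const] by (metis LIMSEQ_const_iff)

lemma approximates_append: "approximates K sg f ==> approximates K \<rho> g ==> approximates K (%n. sg n @ \<rho> n) (%i. f i + g i)"
proof -
  assume a: "approximates K sg f" "approximates K \<rho> g"
  have "vcauchy (%n. sg n @ \<rho> n)"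
  proof (intro allI impI)
    fix e :: real assume "e > 0"
    then obtain M N where M: "!!m n. m \<ge> M ==> n \<ge> M ==> vn (ldiff (sg m) (sg n)) < e / 2"
      and N: "!!m n. m \<ge> N ==> n \<ge> N ==> vn (ldiff (\<rho> m) (\<rho> n)) < e / 2"
      using a unfolding approximates_def by (meson half_gt_zero)
    have "vn (ldiff (sg m @ \<rho> m) (sg n @ \<rho> n)) < e" if "m \<ge> max M N" "n \<ge> max M N" for m n
    proof -
      have "vn (ldiff (sg m @ \<rho> m) (sg n @ \<rho> n)) = vn (ldiff (sg m) (sg n) @ ldiff (\<rho> m) (\<rho> n))"
        by (rule vn_cong) (auto simp: fun_eq_iff)
      also have "\<dots> <= vn (ldiff (sg m) (sg n)) + vn (ldiff (\<rho> m) (\<rho> n))" by (rule vn_append)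
      also have "\<dots> < e" using M[of m n] N[of m n] that by simp
      finally show ?thesis .
    qed
    then show "EX M. \<forall>m\<ge>M. \<forall>n\<ge>M. vn (ldiff (sg m @ \<rho> m) (sg n @ \<rho> n)) < e" by blast
  qed
  then show ?thesis using a by (auto simp: approximates_def intro!: tendsto_intros)
qed

lemma approximates_lscale: "approximates K sg f ==> approximates K (%n. lscale c (sg n)) (%i. c * f i)"
proof -
  assume a: "approximates K sg f"
  have "vn (ldiff (lscale c (sg m)) (lscale c (sg n))) = cmod c * vn (ldiff (sg m) (sg n))" for m n
  proof -
    have "vn (ldiff (lscale c (sg m)) (lscale c (sg n))) = vn (lscale c (ldiff (sg m) (sg n)))"
      by (rule vn_cong) (auto simp: fun_eq_iff algebra_simps)
    then show ?thesis by (simp add: vn_lscale)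
  qed
  moreover have "EX M. \<forall>m\<ge>M. \<forall>n\<ge>M. cmod c * vn (ldiff (sg m) (sg n)) < e" if e: "e > 0" for e
  proof -
    have "0 < e / (cmod c + 1)" using e by (intro divide_pos_pos) (auto intro: add_nonneg_pos)
    then obtain M where M: "!!m n. m \<ge> M ==> n \<ge> M ==> vn (ldiff (sg m) (sg n)) < e / (cmod c + 1)"
      using a unfolding approximates_def by meson
    have "cmod c * vn (ldiff (sg m) (sg n)) < e" if "m \<ge> M" "n \<ge> M" for m n
    proof -
      have "0 < 1 + cmod c" by (simp add: add_pos_nonneg)
      then have p: "cmod c * (e / (cmod c + 1)) < e" using e by (simp add: field_simps)
      have "cmod c * vn (ldiff (sg m) (sg n)) <= cmod c * (e / (cmod c + 1))" using M[OF that] by (intro mult_left_mono) auto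
      also note p
      finally show ?thesis .
    qed
    then show ?thesis by blast
  qed
  ultimately show ?thesis using a by (auto simp: approximates_def intro!: tendsto_intros)
qed

lemma kspace_add: "f \<in> kspace K ==> g \<in> kspace K ==> (%i. f i + g i) \<in> kspace K"
  by (auto simp: kspace_def intro: approximates_append)

lemma kspace_smult: "f \<in> kspace K ==> (%i. c * f i) \<in> kspace K"
  by (auto simp: kspace_def intro: approximates_lscale)

lemma kspace_diff: "f \<in> kspace K ==> g \<in> kspace K ==> (%i. f i - g i) \<in> kspace K"
  using kspace_add[of f "%i. (-1) * g i"] kspace_smult[of g "-1"] by simp

lemma kip_add: assumes "f \<in> kspace K" "g \<in> kspace K" "h \<in> kspace K"
  shows "kip K (%i. f i + g i) h = kip K f h + kip K g h"
proof -
  obtain sg \<rho> \<tau> where a: "approximates K sg f" "approximates K \<rho> g" "approximates K \<tau> h" using assms by (auto simp: kspace_def)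
  show ?thesis
    using LIMSEQ_unique[OF kip_lim[OF approximates_append[OF a(1,2)] a(3)]] tendsto_add[OF kip_lim[OF a(1,3)] kip_lim[OF a(2,3)]] by simp
qed

lemma kip_smult: assumes "f \<in> kspace K" "h \<in> kspace K" shows "kip K (%i. c * f i) h = c * kip K f h"
proof -
  obtain sg \<tau> where a: "approximates K sg f" "approximates K \<tau> h" using assms by (auto simp: kspace_def)
  show ?thesis
    using LIMSEQ_unique[OF kip_lim[OF approximates_lscale[OF a(1)] a(2)]] tendsto_mult_left[OF kip_lim[OF a(1,2)], of c] by simp
qed

lemma kip_cnj: assumes "f \<in> kspace K" "g \<in> kspace K" shows "kip K g f = cnj (kip K f g)"
proof -
  obtain sg \<tau> where a: "approximates K sg f" "approximates K \<tau> g" using assms by (auto simp: kspace_def)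
  have "(%n. cnj (lip K (sg n) (\<tau> n))) \<longlonglongrightarrow> cnj (kip K f g)" by (intro tendsto_intros kip_lim a)
  then show ?thesis using LIMSEQ_unique[OF kip_lim[OF a(2,1)]] by (simp flip: lip_herm)
qed

lemma kip_add_right: assumes "f \<in> kspace K" "g \<in> kspace K" "h \<in> kspace K"
  shows "kip K h (%i. f i + g i) = kip K h f + kip K h g"
  using assms kip_cnj[OF kspace_add[OF assms(1,2)] assms(3)] kip_cnj[OF assms(1,3)] kip_cnj[OF assms(2,3)] by (simp add: kip_add)

lemma kip_smult_right: assumes "f \<in> kspace K" "h \<in> kspace K" shows "kip K h (%i. c * f i) = cnj c * kip K h f"
  using assms kip_cnj[OF kspace_smult[OF assms(1)] assms(2), of c] kip_cnj[OF assms] by (simp add: kip_smult)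

lemma kip_diff: assumes "f \<in> kspace K" "g \<in> kspace K" "h \<in> kspace K"
  shows "kip K (%i. f i - g i) h = kip K f h - kip K g h" "kip K h (%i. f i - g i) = kip K h f - kip K h g"
  using kip_add[OF assms(1) kspace_smult[OF assms(2), of "-1"] assms(3)] kip_smult[OF assms(2,3), of "-1"]
    kip_add_right[OF assms(1) kspace_smult[OF assms(2), of "-1"] assms(3)] kip_smult_right[OF assms(2,3), of "-1"] by simp_all

lemma kip_nrm_lim: assumes "approximates K sg f" shows "(%n. vn (sg n)) \<longlonglongrightarrow> nrm (kip K) f"
proof -
  have "(%n. sqrt (Re (lip K (sg n) (sg n)))) \<longlonglongrightarrow> sqrt (Re (kip K f f))" by (intro tendsto_intros kip_lim assms)
  then show ?thesis by (simp add: nrm_def)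
qed

lemma kip_nonneg: assumes "f \<in> kspace K" shows "kip K f f \<in> \<real>\<^sub>\<ge>\<^sub>0"
proof -
  obtain sg where a: "approximates K sg f" using assms by (auto simp: kspace_def)
  have l: "(%n. lip K (sg n) (sg n)) \<longlonglongrightarrow> kip K f f" by (rule kip_lim[OF a a])
  have "(%n. Re (lip K (sg n) (sg n))) \<longlonglongrightarrow> Re (kip K f f)" "(%n. Im (lip K (sg n) (sg n))) \<longlonglongrightarrow> Im (kip K f f)"
    by (intro tendsto_intros l)+
  moreover have "Re (lip K v v) \<ge> 0" "Im (lip K v v) = 0" for v using pd[of v] by (auto simp: complex_nonneg_Reals_iff)
  ultimately have "0 <= Re (kip K f f)" "(%n. 0::real) \<longlonglongrightarrow> Im (kip K f f)" by (auto intro: LIMSEQ_le_const)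
  then show ?thesis by (simp add: complex_nonneg_Reals_iff LIMSEQ_const_iff)
qed

lemma knrm_nonneg: "f \<in> kspace K ==> 0 <= nrm (kip K) f"
  using kip_nonneg[of f] by (auto simp: nrm_def complex_nonneg_Reals_iff)

lemma reproducing: assumes "f \<in> kspace K" shows "kip K f (K i) = f i"
proof -
  obtain sg where a: "approximates K sg f" using assms by (auto simp: kspace_def)
  have e: "kfun K [(1, i)] = K i" by (simp add: kfun_def)
  have "(%n. kfun K (sg n) i) \<longlonglongrightarrow> kip K f (K i)"
    using kip_lim[OF a approximates_const[of "[(1, i)]"]] by (simp add: e)
  moreover have "(%n. kfun K (sg n) i) \<longlonglongrightarrow> f i" using a by (simp add: approximates_def)
  ultimately show ?thesis by (rule LIMSEQ_unique)
qed

lemma kip_definite: assumes "f \<in> kspace K" "kip K f f = 0" shows "f = (%_. 0)"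
proof
  fix i
  obtain sg where a: "approximates K sg f" using assms by (auto simp: kspace_def)
  have "(%n. vn (sg n)) \<longlonglongrightarrow> 0" using kip_nrm_lim[OF a] assms by (simp add: nrm_def)
  then have t: "(%n. vn (sg n) * vn [(1, i)]) \<longlonglongrightarrow> 0" by (rule tendsto_mult_left_zero)
  have "norm (kfun K (sg n) i) <= vn (sg n) * vn [(1, i)]" for n
    using lip_Cauchy_Schwarz[of "sg n" "[(1, i)]"] by simp
  then have "(%n. kfun K (sg n) i) \<longlonglongrightarrow> 0" using t by (rule Lim_null_comparison[OF always_eventually[OF allI]])
  moreover have "(%n. kfun K (sg n) i) \<longlonglongrightarrow> f i" using a by (simp add: approximates_def)
  ultimately show "f i = 0" using LIMSEQ_unique by blast
qed

lemma approximates_dense: assumes a: "approximates K sg f"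
  shows "(%n. nrm (kip K) (%i. f i - kfun K (sg n) i)) \<longlonglongrightarrow> 0"
proof (rule LIMSEQ_I)
  fix e :: real assume e: "e > 0"
  obtain M where M: "!!m n. m \<ge> M ==> n \<ge> M ==> vn (ldiff (sg m) (sg n)) < e / 2" using a e unfolding approximates_def by (meson half_gt_zero)
  have "norm (nrm (kip K) (%i. f i - kfun K (sg n) i) - 0) < e" if n: "n \<ge> M" for n
  proof -
    have s: "approximates K (%m. sg m @ lscale (-1) (sg n)) (%i. f i + (-1) * kfun K (sg n) i)"
      by (intro approximates_append approximates_lscale a approximates_const)
    have "(%m. vn (ldiff (sg m) (sg n))) \<longlonglongrightarrow> nrm (kip K) (%i. f i - kfun K (sg n) i)"
      using kip_nrm_lim[OF s] by (simp add: ldiff_def)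
    then have "nrm (kip K) (%i. f i - kfun K (sg n) i) <= e / 2"
      using M[OF _ n] by (intro LIMSEQ_le_const2) (auto intro!: exI[of _ M] less_imp_le)
    moreover have "0 <= nrm (kip K) (%i. f i - kfun K (sg n) i)"
      using a by (intro knrm_nonneg kspace_diff kfun_in) (auto simp: kspace_def)
    ultimately show ?thesis using e by simp
  qed
  then show "EX M. \<forall>n\<ge>M. norm (nrm (kip K) (%i. f i - kfun K (sg n) i) - 0) < e" by blast
qed

lemma knrm_triangle: assumes "f \<in> kspace K" "g \<in> kspace K"
  shows "nrm (kip K) (%i. f i + g i) <= nrm (kip K) f + nrm (kip K) g"
proof -
  obtain sg \<rho> where a: "approximates K sg f" "approximates K \<rho> g" using assms by (auto simp: kspace_def)
  show ?thesis
    by (rule LIMSEQ_le[OF kip_nrm_lim[OF approximates_append[OF a]] tendsto_add[OF kip_nrm_lim[OF a(1)] kip_nrm_lim[OF a(2)]]])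
      (simp add: vn_append)
qed

lemma kip_Cauchy_Schwarz: assumes "f \<in> kspace K" "g \<in> kspace K"
  shows "cmod (kip K f g) <= nrm (kip K) f * nrm (kip K) g"
proof -
  obtain sg \<rho> where a: "approximates K sg f" "approximates K \<rho> g" using assms by (auto simp: kspace_def)
  show ?thesis
    by (rule LIMSEQ_le[OF tendsto_norm[OF kip_lim[OF a]] tendsto_mult[OF kip_nrm_lim[OF a(1)] kip_nrm_lim[OF a(2)]]])
      (simp add: lip_Cauchy_Schwarz)
qed

lemma knrm_diff_triangle: assumes "f \<in> kspace K" "g \<in> kspace K" "h \<in> kspace K"
  shows "nrm (kip K) (%i. f i - h i) <= nrm (kip K) (%i. f i - g i) + nrm (kip K) (%i. g i - h i)"
  using knrm_triangle[OF kspace_diff[OF assms(1,2)] kspace_diff[OF assms(2,3)]] by simp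

lemma knrm_diff_commute: assumes "f \<in> kspace K" "g \<in> kspace K"
  shows "nrm (kip K) (%i. f i - g i) = nrm (kip K) (%i. g i - f i)"
proof -
  have d: "(%i. g i - f i) \<in> kspace K" by (rule kspace_diff[OF assms(2,1)])
  have "(%i. f i - g i) = (%i. (-1) * (g i - f i))" by auto
  then show ?thesis using d kspace_smult[OF d, of "-1"] kip_smult[OF d kspace_smult[OF d, of "-1"], of "-1"] kip_smult_right[OF d d, of "-1"]
    by (simp add: nrm_def)
qed

lemma knrm_kfun: "nrm (kip K) (kfun K v) = vn v"
  by (simp add: nrm_def kip_kfun)

lemma kspace_complete:
  assumes f: "!!n. f n \<in> kspace K" and c: "!!e. e > 0 ==> EX M. \<forall>m\<ge>M. \<forall>n\<ge>M. nrm (kip K) (%i. f m i - f n i) < e"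
  shows "\<exists>l\<in>kspace K. (%n. nrm (kip K) (%i. f n i - l i)) \<longlonglongrightarrow> 0"
proof -
  have "EX v. nrm (kip K) (%i. f n i - kfun K v i) < 1 / real (Suc n)" for n
  proof -
    obtain sg where "approximates K sg (f n)" using f by (auto simp: kspace_def)
    from LIMSEQ_D[OF approximates_dense[OF this], of "1 / real (Suc n)"] obtain m
      where "norm (nrm (kip K) (%i. f n i - kfun K (sg m) i) - 0) < 1 / real (Suc n)" by auto
    then show ?thesis by (intro exI[of _ "sg m"]) simp
  qed
  \<comment> \<open>Each \<open>f n\<close> is replaced by a formal combination within
    \<open>1 / (n + 1)\<close>. These form a Cauchy sequence, and its pointwise limit is the limit
    sought.\<close>
  then obtain v where v: "!!n. nrm (kip K) (%i. f n i - kfun K (v n) i) < 1 / real (Suc n)" by metis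
  have vv: "vn (ldiff (v m) (v n)) <= 1 / real (Suc m) + nrm (kip K) (%i. f m i - f n i) + 1 / real (Suc n)" for m n
  proof -
    have "vn (ldiff (v m) (v n)) = nrm (kip K) (%i. kfun K (v m) i - kfun K (v n) i)"
      unfolding knrm_kfun[symmetric] by (rule arg_cong[where f = "nrm (kip K)"]) auto
    also have "\<dots> <= nrm (kip K) (%i. kfun K (v m) i - f m i) + nrm (kip K) (%i. f m i - kfun K (v n) i)"
      by (rule knrm_diff_triangle) (auto simp: f)
    also have "nrm (kip K) (%i. f m i - kfun K (v n) i) <= nrm (kip K) (%i. f m i - f n i) + nrm (kip K) (%i. f n i - kfun K (v n) i)"
      by (rule knrm_diff_triangle) (auto simp: f)
    finally show ?thesis using v[of m] v[of n] knrm_diff_commute[OF f kfun_in, of m "v m"] by simp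
  qed
  have small: "EX M. \<forall>n\<ge>M. 1 / real (Suc n) < e" if e: "e > 0" for e :: real
    using LIMSEQ_D[OF lim_1_over_n[where 'a = real, THEN LIMSEQ_Suc], of e] e by auto
  have vc: "vcauchy v"
  proof (intro allI impI)
    fix e :: real assume e: "e > 0"
    obtain M where M: "!!n. n \<ge> M ==> 1 / real (Suc n) < e / 3" using small[of "e / 3"] e by auto
    obtain N where N: "!!m n. m \<ge> N ==> n \<ge> N ==> nrm (kip K) (%i. f m i - f n i) < e / 3" using c[of "e / 3"] e by auto
    have "vn (ldiff (v m) (v n)) < e" if "m \<ge> max M N" "n \<ge> max M N" for m n
      using vv[of m n] M[of m] M[of n] N[of m n] that by simp
    then show "EX M. \<forall>m\<ge>M. \<forall>n\<ge>M. vn (ldiff (v m) (v n)) < e" by blast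
  qed
  have "convergent (%n. kfun K (v n) i)" for i
    using approximates_lip_Cauchy[of v "%_. [(1, i)]"] vc approximates_const[of "[(1, i)]"] by (simp add: approximates_def)
  then obtain l where l: "!!i. (%n. kfun K (v n) i) \<longlonglongrightarrow> l i" unfolding convergent_def by metis
  have a: "approximates K v l" using vc l by (simp add: approximates_def)
  then have lK: "l \<in> kspace K" by (auto simp: kspace_def)
  have "(%n. nrm (kip K) (%i. f n i - l i)) \<longlonglongrightarrow> 0"
  proof (rule tendsto_sandwich[of "%_. 0" _ _ "%n. 1 / real (Suc n) + nrm (kip K) (%i. l i - kfun K (v n) i)"])
    have "nrm (kip K) (%i. f n i - l i) <= 1 / real (Suc n) + nrm (kip K) (%i. l i - kfun K (v n) i)" for n
      using knrm_diff_triangle[OF f kfun_in lK, of n "v n"] v[of n] knrm_diff_commute[OF lK kfun_in, of "v n"] by simp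
    then show "\<forall>\<^sub>F n in sequentially. nrm (kip K) (%i. f n i - l i) <= 1 / real (Suc n) + nrm (kip K) (%i. l i - kfun K (v n) i)" by simp
    show "(%n. 1 / real (Suc n) + nrm (kip K) (%i. l i - kfun K (v n) i)) \<longlonglongrightarrow> 0"
      using tendsto_add[OF lim_1_over_n[THEN LIMSEQ_Suc] approximates_dense[OF a]] by simp
  qed (auto intro!: always_eventually knrm_nonneg kspace_diff f lK)
  then show ?thesis using lK by blast
qed

sublocale fun_hilbert "kspace K" "kip K"
proof
  show "(%_. 0) \<in> kspace K" using kfun_in[of "[]"] by (simp add: kfun_def)
  show "\<exists>l\<in>kspace K. (%n. nrm (kip K) (%i. sg n i - l i)) \<longlonglongrightarrow> 0"
    if "!!n. sg n \<in> kspace K" "!!e. e > 0 ==> EX M. \<forall>m\<ge>M. \<forall>n\<ge>M. nrm (kip K) (%i. sg m i - sg n i) < e" for sg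
    by (rule kspace_complete[OF that])
qed (rule kspace_add kspace_smult kip_add kip_smult kip_cnj kip_nonneg kip_definite; assumption)+

text \<open>\<open>T\<close> is given on all functions. A bound is asked only on formal
  combinations, and pointwise continuity \<open>Tc\<close> identifies the limit of the images of an
  approximating sequence with \<open>T f\<close>, so nothing has to be extended by choice.\<close>

lemma operator_extension:
  assumes T0: "!!v. EX v'. kfun K v' = T (kfun K v) & vn v' <= C * vn v"
    and Td: "!!f g. T (%i. f i - g i) = (%i. T f i - T g i)"
    and Tc: "!!g f i. (!!j. (%n. g n j) \<longlonglongrightarrow> f j) ==> (%n. T (g n) i) \<longlonglongrightarrow> T f i"
    and C: "0 <= C" and f: "f \<in> kspace K"
  shows "T f \<in> kspace K & nrm (kip K) (T f) <= C * nrm (kip K) f"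
proof -
  obtain sg where a: "approximates K sg f" using f by (auto simp: kspace_def)
  obtain t where t: "!!v. kfun K (t v) = T (kfun K v)" "!!v. vn (t v) <= C * vn v" using T0 by metis
  have td: "vn (ldiff (t v) (t w)) <= C * vn (ldiff v w)" for v w
  proof -
    have "kfun K (ldiff (t v) (t w)) = T (kfun K (ldiff v w))" 
    proof -
      have "kfun K (ldiff v w) = (%i. kfun K v i - kfun K w i)" by (simp add: fun_eq_iff)
      then have "T (kfun K (ldiff v w)) = (%i. T (kfun K v) i - T (kfun K w) i)" by (simp only: Td)
      then show ?thesis by (simp add: fun_eq_iff t)
    qed
    then have "vn (ldiff (t v) (t w)) = vn (t (ldiff v w))" by (intro vn_cong) (simp add: t)
    then show ?thesis using t(2) by simp
  qed
  have "vcauchy (%n. t (sg n))"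
  proof (intro allI impI)
    fix e :: real assume e: "e > 0"
    then have "0 < e / (C + 1)" using C by simp
    then obtain M where M: "!!m n. m \<ge> M ==> n \<ge> M ==> vn (ldiff (sg m) (sg n)) < e / (C + 1)"
      using a unfolding approximates_def by meson
    have "vn (ldiff (t (sg m)) (t (sg n))) < e" if "m \<ge> M" "n \<ge> M" for m n
    proof -
      have "vn (ldiff (t (sg m)) (t (sg n))) <= C * (e / (C + 1))"
        using td[of "sg m" "sg n"] M[OF that] C by (meson less_imp_le mult_left_mono order_trans)
      also have "\<dots> < e" using e C by (simp add: field_simps)
      finally show ?thesis .
    qed
    then show "EX M. \<forall>m\<ge>M. \<forall>n\<ge>M. vn (ldiff (t (sg m)) (t (sg n))) < e" by blast
  qed
  moreover have "(%n. kfun K (t (sg n)) i) \<longlonglongrightarrow> T f i" for i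
    unfolding t by (rule Tc) (use a in \<open>simp add: approximates_def\<close>)
  ultimately have a': "approximates K (%n. t (sg n)) (T f)" by (simp add: approximates_def)
  then have "T f \<in> kspace K" by (auto simp: kspace_def)
  moreover have "nrm (kip K) (T f) <= C * nrm (kip K) f"
    by (rule LIMSEQ_le[OF kip_nrm_lim[OF a'] tendsto_mult_left[OF kip_nrm_lim[OF a]]]) (simp add: t)
  ultimately show ?thesis by blast
qed

lemma adjoint_kfun:
  assumes f: "f \<in> kspace K" and g: "g \<in> kspace K"
    and S: "!!i. S (K i) \<in> kspace K" "!!f g c. S (%i. c * f i + g i) = (%i. c * S f i + S g i)"
    and r: "!!i. g i = kip K f (S (K i))"
  shows "S (kfun K w) \<in> kspace K & kip K g (kfun K w) = kip K f (S (kfun K w))"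
proof (induct w)
  case Nil
  have "S (%_. 0) = (%_. 0)" using S(2)[of "-1" "%_. 0" "%_. 0"] by (simp add: fun_eq_iff)
  then have "S (kfun K []) = kfun K []" by (simp add: kfun_def)
  moreover have "kip K h (kfun K []) = 0" if "h \<in> kspace K" for h
    using kip_smult_right[OF kfun_in[of "[]"] that, of 0] by (simp add: kfun_def)
  ultimately show ?case using f g by (metis kfun_in)
next
  case (Cons p w)
  obtain b i where p: "p = (b, i)" by force
  have e: "kfun K (p # w) = (%j. b * K i j + kfun K w j)" by (simp add: p fun_eq_iff)
  have "S (kfun K (p # w)) = (%j. b * S (K i) j + S (kfun K w) j)" unfolding e by (rule S(2))
  moreover have "kip K f (%j. b * S (K i) j + S (kfun K w) j) = cnj b * kip K f (S (K i)) + kip K f (S (kfun K w))"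
    using kip_add_right[OF kspace_smult[OF S(1)] conjunct1[OF Cons] f] kip_smult_right[OF S(1) f] by simp
  moreover have "kip K g (kfun K (p # w)) = cnj b * g i + kip K g (kfun K w)"
    unfolding e using kip_add_right[OF kspace_smult[OF K_in] kfun_in g] kip_smult_right[OF K_in g] reproducing[OF g] by simp
  ultimately show ?case using Cons r[of i] kspace_add[OF kspace_smult[OF S(1)] conjunct1[OF Cons]] by simp
qed

text \<open>By the reproducing property, \<open>r\<close> is the adjoint relation tested against the
  vectors \<open>K i\<close>. Linearity of \<open>S\<close> carries it to the functions
  \<open>kfun K w\<close> (\<open>adjoint_kfun\<close>), and their density to all of
  \<open>kspace\<close>.\<close>

lemma adjoint_extension:
  assumes T: "!!f. f \<in> kspace K ==> T f \<in> kspace K"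
    and S: "!!f. f \<in> kspace K ==> S f \<in> kspace K & nrm (kip K) (S f) <= C * nrm (kip K) f"
    and Sl: "!!f g c. S (%i. c * f i + g i) = (%i. c * S f i + S g i)"
    and r: "!!f i. f \<in> kspace K ==> T f i = kip K f (S (K i))"
    and f: "f \<in> kspace K" and g: "g \<in> kspace K"
  shows "kip K (T f) g = kip K f (S g)"
proof -
  obtain \<rho> where a: "approximates K \<rho> g" using g by (auto simp: kspace_def)
  have eq: "kip K (T f) (kfun K w) = kip K f (S (kfun K w))" for w
    using adjoint_kfun[of f "T f" S w] f T S Sl r by auto
  have l: "(%n. kip K h (%i. g i - kfun K (\<rho> n) i)) \<longlonglongrightarrow> 0" if h: "h \<in> kspace K" for h
  proof (rule Lim_null_comparison[OF always_eventually[OF allI]])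
    show "norm (kip K h (%i. g i - kfun K (\<rho> n) i)) <= nrm (kip K) h * nrm (kip K) (%i. g i - kfun K (\<rho> n) i)" for n
      by (rule kip_Cauchy_Schwarz) (auto intro!: kspace_diff g h)
    show "(%n. nrm (kip K) h * nrm (kip K) (%i. g i - kfun K (\<rho> n) i)) \<longlonglongrightarrow> 0"
      by (rule tendsto_mult_right_zero[OF approximates_dense[OF a]])
  qed
  have Sd: "S (%i. g i - h i) = (%i. S g i - S h i)" for h
    using Sl[of "-1" h g] by (simp add: fun_eq_iff)
  have "(%n. kip K f (S (%i. g i - kfun K (\<rho> n) i))) \<longlonglongrightarrow> 0"
  proof (rule Lim_null_comparison[OF always_eventually[OF allI]])
    show "norm (kip K f (S (%i. g i - kfun K (\<rho> n) i))) <= nrm (kip K) f * (C * nrm (kip K) (%i. g i - kfun K (\<rho> n) i))" for n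
    proof -
      have d: "(%i. g i - kfun K (\<rho> n) i) \<in> kspace K" by (intro kspace_diff g kfun_in)
      show ?thesis using kip_Cauchy_Schwarz[OF f conjunct1[OF S[OF d]]] S[OF d] knrm_nonneg[OF f] by (meson mult_left_mono order_trans)
    qed
    show "(%n. nrm (kip K) f * (C * nrm (kip K) (%i. g i - kfun K (\<rho> n) i))) \<longlonglongrightarrow> 0"
      by (intro tendsto_mult_right_zero approximates_dense[OF a])
  qed
  moreover have "kip K (T f) (%i. g i - kfun K (\<rho> n) i) - kip K f (S (%i. g i - kfun K (\<rho> n) i)) = kip K (T f) g - kip K f (S g)" for n
    using f g T S eq[of "\<rho> n"] unfolding Sd by (simp add: kip_diff)
  ultimately have "(%n. kip K (T f) g - kip K f (S g)) \<longlonglongrightarrow> 0 - 0"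
    using tendsto_diff[OF l[OF T[OF f]]] by (metis (no_types, lifting) LIMSEQ_const_iff ext diff_zero tendsto_cong)
  then show ?thesis by (simp add: LIMSEQ_const_iff)
qed

end

section \<open>Operators given by matrices with finite rows\<close>

text \<open>Matrices with finite rows act on arbitrary functions and are pointwise continuous, as
  \<open>operator_extension\<close> requires.\<close>

definition mop :: "('i => (complex \<times> 'i) list) => ('i => complex) => 'i => complex" where
  "mop m f = (%i. \<Sum>(b, j)\<leftarrow>m i. b * f j)"

definition lcnj :: "(complex \<times> 'i) list => (complex \<times> 'i) list" where
  "lcnj v = map (%(a, j). (cnj a, j)) v"

text \<open>When \<open>m'\<close> is adjoint to \<open>m\<close>, this is the action of
  \<open>mop m\<close> on formal combinations: column \<open>i\<close> of an operator is the
  conjugated row \<open>i\<close> of its adjoint.\<close>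

definition mapply :: "('i => (complex \<times> 'i) list) => (complex \<times> 'i) list => (complex \<times> 'i) list" where
  "mapply m' v = concat (map (%(a, i). lscale a (lcnj (m' i))) v)"

text \<open>For \<open>f\<close> in \<open>kspace\<close>, the value of \<open>mop m f\<close> at
  \<open>i\<close> is the inner product of \<open>f\<close> with \<open>kfun K (lcnj (m i))\<close>;
  the equation therefore says that \<open>mop m'\<close> is the adjoint on the vectors
  \<open>K i\<close>.\<close>

definition adj_mop :: "('i => 'i => complex) => ('i => (complex \<times> 'i) list) => ('i => (complex \<times> 'i) list) => bool" where
  "adj_mop K m m' \<longleftrightarrow> (ALL i. kfun K (lcnj (m i)) = mop m' (K i))"

lemma row_linear: "(\<Sum>(b, j)\<leftarrow>r. b * (c * f j + g j)) = c * (\<Sum>(b, j)\<leftarrow>r. b * f j) + (\<Sum>(b, j)\<leftarrow>r. b * (g j :: complex))"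
  by (induct r) (auto simp: algebra_simps)

lemma mop_linear: "mop m (%i. c * f i + g i) = (%i. c * mop m f i + mop m g i)"
  unfolding mop_def row_linear ..

lemma mop_diff: "mop m (%i. f i - g i) = (%i. mop m f i - mop m g i)"
  using mop_linear[of m "-1" g f] by (simp add: fun_eq_iff)

lemma mop_zero: "mop m (%_. 0) = (%_. 0)"
proof -
  have "(\<Sum>(b, j)\<leftarrow>r. b * 0) = (0 :: complex)" for r :: "(complex \<times> 'a) list" by (induct r) auto
  then show ?thesis by (simp add: mop_def)
qed

lemma mop_continuous: assumes "!!j. (%n. g n j) \<longlonglongrightarrow> f j" shows "(%n. mop m (g n) i) \<longlonglongrightarrow> mop m f i"
proof -
  have "(%n. \<Sum>(b, j)\<leftarrow>r. b * g n j) \<longlonglongrightarrow> (\<Sum>(b, j)\<leftarrow>r. b * f j)" for r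
    by (induct r) (auto intro!: tendsto_intros assms)
  then show ?thesis by (simp add: mop_def)
qed

context pd_kernel
begin

lemma K_herm: "K i j = cnj (K j i)"
  using lip_herm[of "[(1, i)]" "[(1, j)]"] by simp

lemma adj_mop_sym: assumes "adj_mop K m m'" shows "adj_mop K m' m"
proof -
  have c: "kfun K (lcnj r) k = cnj (\<Sum>(b, j)\<leftarrow>r. b * K k j)" for r k
    by (induct r) (auto simp: lcnj_def K_herm[of _ k])
  have "kfun K (lcnj (m' k)) i = mop m (K k) i" for i k
  proof -
    have "kfun K (lcnj (m i)) k = mop m' (K i) k" using assms by (simp add: adj_mop_def)
    then show ?thesis unfolding c mop_def by (metis complex_cnj_cnj)
  qed
  then show ?thesis by (auto simp: adj_mop_def fun_eq_iff)
qed

lemma kfun_mapply: assumes "adj_mop K m m'" shows "kfun K (mapply m' v) = mop m (kfun K v)"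
proof (induct v)
  case Nil
  have "kfun K [] = (%_. 0)" by (simp add: kfun_def)
  then show ?case by (simp add: mapply_def mop_zero)
next
  case (Cons p v)
  obtain a i where p: "p = (a, i)" by force
  have "kfun K (p # v) = (%j. a * K i j + kfun K v j)" by (simp add: p fun_eq_iff)
  then have "mop m (kfun K (p # v)) = (%j. a * mop m (K i) j + mop m (kfun K v) j)" by (simp add: mop_linear)
  moreover have "kfun K (mapply m' (p # v)) = (%j. a * kfun K (lcnj (m' i)) j + kfun K (mapply m' v) j)"
    by (simp add: mapply_def p fun_eq_iff)
  ultimately show ?case using Cons adj_mop_sym[OF assms] by (simp add: adj_mop_def)
qed

lemma row_reproducing: assumes f: "f \<in> kspace K" shows "(\<Sum>(b, j)\<leftarrow>r. b * f j) = kip K f (kfun K (lcnj r))"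
proof (induct r)
  case Nil
  show ?case using kip_smult_right[OF kfun_in[of "[]"] f, of 0] by (simp add: kfun_def lcnj_def)
next
  case (Cons p r)
  obtain b i where p: "p = (b, i)" by force
  have e: "kfun K (lcnj (p # r)) = (%j. cnj b * K i j + kfun K (lcnj r) j)" by (simp add: p fun_eq_iff lcnj_def)
  show ?case unfolding e
    using Cons p kip_add_right[OF kspace_smult[OF K_in] kfun_in f] kip_smult_right[OF K_in f] reproducing[OF f] by simp
qed

lemma mop_adjoint_kfun:
  assumes a: "adj_mop K m m'" and f: "f \<in> kspace K" and m: "mop m f \<in> kspace K"
  shows "kip K (mop m f) (kfun K w) = kip K f (mop m' (kfun K w))"
proof -
  have "mop m' (K i) \<in> kspace K" for i using a kfun_in by (metis adj_mop_def)
  moreover have "mop m f i = kip K f (mop m' (K i))" for i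
    using row_reproducing[OF f, of "m i"] a by (simp add: mop_def adj_mop_def)
  ultimately show ?thesis using adjoint_kfun[of f "mop m f" "mop m'" w] f m mop_linear by metis
qed

lemma lip_mapply: assumes a: "adj_mop K m m'" shows "lip K (mapply m' v) w = lip K v (mapply m w)"
  using mop_adjoint_kfun[OF a kfun_in, of v w] kfun_mapply[OF a] kfun_mapply[OF adj_mop_sym[OF a]] kip_kfun
  by (metis kfun_in)

text \<open>If the products of the adjoint \<open>m' \<alpha>\<close> with \<open>m \<alpha>\<close>
  sum to the identity, the squared norms of the images of \<open>v\<close> under the operators
  \<open>m \<alpha>\<close> add up to that of \<open>v\<close>, so each is a contraction. All
  operators on word spaces get their bound 1 in this way.\<close>

lemma mop_contraction:
  assumes a: "!!\<alpha>. \<alpha> \<in> A ==> adj_mop K (m \<alpha>) (m' \<alpha>)" and A: "finite A" "\<alpha> \<in> A"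
    and s: "!!v. (%i. \<Sum>\<alpha>\<in>A. mop (m' \<alpha>) (mop (m \<alpha>) (kfun K v)) i) = kfun K v"
  shows "vn (mapply (m' \<alpha>) v) <= vn v"
proof -
  have "lip K v u = (\<Sum>\<alpha>\<in>A. lip K (mapply (m' \<alpha>) v) (mapply (m' \<alpha>) u))" for u
  proof -
    have e: "(\<Sum>\<alpha>\<in>A. kfun K (mapply (m \<alpha>) (mapply (m' \<alpha>) v)) i) = kfun K v i" for i
    proof -
      have "(\<Sum>\<alpha>\<in>A. kfun K (mapply (m \<alpha>) (mapply (m' \<alpha>) v)) i) = (\<Sum>\<alpha>\<in>A. mop (m' \<alpha>) (mop (m \<alpha>) (kfun K v)) i)"
        using kfun_mapply[OF a] kfun_mapply[OF adj_mop_sym[OF a]] by (intro sum.cong) auto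
      then show ?thesis using fun_cong[OF s[of v], of i] by simp
    qed
    have "(\<Sum>\<alpha>\<in>A. lip K (mapply (m' \<alpha>) v) (mapply (m' \<alpha>) u)) = (\<Sum>\<alpha>\<in>A. lip K (mapply (m \<alpha>) (mapply (m' \<alpha>) v)) u)"
      using lip_mapply[OF adj_mop_sym[OF a]] by simp
    also have "\<dots> = (\<Sum>(b, i)\<leftarrow>u. cnj b * (\<Sum>\<alpha>\<in>A. kfun K (mapply (m \<alpha>) (mapply (m' \<alpha>) v)) i))"
      by (induct u) (auto simp: sum.distrib sum_distrib_left)
    finally show ?thesis by (simp add: lip_def e)
  qed
  from arg_cong[where f = Re, OF this[of v]] have "(vn v)\<^sup>2 = (\<Sum>\<alpha>\<in>A. (vn (mapply (m' \<alpha>) v))\<^sup>2)" by (simp add: vn_sq)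
  moreover have "(vn (mapply (m' \<alpha>) v))\<^sup>2 <= (\<Sum>\<alpha>\<in>A. (vn (mapply (m' \<alpha>) v))\<^sup>2)"
    by (rule member_le_sum) (use A in auto)
  ultimately have "(vn (mapply (m' \<alpha>) v))\<^sup>2 <= (vn v)\<^sup>2" by simp
  then show ?thesis by (rule power2_le_imp_le) (rule vn_nonneg)
qed

lemma mop_bounded:
  assumes a: "adj_mop K m m'" and c: "!!v. vn (mapply m' v) <= vn v" and f: "f \<in> kspace K"
  shows "mop m f \<in> kspace K" "nrm (kip K) (mop m f) <= nrm (kip K) f"
proof -
  have "mop m f \<in> kspace K & nrm (kip K) (mop m f) <= 1 * nrm (kip K) f"
  proof (rule operator_extension)
    show "EX v'. kfun K v' = mop m (kfun K v) & vn v' <= 1 * vn v" for v using kfun_mapply[OF a] c by auto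
  qed (auto simp: mop_diff f intro: mop_continuous)
  then show "mop m f \<in> kspace K" "nrm (kip K) (mop m f) <= nrm (kip K) f" by auto
qed

lemma mop_adjoint:
  assumes a: "adj_mop K m m'" and c: "!!v. vn (mapply m' v) <= vn v" and c': "!!v. vn (mapply m v) <= vn v"
    and f: "f \<in> kspace K" and g: "g \<in> kspace K"
  shows "kip K (mop m f) g = kip K f (mop m' g)"
proof (rule adjoint_extension[of _ _ 1])
  show "mop m f \<in> kspace K" if "f \<in> kspace K" for f by (rule mop_bounded(1)[OF a c that])
  show "mop m' f \<in> kspace K & nrm (kip K) (mop m' f) <= 1 * nrm (kip K) f" if "f \<in> kspace K" for f
    using mop_bounded[OF adj_mop_sym[OF a] c' that] by simp
  show "mop m f i = kip K f (mop m' (K i))" if "f \<in> kspace K" for f i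
    using row_reproducing[OF that, of "m i"] a by (simp add: mop_def adj_mop_def)
qed (simp_all add: mop_linear f g)

end

section \<open>Traces on words\<close>

type_synonym 'x letter = "'x \<times> 'x \<times> 'x \<times> 'x"

text \<open>The letter of the adjoint generator: the adjoint of p_{x,x',a,a'} is
  p_{x',x,a',a}.\<close>

definition gstar :: "'x letter => 'x letter" where
  "gstar = (%(x, x', a, a'). (x', x, a', a))"

definition wstar :: "'x letter list => 'x letter list" where
  "wstar w = rev (map gstar w)"

lemma gstar_simp [simp]: "gstar (x, x', a, a') = (x', x, a', a)" by (simp add: gstar_def)
lemma gstar_gstar [simp]: "gstar (gstar g) = g" by (cases g) simp
lemma wstar_simps [simp]: "wstar [] = []" "wstar (g # w) = wstar w @ [gstar g]" "wstar (u @ v) = wstar v @ wstar u"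
  by (auto simp: wstar_def)
lemma wstar_wstar [simp]: "wstar (wstar w) = w" by (induct w) auto

definition wkernel :: "('x letter list => complex) => 'x letter list => 'x letter list => complex" where
  "wkernel t w w' = t (wstar w' @ w)"

text \<open>The Gelfand-Naimark-Segal space of \<open>t\<close>, repeated once for each element of
  \<open>'k\<close>. One copy suffices for left and right multiplications; the unitary matrix of the
  Brown algebra uses copies indexed by \<open>'x\<close>.\<close>

definition ckernel :: "('x letter list => complex) => 'k \<times> 'x letter list => 'k \<times> 'x letter list => complex" where
  "ckernel t = (%(c, w) (d, w'). if c = d then wkernel t w w' else 0)"

lemma ckernel_simp [simp]: "ckernel t (c, w) (d, w') = (if c = d then t (wstar w' @ w) else 0)"
  by (simp add: ckernel_def wkernel_def)

text \<open>The values on words in the generators \<open>p\<^bsub>x,x',a,a'\<^esub>\<close> of a trace of \<open>\<C>\<^bsub>X\<^esub>\<close>. The last two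
  assumptions say that the matrix \<open>(u\<^bsub>a,x\<^esub>)\<close> is an isometry and that it is a coisometry.\<close>

locale word_trace =
  fixes t :: "'x::finite letter list => complex"
  assumes t_one: "t [] = 1"
    and t_pos: "lip (wkernel t) r r \<in> \<real>\<^sub>\<ge>\<^sub>0"
    and t_cyclic: "t (u @ v) = t (v @ u)"
    and t_isometry: "(\<Sum>a\<in>UNIV. t (u @ (x, x', a, a) # v)) = (if x = x' then t (u @ v) else 0)"
    and t_coisometry: "(\<Sum>x\<in>UNIV. t (u @ (y, x, b, c) # (x, y', a, b') # v)) = (if c = a then t (u @ (y, y', b, b') # v) else 0)"

definition component :: "(complex \<times> 'k \<times> 'w) list => 'k => (complex \<times> 'w) list" where
  "component v c = map (%(a, d, w). (a, w)) (filter (%(a, d, w). d = c) v)"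

lemma component_simps [simp]: "component [] c = []"
  "component ((a, d, w) # v) c = (if d = c then (a, w) # component v c else component v c)"
  by (auto simp: component_def)

definition ulist :: "'a::finite list" where
  "ulist = (SOME xs. set xs = UNIV & distinct xs)"

lemma ulist: "set (ulist :: 'a::finite list) = UNIV" "distinct (ulist :: 'a list)"
  using someI_ex[OF finite_distinct_list[of "UNIV :: 'a set"]] unfolding ulist_def by auto

lemma sum_UNIV_pair: "(\<Sum>\<alpha>\<in>UNIV. h \<alpha>) = (\<Sum>x\<in>UNIV. \<Sum>y\<in>UNIV. h (x, y))"
  by (simp add: sum.cartesian_product)

lemma sum_ulist: "(\<Sum>x\<leftarrow>ulist. f x) = (\<Sum>x\<in>UNIV. f x)"
  by (simp add: sum_list_distinct_conv_sum_set ulist)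

text \<open>Functions are evaluated by pairing with words, so left multiplication by
  \<open>g\<close> reads a value at the word with \<open>gstar g\<close> in front. Right
  multiplication is similar, and \<open>rowM\<close> gives the matrix units between the
  copies.\<close>

definition rowL :: "'x letter => 'k \<times> 'x letter list => (complex \<times> 'k \<times> 'x letter list) list" where
  "rowL g = (%(c, w). [(1, c, gstar g # w)])"
definition rowR :: "'x letter => 'k \<times> 'x letter list => (complex \<times> 'k \<times> 'x letter list) list" where
  "rowR g = (%(c, w). [(1, c, w @ [gstar g])])"
definition rowM :: "'k => 'k => 'k \<times> 'x letter list => (complex \<times> 'k \<times> 'x letter list) list" where
  "rowM c d = (%(k, w). if k = c then [(1, d, w)] else [])"
text \<open>A single u is not a word. Let W be the unitary matrix with entries u_{c,y}. Then W*
  u_{a,x} has the entries u_{c,y}* u_{a,x} = p_{y,x,c,a}, and replacing every u_{a,x} by W* u_{a,x}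
  leaves each product u_{a,x}* u_{a',x'} unchanged. \<open>rowU a x\<close> is this matrix of
  letters, and \<open>rowV a x\<close> is its adjoint.\<close>

definition rowU :: "'x::finite => 'x => 'x \<times> 'x letter list => (complex \<times> 'x \<times> 'x letter list) list" where
  "rowU a x = (%(y, w). map (%c. (1, c, (x, y, a, c) # w)) ulist)"
definition rowV :: "'x::finite => 'x => 'x \<times> 'x letter list => (complex \<times> 'x \<times> 'x letter list) list" where
  "rowV a x = (%(c, w). map (%y. (1, y, (y, x, c, a) # w)) ulist)"

lemma mop_rows [simp]:
  "mop (rowL g) f (c, w) = f (c, gstar g # w)"
  "mop (rowR g) f (c, w) = f (c, w @ [gstar g])"
  "mop (rowM k d) f (c, w) = (if c = k then f (d, w) else 0)"
  "mop (rowU a x) h (y, v) = (\<Sum>c\<in>UNIV. h (c, (x, y, a, c) # v))"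
  "mop (rowV a x) h (y, v) = (\<Sum>z\<in>UNIV. h (z, (z, x, y, a) # v))"
  by (auto simp: mop_def rowL_def rowR_def rowM_def rowU_def rowV_def o_def sum_ulist)

text \<open>The antiunitary that sends a word to its adjoint. Cyclicity of \<open>t\<close> makes it
  preserve \<open>kspace\<close>, and it exchanges left and right multiplication.\<close>

definition flip :: "('k \<times> 'x letter list => complex) => 'k \<times> 'x letter list => complex" where
  "flip f = (%(c, w). cnj (f (c, wstar w)))"

definition lflip :: "(complex \<times> 'k \<times> 'x letter list) list => (complex \<times> 'k \<times> 'x letter list) list" where
  "lflip v = map (%(a, c, w). (cnj a, c, wstar w)) v"

lemma flip_simp [simp]: "flip f (c, w) = cnj (f (c, wstar w))" by (simp add: flip_def)

context word_trace
begin

lemma component_kfun: "kfun (ckernel t) v (c, w) = kfun (wkernel t) (component v c) w"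
  by (induct v) (auto simp: wkernel_def)

lemma component_lip: "lip (ckernel t) v u = (\<Sum>c\<in>UNIV. lip (wkernel t) (component v c) (component u (c :: 'k::finite)))"
proof (induct u)
  case (Cons p u)
  obtain b d w where p: "p = (b, d, w)" by (cases p) auto
  have "(\<Sum>c\<in>UNIV. lip (wkernel t) (component v c) (component (p # u) c)) =
      (\<Sum>c\<in>UNIV. (if d = c then cnj b * kfun (wkernel t) (component v c) w else 0) + lip (wkernel t) (component v c) (component u c))"
    by (rule sum.cong) (auto simp: p)
  also have "\<dots> = cnj b * kfun (ckernel t) v (d, w) + lip (ckernel t) v u"
    by (simp add: sum.distrib Cons component_kfun)
  finally show ?case by (simp add: p)
qed simp

lemma ckernel_pd: "pd_kernel (ckernel t :: 'k::finite \<times> 'x letter list => _)"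
proof
  fix v :: "(complex \<times> 'k \<times> 'x letter list) list"
  have "lip (wkernel t) u u \<in> \<real>\<^sub>\<ge>\<^sub>0" for u by (rule t_pos)
  then show "lip (ckernel t) v v \<in> \<real>\<^sub>\<ge>\<^sub>0"
    unfolding component_lip by (auto simp: complex_nonneg_Reals_iff intro!: sum_nonneg)
qed

end

locale word_space = word_trace t for t :: "'x::finite letter list => complex" +
  fixes ktype :: "'k::finite itself"
begin

abbreviation K :: "'k \<times> 'x letter list => 'k \<times> 'x letter list => complex" where "K \<equiv> ckernel t"

sublocale pd_kernel K by (rule ckernel_pd)

lemma kfun_relations:
  "(\<Sum>a\<in>UNIV. kfun K v (c, u @ (x, x', a, a) # w)) = (if x = x' then kfun K v (c, u @ w) else 0)"
  "(\<Sum>x\<in>UNIV. kfun K v (c, u @ (y, x, b, d) # (x, y', a, b') # w)) = (if d = a then kfun K v (c, u @ (y, y', b, b') # w) else 0)"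
proof -
  have 1: "(\<Sum>a\<in>UNIV. K (d, w0) (c, u @ (x, x', a, a) # w)) = (if x = x' then K (d, w0) (c, u @ w) else 0)" for d w0
    using t_isometry[of "wstar w" x' x "wstar u @ w0"] by auto
  have 2: "(\<Sum>x\<in>UNIV. K (k, w0) (c, u @ (y, x, b, d) # (x, y', a, b') # w)) = (if d = a then K (k, w0) (c, u @ (y, y', b, b') # w) else 0)" for k w0
    using t_coisometry[of "wstar w" y' b' a y d b "wstar u @ w0"] by auto
  show "(\<Sum>a\<in>UNIV. kfun K v (c, u @ (x, x', a, a) # w)) = (if x = x' then kfun K v (c, u @ w) else 0)"
  proof (induct v)
    case (Cons p v)
    then show ?case using 1 by (cases p) (simp add: sum.distrib sum_distrib_left[symmetric] del: ckernel_simp)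
  qed simp
  show "(\<Sum>x\<in>UNIV. kfun K v (c, u @ (y, x, b, d) # (x, y', a, b') # w)) = (if d = a then kfun K v (c, u @ (y, y', b, b') # w) else 0)"
  proof (induct v)
    case (Cons p v)
    then show ?case using 2 by (cases p) (simp add: sum.distrib sum_distrib_left[symmetric] del: ckernel_simp)
  qed simp
qed

lemma kspace_relations:
  assumes f: "f \<in> kspace K"
  shows "(\<Sum>a\<in>UNIV. f (c, u @ (x, x', a, a) # w)) = (if x = x' then f (c, u @ w) else 0)"
    "(\<Sum>x\<in>UNIV. f (c, u @ (y, x, b, d) # (x, y', a, b') # w)) = (if d = a then f (c, u @ (y, y', b, b') # w) else 0)"
proof -
  obtain sg where "approximates K sg f" using f by (auto simp: kspace_def)
  then have l: "(%n. kfun K (sg n) i) \<longlonglongrightarrow> f i" for i unfolding approximates_def by blast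
  have "(%n. \<Sum>a\<in>UNIV. kfun K (sg n) (c, u @ (x, x', a, a) # w)) \<longlonglongrightarrow> (\<Sum>a\<in>UNIV. f (c, u @ (x, x', a, a) # w))"
    by (intro tendsto_sum l)
  moreover have "(%n. if x = x' then kfun K (sg n) (c, u @ w) else 0) \<longlonglongrightarrow> (if x = x' then f (c, u @ w) else 0)"
    using l by (cases "x = x'") auto
  ultimately show "(\<Sum>a\<in>UNIV. f (c, u @ (x, x', a, a) # w)) = (if x = x' then f (c, u @ w) else 0)"
    unfolding kfun_relations by (rule LIMSEQ_unique)
  have "(%n. \<Sum>x\<in>UNIV. kfun K (sg n) (c, u @ (y, x, b, d) # (x, y', a, b') # w)) \<longlonglongrightarrow> (\<Sum>x\<in>UNIV. f (c, u @ (y, x, b, d) # (x, y', a, b') # w))"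
    by (intro tendsto_sum l)
  moreover have "(%n. if d = a then kfun K (sg n) (c, u @ (y, y', b, b') # w) else 0) \<longlonglongrightarrow> (if d = a then f (c, u @ (y, y', b, b') # w) else 0)"
    using l by (cases "d = a") auto
  ultimately show "(\<Sum>x\<in>UNIV. f (c, u @ (y, x, b, d) # (x, y', a, b') # w)) = (if d = a then f (c, u @ (y, y', b, b') # w) else 0)"
    unfolding kfun_relations by (rule LIMSEQ_unique)
qed

lemmas kspace_relations_front = kspace_relations[where u = "[]", unfolded append_Nil]

lemma adj_rows:
  "adj_mop K (rowL g) (rowL (gstar g))" "adj_mop K (rowR g) (rowR (gstar g))" "adj_mop K (rowM c d) (rowM d c)"
proof -
  show "adj_mop K (rowL g) (rowL (gstar g))" by (auto simp: adj_mop_def fun_eq_iff rowL_def[of g] lcnj_def)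
  show "adj_mop K (rowR g) (rowR (gstar g))"
    using t_cyclic[of "[gstar g]"] by (auto simp: adj_mop_def fun_eq_iff rowR_def[of g] lcnj_def)
  show "adj_mop K (rowM c d) (rowM d c)" by (auto simp: adj_mop_def fun_eq_iff rowM_def[of c d] lcnj_def)
qed

text \<open>Each letter is put into a family to which \<open>mop_contraction\<close> applies:
  summing p_{y,x,a',b'} p_{x,y,b',a'} over x gives p_{y,y,a',a'} by the coisometry relation, and
  summing that over a' gives 1 by the isometry relation.\<close>

lemma contractions: "vn (mapply (rowL g) v) <= vn v" "vn (mapply (rowR g) v) <= vn v" "vn (mapply (rowM c d) v) <= vn v"
proof -
  obtain y y' b b' where g: "g = (y, y', b, b')" by (cases g)
  show "vn (mapply (rowL g) v) <= vn v"
    unfolding g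
  proof (rule mop_contraction[where A = UNIV and m = "%(x, a'). rowL (x, y, b', a')" and m' = "%(x, a'). rowL (y, x, a', b')" and \<alpha> = "(y', b)", simplified])
    show "adj_mop K (case \<alpha> of (x, a') => rowL (x, y, b', a')) (case \<alpha> of (x, a') => rowL (y, x, a', b'))" for \<alpha>
      using adj_rows(1) by (cases \<alpha>) (metis case_prod_conv gstar_simp)
    show "(%i. \<Sum>\<alpha>\<in>UNIV. mop (case \<alpha> of (x, a') => rowL (y, x, a', b')) (mop (case \<alpha> of (x, a') => rowL (x, y, b', a')) (kfun K u)) i) = kfun K u" for u
    proof
      fix i :: "'k \<times> 'x letter list" obtain k w where i: "i = (k, w)" by force
      have "(\<Sum>\<alpha>\<in>UNIV. mop (case \<alpha> of (x, a') => rowL (y, x, a', b')) (mop (case \<alpha> of (x, a') => rowL (x, y, b', a')) (kfun K u)) i)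
        = (\<Sum>x\<in>UNIV. \<Sum>a'\<in>UNIV. kfun K u (k, (y, x, a', b') # (x, y, b', a') # w))"
        by (simp add: i sum_UNIV_pair)
      also have "\<dots> = (\<Sum>a'\<in>UNIV. \<Sum>x\<in>UNIV. kfun K u (k, (y, x, a', b') # (x, y, b', a') # w))" by (rule sum.swap)
      also have "\<dots> = kfun K u i" by (simp add: kspace_relations_front kfun_in i)
      finally show "(\<Sum>\<alpha>\<in>UNIV. mop (case \<alpha> of (x, a') => rowL (y, x, a', b')) (mop (case \<alpha> of (x, a') => rowL (x, y, b', a')) (kfun K u)) i) = kfun K u i" .
    qed
  qed
  show "vn (mapply (rowR g) v) <= vn v"
    unfolding g
  proof (rule mop_contraction[where A = UNIV and m = "%(x, a'). rowR (y', x, a', b)" and m' = "%(x, a'). rowR (x, y', b, a')" and \<alpha> = "(y, b')", simplified])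
    show "adj_mop K (case \<alpha> of (x, a') => rowR (y', x, a', b)) (case \<alpha> of (x, a') => rowR (x, y', b, a'))" for \<alpha>
      using adj_rows(2) by (cases \<alpha>) (metis case_prod_conv gstar_simp)
    show "(%i. \<Sum>\<alpha>\<in>UNIV. mop (case \<alpha> of (x, a') => rowR (x, y', b, a')) (mop (case \<alpha> of (x, a') => rowR (y', x, a', b)) (kfun K u)) i) = kfun K u" for u
    proof
      fix i :: "'k \<times> 'x letter list" obtain k w where i: "i = (k, w)" by force
      have "(\<Sum>\<alpha>\<in>UNIV. mop (case \<alpha> of (x, a') => rowR (x, y', b, a')) (mop (case \<alpha> of (x, a') => rowR (y', x, a', b)) (kfun K u)) i)
        = (\<Sum>x\<in>UNIV. \<Sum>a'\<in>UNIV. kfun K u (k, w @ (y', x, a', b) # (x, y', b, a') # []))"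
        by (simp add: i sum_UNIV_pair)
      also have "\<dots> = (\<Sum>a'\<in>UNIV. \<Sum>x\<in>UNIV. kfun K u (k, w @ (y', x, a', b) # (x, y', b, a') # []))" by (rule sum.swap)
      also have "\<dots> = kfun K u i" by (simp only: kspace_relations[OF kfun_in] i) (simp add: kspace_relations[OF kfun_in])
      finally show "(\<Sum>\<alpha>\<in>UNIV. mop (case \<alpha> of (x, a') => rowR (x, y', b, a')) (mop (case \<alpha> of (x, a') => rowR (y', x, a', b)) (kfun K u)) i) = kfun K u i" .
    qed
  qed
  show "vn (mapply (rowM c d) v) <= vn v"
  proof (rule mop_contraction[where A = UNIV and m = "%\<alpha>. rowM d \<alpha>" and m' = "%\<alpha>. rowM \<alpha> d" and \<alpha> = c, simplified])
    show "adj_mop K (rowM d \<alpha>) (rowM \<alpha> d)" for \<alpha> by (rule adj_rows)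
    show "(%i. \<Sum>\<alpha>\<in>UNIV. mop (rowM \<alpha> d) (mop (rowM d \<alpha>) (kfun K u)) i) = kfun K u" for u
      by (rule ext) (auto simp: split_paired_all)
  qed
qed

lemma ops_in: "f \<in> kspace K ==> mop (rowL g) f \<in> kspace K" "f \<in> kspace K ==> mop (rowR g) f \<in> kspace K"
  "f \<in> kspace K ==> mop (rowM c d) f \<in> kspace K"
proof -
  assume f: "f \<in> kspace K"
  show "mop (rowL g) f \<in> kspace K" "mop (rowR g) f \<in> kspace K" "mop (rowM c d) f \<in> kspace K"
    using mop_bounded(1)[OF adj_rows(1) contractions(1) f, of g] mop_bounded(1)[OF adj_rows(2) contractions(2) f, of g]
      mop_bounded(1)[OF adj_rows(3) contractions(3) f, of c d] by auto
qed

lemma ops_bound: "f \<in> kspace K ==> nrm (kip K) (mop (rowL g) f) <= nrm (kip K) f"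
  "f \<in> kspace K ==> nrm (kip K) (mop (rowR g) f) <= nrm (kip K) f"
  "f \<in> kspace K ==> nrm (kip K) (mop (rowM c d) f) <= nrm (kip K) f"
proof -
  assume f: "f \<in> kspace K"
  show "nrm (kip K) (mop (rowL g) f) <= nrm (kip K) f" "nrm (kip K) (mop (rowR g) f) <= nrm (kip K) f"
    "nrm (kip K) (mop (rowM c d) f) <= nrm (kip K) f"
    using mop_bounded(2)[OF adj_rows(1) contractions(1) f, of g] mop_bounded(2)[OF adj_rows(2) contractions(2) f, of g]
      mop_bounded(2)[OF adj_rows(3) contractions(3) f, of c d] by auto
qed

lemma ops_adj:
  assumes "f \<in> kspace K" "h \<in> kspace K"
  shows "kip K (mop (rowL g) f) h = kip K f (mop (rowL (gstar g)) h)"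
    "kip K (mop (rowR g) f) h = kip K f (mop (rowR (gstar g)) h)"
    "kip K (mop (rowM c d) f) h = kip K f (mop (rowM d c) h)"
  using mop_adjoint[OF adj_rows(1) contractions(1) contractions(1) assms, of g]
    mop_adjoint[OF adj_rows(2) contractions(2) contractions(2) assms, of g]
    mop_adjoint[OF adj_rows(3) contractions(3) contractions(3) assms, of c d] by auto

lemma flip_kfun: "kfun K (lflip v) = flip (kfun K v)"
proof -
  have "K (c, wstar w) (d, w') = cnj (K (c, w) (d, wstar w'))" for c d w w'
    using K_herm[of "(c, w)" "(d, wstar w')"] t_cyclic[of "wstar w" "wstar w'"] by auto
  then have "kfun K (lflip v) (d, w') = flip (kfun K v) (d, w')" for d w'
    by (induct v) (auto simp: lflip_def simp del: ckernel_simp)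
  then show ?thesis by (auto simp: fun_eq_iff)
qed

lemma lip_lflip: "lip K (lflip v) (lflip u) = cnj (lip K v u)"
  by (induct u) (auto simp: lflip_def[of "_ # _"] flip_kfun lflip_def[of "[]"] simp flip: lflip_def)

lemma approximates_flip: assumes "approximates K sg f" shows "approximates K (%n. lflip (sg n)) (flip f)"
proof -
  have "vn (ldiff (lflip v) (lflip u)) = vn (ldiff v u)" for v u
  proof -
    have "vn (ldiff (lflip v) (lflip u)) = vn (lflip (ldiff v u))"
      by (rule vn_cong) (auto simp: fun_eq_iff flip_kfun)
    then show ?thesis by (simp add: nrm_def lip_lflip)
  qed
  moreover have "(%n. kfun K (lflip (sg n)) (c, w)) \<longlonglongrightarrow> flip f (c, w)" for c w
    unfolding flip_kfun flip_simp using assms by (intro tendsto_intros) (simp add: approximates_def)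
  ultimately show ?thesis using assms by (auto simp: approximates_def)
qed

lemma flip_in: "f \<in> kspace K ==> flip f \<in> kspace K"
  using approximates_flip by (auto simp: kspace_def)

lemma kip_flip: assumes "f \<in> kspace K" "g \<in> kspace K" shows "kip K (flip f) (flip g) = cnj (kip K f g)"
proof -
  obtain sg \<rho> where a: "approximates K sg f" "approximates K \<rho> g" using assms by (auto simp: kspace_def)
  have "(%n. cnj (lip K (sg n) (\<rho> n))) \<longlonglongrightarrow> kip K (flip f) (flip g)"
    using kip_lim[OF approximates_flip[OF a(1)] approximates_flip[OF a(2)]] by (simp add: lip_lflip)
  moreover have "(%n. cnj (lip K (sg n) (\<rho> n))) \<longlonglongrightarrow> cnj (kip K f g)" by (intro tendsto_intros kip_lim a)
  ultimately show ?thesis by (rule LIMSEQ_unique)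
qed

end

section \<open>The unitary matrix on copies of the word space indexed by X\<close>

locale brown_space = word_space t "TYPE('x)" for t :: "'x::finite letter list => complex"
begin

lemma adj_UV: "adj_mop K (rowU a x) (rowV a x)"
  unfolding adj_mop_def fun_eq_iff
proof (intro allI)
  fix i j :: "'x \<times> 'x letter list"
  obtain y w z w' where ij: "i = (y, w)" "j = (z, w')" by force
  have "kfun K (lcnj (rowU a x i)) j = (\<Sum>c\<leftarrow>ulist. K (c, (x, y, a, c) # w) j)"
    by (simp add: ij rowU_def lcnj_def kfun_def o_def del: ckernel_simp)
  then show "kfun K (lcnj (rowU a x i)) j = mop (rowV a x) (K i) j" by (simp add: ij sum_ulist)
qed

lemma mop_VU: assumes f: "f \<in> kspace K" shows "mop (rowV a x) (mop (rowU a' x') f) = mop (rowL (x, x', a, a')) f"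
proof -
  have "mop (rowV a x) (mop (rowU a' x') f) (c, w) = mop (rowL (x, x', a, a')) f (c, w)" for c w
  proof -
    have "mop (rowV a x) (mop (rowU a' x') f) (c, w) = (\<Sum>z\<in>UNIV. \<Sum>y\<in>UNIV. f (z, (x', y, a', z) # (y, x, c, a) # w))"
      by (simp, rule sum.swap)
    \<comment> \<open>The coisometry relation for the sum over y leaves only the copy
      \<open>z = c\<close>, so the product acts on each copy separately.\<close>
    then show ?thesis by (simp add: kspace_relations_front[OF f] if_distrib cong: if_cong)
  qed
  then show ?thesis by (auto simp: fun_eq_iff)
qed

lemma sum_VU: assumes f: "f \<in> kspace K" shows "(\<Sum>a\<in>UNIV. mop (rowV a x) (mop (rowU a x') f) i) = (if x = x' then f i else 0)"
  unfolding mop_VU[OF f] by (cases i) (simp add: kspace_relations_front[OF f])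

lemma sum_UV: assumes f: "f \<in> kspace K" shows "(\<Sum>x\<in>UNIV. mop (rowU a x) (mop (rowV a' x) f) i) = (if a = a' then f i else 0)"
proof -
  obtain y w where i: "i = (y, w)" by force
  have "(\<Sum>x\<in>UNIV. mop (rowU a x) (mop (rowV a' x) f) i) = (\<Sum>x\<in>UNIV. \<Sum>c\<in>UNIV. \<Sum>z\<in>UNIV. f (z, (z, x, c, a') # (x, y, a, c) # w))"
    by (simp add: i)
  also have "\<dots> = (\<Sum>c\<in>UNIV. \<Sum>x\<in>UNIV. \<Sum>z\<in>UNIV. f (z, (z, x, c, a') # (x, y, a, c) # w))" by (rule sum.swap)
  also have "\<dots> = (\<Sum>c\<in>UNIV. \<Sum>z\<in>UNIV. \<Sum>x\<in>UNIV. f (z, (z, x, c, a') # (x, y, a, c) # w))" by (intro sum.cong sum.swap refl)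
  also have "\<dots> = (\<Sum>c\<in>UNIV. \<Sum>z\<in>UNIV. if a' = a then f (z, (z, y, c, c) # w) else 0)"
    by (simp add: kspace_relations_front[OF f] eq_commute[of a a'])
  also have "\<dots> = (\<Sum>z\<in>UNIV. \<Sum>c\<in>UNIV. if a' = a then f (z, (z, y, c, c) # w) else 0)" by (rule sum.swap)
  also have "\<dots> = (if a = a' then f i else 0)" by (simp add: kspace_relations_front[OF f] i)
  finally show ?thesis .
qed

lemma contractions_UV: "vn (mapply (rowV a x) v) <= vn v" "vn (mapply (rowU a x) v) <= vn v"
proof -
  show "vn (mapply (rowV a x) v) <= vn v"
    by (rule mop_contraction[where A = UNIV and m = "%a. rowU a x" and m' = "%a. rowV a x"])
      (auto simp: adj_UV sum_VU kfun_in)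
  show "vn (mapply (rowU a x) v) <= vn v"
    by (rule mop_contraction[where A = UNIV and m = "%x. rowV a x" and m' = "%x. rowU a x"])
      (auto simp: adj_mop_sym[OF adj_UV] sum_UV kfun_in)
qed

lemma UV_in: "f \<in> kspace K ==> mop (rowU a x) f \<in> kspace K" "f \<in> kspace K ==> mop (rowV a x) f \<in> kspace K"
  using mop_bounded(1)[OF adj_UV contractions_UV(1)] mop_bounded(1)[OF adj_mop_sym[OF adj_UV] contractions_UV(2)] by auto

lemma UV_bound: "f \<in> kspace K ==> nrm (kip K) (mop (rowU a x) f) <= nrm (kip K) f"
  using mop_bounded(2)[OF adj_UV contractions_UV(1)] by auto

lemma UV_adj: "f \<in> kspace K ==> g \<in> kspace K ==> kip K (mop (rowU a x) f) g = kip K f (mop (rowV a x) g)"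
  by (rule mop_adjoint[OF adj_UV contractions_UV])

end

section \<open>From word traces to Hilbert spaces\<close>

lemma countable_letter_lists: "countable (UNIV :: ('k::finite \<times> 'x::finite letter list) set)"
proof -
  have "countable (lists (UNIV :: 'x letter set))" by (rule countable_lists) simp
  then have "countable (UNIV :: 'x letter list set)" by (simp add: lists_UNIV)
  then have "countable ((UNIV :: 'k set) \<times> (UNIV :: 'x letter list set))" by (intro countable_SIGMA) auto
  then show ?thesis by simp
qed

text \<open>A surjective enumeration of the index set is enough: restricting a function along it
  loses nothing.\<close>

lemma exists_coding:
  fixes emb :: "(nat => complex) => 'h"
  assumes "inj emb" "countable (UNIV :: 'i set)"
  obtains e :: "('i => complex) => 'h" where "inj e"
proof
  have r: "range (from_nat_into (UNIV :: 'i set)) = UNIV" using assms(2) by (intro range_from_nat_into) auto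
  show "inj (%f :: 'i => complex. emb (%n. f (from_nat_into UNIV n)))"
  proof (rule injI)
    fix f g :: "'i => complex"
    assume "emb (%n. f (from_nat_into UNIV n)) = emb (%n. g (from_nat_into UNIV n))"
    then have "(%n. f (from_nat_into UNIV n)) = (%n. g (from_nat_into UNIV n))" using assms(1) by (simp add: inj_eq)
    then have "f i = g i" if "i \<in> range (from_nat_into (UNIV :: 'i set))" for i using that by (auto dest: fun_cong)
    then show "f = g" using r by auto
  qed
qed

lemma (in hilbert_space) finsum_op_algebra:
  assumes Z: "self_adjoint_set H Z" and "finite A" "!!a. a \<in> A ==> f a \<in> commutant H Z"
  shows "finsum (op_algebra H Z) f A = (\<lambda>x\<in>carrier H. finsum H (%a. f a x) A)"
  using assms(2,3)
proof (induct A rule: finite_induct)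
  case empty
  interpret A: abelian_group "op_algebra H Z" by (rule op_cnormed(2)[OF Z])
  show ?case by simp
next
  case (insert b A)
  interpret A: abelian_group "op_algebra H Z" by (rule op_cnormed(2)[OF Z])
  have "(%a. f a x) \<in> insert b A \<rightarrow> carrier H" if "x \<in> carrier H" for x
    using that insert commutantD(2) by blast
  then show ?case using insert by (simp add: A.finsum_insert M.finsum_insert Pi_iff cong: restrict_cong)
qed

lemma (in fun_hilbert) finsum_fun_hspace:
  assumes e: "inj e" and "finite A" "!!a. a \<in> A ==> g a \<in> F"
  shows "finsum (fun_hspace e F ip) (%a. e (g a)) A = e (%i. \<Sum>a\<in>A. g a i) & (%i. \<Sum>a\<in>A. g a i) \<in> F"
  using assms(2,3)
proof (induct A rule: finite_induct)
  case empty
  interpret hilbert_space "fun_hspace e F ip" by (rule hilbert[OF e])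
  show ?case using F_zero by simp
next
  case (insert b A)
  interpret hilbert_space "fun_hspace e F ip" by (rule hilbert[OF e])
  have "finsum (fun_hspace e F ip) (%a. e (g a)) (insert b A) = e (g b) \<oplus>\<^bsub>fun_hspace e F ip\<^esub> finsum (fun_hspace e F ip) (%a. e (g a)) A"
    using insert by (intro M.finsum_insert) auto
  then show ?case using insert F_add[of "g b" "%i. \<Sum>a\<in>A. g a i"] e by simp
qed

text \<open>Positivity comes from a factorisation of the block matrix into a sum over
  \<open>z\<close> of the adjoint of \<open>Y z\<close> times \<open>Y z\<close>, stated by inner
  products so that no adjoint of \<open>Y z\<close> has to be supplied.\<close>

lemma (in hilbert_space) stochastic_operator_matrixI:
  fixes E :: "'x::finite => 'x => 'y::finite => 'y => 'a => 'a" and Y :: "'z::finite => 'x => 'y => 'a => 'a"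
  assumes adj: "!!x x' a a'. EX S. adj_pair H (E x x' a a') S" and bnd: "!!x x' a a'. EX C. op_bound H (E x x' a a') C"
    and Y: "!!z x a h. h \<in> carrier H ==> Y z x a h \<in> carrier H"
    and pos: "!!x x' a a' h k. h \<in> carrier H ==> k \<in> carrier H
        ==> iprod H (E x x' a a' h) k = (\<Sum>z\<in>UNIV. iprod H (Y z x' a' h) (Y z x a k))"
    and one: "!!x x' h. h \<in> carrier H ==> (\<Oplus>\<^bsub>H\<^esub>a\<in>UNIV. E x x' a a h) = (if x = x' then h else \<zero>)"
  shows "stochastic_operator_matrix H E"
  unfolding stochastic_operator_matrix_def
proof (intro conjI allI impI ballI)
  show "bounded_operator H (E x x' a a')" for x x' a a'
    using adj[of x x' a a'] bnd[of x x' a a'] unfolding bounded_operator_def op_bound_def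
    by (auto simp: adj_pair_add adj_pair_smult adj_pair_closed)
  show "(\<Oplus>\<^bsub>H\<^esub>a\<in>UNIV. E x x' a a h) = (if x = x' then h else \<zero>)" if "h \<in> carrier H" for x x' h using one that .
  fix v :: "'x => 'y => 'a" assume v: "ALL x a. v x a \<in> carrier H"
  define s where "s z = (\<Oplus>\<^bsub>H\<^esub>p\<in>UNIV. Y z (fst p) (snd p) (v (fst p) (snd p)))" for z
  have cl: "(%p. Y z (fst p) (snd p) (v (fst p) (snd p))) \<in> UNIV \<rightarrow> carrier H" for z using v Y by auto
  have sc: "s z \<in> carrier H" for z unfolding s_def using cl by (rule M.finsum_closed)
  have "iprod H (s z) (s z) = (\<Sum>x\<in>UNIV. \<Sum>a\<in>UNIV. \<Sum>x'\<in>UNIV. \<Sum>a'\<in>UNIV. iprod H (Y z x' a' (v x' a')) (Y z x a (v x a)))" for z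
  proof -
    have "iprod H (s z) (s z) = (\<Sum>p\<in>UNIV. \<Sum>q\<in>UNIV. iprod H (Y z (fst q) (snd q) (v (fst q) (snd q))) (Y z (fst p) (snd p) (v (fst p) (snd p))))"
      using cl sc v Y unfolding s_def by (simp add: ip_finsum_left ip_finsum_right)
    then show ?thesis by (simp add: sum_UNIV_pair)
  qed
  then have "(\<Sum>x\<in>UNIV. \<Sum>a\<in>UNIV. \<Sum>x'\<in>UNIV. \<Sum>a'\<in>UNIV. iprod H (E x x' a a' (v x' a')) (v x a)) = (\<Sum>z\<in>UNIV. iprod H (s z) (s z))"
    using v by (simp add: pos sum.swap[of _ "UNIV :: 'z set"])
  moreover have "iprod H (s z) (s z) \<in> \<real>\<^sub>\<ge>\<^sub>0" for z using sc by (rule iprod_nonneg)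
  ultimately show "(\<Sum>x\<in>UNIV. \<Sum>a\<in>UNIV. \<Sum>x'\<in>UNIV. \<Sum>a'\<in>UNIV. iprod H (E x x' a a' (v x' a')) (v x a)) \<in> \<real>\<^sub>\<ge>\<^sub>0"
    by (auto simp: complex_nonneg_Reals_iff intro!: sum_nonneg)
qed

locale coded_space = word_space t "TYPE('k)" for t :: "'x::finite letter list => complex" and ktype :: "'k::finite itself" +
  fixes e :: "('k \<times> 'x letter list => complex) => 'h"
  assumes inj_e: "inj e"
begin

abbreviation "H \<equiv> fun_hspace e (kspace K) (kip K)"
abbreviation "Op m \<equiv> fun_op e (kspace K) (mop m)"
abbreviation "c0 \<equiv> undefined :: 'k"
abbreviation "\<eta> \<equiv> e (K (c0, []))"

sublocale H: hilbert_space H by (rule hilbert[OF inj_e])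

lemma dec_e [simp]: "dec e (e f) = f" by (rule inv_f_f[OF inj_e])

lemma Op_e [simp]: "f \<in> kspace K ==> Op m (e f) = e (mop m f)" by (simp add: inj_e)

lemma carrier_H: "h \<in> carrier H ==> \<exists>f\<in>kspace K. h = e f" by auto

lemma adj_Op:
  "adj_pair H (Op (rowL g)) (Op (rowL (gstar g)))" "adj_pair H (Op (rowR g)) (Op (rowR (gstar g)))"
  "adj_pair H (Op (rowM c d)) (Op (rowM d c))"
  by (rule adj_pair_fun_op[OF inj_e]; simp add: ops_in ops_adj)+

lemma bound_Op: "op_bound H (Op (rowL g)) 1" "op_bound H (Op (rowR g)) 1" "op_bound H (Op (rowM c d)) 1"
  by (rule op_bound_fun_op[OF inj_e]; simp add: ops_bound)+

lemma rows_commute: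
  "mop (rowL g) (mop (rowR g') f) = mop (rowR g') (mop (rowL g) f)"
  "mop (rowL g) (mop (rowM c d) f) = mop (rowM c d) (mop (rowL g) f)"
  by (auto simp: fun_eq_iff)

lemma row_kernel:
  "mop (rowL g) (K (c, w)) = K (c, g # w)"
  "mop (rowR g) (K (c, w)) = K (c, w @ [g])"
  "mop (rowM d d') (K (c, w)) = (if c = d' then K (d, w) else (%_. 0))"
  using t_cyclic[of "[g]"] by (auto simp: fun_eq_iff)

text \<open>The coisometry relation is itself the factorisation: for any fixed \<open>c\<close>,
  p_{x,x',a,a'} is the sum over z of p_{x,z,a,c} p_{z,x',c,a'}, that is, of p_{z,x,c,a}*
  p_{z,x',c,a'}.\<close>

lemma stochastic_rows:
  assumes adj: "!!g. adj_pair H (Op (m g)) (Op (m (gstar g)))" and bnd: "!!g. op_bound H (Op (m g)) 1"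
    and m: "!!f g. f \<in> kspace K ==> mop (m g) f \<in> kspace K"
    and rel: "!!f x x' i. f \<in> kspace K ==> (\<Sum>a\<in>UNIV. mop (m (x, x', a, a)) f i) = (if x = x' then f i else 0)"
      "!!f x x' a a' i. f \<in> kspace K
        ==> (\<Sum>z\<in>UNIV. mop (m (x, z, a, c)) (mop (m (z, x', c, a')) f) i) = mop (m (x, x', a, a')) f i"
  shows "stochastic_operator_matrix H (%x x' a a'. Op (m (x, x', a, a')))"
proof (rule H.stochastic_operator_matrixI[where Y = "%z x a. Op (m (z, x, c, a))"])
  show "EX S. adj_pair H (Op (m (x, x', a, a'))) S" "EX C. op_bound H (Op (m (x, x', a, a'))) C" for x x' a a'
    using adj bnd by blast+
  show "Op (m (z, x, c, a)) h \<in> carrier H" if "h \<in> carrier H" for z x a h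
    using that by (rule H.adj_pair_closed(1)[OF adj])
  show "iprod H (Op (m (x, x', a, a')) h) k = (\<Sum>z\<in>UNIV. iprod H (Op (m (z, x', c, a')) h) (Op (m (z, x, c, a)) k))"
    if hk: "h \<in> carrier H" "k \<in> carrier H" for x x' a a' h k
  proof -
    obtain f where f: "f \<in> kspace K" "h = e f" using hk carrier_H by blast
    have "(\<Sum>z\<in>UNIV. iprod H (Op (m (z, x', c, a')) h) (Op (m (z, x, c, a)) k)) =
        (\<Sum>z\<in>UNIV. iprod H (Op (m (x, z, a, c)) (Op (m (z, x', c, a')) h)) k)"
      using hk H.adj_pair_iprod[OF adj[of "(_, _, _, _)"]] H.adj_pair_closed(1)[OF adj] by simp
    also have "\<dots> = iprod H (\<Oplus>\<^bsub>H\<^esub>z\<in>UNIV. Op (m (x, z, a, c)) (Op (m (z, x', c, a')) h)) k"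
      using hk H.adj_pair_closed(1)[OF adj] by (intro H.ip_finsum_left[symmetric]) auto
    also have "(\<Oplus>\<^bsub>H\<^esub>z\<in>UNIV. Op (m (x, z, a, c)) (Op (m (z, x', c, a')) h)) = Op (m (x, x', a, a')) h"
      using finsum_fun_hspace[OF inj_e, of UNIV "%z. mop (m (x, z, a, c)) (mop (m (z, x', c, a')) f)"] f m
      by (simp add: rel(2))
    finally show ?thesis by simp
  qed
  show "(\<Oplus>\<^bsub>H\<^esub>a\<in>UNIV. Op (m (x, x', a, a)) h) = (if x = x' then h else \<zero>\<^bsub>H\<^esub>)" if h: "h \<in> carrier H" for x x' h
  proof -
    obtain f where f: "f \<in> kspace K" "h = e f" using h carrier_H by blast
    show ?thesis
      using finsum_fun_hspace[OF inj_e, of UNIV "%a. mop (m (x, x', a, a)) f"] f m by (simp add: rel(1))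
  qed
qed

text \<open>The second party acts by right multiplication with the letter (y', y, b', b), so both
  operators together turn \<open>\<eta>\<close> into the vector of the two-letter word in the trace
  formula.\<close>

lemma quantum_commuting_data:
  defines "E \<equiv> %x x' a a'. Op (rowL (x, x', a, a'))" and "G \<equiv> %y y' b b'. Op (rowR (y', y, b', b))"
  shows "stochastic_operator_matrix H E" "stochastic_operator_matrix H G"
    "h \<in> carrier H ==> E x x' a a' (G y y' b b' h) = G y y' b b' (E x x' a a' h)"
    "\<eta> \<in> carrier H" "hnorm H \<eta> = 1"
    "iprod H (E x x' a a' (G y y' b b' \<eta>)) \<eta> = t [(x, x', a, a'), (y', y, b', b)]"
proof -
  show "stochastic_operator_matrix H E" unfolding E_def
  proof (rule stochastic_rows[where m = rowL])
    fix f x x' a a' i assume f: "f \<in> kspace K"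
    show "(\<Sum>a\<in>UNIV. mop (rowL (x, x', a, a)) f i) = (if x = x' then f i else 0)"
      using kspace_relations_front(1)[OF f] by (cases i) auto
    show "(\<Sum>z\<in>UNIV. mop (rowL (x, z, a, undefined)) (mop (rowL (z, x', undefined, a')) f) i) = mop (rowL (x, x', a, a')) f i"
      using kspace_relations_front(2)[OF f] by (cases i) auto
  qed (use adj_Op bound_Op ops_in in auto)
  \<comment> \<open>Right multiplication reverses products; composing with \<open>gstar\<close>
    restores the order that the factorisation requires.\<close>
  have "stochastic_operator_matrix H (%x x' a a'. Op ((rowR \<circ> gstar) (x, x', a, a')))"
  proof (rule stochastic_rows)
    fix f x x' a a' i assume f: "f \<in> kspace K"
    show "(\<Sum>a\<in>UNIV. mop ((rowR \<circ> gstar) (x, x', a, a)) f i) = (if x = x' then f i else 0)"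
      using kspace_relations(1)[OF f, where w = "[]"] by (cases i) auto
    show "(\<Sum>z\<in>UNIV. mop ((rowR \<circ> gstar) (x, z, a, undefined)) (mop ((rowR \<circ> gstar) (z, x', undefined, a')) f) i) = mop ((rowR \<circ> gstar) (x, x', a, a')) f i"
      using kspace_relations(2)[OF f, where w = "[]"] by (cases i) auto
  next
    show "adj_pair H (Op ((rowR \<circ> gstar) g)) (Op ((rowR \<circ> gstar) (gstar g)))" for g
      using adj_Op(2)[of "gstar g"] by (simp only: o_apply)
  qed (use bound_Op ops_in in auto)
  then show "stochastic_operator_matrix H G" unfolding G_def by simp
  show "E x x' a a' (G y y' b b' h) = G y y' b b' (E x x' a a' h)" if "h \<in> carrier H"
    using carrier_H[OF that] ops_in by (auto simp: E_def G_def rows_commute)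
  show "\<eta> \<in> carrier H" by simp
  have "kip K (K (c0, [])) (K (c0, [])) = 1" by (simp add: reproducing t_one)
  then show "hnorm H \<eta> = 1" by (simp add: nrm_def)
  show "iprod H (E x x' a a' (G y y' b b' \<eta>)) \<eta> = t [(x, x', a, a'), (y', y, b', b)]"
    using ops_in by (simp add: E_def G_def row_kernel reproducing)
qed

section \<open>The commutant of the right multiplications\<close>

text \<open>The matrix units between the copies belong to the set, so that operators in its
  commutant act in the same way on every copy.\<close>

definition "RM = {Op (rowR g) |g. True} \<union> {Op (rowM c d) |c d. True}"

abbreviation "D \<equiv> op_algebra H RM"

lemma RM_I: "Op (rowR g) \<in> RM" "Op (rowM c d) \<in> RM"
  unfolding RM_def by blast+

lemma RM_self_adjoint: "self_adjoint_set H RM"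
  unfolding self_adjoint_set_def
proof
  fix Q assume "Q \<in> RM"
  then consider g where "Q = Op (rowR g)" | c d where "Q = Op (rowM c d)" by (auto simp: RM_def)
  then show "\<exists>Q'\<in>RM. adj_pair H Q Q'"
  proof cases
    case 1
    then show ?thesis using adj_Op(2)[of g] RM_I(1)[of "gstar g"] by blast
  next
    case 2
    then show ?thesis using adj_Op(3)[of c d] RM_I(2)[of d c] by blast
  qed
qed

lemma nontrivial: "\<exists>x\<in>carrier H. x ~= \<zero>\<^bsub>H\<^esub>"
proof
  show "\<eta> ~= \<zero>\<^bsub>H\<^esub>"
  proof
    assume "\<eta> = \<zero>\<^bsub>H\<^esub>"
    then have "K (c0, []) = (%_. 0)" using inj_e by (simp add: inj_eq)
    then show False using t_one by (metis append_Nil ckernel_simp wstar_simps(1) zero_neq_one)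
  qed
qed simp

lemma cstar_D: "cstar_algebra D" by (rule H.cstar_op_algebra[OF RM_self_adjoint nontrivial])

definition vec :: "('h => 'h) => 'k \<times> 'x letter list => complex" where
  "vec T = dec e (T \<eta>)"

lemma vec: assumes "T \<in> commutant H RM" shows "vec T \<in> kspace K" "T \<eta> = e (vec T)"
proof -
  have "T \<eta> \<in> carrier H" using H.commutantD(2)[OF assms] by simp
  then show "vec T \<in> kspace K" "T \<eta> = e (vec T)" by (auto simp: vec_def)
qed

text \<open>Every vector \<open>K (c, w)\<close> arises from the one of the empty word by right
  multiplications and a matrix unit. An operator that commutes with these is therefore determined on
  all of them by its value at \<open>\<eta>\<close>.\<close>

lemma commutant_kernel: assumes T: "T \<in> commutant H RM"
  shows "T (e (K (c, w))) = e (%(d, v). if d = c then vec T (c0, v @ wstar w) else 0)"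
    "(%(d, v). if d = c then vec T (c0, v @ wstar w) else 0) \<in> kspace K"
proof -
  have "T (e (K (c, w))) = e (%(d, v). if d = c then vec T (c0, v @ wstar w) else 0)
    & (%(d, v). if d = c then vec T (c0, v @ wstar w) else 0) \<in> kspace K"
  proof (induct w rule: rev_induct)
    case Nil
    have "e (K (c, [])) = Op (rowM c c0) \<eta>" by (simp add: row_kernel)
    then have "T (e (K (c, []))) = Op (rowM c c0) (T \<eta>)"
      using H.commutantD(6)[OF T RM_I(2), of \<eta> c c0] by simp
    also have "\<dots> = e (mop (rowM c c0) (vec T))" using vec[OF T] by simp
    finally have 1: "T (e (K (c, []))) = e (mop (rowM c c0) (vec T))" .
    have 2: "mop (rowM c c0) (vec T) = (%(d, v). if d = c then vec T (c0, v @ wstar []) else 0)" by (auto simp: fun_eq_iff)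
    show ?case using 1 ops_in(3)[OF vec(1)[OF T], of c c0] unfolding 2 by blast
  next
    case (snoc g w)
    let ?f = "%(d, v). if d = c then vec T (c0, v @ wstar w) else 0"
    have "e (K (c, w @ [g])) = Op (rowR g) (e (K (c, w)))" by (simp add: row_kernel)
    then have "T (e (K (c, w @ [g]))) = Op (rowR g) (T (e (K (c, w))))"
      using H.commutantD(6)[OF T RM_I(1), of "e (K (c, w))" g] by simp
    also have "\<dots> = e (mop (rowR g) ?f)" using snoc by simp
    finally have 1: "T (e (K (c, w @ [g]))) = e (mop (rowR g) ?f)" .
    have 2: "mop (rowR g) ?f \<in> kspace K" using snoc ops_in(2) by blast
    have 3: "mop (rowR g) ?f = (%(d, v). if d = c then vec T (c0, v @ wstar (w @ [g])) else 0)" by (auto simp: fun_eq_iff)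
    show ?case using 1 2 unfolding 3 by blast
  qed
  then show "T (e (K (c, w))) = e (%(d, v). if d = c then vec T (c0, v @ wstar w) else 0)"
    "(%(d, v). if d = c then vec T (c0, v @ wstar w) else 0) \<in> kspace K" by auto
qed

lemma vec_off: assumes T: "T \<in> commutant H RM" "d ~= c0" shows "vec T (d, v) = 0"
proof -
  have "e (vec T) = e (%(d, v). if d = c0 then vec T (c0, v @ wstar []) else 0)"
    using commutant_kernel(1)[OF T(1), of c0 "[]"] vec[OF T(1)] by simp
  then have "vec T = (%(d, v). if d = c0 then vec T (c0, v @ wstar []) else 0)" using inj_e by (simp add: inj_eq)
  from fun_cong[OF this, of "(d, v)"] show ?thesis using assms(2) by simp
qed

text \<open>The modular conjugation of the trace is \<open>flip\<close>, so that \<open>T\<^sup>* \<eta> = J T \<eta>\<close>.\<close>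

lemma vec_hadjoint: assumes T: "T \<in> commutant H RM" shows "vec (hadjoint H T) = flip (vec T)"
proof -
  let ?T' = "hadjoint H T"
  have T': "?T' \<in> commutant H RM" by (rule H.hadjoint_commutant[OF T RM_self_adjoint])
  have "vec ?T' (c, w) = flip (vec T) (c, w)" for c w
  proof -
    have "vec ?T' (c, w) = iprod H (?T' \<eta>) (e (K (c, w)))" using vec[OF T'] by (simp add: reproducing)
    also have "\<dots> = iprod H \<eta> (T (e (K (c, w))))"
      by (rule H.adj_pair_iprod[OF H.adj_pair_sym[OF H.hadjoint_pair[OF T]]]) auto
    also have "\<dots> = cnj (iprod H (T (e (K (c, w)))) \<eta>)"
      using H.ip_cnj[of "T (e (K (c, w)))" \<eta>] H.commutantD(2)[OF T] by simp
    also have "iprod H (T (e (K (c, w)))) \<eta> = (if c0 = c then vec T (c0, wstar w) else 0)"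
      using commutant_kernel[OF T, of c w] by (simp add: reproducing)
    finally show ?thesis using vec_off[OF T, of c] by auto
  qed
  then show ?thesis by (auto simp: fun_eq_iff)
qed

definition tau0 :: "('h => 'h) => complex" where "tau0 T = iprod H (T \<eta>) \<eta>"

lemma tau0_product: assumes S: "S \<in> commutant H RM" and T: "T \<in> commutant H RM"
  shows "tau0 (\<lambda>x\<in>carrier H. S (T x)) = kip K (vec T) (flip (vec S))"
proof -
  have "tau0 (\<lambda>x\<in>carrier H. S (T x)) = iprod H (S (T \<eta>)) \<eta>" by (simp add: tau0_def)
  also have "\<dots> = iprod H (T \<eta>) (hadjoint H S \<eta>)"
    by (rule H.adj_pair_iprod[OF H.hadjoint_pair[OF S]]) (use H.commutantD(2)[OF T] in auto)
  also have "\<dots> = kip K (vec T) (vec (hadjoint H S))"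
    using vec[OF T] vec[OF H.hadjoint_commutant[OF S RM_self_adjoint]] by simp
  finally show ?thesis by (simp add: vec_hadjoint[OF S])
qed

lemma flip_flip [simp]: "flip (flip f) = f" by (auto simp: fun_eq_iff)

text \<open>By \<open>tau0_product\<close> the value on a product is
  \<open>kip K (vec T) (flip (vec S))\<close>, which is symmetric in \<open>S\<close> and
  \<open>T\<close> because \<open>flip\<close> is an antiunitary involution.\<close>

lemma tau0_commute: assumes S: "S \<in> commutant H RM" and T: "T \<in> commutant H RM"
  shows "tau0 (\<lambda>x\<in>carrier H. S (T x)) = tau0 (\<lambda>x\<in>carrier H. T (S x))"
proof -
  note vS = vec(1)[OF S] and vT = vec(1)[OF T]
  have "kip K (vec T) (flip (vec S)) = cnj (kip K (flip (vec T)) (vec S))"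
    using kip_flip[OF flip_in[OF vT] vS] by simp
  also have "\<dots> = kip K (vec S) (flip (vec T))" using kip_cnj[OF flip_in[OF vT] vS] by simp
  finally show ?thesis unfolding tau0_product[OF S T] tau0_product[OF T S] .
qed

lemma tracial_tau0: "tracial_state D tau0"
  unfolding tracial_state_def op_algebra_simps
proof (intro conjI ballI allI)
  fix S T assume S: "S \<in> commutant H RM" and T: "T \<in> commutant H RM"
  show "tau0 (\<lambda>x\<in>carrier H. S (T x)) = tau0 (\<lambda>x\<in>carrier H. T (S x))" by (rule tau0_commute[OF S T])
  show "tau0 (\<lambda>x\<in>carrier H. S x \<oplus>\<^bsub>H\<^esub> T x) = tau0 S + tau0 T"
    using H.iprod_add[OF H.commutantD(2)[OF S] H.commutantD(2)[OF T], of \<eta> \<eta> \<eta>] unfolding tau0_def by (simp del: fun_hspace_simps(3,5))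
next
  fix T assume T: "T \<in> commutant H RM"
  show "tau0 (\<lambda>x\<in>carrier H. c \<odot>\<^bsub>H\<^esub> T x) = c * tau0 T" for c
    using H.iprod_smult[OF H.commutantD(2)[OF T], of \<eta> \<eta>] unfolding tau0_def by (simp del: fun_hspace_simps(4,5))
  have "tau0 (\<lambda>x\<in>carrier H. hadjoint H T (T x)) = kip K (vec T) (vec T)"
    using tau0_product[OF H.hadjoint_commutant[OF T RM_self_adjoint] T] by (simp add: vec_hadjoint[OF T])
  then show "tau0 (\<lambda>x\<in>carrier H. hadjoint H T (T x)) \<in> \<real>\<^sub>\<ge>\<^sub>0" using kip_nonneg[OF vec(1)[OF T]] by simp
next
  show "tau0 (\<lambda>x\<in>carrier H. x) = 1" unfolding tau0_def by (simp add: reproducing t_one)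
qed

text \<open>The vector \<open>\<eta>\<close> separates the commutant. The vanishing of
  \<open>vec T\<close> passes to the adjoint by \<open>vec_hadjoint\<close>, so the adjoint kills
  every \<open>K i\<close>; the values of \<open>T x\<close> are inner products of \<open>x\<close>
  with these images.\<close>

lemma commutant_zero: assumes T: "T \<in> commutant H RM" and z: "!!w. vec T (c0, w) = 0"
  shows "T = (\<lambda>x\<in>carrier H. \<zero>\<^bsub>H\<^esub>)"
proof -
  let ?T' = "hadjoint H T"
  have T': "?T' \<in> commutant H RM" by (rule H.hadjoint_commutant[OF T RM_self_adjoint])
  have "vec ?T' (c0, w) = 0" for w using z by (simp add: vec_hadjoint[OF T])
  then have 0: "?T' (e (K (c, w))) = \<zero>\<^bsub>H\<^esub>" for c w
    using commutant_kernel(1)[OF T', of c w] by (simp add: case_prod_unfold cong: if_cong)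
  have "T x = \<zero>\<^bsub>H\<^esub>" if x: "x \<in> carrier H" for x
  proof -
    have Tx: "T x \<in> carrier H" using H.commutantD(2)[OF T x] .
    then obtain f where f: "f \<in> kspace K" "T x = e f" using carrier_H by blast
    have "f i = 0" for i
    proof -
      obtain c w where i: "i = (c, w)" by force
      have "f i = iprod H (T x) (e (K i))" using f by (simp add: reproducing)
      also have "\<dots> = iprod H x (?T' (e (K i)))" by (rule H.adj_pair_iprod[OF H.hadjoint_pair[OF T] x]) simp
      also have "\<dots> = 0" unfolding i 0 using x by (rule H.ip_zero_right)
      finally show ?thesis .
    qed
    then have "f = (%_. 0)" by (rule ext)
    then show ?thesis using f by simp
  qed
  then show ?thesis using H.commutantD(1)[OF T] by (intro extensionalityI[of _ "carrier H"]) auto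
qed

lemma L_commutant: "Op (rowL g) \<in> commutant H RM"
proof (rule H.commutantI[OF _ bound_Op(1) adj_Op(1)])
  show "Op (rowL g) \<in> extensional (carrier H)" by (simp add: fun_op_def)
  fix Q x assume "Q \<in> RM" and x: "x \<in> carrier H"
  then consider g' where "Q = Op (rowR g')" | c d where "Q = Op (rowM c d)" by (auto simp: RM_def)
  then show "Op (rowL g) (Q x) = Q (Op (rowL g) x)"
    using carrier_H[OF x] by cases (auto simp: rows_commute ops_in)
qed

text \<open>When letters may be moved freely, left and right multiplication by a letter agree, so
  left multiplications by words are central in the commutant. A product is determined by its traces
  against words, and for central \<open>X\<close> the trace of \<open>X S T\<close> equals that of
  \<open>X T S\<close>.\<close>

lemma commutant_abelian:
  assumes comm: "!!u g v. t (u @ g # v) = t (g # u @ v)"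
    and S: "S \<in> commutant H RM" and T: "T \<in> commutant H RM"
  shows "S \<otimes>\<^bsub>D\<^esub> T = T \<otimes>\<^bsub>D\<^esub> S"
proof -
  interpret D: cstar_algebra D by (rule cstar_D)
  have fR: "mop (rowL g) f = mop (rowR g) f" if f: "f \<in> kspace K" for f g
  proof -
    have 1: "K (d, w0) (c, gstar g # w) = K (d, w0) (c, w @ [gstar g])" for c d w w0
      using comm[of "wstar w" g w0] by auto
    have "f (c, gstar g # w) = f (c, w @ [gstar g])" for c w
    proof -
      have "K (c, gstar g # w) j = K (c, w @ [gstar g]) j" for j
        using 1[of "fst j" "snd j" c w] K_herm[of "(c, gstar g # w)" j] K_herm[of "(c, w @ [gstar g])" j]
        by (metis prod.collapse)
      then have "K (c, gstar g # w) = K (c, w @ [gstar g])" by auto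
      then show ?thesis using reproducing[OF f] by metis
    qed
    then show ?thesis by (auto simp: fun_eq_iff)
  qed
  have LT: "Q (Op (rowL g) x) = Op (rowL g) (Q x)" if Q: "Q \<in> commutant H RM" and x: "x \<in> carrier H" for Q g x
  proof -
    have eq: "Op (rowL g) y = Op (rowR g) y" if "y \<in> carrier H" for y using carrier_H[OF that] by (auto simp: fR)
    show ?thesis unfolding eq[OF x] eq[OF H.commutantD(2)[OF Q x]]
      by (rule H.commutantD(6)[OF Q RM_I(1) x])
  qed
  have X: "\<exists>X\<in>commutant H RM. X \<eta> = e (K (c0, w)) & (\<forall>Q\<in>commutant H RM. \<forall>x\<in>carrier H. Q (X x) = X (Q x))" for w
  proof (induct w)
    case Nil
    show ?case by (rule bexI[OF _ H.commutant_ops(4)[OF RM_self_adjoint]]) (auto simp: H.commutantD(2)[simplified])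
  next
    case (Cons g w)
    then obtain X where X: "X \<in> commutant H RM" "X \<eta> = e (K (c0, w))"
      "!!Q x. Q \<in> commutant H RM ==> x \<in> carrier H ==> Q (X x) = X (Q x)" by blast
    show ?case
    proof (rule bexI[OF _ H.commutant_ops(1)[OF RM_self_adjoint L_commutant X(1)]], intro conjI ballI)
      show "(\<lambda>x\<in>carrier H. Op (rowL g) (X x)) \<eta> = e (K (c0, g # w))" by (simp add: X row_kernel)
      fix Q x assume Q: "Q \<in> commutant H RM" and x: "x \<in> carrier H"
      show "Q ((\<lambda>x\<in>carrier H. Op (rowL g) (X x)) x) = (\<lambda>x\<in>carrier H. Op (rowL g) (X x)) (Q x)"
        using x H.commutantD(2)[OF Q x] LT[OF Q H.commutantD(2)[OF X(1) x]] X(3)[OF Q x] by simp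
    qed
  qed
  have key: "vec (S \<otimes>\<^bsub>D\<^esub> T) (c0, w) = vec (T \<otimes>\<^bsub>D\<^esub> S) (c0, w)" for w
  proof -
    obtain X where X: "X \<in> commutant H RM" "X \<eta> = e (K (c0, w))"
      "!!Q x. Q \<in> commutant H RM ==> x \<in> carrier H ==> Q (X x) = X (Q x)" using X by blast
    let ?X = "hadjoint H X"
    have X': "?X \<in> commutant H RM" by (rule H.hadjoint_commutant[OF X(1) RM_self_adjoint])
    have v: "vec Q (c0, w) = tau0 (?X \<otimes>\<^bsub>D\<^esub> Q)" if Q: "Q \<in> commutant H RM" for Q
    proof -
      have "vec Q (c0, w) = iprod H (Q \<eta>) (X \<eta>)" using vec[OF Q] X by (simp add: reproducing)
      also have "\<dots> = iprod H (?X (Q \<eta>)) \<eta>"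
        by (rule H.adj_pair_iprod[OF H.adj_pair_sym[OF H.hadjoint_pair[OF X(1)]], symmetric]) (use H.commutantD(2)[OF Q] in auto)
      finally show ?thesis by (simp add: tau0_def)
    qed
    \<comment> \<open>Centrality passes to the adjoint of \<open>X\<close>, since the commutant is
      closed under adjoints.\<close>
    have cX: "Q \<otimes>\<^bsub>D\<^esub> ?X = ?X \<otimes>\<^bsub>D\<^esub> Q" if Q: "Q \<in> commutant H RM" for Q
    proof -
      let ?Q = "hadjoint H Q"
      have Q': "?Q \<in> commutant H RM" by (rule H.hadjoint_commutant[OF Q RM_self_adjoint])
      have "?Q \<otimes>\<^bsub>D\<^esub> X = X \<otimes>\<^bsub>D\<^esub> ?Q" using X(3)[OF Q'] by (auto intro!: restrict_ext)
      then have "star D (?Q \<otimes>\<^bsub>D\<^esub> X) = star D (X \<otimes>\<^bsub>D\<^esub> ?Q)" by simp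
      then have "star D X \<otimes>\<^bsub>D\<^esub> star D ?Q = star D ?Q \<otimes>\<^bsub>D\<^esub> star D X"
        using D.star_mult[of ?Q X] D.star_mult[of X ?Q] Q' X(1) by simp
      then show ?thesis using H.hadjoint_hadjoint[OF Q] by (simp only: op_algebra_simps)
    qed
    have c: "S \<in> carrier D" "T \<in> carrier D" "?X \<in> carrier D" using S T X' by auto
    have "tau0 (?X \<otimes>\<^bsub>D\<^esub> (S \<otimes>\<^bsub>D\<^esub> T)) = tau0 ((?X \<otimes>\<^bsub>D\<^esub> S) \<otimes>\<^bsub>D\<^esub> T)" using D.m_assoc[OF c(3,1,2)] by simp
    also have "\<dots> = tau0 (T \<otimes>\<^bsub>D\<^esub> (?X \<otimes>\<^bsub>D\<^esub> S))"
      using tracial_tau0 c D.m_closed[OF c(3,1)] unfolding tracial_state_def by blast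
    also have "T \<otimes>\<^bsub>D\<^esub> (?X \<otimes>\<^bsub>D\<^esub> S) = ?X \<otimes>\<^bsub>D\<^esub> (T \<otimes>\<^bsub>D\<^esub> S)"
      using D.m_assoc[OF c(2,3,1)] D.m_assoc[OF c(3,2,1)] cX[OF T] by metis
    finally show ?thesis
      using v D.m_closed[OF c(1,2)] D.m_closed[OF c(2,1)] by (metis op_algebra_simps(1))
  qed
  define Q where "Q = (S \<otimes>\<^bsub>D\<^esub> T) \<ominus>\<^bsub>D\<^esub> (T \<otimes>\<^bsub>D\<^esub> S)"
  have c: "S \<otimes>\<^bsub>D\<^esub> T \<in> carrier D" "T \<otimes>\<^bsub>D\<^esub> S \<in> carrier D" using S T D.m_closed by auto
  have QD: "Q \<in> commutant H RM" using D.minus_closed'[OF c] by (simp add: Q_def)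
  have "vec Q (c0, w) = 0" for w
  proof -
    have "Q \<eta> = (S \<otimes>\<^bsub>D\<^esub> T) \<eta> \<oplus>\<^bsub>H\<^esub> (-1) \<odot>\<^bsub>H\<^esub> (T \<otimes>\<^bsub>D\<^esub> S) \<eta>"
      unfolding Q_def D.minus_csm[OF c] op_algebra_simps(5,6) by simp
    also have "\<dots> = e (%i. vec (S \<otimes>\<^bsub>D\<^esub> T) i - vec (T \<otimes>\<^bsub>D\<^esub> S) i)"
      using vec(2)[of "S \<otimes>\<^bsub>D\<^esub> T"] vec(2)[of "T \<otimes>\<^bsub>D\<^esub> S"] c by (simp del: op_algebra_simps(2))
    finally have "vec Q = (%i. vec (S \<otimes>\<^bsub>D\<^esub> T) i - vec (T \<otimes>\<^bsub>D\<^esub> S) i)" by (simp only: vec_def[of Q] dec_e)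
    then have "vec Q (c0, w) = vec (S \<otimes>\<^bsub>D\<^esub> T) (c0, w) - vec (T \<otimes>\<^bsub>D\<^esub> S) (c0, w)" by (rule fun_cong)
    then show ?thesis by (simp only: key diff_self)
  qed
  then have "Q = \<zero>\<^bsub>D\<^esub>" using commutant_zero[OF QD] by (simp only: op_algebra_simps)
  then have "Q \<oplus>\<^bsub>D\<^esub> (T \<otimes>\<^bsub>D\<^esub> S) = T \<otimes>\<^bsub>D\<^esub> S" using D.l_zero[OF c(2)] by (simp only:)
  moreover have "Q \<oplus>\<^bsub>D\<^esub> (T \<otimes>\<^bsub>D\<^esub> S) = S \<otimes>\<^bsub>D\<^esub> T" using D.add_minus_self[OF c] by (simp only: Q_def)
  ultimately show ?thesis by (simp only:)
qed

end

section \<open>Finite rank of a trace and finite dimension of the commutant\<close>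

lemma (in cmodule) finite_dimensional_separated:
  assumes "finite S"
    and add: "!!s x y. x \<in> carrier V ==> y \<in> carrier V ==> ell s (x \<oplus> y) = ell s x + ell s y"
    and sm: "!!s c x. x \<in> carrier V ==> ell s (c \<odot> x) = c * (ell s x :: complex)"
    and sep: "!!x. x \<in> carrier V ==> (!!s. s \<in> S ==> ell s x = 0) ==> x = \<zero>"
  shows "finite_dimensional V"
proof -
  have "EX B. finite B & B \<subseteq> W & (\<forall>x\<in>W. EX c. x = (\<Oplus>s\<in>B. c s \<odot> s))"
    if "W \<subseteq> carrier V" "!!x y. x \<in> W ==> y \<in> W ==> x \<oplus> y \<in> W" "!!c x. x \<in> W ==> c \<odot> x \<in> W"
      "!!x. x \<in> W ==> (!!s. s \<in> S ==> ell s x = 0) ==> x = \<zero>" for W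
    using \<open>finite S\<close> that
  proof (induct S arbitrary: W rule: finite_induct)
    case empty
    then show ?case by (intro exI[of _ "{}"]) auto
  next
    case (insert s S)
    define W' where "W' = {x \<in> W. ell s x = 0}"
    have "EX B. finite B & B \<subseteq> W' & (\<forall>x\<in>W'. EX c. x = (\<Oplus>s\<in>B. c s \<odot> s))"
    proof (rule insert(3))
      show "x = \<zero>" if "x \<in> W'" "!!s. s \<in> S ==> ell s x = 0" for x
        by (rule insert(7)) (use that in \<open>auto simp: W'_def\<close>)
    qed (use insert(4-6) in \<open>auto simp: W'_def add sm subset_iff\<close>)
    then obtain B where B: "finite B" "B \<subseteq> W'" "!!x. x \<in> W' ==> EX c. x = (\<Oplus>s\<in>B. c s \<odot> s)" by blast
    show ?case
    proof (cases "W' = W")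
      case True
      then show ?thesis using B by blast
    next
      case False
      then obtain w where w: "w \<in> W" "ell s w ~= 0" by (auto simp: W'_def)
      have wB: "w \<notin> B" using B w by (auto simp: W'_def)
      have cB: "B \<subseteq> carrier V" "w \<in> carrier V" using B insert(4) w by (auto simp: W'_def)
      have "EX c. x = (\<Oplus>s\<in>insert w B. c s \<odot> s)" if x: "x \<in> W" for x
      proof -
        \<comment> \<open>Subtracting \<open>a w\<close> moves \<open>x\<close> into the kernel
          \<open>W'\<close> of the functional \<open>ell s\<close>, where the basis from the
          induction is available.\<close>
        define a where "a = ell s x / ell s w"
        have xc: "x \<in> carrier V" using x insert(4) by auto
        have "x \<ominus> a \<odot> w \<in> W" using x w insert(5,6) xc cB by (simp add: minus_csm)
        moreover have "ell s (x \<ominus> a \<odot> w) = 0" using xc cB w by (simp add: minus_csm add sm a_def)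
        ultimately obtain c where c: "x \<ominus> a \<odot> w = (\<Oplus>s\<in>B. c s \<odot> s)" using B(3) by (auto simp: W'_def)
        have "(\<Oplus>s\<in>insert w B. (c(w := a)) s \<odot> s) = a \<odot> w \<oplus> (\<Oplus>s\<in>B. (c(w := a)) s \<odot> s)"
          using B(1) wB cB by (subst M.finsum_insert) (auto simp: Pi_iff subset_iff)
        also have "(\<Oplus>s\<in>B. (c(w := a)) s \<odot> s) = (\<Oplus>s\<in>B. c s \<odot> s)"
          using wB cB by (intro M.finsum_cong') auto
        also have "a \<odot> w \<oplus> \<dots> = x" unfolding c[symmetric] using xc cB add_minus_self[of x "a \<odot> w"] by (simp add: M.a_comm)
        finally show ?thesis by metis
      qed
      then show ?thesis using B w cB by (intro exI[of _ "insert w B"]) (auto simp: W'_def)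
    qed
  qed
  from this[of "carrier V"] show ?thesis using sep unfolding finite_dimensional_def by auto
qed

text \<open>The matrix with entries \<open>t (wstar v @ w)\<close> has finite rank, expressed by
  finitely many of its own columns.\<close>

definition finite_rank :: "('x letter list => complex) => bool" where
  "finite_rank t \<longleftrightarrow> (EX W. finite W & (ALL w. EX c. ALL v. t (wstar v @ w) = (\<Sum>s\<in>W. c s * t (wstar v @ s))))"

text \<open>By hermitian symmetry a linear relation among columns of the kernel holds, with
  conjugated coefficients, between the values of each kernel function, and limits carry it to all of
  \<open>kspace\<close>. The values at the words in \<open>W\<close> then determine a
  function.\<close>

lemma (in coded_space) finite_rank_functions:
  assumes "finite_rank t"
  obtains W where "finite W" "!!f. f \<in> kspace K ==> (!!c s. s \<in> W ==> f (c, s) = 0) ==> f = (%_. 0)"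
    "!!f c w. f \<in> kspace K ==> (!!s. s \<in> W ==> f (c, s) = 0) ==> f (c, w) = 0"
proof -
  obtain W where W: "finite W" "!!w. EX c. ALL v. t (wstar v @ w) = (\<Sum>s\<in>W. c s * t (wstar v @ s))"
    using assms by (auto simp: finite_rank_def)
  have r: "f (c, w) = 0" if f: "f \<in> kspace K" and z: "!!s. s \<in> W ==> f (c, s) = 0" for f c w
  proof -
    obtain b where b: "!!v. t (wstar v @ w) = (\<Sum>s\<in>W. b s * t (wstar v @ s))" using W by blast
    have k: "K (d, v) (c, w) = (\<Sum>s\<in>W. cnj (b s) * K (d, v) (c, s))" for d v
    proof -
      have "K (c, w) (d, v) = (\<Sum>s\<in>W. b s * K (c, s) (d, v))" using b by auto
      then have "K (d, v) (c, w) = cnj (\<Sum>s\<in>W. b s * K (c, s) (d, v))" by (subst K_herm) (simp only:)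
      also have "\<dots> = (\<Sum>s\<in>W. cnj (b s) * cnj (K (c, s) (d, v)))" by simp
      finally show ?thesis by (simp only: K_herm[symmetric])
    qed
    obtain sg where "approximates K sg f" using f by (auto simp: kspace_def)
    then have l: "(%n. kfun K (sg n) i) \<longlonglongrightarrow> f i" for i unfolding approximates_def by blast
    have "kfun K v (c, w) = (\<Sum>s\<in>W. cnj (b s) * kfun K v (c, s))" for v
    proof (induct v)
      case (Cons p v)
      then show ?case using k by (cases p) (simp add: sum.distrib sum_distrib_left algebra_simps del: ckernel_simp)
    qed simp
    then have "(%n. kfun K (sg n) (c, w)) \<longlonglongrightarrow> (\<Sum>s\<in>W. cnj (b s) * f (c, s))"
      by (simp only:) (intro tendsto_intros l)
    then show ?thesis using LIMSEQ_unique[OF l[of "(c, w)"]] z by simp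
  qed
  show ?thesis
  proof (rule that[OF W(1)])
    show "f = (%_. 0)" if "f \<in> kspace K" "!!c s. s \<in> W ==> f (c, s) = 0" for f
      by (rule ext) (use r that in \<open>auto simp: split_paired_all\<close>)
  qed (rule r)
qed

text \<open>An element of the commutant is determined by its \<open>vec\<close>, hence by the
  finitely many values of \<open>vec\<close> at words in \<open>W\<close>.\<close>

lemma (in coded_space) commutant_finite_dimensional:
  assumes "finite_rank t" shows "finite_dimensional D"
proof -
  interpret D: cstar_algebra D by (rule cstar_D)
  obtain W where W: "finite W" "!!f c w. f \<in> kspace K ==> (!!s. s \<in> W ==> f (c, s) = 0) ==> f (c, w) = 0"
    using finite_rank_functions[OF assms] by metis
  show ?thesis
  proof (rule D.finite_dimensional_separated[OF W(1), where ell = "%s T. vec T (c0, s)"])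
    show "vec (S \<oplus>\<^bsub>D\<^esub> T) (c0, s) = vec S (c0, s) + vec T (c0, s)" if "S \<in> carrier D" "T \<in> carrier D" for s S T
      using vec(2)[of S] vec(2)[of T] that by (simp add: vec_def[of "restrict _ _"])
    show "vec (c \<odot>\<^bsub>D\<^esub> T) (c0, s) = c * vec T (c0, s)" if "T \<in> carrier D" for s c T
      using vec(2)[of T] that by (simp add: vec_def[of "restrict _ _"])
    show "T = \<zero>\<^bsub>D\<^esub>" if T: "T \<in> carrier D" and z: "!!s. s \<in> W ==> vec T (c0, s) = 0" for T
    proof -
      have T': "T \<in> commutant H RM" using T by simp
      show ?thesis using commutant_zero[OF T'] W(2)[OF vec(1)[OF T']] z by simp
    qed
  qed
qed

section \<open>Traces of the Brown algebra\<close>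

definition comm_trace :: "('x letter list => complex) => bool" where
  "comm_trace t \<longleftrightarrow> (ALL u g v. t (u @ g # v) = t (g # u @ v))"

definition word_represents :: "('x::finite letter list => complex) => (('x \<times> 'x) cmat => ('x \<times> 'x) cmat) => bool" where
  "word_represents t \<Gamma> \<longleftrightarrow> (ALL x x' y y'. \<Gamma> (kron (mat_unit x x') (mat_unit y y')) =
     (\<Sum>a\<in>UNIV. \<Sum>a'\<in>UNIV. \<Sum>b\<in>UNIV. \<Sum>b'\<in>UNIV.
        cscale (t [(x, x', a, a'), (y', y, b', b)]) (kron (mat_unit a a') (mat_unit b b'))))"

text \<open>Elimination of one spanning function at a time: a member \<open>w0\<close> that involves
  \<open>q\<close> is used to cancel \<open>q\<close> from all others. \<open>finite_rank\<close>
  asks for columns of the matrix itself, whereas a spanning set of an algebra or an orthonormal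
  basis provides other functions.\<close>

lemma finite_spanning_subfamily:
  fixes r :: "'w => 'v => complex" and \<beta> :: "'s => 'v => complex"
  assumes "finite S" "!!w. w \<in> A ==> \<exists>\<alpha>. ALL v. r w v = (\<Sum>s\<in>S. \<alpha> s * \<beta> s v)"
  shows "EX W. finite W & W \<subseteq> A & (\<forall>w\<in>A. EX c. ALL v. r w v = (\<Sum>s\<in>W. c s * r s v))"
  using assms
proof (induct S arbitrary: r rule: finite_induct)
  case empty
  then show ?case by (intro exI[of _ "{}"]) auto
next
  case (insert q S)
  show ?case
  proof (cases "\<forall>w\<in>A. \<exists>\<alpha>. ALL v. r w v = (\<Sum>s\<in>S. \<alpha> s * \<beta> s v)")
    case True
    then have "EX W. finite W & W \<subseteq> A & (\<forall>w\<in>A. EX c. ALL v. r w v = (\<Sum>s\<in>W. c s * r s v))" by (intro insert(3)) simp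
    then show ?thesis .
  next
    case False
    then obtain w0 where w0: "w0 \<in> A" "\<nexists>\<alpha>. ALL v. r w0 v = (\<Sum>s\<in>S. \<alpha> s * \<beta> s v)" by blast
    obtain \<alpha> where \<alpha>: "!!w v. w \<in> A ==> r w v = (\<Sum>s\<in>insert q S. \<alpha> w s * \<beta> s v)" using insert(4) by metis
    have nz: "\<alpha> w0 q ~= 0"
    proof
      assume "\<alpha> w0 q = 0"
      then have "ALL v. r w0 v = (\<Sum>s\<in>S. \<alpha> w0 s * \<beta> s v)" using \<alpha>[OF w0(1)] insert(1,2) by simp
      then show False using w0 by blast
    qed
    define k where "k w = \<alpha> w q / \<alpha> w0 q" for w
    define r' where "r' w v = r w v - k w * r w0 v" for w v
    have "\<exists>\<alpha>. ALL v. r' w v = (\<Sum>s\<in>S. \<alpha> s * \<beta> s v)" if w: "w \<in> A" for w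
    proof (intro exI[of _ "%s. \<alpha> w s - k w * \<alpha> w0 s"] allI)
      fix v
      have "r' w v = (\<alpha> w q - k w * \<alpha> w0 q) * \<beta> q v + ((\<Sum>s\<in>S. \<alpha> w s * \<beta> s v) - k w * (\<Sum>s\<in>S. \<alpha> w0 s * \<beta> s v))"
        unfolding r'_def \<alpha>[OF w] \<alpha>[OF w0(1)] using insert(1,2) by (simp add: algebra_simps)
      also have "\<alpha> w q - k w * \<alpha> w0 q = 0" using nz by (simp add: k_def)
      finally show "r' w v = (\<Sum>s\<in>S. (\<alpha> w s - k w * \<alpha> w0 s) * \<beta> s v)"
        by (simp add: algebra_simps sum_subtractf sum_distrib_left)
    qed
    then have "EX W. finite W & W \<subseteq> A & (\<forall>w\<in>A. EX c. ALL v. r' w v = (\<Sum>s\<in>W. c s * r' s v))" by (rule insert(3))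
    then obtain W where W: "finite W" "W \<subseteq> A" "!!w. w \<in> A ==> EX c. ALL v. r' w v = (\<Sum>s\<in>W. c s * r' s v)" by auto
    have "EX c. ALL v. r w v = (\<Sum>s\<in>insert w0 W. c s * r s v)" if w: "w \<in> A" for w
    proof -
      obtain c where c: "!!v. r' w v = (\<Sum>s\<in>W. c s * r' s v)" using W(3)[OF w] by blast
      define d where "d = k w - (\<Sum>s\<in>W. c s * k s)"
      have rw: "r w v = (\<Sum>s\<in>W. c s * r s v) + d * r w0 v" for v
      proof -
        have "r w v = r' w v + k w * r w0 v" by (simp add: r'_def)
        also have "r' w v = (\<Sum>s\<in>W. c s * r' s v)" by (rule c)
        also have "\<dots> = (\<Sum>s\<in>W. c s * r s v) - (\<Sum>s\<in>W. c s * k s) * r w0 v"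
          by (simp add: r'_def algebra_simps sum_subtractf sum_distrib_left)
        finally show ?thesis by (simp add: d_def algebra_simps)
      qed
      \<comment> \<open>The coefficient has two summands because \<open>w0\<close> may already
        belong to \<open>W\<close>.\<close>
      have "r w v = (\<Sum>s\<in>insert w0 W. ((if s \<in> W then c s else 0) + (if s = w0 then d else 0)) * r s v)" for v
      proof -
        have "(\<Sum>s\<in>insert w0 W. ((if s \<in> W then c s else 0) + (if s = w0 then d else 0)) * r s v) =
            (\<Sum>s\<in>insert w0 W. if s \<in> W then c s * r s v else 0) + (\<Sum>s\<in>insert w0 W. if s = w0 then d * r s v else 0)"
          unfolding sum.distrib[symmetric] by (rule sum.cong) (auto simp: algebra_simps)
        also have "(\<Sum>s\<in>insert w0 W. if s \<in> W then c s * r s v else 0) = (\<Sum>s\<in>W. c s * r s v)"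
          by (rule sum.mono_neutral_cong_right) (use W in auto)
        also have "(\<Sum>s\<in>insert w0 W. if s = w0 then d * r s v else 0) = d * r w0 v" using W(1) by simp
        finally show ?thesis using rw by simp
      qed
      then show ?thesis by (intro exI[of _ "%s. (if s \<in> W then c s else 0) + (if s = w0 then d else 0)"]) simp
    qed
    moreover have "finite (insert w0 W)" "insert w0 W \<subseteq> A" using W(1,2) w0(1) by auto
    ultimately show ?thesis by (intro exI[of _ "insert w0 W"] conjI ballI)
  qed
qed

lemma finite_rankI:
  assumes "finite S" "!!w. \<exists>\<alpha>. ALL v. t (wstar v @ w) = (\<Sum>s\<in>S. \<alpha> s * \<beta> s v)"
  shows "finite_rank t"
  using finite_spanning_subfamily[of S UNIV "%w v. t (wstar v @ w)" \<beta>] assms unfolding finite_rank_def by auto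

locale brown =
  fixes B :: "'c cstar" and u :: "'x::finite => 'x => 'c"
  assumes B: "cstar_algebra B" and u: "unitary_matrix B u"
begin

sublocale B: cstar_algebra B by (rule B)

abbreviation "C \<equiv> brown_sub B u"
abbreviation "p \<equiv> brown_p B u"

definition P :: "'x letter => 'c" where "P = (%(x, x', a, a'). p x x' a a')"

lemma P_simp [simp]: "P (x, x', a, a') = p x x' a a'" by (simp add: P_def)

lemma u_closed [simp, intro]: "u a x \<in> carrier B" using u by (auto simp: unitary_matrix_def)

lemma p_B [simp, intro]: "p x x' a a' \<in> carrier B" by (simp add: brown_p_def B.star_closed)

lemma p_star: "star B (p x x' a a') = p x' x a' a"
  by (simp add: brown_p_def B.star_mult B.star_closed B.star_star)

lemma p_isometry: "(\<Oplus>\<^bsub>B\<^esub>a\<in>UNIV. p x x' a a) = (if x = x' then \<one>\<^bsub>B\<^esub> else \<zero>\<^bsub>B\<^esub>)"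
  using u by (simp add: brown_p_def unitary_matrix_def)

lemma p_coisometry: "(\<Oplus>\<^bsub>B\<^esub>x\<in>UNIV. p y x b c \<otimes>\<^bsub>B\<^esub> p x y' a b') = (if c = a then p y y' b b' else \<zero>\<^bsub>B\<^esub>)"
proof -
  have "(\<Oplus>\<^bsub>B\<^esub>x\<in>UNIV. p y x b c \<otimes>\<^bsub>B\<^esub> p x y' a b') =
      (\<Oplus>\<^bsub>B\<^esub>x\<in>UNIV. star B (u b y) \<otimes>\<^bsub>B\<^esub> (u c x \<otimes>\<^bsub>B\<^esub> star B (u a x)) \<otimes>\<^bsub>B\<^esub> u b' y')"
    by (rule B.finsum_cong') (auto simp: brown_p_def B.m_assoc B.star_closed)
  also have "\<dots> = (\<Oplus>\<^bsub>B\<^esub>x\<in>UNIV. star B (u b y) \<otimes>\<^bsub>B\<^esub> (u c x \<otimes>\<^bsub>B\<^esub> star B (u a x))) \<otimes>\<^bsub>B\<^esub> u b' y'"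
    by (rule B.finsum_ldistr[symmetric]) (auto simp: B.star_closed)
  also have "(\<Oplus>\<^bsub>B\<^esub>x\<in>UNIV. star B (u b y) \<otimes>\<^bsub>B\<^esub> (u c x \<otimes>\<^bsub>B\<^esub> star B (u a x))) =
      star B (u b y) \<otimes>\<^bsub>B\<^esub> (\<Oplus>\<^bsub>B\<^esub>x\<in>UNIV. u c x \<otimes>\<^bsub>B\<^esub> star B (u a x))"
    by (rule B.finsum_rdistr[symmetric]) (auto simp: B.star_closed)
  finally show ?thesis using u by (simp add: unitary_matrix_def brown_p_def B.star_closed)
qed

lemma gens: "{p x x' a a' |x x' a a'. True} \<subseteq> carrier B" by auto

lemma C_subalgebra: "cstar_subalgebra B (carrier C)"
  using cstar_generated_subalgebra(1)[OF B gens] by (simp add: brown_sub_def)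

lemma C_ops [simp]: "x \<otimes>\<^bsub>C\<^esub> y = x \<otimes>\<^bsub>B\<^esub> y" "x \<oplus>\<^bsub>C\<^esub> y = x \<oplus>\<^bsub>B\<^esub> y" "\<one>\<^bsub>C\<^esub> = \<one>\<^bsub>B\<^esub>" "\<zero>\<^bsub>C\<^esub> = \<zero>\<^bsub>B\<^esub>"
  "c \<odot>\<^bsub>C\<^esub> x = c \<odot>\<^bsub>B\<^esub> x" "star C = star B" "cnorm C = cnorm B"
  by (auto simp: brown_sub_def)

lemma p_C [simp, intro]: "p x x' a a' \<in> carrier C"
proof -
  have "p x x' a a' \<in> {p x x' a a' |x x' a a'. True}" by blast
  then have "p x x' a a' \<in> cstar_generated B {p x x' a a' |x x' a a'. True}"
    by (rule subsetD[OF cstar_generated_subalgebra(2)[OF B gens]])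
  then show ?thesis by (simp add: brown_sub_def)
qed

lemma C_B: "x \<in> carrier C ==> x \<in> carrier B"
  using C_subalgebra by (auto simp: cstar_subalgebra_def)

lemma C_closed: "\<zero>\<^bsub>B\<^esub> \<in> carrier C" "x \<in> carrier C ==> y \<in> carrier C ==> x \<oplus>\<^bsub>B\<^esub> y \<in> carrier C"
  "x \<in> carrier C ==> y \<in> carrier C ==> x \<otimes>\<^bsub>B\<^esub> y \<in> carrier C" "x \<in> carrier C ==> c \<odot>\<^bsub>B\<^esub> x \<in> carrier C"
  "x \<in> carrier C ==> star B x \<in> carrier C"
  using C_subalgebra by (auto simp: cstar_subalgebra_def)

lemma finsum_B_C: "finite A ==> (!!a. a \<in> A ==> f a \<in> carrier C) ==> finsum B f A \<in> carrier C"
proof (induct A rule: finite_induct)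
  case (insert x A)
  then have "finsum B f (insert x A) = f x \<oplus>\<^bsub>B\<^esub> finsum B f A" using C_B by (intro B.finsum_insert) auto
  then show ?case using insert C_closed by auto
qed (simp add: C_closed)

lemma one_C: "\<one>\<^bsub>B\<^esub> \<in> carrier C"
  using finsum_B_C[of UNIV "%a. p undefined undefined a a"] p_isometry[of undefined undefined] by simp

lemma cstar_C: "cstar_algebra C"
  using cstar_subalgebra_algebra[OF B C_subalgebra one_C] by (simp add: brown_sub_def)

sublocale C: cstar_algebra C by (rule cstar_C)

definition pword :: "'x letter list => 'c" where
  "pword w = foldr (%g z. P g \<otimes>\<^bsub>B\<^esub> z) w \<one>\<^bsub>B\<^esub>"

lemma P_C [simp, intro]: "P g \<in> carrier C" by (cases g) simp
lemma P_B [simp, intro]: "P g \<in> carrier B" by (cases g) simp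
lemma P_star: "star B (P g) = P (gstar g)" by (cases g) (simp add: p_star)

lemma pword_simps [simp]: "pword [] = \<one>\<^bsub>B\<^esub>" "pword (g # w) = P g \<otimes>\<^bsub>B\<^esub> pword w" by (auto simp: pword_def)
lemma pword_C [simp, intro]: "pword w \<in> carrier C" by (induct w) (auto simp: one_C C_closed)
lemma pword_B [simp, intro]: "pword w \<in> carrier B" by (rule C_B) simp
lemma pword_append: "pword (v @ w) = pword v \<otimes>\<^bsub>B\<^esub> pword w" by (induct v) (auto simp: B.m_assoc)
lemma pword_wstar: "pword (wstar w) = star B (pword w)"
  by (induct w) (auto simp: pword_append B.star_mult P_star)

context
  fixes \<tau> assumes \<tau>: "tracial_state C \<tau>"
begin

lemma tau_simps:
  "x \<in> carrier C ==> y \<in> carrier C ==> \<tau> (x \<oplus>\<^bsub>B\<^esub> y) = \<tau> x + \<tau> y" "x \<in> carrier C ==> \<tau> (c \<odot>\<^bsub>B\<^esub> x) = c * \<tau> x"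
  "\<tau> \<one>\<^bsub>B\<^esub> = 1" "x \<in> carrier C ==> y \<in> carrier C ==> \<tau> (x \<otimes>\<^bsub>B\<^esub> y) = \<tau> (y \<otimes>\<^bsub>B\<^esub> x)"
  "x \<in> carrier C ==> \<tau> (star B x \<otimes>\<^bsub>B\<^esub> x) \<in> \<real>\<^sub>\<ge>\<^sub>0"
  using \<tau> unfolding tracial_state_def C_ops by blast+

lemma tau_zero: "\<tau> \<zero>\<^bsub>B\<^esub> = 0"
  using tau_simps(1)[OF C_closed(1) C_closed(1)] by simp

lemma tau_finsum: "finite A ==> (!!a. a \<in> A ==> f a \<in> carrier C) ==> \<tau> (finsum B f A) = (\<Sum>a\<in>A. \<tau> (f a))"
proof (induct A rule: finite_induct)
  case (insert x A)
  then have "finsum B f (insert x A) = f x \<oplus>\<^bsub>B\<^esub> finsum B f A" using C_B by (intro B.finsum_insert) auto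
  then show ?case using insert by (simp add: tau_simps finsum_B_C)
qed (simp add: tau_zero)

definition lsum :: "(complex \<times> 'x letter list) list => 'c" where
  "lsum v = foldr (%(a, w) z. a \<odot>\<^bsub>B\<^esub> pword w \<oplus>\<^bsub>B\<^esub> z) v \<zero>\<^bsub>B\<^esub>"

text \<open>A formal combination stands for the element \<open>lsum v\<close>; the form of the word
  kernel at \<open>v\<close>, \<open>w\<close> is the trace of the adjoint of \<open>lsum w\<close>
  times \<open>lsum v\<close>, hence positive.\<close>

lemma word_trace_tau: "word_trace (%w. \<tau> (pword w))"
proof
  have lC: "lsum v \<in> carrier C" for v by (induct v) (auto simp: lsum_def C_closed)
  have k: "kfun (wkernel (%w. \<tau> (pword w))) v w = \<tau> (star B (pword w) \<otimes>\<^bsub>B\<^esub> lsum v)" for v w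
  proof (induct v)
    case Nil
    show ?case by (simp add: lsum_def tau_zero B.star_closed)
  next
    case (Cons q v)
    obtain a w' where q: "q = (a, w')" by force
    have "lsum (q # v) = a \<odot>\<^bsub>B\<^esub> pword w' \<oplus>\<^bsub>B\<^esub> lsum v" by (simp add: q lsum_def)
    then have "star B (pword w) \<otimes>\<^bsub>B\<^esub> lsum (q # v) = a \<odot>\<^bsub>B\<^esub> (star B (pword w) \<otimes>\<^bsub>B\<^esub> pword w') \<oplus>\<^bsub>B\<^esub> star B (pword w) \<otimes>\<^bsub>B\<^esub> lsum v"
      using C_B[OF lC] by (simp add: B.r_distr B.star_closed B.smult_mult_right)
    then show ?case using Cons lC by (simp add: q wkernel_def tau_simps C_closed pword_append pword_wstar)
  qed
  have l: "lip (wkernel (%w. \<tau> (pword w))) v w = \<tau> (star B (lsum w) \<otimes>\<^bsub>B\<^esub> lsum v)" for v w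
  proof (induct w)
    case Nil
    show ?case using C_B[OF lC] by (simp add: lsum_def[of "[]"] tau_zero)
  next
    case (Cons q w)
    obtain b i where q: "q = (b, i)" by force
    have "lsum (q # w) = b \<odot>\<^bsub>B\<^esub> pword i \<oplus>\<^bsub>B\<^esub> lsum w" by (simp add: q lsum_def)
    then have "star B (lsum (q # w)) \<otimes>\<^bsub>B\<^esub> lsum v = cnj b \<odot>\<^bsub>B\<^esub> (star B (pword i) \<otimes>\<^bsub>B\<^esub> lsum v) \<oplus>\<^bsub>B\<^esub> star B (lsum w) \<otimes>\<^bsub>B\<^esub> lsum v"
      using C_B[OF lC] by (simp add: B.l_distr B.star_closed B.star_add B.star_smult B.smult_mult_left)
    then show ?case using Cons lC by (simp add: q k tau_simps C_closed)
  qed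
  show "lip (wkernel (%w. \<tau> (pword w))) r r \<in> \<real>\<^sub>\<ge>\<^sub>0" for r unfolding l by (rule tau_simps(5)[OF lC])
  show "\<tau> (pword []) = 1" by (simp add: tau_simps)
  show "\<tau> (pword (v @ w)) = \<tau> (pword (w @ v))" for v w by (simp add: pword_append tau_simps(4)[of "pword v"])
  show "(\<Sum>a\<in>UNIV. \<tau> (pword (v @ (x, x', a, a) # w))) = (if x = x' then \<tau> (pword (v @ w)) else 0)" for v x x' w
  proof -
    have "(\<Sum>a\<in>UNIV. \<tau> (pword (v @ (x, x', a, a) # w))) = \<tau> (\<Oplus>\<^bsub>B\<^esub>a\<in>UNIV. pword v \<otimes>\<^bsub>B\<^esub> (p x x' a a \<otimes>\<^bsub>B\<^esub> pword w))"
      by (subst tau_finsum) (auto simp: pword_append C_closed)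
    also have "(\<Oplus>\<^bsub>B\<^esub>a\<in>UNIV. pword v \<otimes>\<^bsub>B\<^esub> (p x x' a a \<otimes>\<^bsub>B\<^esub> pword w)) = pword v \<otimes>\<^bsub>B\<^esub> (\<Oplus>\<^bsub>B\<^esub>a\<in>UNIV. p x x' a a \<otimes>\<^bsub>B\<^esub> pword w)"
      by (rule B.finsum_rdistr[symmetric]) auto
    also have "(\<Oplus>\<^bsub>B\<^esub>a\<in>UNIV. p x x' a a \<otimes>\<^bsub>B\<^esub> pword w) = (\<Oplus>\<^bsub>B\<^esub>a\<in>UNIV. p x x' a a) \<otimes>\<^bsub>B\<^esub> pword w"
      by (rule B.finsum_ldistr[symmetric]) auto
    finally show ?thesis by (simp add: p_isometry pword_append tau_zero)
  qed
  show "(\<Sum>x\<in>UNIV. \<tau> (pword (v @ (y, x, b, c) # (x, y', a, b') # w))) = (if c = a then \<tau> (pword (v @ (y, y', b, b') # w)) else 0)"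
    for v y b c y' a b' w
  proof -
    have "(\<Sum>x\<in>UNIV. \<tau> (pword (v @ (y, x, b, c) # (x, y', a, b') # w))) =
        \<tau> (\<Oplus>\<^bsub>B\<^esub>x\<in>UNIV. pword v \<otimes>\<^bsub>B\<^esub> ((p y x b c \<otimes>\<^bsub>B\<^esub> p x y' a b') \<otimes>\<^bsub>B\<^esub> pword w))"
      by (subst tau_finsum) (auto simp: pword_append C_closed B.m_assoc)
    also have "(\<Oplus>\<^bsub>B\<^esub>x\<in>UNIV. pword v \<otimes>\<^bsub>B\<^esub> ((p y x b c \<otimes>\<^bsub>B\<^esub> p x y' a b') \<otimes>\<^bsub>B\<^esub> pword w)) =
        pword v \<otimes>\<^bsub>B\<^esub> (\<Oplus>\<^bsub>B\<^esub>x\<in>UNIV. (p y x b c \<otimes>\<^bsub>B\<^esub> p x y' a b') \<otimes>\<^bsub>B\<^esub> pword w)"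
      by (rule B.finsum_rdistr[symmetric]) auto
    also have "(\<Oplus>\<^bsub>B\<^esub>x\<in>UNIV. (p y x b c \<otimes>\<^bsub>B\<^esub> p x y' a b') \<otimes>\<^bsub>B\<^esub> pword w) = (\<Oplus>\<^bsub>B\<^esub>x\<in>UNIV. p y x b c \<otimes>\<^bsub>B\<^esub> p x y' a b') \<otimes>\<^bsub>B\<^esub> pword w"
      by (rule B.finsum_ldistr[symmetric]) auto
    finally show ?thesis by (simp add: p_coisometry pword_append tau_zero)
  qed
qed

lemma word_represents_tau: "trace_represents C p \<tau> \<Gamma> \<longleftrightarrow> word_represents (%w. \<tau> (pword w)) \<Gamma>"
  by (simp add: trace_represents_def word_represents_def)

text \<open>Expanding the image of a word in a finite spanning set of the target algebra expresses
  all columns by one function of \<open>v\<close> for each member of that set.\<close>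

lemma finite_rank_tau: assumes "factors_finite_dim TYPE('d) C \<tau>" shows "finite_rank (%w. \<tau> (pword w))"
proof -
  obtain D :: "'d cstar" and \<tau>\<^sub>0 \<pi> where D: "cstar_algebra D" "finite_dimensional D" "tracial_state D \<tau>\<^sub>0"
      "star_hom C D \<pi>" "!!x. x \<in> carrier C ==> \<tau> x = \<tau>\<^sub>0 (\<pi> x)"
    using assms by (auto simp: factors_finite_dim_def)
  interpret D: cstar_algebra D by (rule D(1))
  obtain S where S: "finite S" "S \<subseteq> carrier D" "!!x. x \<in> carrier D ==> EX c. x = (\<Oplus>\<^bsub>D\<^esub>s\<in>S. c s \<odot>\<^bsub>D\<^esub> s)"
    using D(2) by (auto simp: finite_dimensional_def)
  have h: "\<pi> x \<in> carrier D" "\<pi> (x \<otimes>\<^bsub>B\<^esub> y) = \<pi> x \<otimes>\<^bsub>D\<^esub> \<pi> y" if "x \<in> carrier C" "y \<in> carrier C" for x y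
    using D(4) that by (auto simp: star_hom_def ring_hom_def)
  have t0: "\<tau>\<^sub>0 (x \<oplus>\<^bsub>D\<^esub> y) = \<tau>\<^sub>0 x + \<tau>\<^sub>0 y" "\<tau>\<^sub>0 (c \<odot>\<^bsub>D\<^esub> x) = c * \<tau>\<^sub>0 x" if "x \<in> carrier D" "y \<in> carrier D" for x y c
    using D(3) that by (auto simp: tracial_state_def)
  have t0z: "\<tau>\<^sub>0 \<zero>\<^bsub>D\<^esub> = 0" using t0(1)[of "\<zero>\<^bsub>D\<^esub>" "\<zero>\<^bsub>D\<^esub>"] by simp
  have sum0: "\<tau>\<^sub>0 (finsum D f A) = (\<Sum>a\<in>A. \<tau>\<^sub>0 (f a))" if "finite A" "f \<in> A \<rightarrow> carrier D" for f and A :: "'d set"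
    using that by (induct A rule: finite_induct) (auto simp: t0z t0 D.finsum_insert)
  show ?thesis
  proof (rule finite_rankI[OF S(1), where \<beta> = "%s v. \<tau>\<^sub>0 (\<pi> (pword (wstar v)) \<otimes>\<^bsub>D\<^esub> s)"])
    fix w
    obtain c where c: "\<pi> (pword w) = (\<Oplus>\<^bsub>D\<^esub>s\<in>S. c s \<odot>\<^bsub>D\<^esub> s)" using S(3)[OF h(1)[OF pword_C pword_C]] by blast
    show "\<exists>\<alpha>. ALL v. \<tau> (pword (wstar v @ w)) = (\<Sum>s\<in>S. \<alpha> s * \<tau>\<^sub>0 (\<pi> (pword (wstar v)) \<otimes>\<^bsub>D\<^esub> s))"
    proof (intro exI[of _ c] allI)
      fix v
      let ?v = "\<pi> (pword (wstar v))"
      have vD: "?v \<in> carrier D" using h(1)[OF pword_C pword_C] .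
      have sc: "(%s. c s \<odot>\<^bsub>D\<^esub> s) \<in> S \<rightarrow> carrier D" using S(2) by auto
      have "\<tau> (pword (wstar v @ w)) = \<tau>\<^sub>0 (\<pi> (pword (wstar v @ w)))" by (rule D(5)[OF pword_C])
      also have "\<pi> (pword (wstar v @ w)) = ?v \<otimes>\<^bsub>D\<^esub> \<pi> (pword w)" by (simp only: pword_append h(2)[OF pword_C pword_C])
      also have "?v \<otimes>\<^bsub>D\<^esub> \<pi> (pword w) = (\<Oplus>\<^bsub>D\<^esub>s\<in>S. ?v \<otimes>\<^bsub>D\<^esub> (c s \<odot>\<^bsub>D\<^esub> s))"
        unfolding c by (rule D.finsum_rdistr[OF S(1) vD sc])
      also have "\<tau>\<^sub>0 \<dots> = (\<Sum>s\<in>S. \<tau>\<^sub>0 (?v \<otimes>\<^bsub>D\<^esub> (c s \<odot>\<^bsub>D\<^esub> s)))" using sc vD by (intro sum0[OF S(1)]) auto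
      also have "\<dots> = (\<Sum>s\<in>S. c s * \<tau>\<^sub>0 (?v \<otimes>\<^bsub>D\<^esub> s))"
        by (rule sum.cong) (use S(2) vD in \<open>auto simp: D.smult_mult_right t0 subset_iff\<close>)
      finally show "\<tau> (pword (wstar v @ w)) = (\<Sum>s\<in>S. c s * \<tau>\<^sub>0 (?v \<otimes>\<^bsub>D\<^esub> s))" .
    qed
  qed
qed

lemma comm_trace_tau: assumes "factors_abelian TYPE('d) C \<tau>" shows "comm_trace (%w. \<tau> (pword w))"
  unfolding comm_trace_def
proof (intro allI)
  fix v g w
  obtain D :: "'d cstar" and \<tau>\<^sub>0 \<pi> where D: "cstar_algebra D" "!!x y. x \<in> carrier D ==> y \<in> carrier D ==> x \<otimes>\<^bsub>D\<^esub> y = y \<otimes>\<^bsub>D\<^esub> x"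
      "star_hom C D \<pi>" "!!x. x \<in> carrier C ==> \<tau> x = \<tau>\<^sub>0 (\<pi> x)"
    using assms by (auto simp: factors_abelian_def)
  interpret D: cstar_algebra D by (rule D(1))
  have h: "\<pi> x \<in> carrier D" "\<pi> (x \<otimes>\<^bsub>B\<^esub> y) = \<pi> x \<otimes>\<^bsub>D\<^esub> \<pi> y" if "x \<in> carrier C" "y \<in> carrier C" for x y
    using D(3) that by (auto simp: star_hom_def ring_hom_def)
  have c: "\<pi> (pword v) \<in> carrier D" "\<pi> (P g) \<in> carrier D" "\<pi> (pword w) \<in> carrier D" using h(1) by auto
  have "\<pi> (pword (v @ g # w)) = \<pi> (pword v) \<otimes>\<^bsub>D\<^esub> (\<pi> (P g) \<otimes>\<^bsub>D\<^esub> \<pi> (pword w))"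
    by (simp add: pword_append h C_closed)
  also have "\<dots> = \<pi> (P g) \<otimes>\<^bsub>D\<^esub> (\<pi> (pword v) \<otimes>\<^bsub>D\<^esub> \<pi> (pword w))"
    using D.m_assoc[OF c(1,2,3)] D.m_assoc[OF c(2,1,3)] D(2)[OF c(1,2)] by simp
  also have "\<dots> = \<pi> (pword (g # v @ w))" by (simp add: pword_append h C_closed)
  finally show "\<tau> (pword (v @ g # w)) = \<tau> (pword (g # v @ w))" by (simp only: D(4)[OF pword_C])
qed

end

end

section \<open>The representation of the Brown algebra on the coded word space\<close>

locale coded_brown = brown_space t + coded_space t "TYPE('x)" e
  for t :: "'x::finite letter list => complex" and e :: "('x \<times> 'x letter list => complex) => 'h"
begin

abbreviation "BH \<equiv> op_algebra H {}"

lemma empty_self_adjoint: "self_adjoint_set H {}" by (simp add: self_adjoint_set_def)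

lemma adj_OpU: "adj_pair H (Op (rowU a x)) (Op (rowV a x))"
  by (rule adj_pair_fun_op[OF inj_e]) (auto simp: UV_in UV_adj)

lemma OpU_in: "Op (rowU a x) \<in> commutant H {}"
proof (rule H.commutantI[OF _ op_bound_fun_op[OF inj_e, of 1] adj_OpU])
  show "Op (rowU a x) \<in> extensional (carrier H)" by (simp add: fun_op_def)
qed (auto simp: UV_bound)

lemma hadjoint_OpU: "hadjoint H (Op (rowU a x)) = Op (rowV a x)"
  by (rule H.hadjoint_eqI[OF adj_OpU]) (simp add: fun_op_def)

lemma OpV_in: "Op (rowV a x) \<in> commutant H {}"
  using H.hadjoint_commutant[OF OpU_in empty_self_adjoint, of a x] by (simp add: hadjoint_OpU)

lemma unitary_U: "unitary_matrix BH (%a x. Op (rowU a x))"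
proof -
  note oc = H.commutant_ops(1)[OF empty_self_adjoint]
  have 1: "(\<Oplus>\<^bsub>BH\<^esub>a\<in>UNIV. star BH (Op (rowU a x)) \<otimes>\<^bsub>BH\<^esub> Op (rowU a x')) = (if x = x' then \<one>\<^bsub>BH\<^esub> else \<zero>\<^bsub>BH\<^esub>)" for x x'
  proof -
    have "(\<Oplus>\<^bsub>BH\<^esub>a\<in>UNIV. star BH (Op (rowU a x)) \<otimes>\<^bsub>BH\<^esub> Op (rowU a x')) =
        (\<lambda>h\<in>carrier H. \<Oplus>\<^bsub>H\<^esub>a\<in>UNIV. (star BH (Op (rowU a x)) \<otimes>\<^bsub>BH\<^esub> Op (rowU a x')) h)"
      by (rule H.finsum_op_algebra[OF empty_self_adjoint]) (use oc[OF OpV_in OpU_in] in \<open>auto simp: hadjoint_OpU\<close>)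
    also have "\<dots> = (\<lambda>h\<in>carrier H. if x = x' then h else \<zero>\<^bsub>H\<^esub>)"
    proof (rule restrict_ext)
      fix h assume "h \<in> carrier H"
      then obtain f where f: "f \<in> kspace K" "h = e f" using carrier_H by blast
      have "(\<Oplus>\<^bsub>H\<^esub>a\<in>UNIV. (star BH (Op (rowU a x)) \<otimes>\<^bsub>BH\<^esub> Op (rowU a x')) h) = (\<Oplus>\<^bsub>H\<^esub>a\<in>UNIV. e (mop (rowV a x) (mop (rowU a x') f)))"
        using f by (simp add: hadjoint_OpU UV_in)
      also have "\<dots> = e (%i. \<Sum>a\<in>UNIV. mop (rowV a x) (mop (rowU a x') f) i)"
        using finsum_fun_hspace[OF inj_e, of UNIV "%a. mop (rowV a x) (mop (rowU a x') f)"] f UV_in by simp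
      finally show "(\<Oplus>\<^bsub>H\<^esub>a\<in>UNIV. (star BH (Op (rowU a x)) \<otimes>\<^bsub>BH\<^esub> Op (rowU a x')) h) = (if x = x' then h else \<zero>\<^bsub>H\<^esub>)"
        using f by (simp add: sum_VU[OF f(1)])
    qed
    finally show ?thesis by simp
  qed
  have 2: "(\<Oplus>\<^bsub>BH\<^esub>x\<in>UNIV. Op (rowU a x) \<otimes>\<^bsub>BH\<^esub> star BH (Op (rowU a' x))) = (if a = a' then \<one>\<^bsub>BH\<^esub> else \<zero>\<^bsub>BH\<^esub>)" for a a'
  proof -
    have "(\<Oplus>\<^bsub>BH\<^esub>x\<in>UNIV. Op (rowU a x) \<otimes>\<^bsub>BH\<^esub> star BH (Op (rowU a' x))) =
        (\<lambda>h\<in>carrier H. \<Oplus>\<^bsub>H\<^esub>x\<in>UNIV. (Op (rowU a x) \<otimes>\<^bsub>BH\<^esub> star BH (Op (rowU a' x))) h)"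
      by (rule H.finsum_op_algebra[OF empty_self_adjoint]) (use oc[OF OpU_in OpV_in] in \<open>auto simp: hadjoint_OpU\<close>)
    also have "\<dots> = (\<lambda>h\<in>carrier H. if a = a' then h else \<zero>\<^bsub>H\<^esub>)"
    proof (rule restrict_ext)
      fix h assume "h \<in> carrier H"
      then obtain f where f: "f \<in> kspace K" "h = e f" using carrier_H by blast
      have "(\<Oplus>\<^bsub>H\<^esub>x\<in>UNIV. (Op (rowU a x) \<otimes>\<^bsub>BH\<^esub> star BH (Op (rowU a' x))) h) = (\<Oplus>\<^bsub>H\<^esub>x\<in>UNIV. e (mop (rowU a x) (mop (rowV a' x) f)))"
        using f by (simp add: hadjoint_OpU UV_in)
      also have "\<dots> = e (%i. \<Sum>x\<in>UNIV. mop (rowU a x) (mop (rowV a' x) f) i)"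
        using finsum_fun_hspace[OF inj_e, of UNIV "%x. mop (rowU a x) (mop (rowV a' x) f)"] f UV_in by simp
      finally show "(\<Oplus>\<^bsub>H\<^esub>x\<in>UNIV. (Op (rowU a x) \<otimes>\<^bsub>BH\<^esub> star BH (Op (rowU a' x))) h) = (if a = a' then h else \<zero>\<^bsub>H\<^esub>)"
        using f by (simp add: sum_UV[OF f(1)])
    qed
    finally show ?thesis by simp
  qed
  show ?thesis unfolding unitary_matrix_def using 1 2 OpU_in by (simp del: op_algebra_simps(2-))
qed

end

lemma tracial_state_pullback:
  assumes C: "cstar_algebra C" and h: "star_hom C D \<pi>" and t: "tracial_state D \<tau>\<^sub>0"
  shows "tracial_state C (%x. \<tau>\<^sub>0 (\<pi> x))"
proof -
  interpret C: cstar_algebra C by (rule C)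
  show ?thesis
    using h t C.star_closed unfolding tracial_state_def star_hom_def ring_hom_def by (auto simp: Pi_iff)
qed

text \<open>The universal property yields a representation that sends \<open>u\<close> to the
  matrices \<open>rowU\<close>, hence each generator p to a left multiplication. These commute with
  the right multiplications, so \<open>C\<close> is mapped into \<open>D\<close>, where
  \<open>tau0\<close> is a trace; \<open>D\<close> is also the algebra through which the trace
  factors. Agreement with \<open>t\<close> on two-letter words is all that
  \<open>trace_represents\<close> asks for.\<close>

theorem trace_of_word_trace:
  fixes B :: "'c cstar" and u :: "'x::finite => 'x => 'c" and emb :: "(nat => complex) => 'h"
  assumes emb: "inj emb" and br: "brown_algebra TYPE('h => 'h) B u" and wt: "word_trace t" and rep: "word_represents t \<Gamma>"
  obtains \<tau> where "tracial_state (brown_sub B u) \<tau>" "trace_represents (brown_sub B u) (brown_p B u) \<tau> \<Gamma>"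
    "finite_rank t ==> factors_finite_dim TYPE('h => 'h) (brown_sub B u) \<tau>"
    "comm_trace t ==> factors_abelian TYPE('h => 'h) (brown_sub B u) \<tau>"
proof -
  obtain e :: "('x \<times> 'x letter list => complex) => 'h" where e: "inj e"
    using exists_coding[OF emb countable_letter_lists] by blast
  interpret word_trace t by (rule wt)
  interpret coded_brown t e by unfold_locales (rule e)
  have "cstar_algebra B" "unitary_matrix B u" using br unfolding brown_algebra_def by simp_all
  then interpret brown B u by (rule brown.intro)
  have uni: "cstar_algebra D' ==> unitary_matrix D' v ==> \<exists>\<pi>. star_hom B D' \<pi> & (ALL a x. \<pi> (u a x) = v a x)"
    for D' :: "('h => 'h) cstar" and v
    using br unfolding brown_algebra_def by simp
  obtain \<pi> where \<pi>: "star_hom B BH \<pi>" "!!a x. \<pi> (u a x) = Op (rowU a x)"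
    using uni[OF H.cstar_op_algebra[OF empty_self_adjoint nontrivial] unitary_U] by (elim exE conjE) blast
  have mlt: "\<pi> (y \<otimes>\<^bsub>B\<^esub> z) = (\<lambda>x\<in>carrier H. \<pi> y (\<pi> z x))" if "y \<in> carrier B" "z \<in> carrier B" for y z
    using \<pi>(1) that by (auto simp: star_hom_def ring_hom_def)
  have sta: "\<pi> (star B y) = hadjoint H (\<pi> y)" if "y \<in> carrier B" for y
    using \<pi>(1) that by (auto simp: star_hom_def)
  have pL: "\<pi> (P g) = Op (rowL g)" for g
  proof -
    obtain x x' a a' where g: "g = (x, x', a, a')" by (cases g)
    have "\<pi> (P g) = (\<lambda>h\<in>carrier H. Op (rowV a x) (Op (rowU a' x') h))"
      unfolding g by (simp add: brown_p_def mlt sta B.star_closed \<pi>(2) hadjoint_OpU)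
    also have "\<dots> = Op (rowL g)"
    proof (rule extensionalityI[of _ "carrier H"])
      fix h assume "h \<in> carrier H"
      then obtain f where "f \<in> kspace K" "h = e f" using carrier_H by blast
      then show "(\<lambda>h\<in>carrier H. Op (rowV a x) (Op (rowU a' x') h)) h = Op (rowL g) h"
        by (simp add: UV_in mop_VU g)
    qed (auto simp: fun_op_def)
    finally show ?thesis .
  qed
  have \<pi>D: "\<pi> x \<in> commutant H RM" if "x \<in> carrier C" for x
  proof (rule H.star_hom_generated_commutant[OF B empty_self_adjoint \<pi>(1) RM_self_adjoint gens])
    show "\<pi> g \<in> commutant H RM" if "g \<in> {p x x' a a' |x x' a a'. True}" for g
    proof -
      obtain h where "g = P h" using \<open>g \<in> _\<close> by (auto simp flip: P_simp)
      then show ?thesis by (simp add: pL L_commutant)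
    qed
    show "x \<in> cstar_generated B {p x x' a a' |x x' a a'. True}" using that by (simp add: brown_sub_def)
  qed
  have hom: "star_hom C D \<pi>"
    using \<pi>(1) \<pi>D C_B unfolding star_hom_def ring_hom_def by auto
  define \<tau> where "\<tau> x = tau0 (\<pi> x)" for x
  have tr: "tracial_state C \<tau>" unfolding \<tau>_def by (rule tracial_state_pullback[OF cstar_C hom tracial_tau0])
  have val: "\<tau> (P g \<otimes>\<^bsub>B\<^esub> P h) = t [g, h]" for g h
    using ops_in(1)[OF K_in] by (simp add: \<tau>_def tau0_def mlt pL row_kernel reproducing)
  have "trace_represents C p \<tau> \<Gamma>"
    using rep val[of "(_, _, _, _)" "(_, _, _, _)"] by (simp add: trace_represents_def word_represents_def)
  moreover have "factors_finite_dim TYPE('h => 'h) C \<tau>" if "finite_rank t"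
    unfolding factors_finite_dim_def
    using cstar_D commutant_finite_dimensional[OF that] tracial_tau0 hom by (intro exI[of _ D] exI[of _ tau0] exI[of _ \<pi>]) (auto simp: \<tau>_def)
  moreover have "factors_abelian TYPE('h => 'h) C \<tau>" if "comm_trace t"
  proof -
    have "x \<otimes>\<^bsub>D\<^esub> y = y \<otimes>\<^bsub>D\<^esub> x" if "x \<in> carrier D" "y \<in> carrier D" for x y
      using that \<open>comm_trace t\<close> by (intro commutant_abelian) (auto simp: comm_trace_def)
    then show ?thesis unfolding factors_abelian_def
      using cstar_D tracial_tau0 hom by (intro exI[of _ D] exI[of _ tau0] exI[of _ \<pi>]) (auto simp: \<tau>_def)
  qed
  ultimately show ?thesis using that tr by blast
qed

section \<open>Commuting stochastic operator matrices and word traces\<close>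

text \<open>For a block matrix V* V the form \<open>Q\<close> is the inner product of V v with V w.
  Arguments about such a V are carried out with the possibly degenerate form \<open>Q\<close> alone,
  so no square root of the block matrix has to be constructed.\<close>

locale positive_blocks = hilbert_space H for H :: "('h, 'm) hspace_scheme" (structure) +
  fixes A :: "'i::finite => 'i => 'h => 'h"
  assumes A_closed [simp]: "h \<in> carrier H ==> A p q h \<in> carrier H"
    and A_add: "h \<in> carrier H ==> k \<in> carrier H ==> A p q (h \<oplus> k) = A p q h \<oplus> A p q k"
    and A_smult: "h \<in> carrier H ==> A p q (c \<odot> h) = c \<odot> A p q h"
    and A_pos: "(!!p. v p \<in> carrier H) ==> (\<Sum>p\<in>UNIV. \<Sum>q\<in>UNIV. iprod H (A p q (v q)) (v p)) \<in> \<real>\<^sub>\<ge>\<^sub>0"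
begin

definition Q :: "('i => 'h) => ('i => 'h) => complex" where
  "Q v w = (\<Sum>p\<in>UNIV. \<Sum>q\<in>UNIV. iprod H (A p q (v q)) (w p))"

definition single :: "'i => 'h => 'i => 'h" where
  "single p h = (%q. if q = p then h else \<zero>)"

lemma A_zero [simp]: "A p q \<zero> = \<zero>"
  using A_smult[of \<zero> p q 0] by simp

lemma single_closed [simp]: "h \<in> carrier H ==> single p h q \<in> carrier H" by (simp add: single_def)

lemma iprod_single: assumes "!!p. f p \<in> carrier H" "k \<in> carrier H"
  shows "(\<Sum>p\<in>UNIV. iprod H (f p) (single q k p)) = iprod H (f q) k"
proof -
  have "(\<Sum>p\<in>UNIV. iprod H (f p) (single q k p)) = (\<Sum>p\<in>UNIV. if p = q then iprod H (f q) k else 0)"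
    using assms by (intro sum.cong) (auto simp: single_def)
  then show ?thesis by simp
qed

lemma Q_pos: "(!!p. v p \<in> carrier H) ==> Q v v \<in> \<real>\<^sub>\<ge>\<^sub>0"
  unfolding Q_def by (rule A_pos)

lemma Q_add: assumes "!!p. u p \<in> carrier H" "!!p. v p \<in> carrier H" "!!p. w p \<in> carrier H"
  shows "Q (%p. u p \<oplus> c \<odot> v p) w = Q u w + c * Q v w" "Q w (%p. u p \<oplus> c \<odot> v p) = Q w u + cnj c * Q w v"
  using assms by (simp_all add: Q_def A_add A_smult ip_simps sum.distrib sum_distrib_left)

lemma Q_herm: assumes "!!p. v p \<in> carrier H" "!!p. w p \<in> carrier H" shows "Q w v = cnj (Q v w)"
proof -
  have r: "Im (Q u u) = 0" if "!!p. u p \<in> carrier H" for u using Q_pos[OF that] by (auto simp: complex_nonneg_Reals_iff)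
  have "Q (%p. v p \<oplus> c \<odot> w p) (%p. v p \<oplus> c \<odot> w p) = Q v v + cnj c * Q v w + c * (Q w v + cnj c * Q w w)" for c
    using assms by (simp add: Q_add)
  then have "Im (Q v v + cnj c * Q v w + c * (Q w v + cnj c * Q w w)) = 0" for c
    using r[of "%p. v p \<oplus> c \<odot> w p"] assms by simp
  from this[of 1] this[of \<i>] have "Im (Q v w) + Im (Q w v) = 0" "- Re (Q v w) + Re (Q w v) = 0"
    using r[of v] r[of w] assms by auto
  then show ?thesis by (simp add: complex_eq_iff)
qed

lemma Q_null: assumes v: "!!p. v p \<in> carrier H" and w: "!!p. w p \<in> carrier H" and z: "Re (Q v v) <= 0" shows "Q v w = 0"
proof -
  have "(cmod (Q v w))\<^sup>2 <= Re (Q w w) * Re (Q v v)"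
  proof (rule quadratic_discriminant)
    fix z
    have "Q (%p. w p \<oplus> z \<odot> v p) (%p. w p \<oplus> z \<odot> v p) = Q w w + cnj z * Q w v + z * (Q v w + cnj z * Q v v)"
      using v w by (simp add: Q_add)
    also have "\<dots> = Q w w + cnj (z * Q v w) + z * Q v w + (z * cnj z) * Q v v"
      using Q_herm[OF v w] by (simp add: algebra_simps)
    also have "z * cnj z = of_real ((cmod z)\<^sup>2)" by (rule complex_norm_square[symmetric])
    finally have "Re (Q (%p. w p \<oplus> z \<odot> v p) (%p. w p \<oplus> z \<odot> v p)) = Re (Q w w) + 2 * Re (z * Q v w) + (cmod z)\<^sup>2 * Re (Q v v)" by simp
    then show "0 <= Re (Q w w) + 2 * Re (z * Q v w) + (cmod z)\<^sup>2 * Re (Q v v)"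
      using Q_pos[of "%p. w p \<oplus> z \<odot> v p"] v w by (simp add: complex_nonneg_Reals_iff)
  qed (use Q_pos[of v] v in \<open>simp add: complex_nonneg_Reals_iff\<close>)
  also have "\<dots> <= 0" using z Q_pos[of w] w by (auto simp: complex_nonneg_Reals_iff mult_nonneg_nonpos)
  finally show ?thesis by simp
qed

lemma Q_single_right: assumes "!!p. v p \<in> carrier H" "k \<in> carrier H"
  shows "Q v (single p k) = (\<Sum>q\<in>UNIV. iprod H (A p q (v q)) k)"
proof -
  have "Q v (single p k) = (\<Sum>p'\<in>UNIV. if p' = p then \<Sum>q\<in>UNIV. iprod H (A p q (v q)) k else 0)"
    unfolding Q_def using assms by (intro sum.cong) (auto simp: single_def)
  then show ?thesis by simp
qed

lemma Q_single_left: assumes "!!p. w p \<in> carrier H" "h \<in> carrier H"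
  shows "Q (single q h) w = (\<Sum>p\<in>UNIV. iprod H (A p q h) (w p))"
proof -
  have "(\<Sum>q'\<in>UNIV. iprod H (A p q' (single q h q')) (w p)) = (\<Sum>q'\<in>UNIV. if q' = q then iprod H (A p q h) (w p) else 0)" for p
    using assms by (intro sum.cong) (auto simp: single_def)
  then show ?thesis by (simp add: Q_def)
qed

text \<open>Hermitian symmetry of \<open>Q\<close>, read on vectors supported in a single
  block.\<close>

lemma A_adjoint: assumes "h \<in> carrier H" "k \<in> carrier H" shows "iprod H (A p q h) k = iprod H h (A q p k)"
proof -
  have s: "Q (single q h) (single p k) = iprod H (A p q h) k" if "h \<in> carrier H" "k \<in> carrier H" for p q h k
    using that by (simp add: Q_single_left iprod_single)
  show ?thesis
    using Q_herm[of "single p k" "single q h"] assms by (simp add: s ip_cnj)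
qed

end

lemma (in hilbert_space) stochastic_blocks:
  fixes E :: "'x::finite => 'x => 'y::finite => 'y => 'a => 'a"
  assumes "stochastic_operator_matrix H E"
  shows "positive_blocks H (%p q. E (fst p) (fst q) (snd p) (snd q))"
proof unfold_locales
  have b: "bounded_operator H (E x x' a a')" for x x' a a' using assms by (simp add: stochastic_operator_matrix_def)
  show "E (fst p) (fst q) (snd p) (snd q) h \<in> carrier H" if "h \<in> carrier H" for p q h
    using b that unfolding bounded_operator_def by blast
  show "E (fst p) (fst q) (snd p) (snd q) (h \<oplus> k) = E (fst p) (fst q) (snd p) (snd q) h \<oplus> E (fst p) (fst q) (snd p) (snd q) k"
    if "h \<in> carrier H" "k \<in> carrier H" for p q h k
    using b that unfolding bounded_operator_def by blast
  show "E (fst p) (fst q) (snd p) (snd q) (c \<odot> h) = c \<odot> E (fst p) (fst q) (snd p) (snd q) h"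
    if "h \<in> carrier H" for p q h c
    using b that unfolding bounded_operator_def by blast
  fix v :: "'x \<times> 'y => 'a" assume v: "!!p. v p \<in> carrier H"
  have "ALL v. (ALL x a. v x a \<in> carrier H) --> (\<Sum>x\<in>UNIV. \<Sum>a\<in>UNIV. \<Sum>x'\<in>UNIV. \<Sum>a'\<in>UNIV.
             iprod H (E x x' a a' (v x' a')) (v x a)) \<in> \<real>\<^sub>\<ge>\<^sub>0" using assms unfolding stochastic_operator_matrix_def by blast
  from this[rule_format, of "%x a. v (x, a)"] show "(\<Sum>p\<in>UNIV. \<Sum>q\<in>UNIV. iprod H (E (fst p) (fst q) (snd p) (snd q) (v q)) (v p)) \<in> \<real>\<^sub>\<ge>\<^sub>0"
    using v by (simp add: sum_UNIV_pair)
qed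

locale stochastic = hilbert_space H for H :: "('h, 'm) hspace_scheme" (structure) +
  fixes E :: "'x::finite => 'x => 'x => 'x => 'h => 'h"
  assumes E: "stochastic_operator_matrix H E"
begin

sublocale P: positive_blocks H "%p q. E (fst p) (fst q) (snd p) (snd q)"
  by (rule stochastic_blocks[OF E])

lemma E_closed [simp]: "h \<in> carrier H ==> E x x' a a' h \<in> carrier H"
  using P.A_closed[of h "(x, a)" "(x', a')"] by simp

lemma E_add: "h \<in> carrier H ==> k \<in> carrier H ==> E x x' a a' (h \<oplus> k) = E x x' a a' h \<oplus> E x x' a a' k"
  using P.A_add[of h k "(x, a)" "(x', a')"] by simp

lemma E_smult: "h \<in> carrier H ==> E x x' a a' (c \<odot> h) = c \<odot> E x x' a a' h"
  using P.A_smult[of h "(x, a)" "(x', a')"] by simp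

lemma E_zero [simp]: "E x x' a a' \<zero> = \<zero>"
  using E_smult[of \<zero> x x' a a' 0] by simp

lemma E_adjoint: "h \<in> carrier H ==> k \<in> carrier H ==> iprod H (E x x' a a' h) k = iprod H h (E x' x a' a k)"
  using P.A_adjoint[of h k "(x, a)" "(x', a')"] by simp

lemma E_sum: "h \<in> carrier H ==> (\<Oplus>a\<in>UNIV. E x x' a a h) = (if x = x' then h else \<zero>)"
  using E unfolding stochastic_operator_matrix_def by blast

lemma E_sum_iprod: assumes "h \<in> carrier H" "k \<in> carrier H"
  shows "(\<Sum>a\<in>UNIV. iprod H (E x x' a a h) k) = (if x = x' then iprod H h k else 0)"
proof -
  have "(\<Sum>a\<in>UNIV. iprod H (E x x' a a h) k) = iprod H (\<Oplus>a\<in>UNIV. E x x' a a h) k"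
    using assms by (intro ip_finsum_left[symmetric]) auto
  then show ?thesis using assms by (simp add: E_sum)
qed

definition column :: "'x => ('x => 'h) => 'x \<times> 'x => 'h" where
  "column c h = (%q. if snd q = c then h (fst q) else \<zero>)"

lemma column_closed: "(!!y. h y \<in> carrier H) ==> column c h q \<in> carrier H" by (simp add: column_def)

lemma Q_column: assumes h: "!!y. h y \<in> carrier H" and w: "!!q. w q \<in> carrier H"
  shows "P.Q w (column c h) = (\<Sum>y\<in>UNIV. \<Sum>q\<in>UNIV. iprod H (E y (fst q) c (snd q) (w q)) (h y))"
    "P.Q (column c h) w = (\<Sum>p\<in>UNIV. \<Sum>y\<in>UNIV. iprod H (E (fst p) y (snd p) c (h y)) (w p))"
proof -
  have "P.Q w (column c h) = (\<Sum>y\<in>UNIV. \<Sum>b\<in>UNIV. if b = c then \<Sum>q\<in>UNIV. iprod H (E y (fst q) c (snd q) (w q)) (h y) else 0)"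
    unfolding P.Q_def sum_UNIV_pair[of "%p. \<Sum>q\<in>UNIV. _ p q"] using assms by (intro sum.cong) (auto simp: column_def)
  then show "P.Q w (column c h) = (\<Sum>y\<in>UNIV. \<Sum>q\<in>UNIV. iprod H (E y (fst q) c (snd q) (w q)) (h y))" by simp
  have "(\<Sum>q\<in>UNIV. iprod H (E (fst p) (fst q) (snd p) (snd q) (column c h q)) (w p)) =
      (\<Sum>y\<in>UNIV. \<Sum>b\<in>UNIV. if b = c then iprod H (E (fst p) y (snd p) c (h y)) (w p) else 0)" for p
    unfolding sum_UNIV_pair using assms by (intro sum.cong) (auto simp: column_def)
  then show "P.Q (column c h) w = (\<Sum>p\<in>UNIV. \<Sum>y\<in>UNIV. iprod H (E (fst p) y (snd p) c (h y)) (w p))"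
    by (simp add: P.Q_def)
qed

text \<open>If E_{x,x',a,a'} is written as V_{a,x}* V_{a',x'}, the stochastic condition says that
  the matrix V is an isometry; the sum over \<open>c\<close> is the squared norm of V h.\<close>

lemma sum_Q_column: assumes h: "!!y. h y \<in> carrier H"
  shows "(\<Sum>c\<in>UNIV. P.Q (column c h) (column c h)) = (\<Sum>y\<in>UNIV. iprod H (h y) (h y))"
proof -
  have "P.Q (column c h) (column c h) = (\<Sum>y\<in>UNIV. \<Sum>y'\<in>UNIV. iprod H (E y y' c c (h y')) (h y))" for c
  proof -
    have "(\<Sum>q\<in>UNIV. iprod H (E y (fst q) c (snd q) (column c h q)) (h y)) =
        (\<Sum>y'\<in>UNIV. \<Sum>b\<in>UNIV. if b = c then iprod H (E y y' c c (h y')) (h y) else 0)" for y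
      unfolding sum_UNIV_pair using h by (intro sum.cong) (auto simp: column_def)
    then show ?thesis unfolding Q_column(1)[OF h column_closed[OF h]] by simp
  qed
  then have "(\<Sum>c\<in>UNIV. P.Q (column c h) (column c h)) = (\<Sum>c\<in>UNIV. \<Sum>y\<in>UNIV. \<Sum>y'\<in>UNIV. iprod H (E y y' c c (h y')) (h y))" by simp
  also have "\<dots> = (\<Sum>y\<in>UNIV. \<Sum>c\<in>UNIV. \<Sum>y'\<in>UNIV. iprod H (E y y' c c (h y')) (h y))" by (rule sum.swap)
  also have "\<dots> = (\<Sum>y\<in>UNIV. \<Sum>y'\<in>UNIV. \<Sum>c\<in>UNIV. iprod H (E y y' c c (h y')) (h y))" by (intro sum.cong sum.swap refl)
  also have "\<dots> = (\<Sum>y\<in>UNIV. iprod H (h y) (h y))" using h by (simp add: E_sum_iprod)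
  finally show ?thesis .
qed

text \<open>With \<open>E = V\<^sup>* V\<close>, the vector \<open>single (x', a') \<xi> - column a h\<close> is \<open>(I - V V\<^sup>*) (V\<^bsub>a',x'\<^esub> \<xi> \<otimes> e\<^sub>a)\<close>;
  the estimate is \<open>V V\<^sup>* <= I\<close>, and its equality case makes \<open>V\<close> a coisometry on this vector.\<close>

lemma column_estimate:
  assumes \<xi>: "\<xi> \<in> carrier H"
  shows "(\<Sum>x\<in>UNIV. (hnorm H (E x x' a a' \<xi>))\<^sup>2) <= Re (iprod H (E x' x' a' a' \<xi>) \<xi>)"
    "(\<Sum>x\<in>UNIV. (hnorm H (E x x' a a' \<xi>))\<^sup>2) = Re (iprod H (E x' x' a' a' \<xi>) \<xi>)
      ==> (\<Oplus>x\<in>UNIV. E y x b c (E x x' a a' \<xi>)) = (if c = a then E y x' b a' \<xi> else \<zero>)"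
proof -
  define h where "h x = E x x' a a' \<xi>" for x
  have h: "h x \<in> carrier H" for x using \<xi> by (simp add: h_def)
  define w where "w = P.single (x', a') \<xi>"
  have w: "w p \<in> carrier H" for p using \<xi> by (simp add: w_def)
  define s where "s = (\<Sum>x\<in>UNIV. (hnorm H (h x))\<^sup>2)"
  define q where "q = Re (iprod H (E x' x' a' a' \<xi>) \<xi>)"
  have so: "(\<Sum>y\<in>UNIV. iprod H (h y) (h y)) = of_real s" using h by (simp add: s_def ip_self)
  note u = column_closed[of h, OF h]
  define v where "v = (%p. w p \<oplus> (-1) \<odot> column a h p)"
  have v: "v p \<in> carrier H" for p using w u by (simp add: v_def)
  have Qww: "Re (P.Q w w) = q" using \<xi> by (simp add: w_def P.Q_single_left P.iprod_single q_def del: Re_sum)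
  have Qwu: "P.Q w (column a h) = of_real s"
  proof -
    have "P.Q w (column a h) = (\<Sum>p\<in>UNIV. iprod H (E (fst p) x' (snd p) a' \<xi>) (column a h p))"
      unfolding w_def using \<xi> u by (simp add: P.Q_single_left)
    also have "\<dots> = (\<Sum>x\<in>UNIV. \<Sum>b\<in>UNIV. if b = a then iprod H (h x) (h x) else 0)"
      unfolding sum_UNIV_pair using \<xi> by (intro sum.cong) (auto simp: column_def h_def)
    finally show ?thesis by (simp add: so)
  qed
  have Quw: "P.Q (column a h) w = of_real s" using P.Q_herm[of w "column a h"] w u Qwu by simp
  have Qu: "0 <= Re (P.Q (column c h) (column c h))" for c using P.Q_pos[of "column c h"] u by (simp add: complex_nonneg_Reals_iff)
  have Qs: "(\<Sum>c\<in>UNIV. Re (P.Q (column c h) (column c h))) = s"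
    using arg_cong[where f = Re, OF sum_Q_column[of h]] h so by simp
  have Qus: "Re (P.Q (column c h) (column c h)) <= s" for c
    unfolding Qs[symmetric] by (rule member_le_sum) (use Qu in auto)
  have "P.Q v v = P.Q w w + cnj (-1) * P.Q w (column a h) + (-1) * (P.Q (column a h) w + cnj (-1) * P.Q (column a h) (column a h))"
    unfolding v_def using w u by (simp add: P.Q_add)
  then have Qv: "Re (P.Q v v) = q - 2 * s + Re (P.Q (column a h) (column a h))" using Qwu Quw Qww by simp
  \<comment> \<open>One column contributes at most the total \<open>s\<close>, so positivity yields
    \<open>0 <= q - 2 s + s\<close>.\<close>
  have "0 <= Re (P.Q v v)" using P.Q_pos[of v] v by (simp add: complex_nonneg_Reals_iff)
  then have le: "s <= q" using Qv Qus[of a] by simp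
  then show "(\<Sum>x\<in>UNIV. (hnorm H (E x x' a a' \<xi>))\<^sup>2) <= Re (iprod H (E x' x' a' a' \<xi>) \<xi>)" by (simp add: s_def q_def h_def)
  assume "(\<Sum>x\<in>UNIV. (hnorm H (E x x' a a' \<xi>))\<^sup>2) = Re (iprod H (E x' x' a' a' \<xi>) \<xi>)"
  then have eq: "s = q" by (simp add: s_def q_def h_def)
  have col: "P.Q (column c h) (P.single (y, b) k) = iprod H (\<Oplus>x\<in>UNIV. E y x b c (h x)) k" if k: "k \<in> carrier H" for c k
  proof -
    have "P.Q (column c h) (P.single (y, b) k) = (\<Sum>x\<in>UNIV. \<Sum>d\<in>UNIV. if d = c then iprod H (E y x b c (h x)) k else 0)"
      unfolding P.Q_single_right[OF u k] sum_UNIV_pair using h k by (intro sum.cong) (auto simp: column_def)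
    also have "\<dots> = iprod H (\<Oplus>x\<in>UNIV. E y x b c (h x)) k" using h k by (simp add: ip_finsum_left)
    finally show ?thesis .
  qed
  have fc: "(\<Oplus>x\<in>UNIV. E y x b c (h x)) \<in> carrier H" using h by (intro M.finsum_closed) auto
  show "(\<Oplus>x\<in>UNIV. E y x b c (E x x' a a' \<xi>)) = (if c = a then E y x' b a' \<xi> else \<zero>)"
  proof (cases "c = a")
    case True
    have "Re (P.Q v v) <= 0" using Qv Qus[of a] eq by simp
    have "iprod H (\<Oplus>x\<in>UNIV. E y x b a (h x)) k = iprod H (E y x' b a' \<xi>) k" if k: "k \<in> carrier H" for k
    proof -
      have "P.Q v (P.single (y, b) k) = 0" by (rule P.Q_null[OF v _ \<open>Re (P.Q v v) <= 0\<close>]) (use k in simp)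
      moreover have "P.Q v (P.single (y, b) k) = P.Q w (P.single (y, b) k) + (-1) * P.Q (column a h) (P.single (y, b) k)"
        unfolding v_def using w u k by (intro P.Q_add(1)) auto
      moreover have "P.Q w (P.single (y, b) k) = iprod H (E y x' b a' \<xi>) k"
        unfolding w_def using \<xi> k by (simp add: P.Q_single_left P.iprod_single)
      ultimately show ?thesis using col[OF k] by simp
    qed
    then show ?thesis using True fc \<xi> by (intro hilbert_eqI) (auto simp: h_def)
  next
    case False
    \<comment> \<open>In the equality case the column \<open>a\<close> already uses up the total
      \<open>s\<close>, so every other column has norm zero.\<close>
    have "0 <= Re (P.Q v v)" using P.Q_pos[of v] v by (simp add: complex_nonneg_Reals_iff)
    then have "Re (P.Q (column a h) (column a h)) = s" using Qv Qus[of a] eq by simp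
    moreover have "Re (P.Q (column a h) (column a h)) + Re (P.Q (column c h) (column c h)) <= s"
    proof -
      have "(\<Sum>d\<in>{a, c}. Re (P.Q (column d h) (column d h))) <= s" unfolding Qs[symmetric] by (rule sum_mono2) (use Qu in auto)
      then show ?thesis using False by simp
    qed
    ultimately have 0: "Re (P.Q (column c h) (column c h)) <= 0" by simp
    have "iprod H (\<Oplus>x\<in>UNIV. E y x b c (h x)) k = iprod H \<zero> k" if k: "k \<in> carrier H" for k
      using P.Q_null[OF u, of "P.single (y, b) k", OF _ 0] k col[OF k] by simp
    then have "(\<Oplus>x\<in>UNIV. E y x b c (h x)) = \<zero>" using fc by (intro hilbert_eqI) auto
    then show ?thesis using False by (simp add: h_def)
  qed
qed

text \<open>The column estimates are summed over x', a and a'. For fixed x' and a their right sides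
  add up to 1 over a', and x' and a range freely, whence the square of the cardinality. Equality of
  the sums forces equality in each estimate.\<close>

lemma total_estimate:
  assumes \<xi>: "\<xi> \<in> carrier H" "hnorm H \<xi> = 1"
  shows "(\<Sum>(x, x', a, a')\<in>UNIV. (hnorm H (E x x' a a' \<xi>))\<^sup>2) <= (real CARD('x))\<^sup>2"
    "(\<Sum>(x, x', a, a')\<in>UNIV. (hnorm H (E x x' a a' \<xi>))\<^sup>2) = (real CARD('x))\<^sup>2
      ==> (\<Oplus>x\<in>UNIV. E y x b c (E x x' a a' \<xi>)) = (if c = a then E y x' b a' \<xi> else \<zero>)"
proof -
  define s where "s x' a a' = (\<Sum>x\<in>UNIV. (hnorm H (E x x' a a' \<xi>))\<^sup>2)" for x' a a'
  define q where "q x' a' = Re (iprod H (E x' x' a' a' \<xi>) \<xi>)" for x' a'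
  have le: "s x' a a' <= q x' a'" for x' a a' using column_estimate(1)[OF \<xi>(1)] by (simp add: s_def q_def)
  have S: "(\<Sum>(x, x', a, a')\<in>UNIV. (hnorm H (E x x' a a' \<xi>))\<^sup>2) = (\<Sum>x'\<in>UNIV. \<Sum>a\<in>UNIV. \<Sum>a'\<in>UNIV. s x' a a')"
    unfolding s_def
  proof -
    have "(\<Sum>(x, x', a, a')\<in>UNIV. (hnorm H (E x x' a a' \<xi>))\<^sup>2) = (\<Sum>x\<in>UNIV. \<Sum>x'\<in>UNIV. \<Sum>a\<in>UNIV. \<Sum>a'\<in>UNIV. (hnorm H (E x x' a a' \<xi>))\<^sup>2)"
      by (simp add: sum_UNIV_pair)
    also have "\<dots> = (\<Sum>x'\<in>UNIV. \<Sum>x\<in>UNIV. \<Sum>a\<in>UNIV. \<Sum>a'\<in>UNIV. (hnorm H (E x x' a a' \<xi>))\<^sup>2)" by (rule sum.swap)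
    also have "\<dots> = (\<Sum>x'\<in>UNIV. \<Sum>a\<in>UNIV. \<Sum>x\<in>UNIV. \<Sum>a'\<in>UNIV. (hnorm H (E x x' a a' \<xi>))\<^sup>2)" by (intro sum.cong sum.swap refl)
    also have "\<dots> = (\<Sum>x'\<in>UNIV. \<Sum>a\<in>UNIV. \<Sum>a'\<in>UNIV. \<Sum>x\<in>UNIV. (hnorm H (E x x' a a' \<xi>))\<^sup>2)" by (intro sum.cong sum.swap refl)
    finally show "(\<Sum>(x, x', a, a')\<in>UNIV. (hnorm H (E x x' a a' \<xi>))\<^sup>2) = (\<Sum>x'\<in>UNIV. \<Sum>a\<in>UNIV. \<Sum>a'\<in>UNIV. \<Sum>x\<in>UNIV. (hnorm H (E x x' a a' \<xi>))\<^sup>2)" .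
  qed
  have "(\<Sum>a'\<in>UNIV. q x' a') = 1" for x'
  proof -
    have "(\<Sum>a'\<in>UNIV. q x' a') = Re (\<Sum>a'\<in>UNIV. iprod H (E x' x' a' a' \<xi>) \<xi>)" by (simp add: q_def)
    also have "\<dots> = 1" using \<xi> hnorm_sq[OF \<xi>(1)] by (simp add: E_sum_iprod)
    finally show ?thesis .
  qed
  then have N: "(\<Sum>x'\<in>UNIV. \<Sum>a\<in>(UNIV :: 'x set). \<Sum>a'\<in>UNIV. q x' a') = (real CARD('x))\<^sup>2" by (simp add: power2_eq_square)
  show "(\<Sum>(x, x', a, a')\<in>UNIV. (hnorm H (E x x' a a' \<xi>))\<^sup>2) <= (real CARD('x))\<^sup>2"
    unfolding S N[symmetric] by (intro sum_mono le)
  assume "(\<Sum>(x, x', a, a')\<in>UNIV. (hnorm H (E x x' a a' \<xi>))\<^sup>2) = (real CARD('x))\<^sup>2"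
  then have "(\<Sum>x'\<in>UNIV. \<Sum>a\<in>UNIV. \<Sum>a'\<in>UNIV. q x' a' - s x' a a') = 0"
    unfolding S using N by (simp add: sum_subtractf)
  then have "q x' a' - s x' a a' = 0"
    using le by (simp add: sum_nonneg_eq_0_iff sum_nonneg)
  then show "(\<Oplus>x\<in>UNIV. E y x b c (E x x' a a' \<xi>)) = (if c = a then E y x' b a' \<xi> else \<zero>)"
    using column_estimate(2)[OF \<xi>(1)] by (simp add: q_def s_def)
qed

end

text \<open>The sum in \<open>total\<close> is |X|^2 times the trace of \<open>\<Gamma> J J\<close>
  for the maximally entangled projection J and the correlation \<Gamma> of the pair; the hypothesis
  says that this trace is 1.\<close>

locale commuting_pair = E: stochastic H E + F: stochastic H F
  for H :: "('h, 'm) hspace_scheme" (structure) and E F :: "'x::finite => 'x => 'x => 'x => 'h => 'h" +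
  fixes \<xi> :: 'h
  assumes comm: "h \<in> carrier H ==> E x x' a a' (F y y' b b' h) = F y y' b b' (E x x' a a' h)"
    and \<xi>: "\<xi> \<in> carrier H" "hnorm H \<xi> = 1"
    and total: "(\<Sum>(x, x', a, a')\<in>UNIV. iprod H (E x x' a a' (F x x' a a' \<xi>)) \<xi>) = (of_nat CARD('x))\<^sup>2"
begin

text \<open>The squared norms of the vectors \<open>F_g \<xi> - E_g* \<xi>\<close> add up to at most
  \<open>N + N - 2 N\<close> for \<open>N = |X|^2\<close>, by \<open>total_estimate\<close> for both
  matrices and by \<open>total\<close>; here \<open>gstar\<close> permutes the letters. So all these
  vectors vanish, and \<open>E\<close> attains its bound.\<close>

lemma transfer: "F x x' a a' \<xi> = E x' x a' a \<xi>"
  and E_total: "(\<Sum>(x, x', a, a')\<in>UNIV. (hnorm H (E x x' a a' \<xi>))\<^sup>2) = (real CARD('x))\<^sup>2"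
proof -
  define d where "d g = (case g of (x, x', a, a') => (hnorm H (F x x' a a' \<xi> \<ominus> E x' x a' a \<xi>))\<^sup>2)" for g
  define e where "e g = (case g of (x, x', a, a') => (hnorm H (E x x' a a' \<xi>))\<^sup>2)" for g
  define f where "f g = (case g of (x, x', a, a') => (hnorm H (F x x' a a' \<xi>))\<^sup>2)" for g
  define r where "r g = (case g of (x, x', a, a') => Re (iprod H (E x x' a a' (F x x' a a' \<xi>)) \<xi>))" for g
  have "d g = f g + e (gstar g) - 2 * r g" for g
  proof -
    obtain x x' a a' where g: "g = (x, x', a, a')" by (cases g)
    let ?f = "F x x' a a' \<xi>" and ?e = "E x' x a' a \<xi>"
    have c: "?f \<in> carrier H" "?e \<in> carrier H" using \<xi> by auto
    have "iprod H (E x x' a a' ?f) \<xi> = iprod H ?f ?e" using E.E_adjoint[OF c(1) \<xi>(1)] .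
    moreover have "Re (iprod H ?e ?f) = Re (iprod H ?f ?e)" using E.ip_cnj[OF c] by (metis cnj.simps(1))
    ultimately show ?thesis
      using c by (simp add: g d_def e_def f_def r_def E.hnorm_sq E.ip_minus_left E.ip_minus_right)
  qed
  then have "(\<Sum>g\<in>UNIV. d g) = (\<Sum>g\<in>UNIV. f g) + (\<Sum>g\<in>UNIV. e (gstar g)) - 2 * (\<Sum>g\<in>UNIV. r g)"
    by (simp add: sum.distrib sum_subtractf sum_distrib_left)
  moreover have "(\<Sum>g\<in>UNIV. e (gstar g)) = (\<Sum>g\<in>UNIV. e g)"
    by (rule sum.reindex_bij_witness[of _ gstar gstar]) auto
  moreover have "(\<Sum>g\<in>UNIV. r g) = (real CARD('x))\<^sup>2"
  proof -
    have "(\<Sum>g\<in>UNIV. r g) = Re (\<Sum>(x, x', a, a')\<in>UNIV. iprod H (E x x' a a' (F x x' a a' \<xi>)) \<xi>)"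
      by (simp add: r_def case_prod_unfold)
    then show ?thesis unfolding total by (simp add: power2_eq_square)
  qed
  moreover have ee: "(\<Sum>g\<in>UNIV. e g) <= (real CARD('x))\<^sup>2" using E.total_estimate(1)[OF \<xi>] by (simp add: e_def case_prod_unfold)
  moreover have "(\<Sum>g\<in>UNIV. f g) <= (real CARD('x))\<^sup>2" using F.total_estimate(1)[OF \<xi>] by (simp add: f_def case_prod_unfold)
  moreover have d0: "0 <= d g" for g by (auto simp: d_def split: prod.split)
  moreover have "0 <= (\<Sum>g\<in>UNIV. d g)" by (rule sum_nonneg) (rule d0)
  ultimately have "(\<Sum>g\<in>UNIV. d g) = 0" "(\<Sum>g\<in>UNIV. e g) = (real CARD('x))\<^sup>2" by auto
  then have dz: "d g = 0" for g using iffD1[OF sum_nonneg_eq_0_iff[of UNIV d], rule_format, OF finite d0] \<open>(\<Sum>g\<in>UNIV. d g) = 0\<close> by blast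
  have "hnorm H (F x x' a a' \<xi> \<ominus> E x' x a' a \<xi>) = 0" using dz[of "(x, x', a, a')"] by (simp add: d_def)
  then show "F x x' a a' \<xi> = E x' x a' a \<xi>" using \<xi> by (intro E.eq_of_minus) auto
  show "(\<Sum>(x, x', a, a')\<in>UNIV. (hnorm H (E x x' a a' \<xi>))\<^sup>2) = (real CARD('x))\<^sup>2"
    using \<open>(\<Sum>g\<in>UNIV. e g) = _\<close> by (simp add: e_def case_prod_unfold)
qed

definition EL :: "'x letter => 'h => 'h" where "EL = (%(x, x', a, a'). E x x' a a')"
definition EW :: "'x letter list => 'h => 'h" where "EW w h = foldr EL w h"
definition t :: "'x letter list => complex" where "t w = iprod H (EW w \<xi>) \<xi>"

lemma EL_simp [simp]: "EL (x, x', a, a') = E x x' a a'" by (simp add: EL_def)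
lemma EL_closed [simp]: "h \<in> carrier H ==> EL g h \<in> carrier H" by (cases g) simp
lemma EW_simps [simp]: "EW [] h = h" "EW (g # w) h = EL g (EW w h)" by (auto simp: EW_def)
lemma EW_closed [simp]: "h \<in> carrier H ==> EW w h \<in> carrier H" by (induct w) auto
lemma EW_append: "EW (v @ w) h = EW v (EW w h)" by (induct v) auto

lemma EL_adjoint: "h \<in> carrier H ==> k \<in> carrier H ==> iprod H (EL g h) k = iprod H h (EL (gstar g) k)"
  by (cases g) (simp add: E.E_adjoint)

lemma EW_adjoint: "h \<in> carrier H ==> k \<in> carrier H ==> iprod H (EW w h) k = iprod H h (EW (wstar w) k)"
  by (induct w arbitrary: k) (auto simp: EL_adjoint EW_append)

definition FL :: "'x letter => 'h => 'h" where "FL = (%(x, x', a, a'). F x x' a a')"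

lemma FL_closed [simp]: "h \<in> carrier H ==> FL g h \<in> carrier H" by (cases g) (simp add: FL_def)
lemma EL_FL: "h \<in> carrier H ==> EL g (FL g' h) = FL g' (EL g h)" by (cases g, cases g') (simp add: FL_def comm)
lemma EW_FL: "h \<in> carrier H ==> EW w (FL g' h) = FL g' (EW w h)" by (induct w) (auto simp: EL_FL)
lemma FL_\<xi>: "FL g \<xi> = EL (gstar g) \<xi>" by (cases g) (simp add: FL_def transfer)
lemma FL_adjoint: "h \<in> carrier H ==> k \<in> carrier H ==> iprod H (FL g h) k = iprod H h (FL (gstar g) k)"
  by (cases g) (simp add: FL_def F.E_adjoint)

lemma EW_snoc: "EW (w @ [g]) \<xi> = FL (gstar g) (EW w \<xi>)"
  using FL_\<xi>[of "gstar g"] EW_FL[OF \<xi>(1), of w "gstar g"] by (simp add: EW_append)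

text \<open>At \<open>\<xi>\<close> this is the equality case of \<open>total_estimate\<close>. A
  letter appended on the right of the word acts as an operator \<open>F\<close>
  (\<open>EW_snoc\<close>), which commutes with every \<open>E\<close>, so the induction adds
  letters on that side.\<close>

lemma relations: "(\<Oplus>x\<in>UNIV. E y x b c (E x y' a b' (EW w \<xi>))) = (if c = a then E y y' b b' (EW w \<xi>) else \<zero>)"
proof (induct w rule: rev_induct)
  case Nil
  show ?case using E.total_estimate(2)[OF \<xi> E_total] by simp
next
  case (snoc g w)
  let ?h = "EW w \<xi>" and ?F = "FL (gstar g)"
  have h: "?h \<in> carrier H" using \<xi> by simp
  have l: "iprod H (?F h) k = iprod H h (FL g k)" if "h \<in> carrier H" "k \<in> carrier H" for h k
    using FL_adjoint[OF that, of "gstar g"] by simp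
  have c: "E y x b c (E x y' a b' (?F ?h)) = ?F (E y x b c (E x y' a b' ?h))" for y x b c y' a b'
    using EL_FL[of ?h "(x, y', a, b')" "gstar g"] EL_FL[of "E x y' a b' ?h" "(y, x, b, c)" "gstar g"] h by simp
  have s: "(\<Oplus>x\<in>UNIV. ?F (E y x b c (E x y' a b' ?h))) = ?F (\<Oplus>x\<in>UNIV. E y x b c (E x y' a b' ?h))"
  proof (rule E.hilbert_eqI)
    have cl: "(%x. E y x b c (E x y' a b' ?h)) \<in> UNIV \<rightarrow> carrier H" using h by auto
    show "(\<Oplus>x\<in>UNIV. ?F (E y x b c (E x y' a b' ?h))) \<in> carrier H" using h by (intro E.M.finsum_closed) auto
    show "?F (\<Oplus>x\<in>UNIV. E y x b c (E x y' a b' ?h)) \<in> carrier H" using cl by simp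
    fix z assume z: "z \<in> carrier H"
    show "iprod H (\<Oplus>x\<in>UNIV. ?F (E y x b c (E x y' a b' ?h))) z = iprod H (?F (\<Oplus>x\<in>UNIV. E y x b c (E x y' a b' ?h))) z"
      using h z cl by (simp add: E.ip_finsum_left l)
  qed
  have F0: "?F \<zero> = \<zero>" by (rule E.hilbert_eqI) (auto simp: l)
  have "E y y' b b' (?F ?h) = ?F (E y y' b b' ?h)" using EL_FL[of ?h "(y, y', b, b')" "gstar g"] h by simp
  then show ?case unfolding EW_snoc c s snoc by (simp add: F0)
qed

definition LV :: "(complex \<times> 'x letter list) list => 'h" where
  "LV v = foldr (%(a, w) z. a \<odot> EW w \<xi> \<oplus> z) v \<zero>"

lemma LV_simps [simp]: "LV [] = \<zero>" "LV ((a, w) # v) = a \<odot> EW w \<xi> \<oplus> LV v" by (auto simp: LV_def)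
lemma LV_closed [simp]: "LV v \<in> carrier H" using \<xi> by (induct v) auto

lemma t_product: "t (wstar v @ w) = iprod H (EW w \<xi>) (EW v \<xi>)"
  using EW_adjoint[of "EW w \<xi>" \<xi> "wstar v"] \<xi> by (simp add: t_def EW_append)

lemma word_trace: "word_trace t"
proof
  have k: "kfun (wkernel t) v w = iprod H (LV v) (EW w \<xi>)" for v w
    using \<xi> by (induct v) (auto simp: wkernel_def t_product E.ip_simps)
  have l: "lip (wkernel t) v w = iprod H (LV v) (LV w)" for v w
    using \<xi> by (induct w) (auto simp: k E.ip_simps)
  show "lip (wkernel t) r r \<in> \<real>\<^sub>\<ge>\<^sub>0" for r unfolding l by (rule E.iprod_nonneg) simp
  show "t [] = 1" using \<xi> E.ip_self[OF \<xi>(1)] by (simp add: t_def)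
  \<comment> \<open>Move \<open>E_g\<close> to the other side of the inner product, replace
    \<open>E_g* \<xi>\<close> by \<open>F_g \<xi>\<close>, move \<open>F_g\<close> back, and absorb
    it as a letter at the end of the word.\<close>
  have rot: "t (g # w) = t (w @ [g])" for g w
  proof -
    have "t (g # w) = iprod H (EW w \<xi>) (EL (gstar g) \<xi>)" using \<xi> by (simp add: t_def EL_adjoint)
    also have "\<dots> = iprod H (FL (gstar g) (EW w \<xi>)) \<xi>"
      using FL_adjoint[of "EW w \<xi>" \<xi> "gstar g"] FL_\<xi>[of g] \<xi> by simp
    also have "\<dots> = t (w @ [g])" by (simp add: t_def EW_snoc)
    finally show ?thesis .
  qed
  show "t (u @ v) = t (v @ u)" for u v
  proof (induct u arbitrary: v)
    case (Cons g u)
    have "t ((g # u) @ v) = t (u @ (v @ [g]))" using rot[of g "u @ v"] by simp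
    also have "\<dots> = t ((v @ [g]) @ u)" by (rule Cons)
    finally show ?case by simp
  qed simp
  show "(\<Sum>a\<in>UNIV. t (u @ (x, x', a, a) # v)) = (if x = x' then t (u @ v) else 0)" for u x x' v
    using E.E_sum_iprod[of "EW v \<xi>" "EW (wstar u) \<xi>" x x'] \<xi> EW_adjoint[of "EW v \<xi>" \<xi> u]
    by (simp add: t_def EW_append EW_adjoint[of _ \<xi>])
  show "(\<Sum>x\<in>UNIV. t (u @ (y, x, b, c) # (x, y', a, b') # v)) = (if c = a then t (u @ (y, y', b, b') # v) else 0)"
    for u y b c y' a b' v
  proof -
    let ?k = "EW (wstar u) \<xi>"
    have cl: "(%x. E y x b c (E x y' a b' (EW v \<xi>))) \<in> UNIV \<rightarrow> carrier H" "?k \<in> carrier H" using \<xi> by auto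
    have "(\<Sum>x\<in>UNIV. t (u @ (y, x, b, c) # (x, y', a, b') # v)) = (\<Sum>x\<in>UNIV. iprod H (E y x b c (E x y' a b' (EW v \<xi>))) ?k)"
      using \<xi> by (simp add: t_def EW_append EW_adjoint[of _ \<xi>])
    also have "\<dots> = iprod H (\<Oplus>x\<in>UNIV. E y x b c (E x y' a b' (EW v \<xi>))) ?k" by (rule E.ip_finsum_left[OF cl, symmetric])
    finally show ?thesis unfolding relations using \<xi> by (simp add: t_def EW_append EW_adjoint[of _ \<xi>])
  qed
qed

lemma t_value: "t [(x, x', a, a'), (y', y, b', b)] = iprod H (E x x' a a' (F y y' b b' \<xi>)) \<xi>"
  by (simp add: t_def transfer)

lemma t_finite_rank:
  assumes "finite S" "!!h k. h \<in> carrier H ==> k \<in> carrier H ==> iprod H h k = (\<Sum>s\<in>S. \<phi> s h * \<psi> s k)"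
  shows "finite_rank t"
  using assms \<xi> by (intro finite_rankI[of S t "%s v. \<psi> s (EW v \<xi>)"]) (auto simp: t_product)

lemma t_comm:
  assumes "!!g g' h. h \<in> carrier H ==> EL g (EL g' h) = EL g' (EL g h)"
  shows "comm_trace t"
proof -
  have "EW u (EL g h) = EL g (EW u h)" if "h \<in> carrier H" for u g h
    using that by (induct u) (auto simp: assms)
  then show ?thesis using \<xi> by (simp add: comm_trace_def t_def EW_append)
qed

end

section \<open>Orthonormal bases\<close>

definition orthonormal :: "('h, 'm) hspace_scheme => 'h set => bool" where
  "orthonormal H B \<longleftrightarrow> finite B & B \<subseteq> carrier H & (\<forall>b\<in>B. \<forall>c\<in>B. iprod H b c = (if b = c then 1 else 0))"

text \<open>Completeness of the system is stated as Parseval's identity, the form in which it is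
  applied.\<close>

definition orthonormal_basis :: "('h, 'm) hspace_scheme => 'h set => bool" where
  "orthonormal_basis H B \<longleftrightarrow> orthonormal H B
     & (\<forall>h\<in>carrier H. \<forall>k\<in>carrier H. iprod H h k = (\<Sum>b\<in>B. iprod H h b * iprod H b k))"

context hilbert_space
begin

lemma finsum_subspace:
  assumes V: "V \<subseteq> carrier H" "V ~= {}" "!!x y. x \<in> V ==> y \<in> V ==> x \<oplus> y \<in> V" "!!c x. x \<in> V ==> c \<odot> x \<in> V"
    and f: "!!b. b \<in> B ==> f b \<in> V"
  shows "finsum H f B \<in> V"
proof -
  obtain v where v: "v \<in> V" using V by blast
  then have "0 \<odot> v \<in> V" "v \<in> carrier H" using V by auto
  then have z: "\<zero> \<in> V" by simp
  show ?thesis using f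
  proof (induct B rule: infinite_finite_induct)
    case (insert b B)
    then have "f \<in> B \<rightarrow> carrier H" "f b \<in> carrier H" using V by auto
    then show ?case using insert V by (simp add: M.finsum_insert)
  qed (auto simp: z)
qed

lemma iprod_residual:
  assumes B: "orthonormal H B" and s: "s \<in> carrier H" and b: "b \<in> B"
  shows "iprod H (s \<ominus> (\<Oplus>c\<in>B. iprod H s c \<odot> c)) b = 0"
proof -
  have c: "(%c. iprod H s c \<odot> c) \<in> B \<rightarrow> carrier H" "b \<in> carrier H" using B b by (auto simp: orthonormal_def)
  have "(\<Sum>c\<in>B. iprod H (iprod H s c \<odot> c) b) = (\<Sum>c\<in>B. if c = b then iprod H s b else 0)"
    using B b by (intro sum.cong) (auto simp: orthonormal_def ip_simps subset_iff)
  then show ?thesis using c s b B M.finsum_closed[OF c(1)]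
    by (simp add: ip_minus_left ip_finsum_left orthonormal_def)
qed

text \<open>The new vectors stay in the subspace \<open>V\<close>, in one use the orbit of a vector
  under an algebra, and \<open>B0\<close> is kept, so that a prescribed unit vector remains in the
  system. That \<open>S\<close> is spanned is expressed through orthogonal complements.\<close>

lemma gram_schmidt:
  assumes V: "V \<subseteq> carrier H" "!!x y. x \<in> V ==> y \<in> V ==> x \<oplus> y \<in> V" "!!c x. x \<in> V ==> c \<odot> x \<in> V"
    and B0: "orthonormal H B0" "B0 \<subseteq> V" and S: "finite S" "S \<subseteq> V"
  shows "EX B. B0 \<subseteq> B & B \<subseteq> V & orthonormal H B
    & (\<forall>h\<in>carrier H. (\<forall>b\<in>B. iprod H h b = 0) --> (\<forall>s\<in>S. iprod H h s = 0))"
  using S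
proof (induct S rule: finite_induct)
  case empty
  show ?case using B0 by (intro exI[of _ B0]) auto
next
  case (insert s S)
  then obtain B where B: "B0 \<subseteq> B" "B \<subseteq> V" "orthonormal H B"
    and P: "!!h s. h \<in> carrier H ==> (!!b. b \<in> B ==> iprod H h b = 0) ==> s \<in> S ==> iprod H h s = 0" by auto
  define p where "p = (\<Oplus>c\<in>B. iprod H s c \<odot> c)"
  define r where "r = s \<ominus> p"
  have s: "s \<in> V" "s \<in> carrier H" using insert V by auto
  have pV: "p \<in> V" unfolding p_def by (rule finsum_subspace) (use V s B in auto)
  then have pc: "p \<in> carrier H" using V by auto
  have rV: "r \<in> V" "r \<in> carrier H" unfolding r_def using minus_csm[OF s(2) pc] V pV s by auto
  have rb: "iprod H r b = 0" "iprod H b r = 0" if "b \<in> B" for b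
    using iprod_residual[OF B(3) s(2) that] ip_cnj[of r b] rV that V B by (auto simp: r_def p_def)
  have hp: "iprod H h p = 0" if "h \<in> carrier H" "!!b. b \<in> B ==> iprod H h b = 0" for h
  proof -
    have "(%c. iprod H s c \<odot> c) \<in> B \<rightarrow> carrier H" using B V by auto
    then show ?thesis unfolding p_def using that B V by (simp add: ip_finsum_right ip_smult_right subset_iff)
  qed
  have sr: "s = r \<oplus> p" unfolding r_def using s pc by (simp add: add_minus_self)
  have hs: "iprod H h s = iprod H h r" if "h \<in> carrier H" "!!b. b \<in> B ==> iprod H h b = 0" for h
    using hp[OF that] that(1) rV pc by (subst sr) (simp add: ip_add_right)
  show ?case
  proof (cases "r = \<zero>")
    case True
    have "iprod H h s' = 0" if "h \<in> carrier H" "\<forall>b\<in>B. iprod H h b = 0" "s' \<in> insert s S" for h s'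
      using that P[of h s'] hs[of h] True by auto
    then show ?thesis using B by blast
  next
    case False
    define k where "k = complex_of_real (1 / hnorm H r) \<odot> r"
    have n: "hnorm H r > 0" using False rV(2) hnorm_nonneg[OF rV(2)] N_definite[OF rV(2)] by (cases "hnorm H r = 0") auto
    have k: "k \<in> V" "k \<in> carrier H" using rV V by (auto simp: k_def)
    have kk: "iprod H k k = 1" using rV n ip_self[of r] by (simp add: k_def ip_simps power2_eq_square)
    have kb: "iprod H k b = 0" "iprod H b k = 0" if "b \<in> B" for b
      using rb[OF that] rV that B V by (auto simp: k_def ip_simps subset_iff)
    have B': "orthonormal H (insert k B)" using B k kk kb by (auto simp: orthonormal_def)
    have "iprod H h s' = 0" if h: "h \<in> carrier H" "\<forall>b\<in>insert k B. iprod H h b = 0" "s' \<in> insert s S" for h s'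
    proof (cases "s' = s")
      case True
      have "iprod H h r = 0" using h n rV by (auto simp: k_def ip_simps)
      then show ?thesis using hs[of h] h True by auto
    qed (use h P[of h s'] in auto)
    then show ?thesis using B B' k by (intro exI[of _ "insert k B"]) blast
  qed
qed

text \<open>The difference of \<open>h\<close> and its expansion is orthogonal to \<open>B\<close>,
  so \<open>sep\<close> makes it vanish.\<close>

lemma orthonormal_basisI:
  assumes B: "orthonormal H B" and sep: "!!h. h \<in> carrier H ==> (!!b. b \<in> B ==> iprod H h b = 0) ==> h = \<zero>"
  shows "orthonormal_basis H B"
  unfolding orthonormal_basis_def
proof (intro conjI B ballI)
  fix h k assume hk: "h \<in> carrier H" "k \<in> carrier H"
  define p where "p = (\<Oplus>c\<in>B. iprod H h c \<odot> c)"
  have c: "(%c. iprod H h c \<odot> c) \<in> B \<rightarrow> carrier H" using B by (auto simp: orthonormal_def)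
  then have pc: "p \<in> carrier H" unfolding p_def by (rule M.finsum_closed)
  have "h \<ominus> p = \<zero>" using hk pc iprod_residual[OF B hk(1)] by (intro sep) (auto simp: p_def)
  then have "h = p" using hk pc by (intro eq_of_minus) simp_all
  then have "iprod H h k = iprod H p k" by simp
  also have "\<dots> = (\<Sum>b\<in>B. iprod H h b * iprod H b k)"
    unfolding p_def ip_finsum_left[OF c hk(2)] using B hk by (intro sum.cong) (auto simp: orthonormal_def ip_simps)
  finally show "iprod H h k = (\<Sum>b\<in>B. iprod H h b * iprod H b k)" .
qed

lemma finite_dimensional_orthonormal_basis:
  assumes "finite_dimensional H"
  obtains B where "orthonormal_basis H B"
proof -
  obtain S where S: "finite S" "S \<subseteq> carrier H" "!!x. x \<in> carrier H ==> EX c. x = (\<Oplus>s\<in>S. c s \<odot> s)"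
    using assms by (auto simp: finite_dimensional_def)
  have "EX B. {} \<subseteq> B & B \<subseteq> carrier H & orthonormal H B
      & (\<forall>h\<in>carrier H. (\<forall>b\<in>B. iprod H h b = 0) --> (\<forall>s\<in>S. iprod H h s = 0))"
    by (rule gram_schmidt[OF subset_refl _ _ _ empty_subsetI S(1,2)]) (simp_all add: orthonormal_def)
  then obtain B where B: "orthonormal H B"
    "\<forall>h\<in>carrier H. (\<forall>b\<in>B. iprod H h b = 0) --> (\<forall>s\<in>S. iprod H h s = 0)" by (elim exE conjE)
  have "orthonormal_basis H B"
  proof (rule orthonormal_basisI[OF B(1)])
    fix h assume h: "h \<in> carrier H" "!!b. b \<in> B ==> iprod H h b = 0"
    obtain c where c: "h = (\<Oplus>s\<in>S. c s \<odot> s)" using S(3)[OF h(1)] by (elim exE)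
    have cl: "(%s. c s \<odot> s) \<in> S \<rightarrow> carrier H" using S by auto
    have "iprod H h h = iprod H h (\<Oplus>s\<in>S. c s \<odot> s)" using c by simp
    also have "\<dots> = (\<Sum>s\<in>S. iprod H h (c s \<odot> s))" by (rule ip_finsum_right[OF cl h(1)])
    also have "\<dots> = 0" using B(2) h S(2) by (intro sum.neutral) (auto simp: ip_simps)
    finally show "h = \<zero>" using h iprod_definite by blast
  qed
  then show ?thesis by (rule that)
qed

lemma orthonormal_basisD: assumes "orthonormal_basis H B"
  shows "finite B" "b \<in> B ==> b \<in> carrier H" "b \<in> B ==> c \<in> B ==> iprod H b c = (if b = c then 1 else 0)"
    "h \<in> carrier H ==> k \<in> carrier H ==> iprod H h k = (\<Sum>b\<in>B. iprod H h b * iprod H b k)"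
  using assms by (auto simp: orthonormal_basis_def orthonormal_def)

lemma bounded_operatorD: assumes "bounded_operator H T"
  shows "x \<in> carrier H ==> T x \<in> carrier H" "x \<in> carrier H ==> y \<in> carrier H ==> T (x \<oplus> y) = T x \<oplus> T y"
    "x \<in> carrier H ==> T (c \<odot> x) = c \<odot> T x" "EX C. \<forall>x\<in>carrier H. hnorm H (T x) <= C * hnorm H x"
  using assms by (auto simp: bounded_operator_def)

lemma bounded_operator_zero: "bounded_operator H T ==> T \<zero> = \<zero>"
  using bounded_operatorD(3)[of T \<zero> 0] bounded_operatorD(1)[of T \<zero>] by simp

lemma bounded_operator_finsum:
  assumes "bounded_operator H T" "f \<in> A \<rightarrow> carrier H"
  shows "T (finsum H f A) = (\<Oplus>a\<in>A. T (f a))"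
  using assms(2)
proof (induct A rule: infinite_finite_induct)
  case (insert a A)
  then have "f \<in> A \<rightarrow> carrier H" "f a \<in> carrier H" "(%a. T (f a)) \<in> A \<rightarrow> carrier H" "T (f a) \<in> carrier H"
    using bounded_operatorD(1)[OF assms(1)] by auto
  then show ?case using insert bounded_operatorD(2)[OF assms(1)] by (simp add: M.finsum_insert)
qed (auto simp: bounded_operator_zero[OF assms(1)])

lemma bounded_operator_sum:
  assumes "finite A" "!!a. a \<in> A ==> bounded_operator H (T a)"
  shows "bounded_operator H (%x. \<Oplus>a\<in>A. T a x)"
  using assms
proof (induct A rule: finite_induct)
  case empty
  have "hnorm H \<zero> = 0" by simp
  then show ?case by (auto simp: bounded_operator_def intro!: exI[of _ 0])
next
  case (insert a A)
  note D = bounded_operatorD[OF insert(4), OF insertI1]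
  have c: "(%a. T a x) \<in> A \<rightarrow> carrier H" if "x \<in> carrier H" for x
    using that bounded_operatorD(1)[OF insert(4)] by auto
  have I: "bounded_operator H (%x. \<Oplus>a\<in>A. T a x)" using insert by auto
  note D' = bounded_operatorD[OF I]
  have e: "(\<Oplus>b\<in>insert a A. T b x) = T a x \<oplus> (\<Oplus>b\<in>A. T b x)" if "x \<in> carrier H" for x
    using c[OF that] D(1)[OF that] insert(1,2) by (simp add: M.finsum_insert)
  obtain C C' where "!!x. x \<in> carrier H ==> hnorm H (T a x) <= C * hnorm H x"
    "!!x. x \<in> carrier H ==> hnorm H (\<Oplus>b\<in>A. T b x) <= C' * hnorm H x" using D(4) D'(4) by auto
  then have "hnorm H (T a x \<oplus> (\<Oplus>b\<in>A. T b x)) <= (C + C') * hnorm H x" if "x \<in> carrier H" for x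
    using order_trans[OF N_triangle[OF D(1)[OF that] D'(1)[OF that]] add_mono] that by (simp add: distrib_right)
  then have "EX C. \<forall>x\<in>carrier H. hnorm H (T a x \<oplus> (\<Oplus>b\<in>A. T b x)) <= C * hnorm H x" by blast
  then show ?case unfolding bounded_operator_def using D(1-3) D'(1-3)
    by (auto simp: e M.a_ac smult_r_distr)
qed

end

section \<open>Correlations given by tensor products\<close>

text \<open>The aim is to turn a tensor product correlation into a commuting pair on
  \<open>K\<close>, to which the maximality argument applies. \<open>K\<close> is known only through
  elementary tensors; the orthonormal basis \<open>C\<close> of the second factor lets its vectors
  be treated as families of vectors of \<open>H1\<close>.\<close>

locale tensor_blocks = K: hilbert_space K + H2: hilbert_space H2 + E: stochastic H1 E + F: stochastic H2 F
  for K :: "'h hspace" and H1 H2 :: "'h hspace" and E F :: "'x::finite => 'x => 'x => 'x => 'h => 'h" +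
  fixes t :: "'h => 'h => 'h" and G C
  assumes t: "is_tensor_product H1 H2 K t" and C: "orthonormal_basis H2 C"
    and G: "is_operator_tensor H1 H2 K t (E x x' a a') (F y y' b b') (G x x' a a' y y' b b')"
begin

lemma t_closed [simp]: "h \<in> carrier H1 ==> k \<in> carrier H2 ==> t h k \<in> carrier K"
  and t_iprod: "h \<in> carrier H1 ==> h' \<in> carrier H1 ==> k \<in> carrier H2 ==> k' \<in> carrier H2
    ==> iprod K (t h k) (t h' k') = iprod H1 h h' * iprod H2 k k'"
  and t_span: "z \<in> carrier K ==> \<exists>(n::nat) f g. f \<in> {..<n} \<rightarrow> carrier H1 & g \<in> {..<n} \<rightarrow> carrier H2
          & z = (\<Oplus>\<^bsub>K\<^esub>i\<in>{..<n}. t (f i) (g i))"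
  using t unfolding is_tensor_product_def by blast+

lemma G_bounded: "bounded_operator K (G x x' a a' y y' b b')"
  and G_apply: "h \<in> carrier H1 ==> k \<in> carrier H2 ==> G x x' a a' y y' b b' (t h k) = t (E x x' a a' h) (F y y' b b' k)"
  using G unfolding is_operator_tensor_def by blast+

lemma tensor_eqI:
  assumes z: "z \<in> carrier K" "z' \<in> carrier K"
    and eq: "!!h k. h \<in> carrier H1 ==> k \<in> carrier H2 ==> iprod K z (t h k) = iprod K z' (t h k)"
  shows "z = z'"
proof (rule K.hilbert_eqI[OF z])
  fix w assume "w \<in> carrier K"
  then obtain n f g where fg: "f \<in> {..<n::nat} \<rightarrow> carrier H1" "g \<in> {..<n} \<rightarrow> carrier H2"
    "w = (\<Oplus>\<^bsub>K\<^esub>i\<in>{..<n}. t (f i) (g i))" using t_span by blast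
  have c: "(%i. t (f i) (g i)) \<in> {..<n} \<rightarrow> carrier K" using fg(1,2) by (auto intro!: t_closed)
  show "iprod K z w = iprod K z' w" unfolding fg(3) K.ip_finsum_right[OF c z(1)] K.ip_finsum_right[OF c z(2)]
    using fg(1,2) by (intro sum.cong eq) auto
qed

lemma slices: assumes z: "z \<in> carrier K"
  obtains s where "!!c. s c \<in> carrier H1" "z = (\<Oplus>\<^bsub>K\<^esub>c\<in>C. t (s c) c)"
proof -
  obtain n f g where fg: "f \<in> {..<n::nat} \<rightarrow> carrier H1" "g \<in> {..<n} \<rightarrow> carrier H2"
    "z = (\<Oplus>\<^bsub>K\<^esub>i\<in>{..<n}. t (f i) (g i))" using t_span[OF z] by blast
  \<comment> \<open>The component at \<open>c\<close> is obtained by pairing the second tensor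
    factors with \<open>c\<close>.\<close>
  define s where "s c = (\<Oplus>\<^bsub>H1\<^esub>i\<in>{..<n}. iprod H2 (g i) c \<odot>\<^bsub>H1\<^esub> f i)" for c
  have fc: "(%i. iprod H2 (g i) c \<odot>\<^bsub>H1\<^esub> f i) \<in> {..<n} \<rightarrow> carrier H1" for c using fg by auto
  have s: "s c \<in> carrier H1" for c unfolding s_def by (rule E.M.finsum_closed[OF fc])
  note D = H2.orthonormal_basisD(1-3)[OF C]
  have ct: "(%c. t (s c) c) \<in> C \<rightarrow> carrier K" "(%i. t (f i) (g i)) \<in> {..<n} \<rightarrow> carrier K" using s D fg(1,2) by (auto intro!: t_closed)
  have "z = (\<Oplus>\<^bsub>K\<^esub>c\<in>C. t (s c) c)"
  proof (rule tensor_eqI[OF z K.M.finsum_closed[OF ct(1)]])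
    fix h k assume hk: "h \<in> carrier H1" "k \<in> carrier H2"
    have "iprod K (\<Oplus>\<^bsub>K\<^esub>c\<in>C. t (s c) c) (t h k) = (\<Sum>c\<in>C. iprod H1 (s c) h * iprod H2 c k)"
      using K.ip_finsum_left[OF ct(1)] hk s D by (simp add: t_iprod)
    also have "\<dots> = (\<Sum>c\<in>C. \<Sum>i<n. iprod H1 (f i) h * (iprod H2 (g i) c * iprod H2 c k))"
      unfolding s_def E.ip_finsum_left[OF fc hk(1)] sum_distrib_right using hk
      by (intro sum.cong) (auto simp: E.iprod_smult fg(1)[THEN funcset_mem])
    also have "\<dots> = (\<Sum>i<n. iprod H1 (f i) h * (\<Sum>c\<in>C. iprod H2 (g i) c * iprod H2 c k))"
      unfolding sum_distrib_left by (rule sum.swap)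
    also have "\<dots> = (\<Sum>i<n. iprod K (t (f i) (g i)) (t h k))"
      using hk
      by (intro sum.cong) (auto simp: t_iprod fg(1,2)[THEN funcset_mem] H2.orthonormal_basisD(4)[OF C, symmetric])
    also have "\<dots> = iprod K z (t h k)" unfolding fg(3) using K.ip_finsum_left[OF ct(2)] hk by simp
    finally show "iprod K z (t h k) = iprod K (\<Oplus>\<^bsub>K\<^esub>c\<in>C. t (s c) c) (t h k)" by simp
  qed
  then show ?thesis using that s by blast
qed

lemma iprod_slices: assumes "!!c. r c \<in> carrier H1" "!!c. s c \<in> carrier H1"
  shows "iprod K (\<Oplus>\<^bsub>K\<^esub>c\<in>C. t (r c) c) (\<Oplus>\<^bsub>K\<^esub>c\<in>C. t (s c) c) = (\<Sum>c\<in>C. iprod H1 (r c) (s c))"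
proof -
  note D = H2.orthonormal_basisD(1-3)[OF C]
  have ct: "(%c. t (s c) c) \<in> C \<rightarrow> carrier K" "(%c. t (r c) c) \<in> C \<rightarrow> carrier K" using assms D by auto
  have "iprod K (t (r c) c) (\<Oplus>\<^bsub>K\<^esub>c\<in>C. t (s c) c) = iprod H1 (r c) (s c)" if "c \<in> C" for c
  proof -
    have "iprod K (t (r c) c) (\<Oplus>\<^bsub>K\<^esub>c\<in>C. t (s c) c) = (\<Sum>d\<in>C. if d = c then iprod H1 (r c) (s c) else 0)"
      unfolding K.ip_finsum_right[OF ct(1) t_closed[OF assms(1) D(2)[OF that]]]
      using assms D(2) that by (intro sum.cong) (auto simp: t_iprod D(3))
    then show ?thesis using D(1) that by simp
  qed
  then show ?thesis using K.ip_finsum_left[OF ct(2) K.M.finsum_closed[OF ct(1)]] by simp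
qed

lemma operator_eqI:
  assumes "bounded_operator K S" "bounded_operator K T"
    and "!!h k. h \<in> carrier H1 ==> k \<in> carrier H2 ==> S (t h k) = T (t h k)" and z: "z \<in> carrier K"
  shows "S z = T z"
proof -
  obtain s where s: "!!c. s c \<in> carrier H1" "z = (\<Oplus>\<^bsub>K\<^esub>c\<in>C. t (s c) c)" using slices[OF z] by blast
  note D = H2.orthonormal_basisD(1-3)[OF C]
  have "(%c. t (s c) c) \<in> C \<rightarrow> carrier K" using s D by auto
  then show ?thesis unfolding s(2) using assms(1,2) s D K.bounded_operatorD(1)[OF assms(2)] assms(3)
    by (simp add: K.bounded_operator_finsum) (intro K.M.finsum_cong', auto)
qed

text \<open>This is \<open>E\<close> tensored with the identity. The given operators are tensor
  products of \<open>E\<close> with \<open>F\<close>, and the blocks \<open>F u u b b\<close> sum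
  over \<open>b\<close> to the identity for any fixed index, so the sum over \<open>b\<close>
  recovers it.\<close>

definition E1 :: "'x => 'x => 'x => 'x => 'h => 'h" where
  "E1 x x' a a' z = (\<Oplus>\<^bsub>K\<^esub>b\<in>UNIV. G x x' a a' undefined undefined b b z)"

lemma E1_bounded: "bounded_operator K (E1 x x' a a')"
  unfolding E1_def[abs_def] by (intro K.bounded_operator_sum G_bounded) simp

lemma E1_apply: assumes "h \<in> carrier H1" "k \<in> carrier H2" shows "E1 x x' a a' (t h k) = t (E x x' a a' h) k"
proof -
  have c: "(%b. t (E x x' a a' h) (F u u b b k)) \<in> UNIV \<rightarrow> carrier K" for u using assms by auto
  show ?thesis unfolding E1_def G_apply[OF assms]
  proof (rule tensor_eqI[OF K.M.finsum_closed[OF c]])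
    fix h' k' assume hk': "h' \<in> carrier H1" "k' \<in> carrier H2"
    show "iprod K (\<Oplus>\<^bsub>K\<^esub>b\<in>UNIV. t (E x x' a a' h) (F undefined undefined b b k)) (t h' k') = iprod K (t (E x x' a a' h) k) (t h' k')"
      using assms hk' F.E_sum_iprod[of k k' undefined undefined]
      by (simp add: K.ip_finsum_left[OF c] t_iprod flip: sum_distrib_left)
  qed (use assms in simp)
qed

lemma E1_slices: assumes "!!c. s c \<in> carrier H1"
  shows "E1 x x' a a' (\<Oplus>\<^bsub>K\<^esub>c\<in>C. t (s c) c) = (\<Oplus>\<^bsub>K\<^esub>c\<in>C. t (E x x' a a' (s c)) c)"
proof -
  note D = H2.orthonormal_basisD(1-3)[OF C]
  have "(%c. t (s c) c) \<in> C \<rightarrow> carrier K" using assms D by auto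
  then have "E1 x x' a a' (\<Oplus>\<^bsub>K\<^esub>c\<in>C. t (s c) c) = (\<Oplus>\<^bsub>K\<^esub>c\<in>C. E1 x x' a a' (t (s c) c))"
    by (rule K.bounded_operator_finsum[OF E1_bounded])
  also have "\<dots> = (\<Oplus>\<^bsub>K\<^esub>c\<in>C. t (E x x' a a' (s c)) c)" using assms D by (intro K.M.finsum_cong') (auto simp: E1_apply)
  finally show ?thesis .
qed

text \<open>Positivity is checked separately for each \<open>c\<close>, where it is that of
  \<open>E\<close>.\<close>

lemma E1_stochastic: "stochastic_operator_matrix K E1"
  unfolding stochastic_operator_matrix_def
proof (intro conjI allI impI ballI)
  show "bounded_operator K (E1 x x' a a')" for x x' a a' by (rule E1_bounded)
next
  fix v :: "'x => 'x => 'h" assume v: "ALL x a. v x a \<in> carrier K"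
  have "ALL x a. EX s. (ALL c. s c \<in> carrier H1) & v x a = (\<Oplus>\<^bsub>K\<^esub>c\<in>C. t (s c) c)"
  proof (intro allI)
    fix x a
    show "EX s. (ALL c. s c \<in> carrier H1) & v x a = (\<Oplus>\<^bsub>K\<^esub>c\<in>C. t (s c) c)"
      by (rule slices[OF v[rule_format, of x a]]) (intro exI conjI allI)
  qed
  then have "EX s. ALL x a. (ALL c. s x a c \<in> carrier H1) & v x a = (\<Oplus>\<^bsub>K\<^esub>c\<in>C. t (s x a c) c)" by (simp only: choice_iff)
  then obtain s where "ALL x a. (ALL c. s x a c \<in> carrier H1) & v x a = (\<Oplus>\<^bsub>K\<^esub>c\<in>C. t (s x a c) c)" by (elim exE)
  then have s: "!!x a c. s x a c \<in> carrier H1" "!!x a. v x a = (\<Oplus>\<^bsub>K\<^esub>c\<in>C. t (s x a c) c)" by simp_all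
  define r where "r c = (\<Sum>p\<in>UNIV. \<Sum>q\<in>UNIV. iprod H1 (E (fst p) (fst q) (snd p) (snd q) (s (fst q) (snd q) c)) (s (fst p) (snd p) c))" for c
  have "(\<Sum>x\<in>UNIV. \<Sum>a\<in>UNIV. \<Sum>x'\<in>UNIV. \<Sum>a'\<in>UNIV. iprod K (E1 x x' a a' (v x' a')) (v x a)) =
      (\<Sum>p\<in>UNIV. \<Sum>q\<in>UNIV. \<Sum>c\<in>C. iprod H1 (E (fst p) (fst q) (snd p) (snd q) (s (fst q) (snd q) c)) (s (fst p) (snd p) c))"
    by (simp add: s E1_slices iprod_slices sum_UNIV_pair)
  also have "\<dots> = (\<Sum>c\<in>C. r c)"
    unfolding r_def by (simp only: sum.swap[of _ C UNIV])
  finally have e: "(\<Sum>x\<in>UNIV. \<Sum>a\<in>UNIV. \<Sum>x'\<in>UNIV. \<Sum>a'\<in>UNIV. iprod K (E1 x x' a a' (v x' a')) (v x a)) = (\<Sum>c\<in>C. r c)" .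
  have "r c \<in> \<real>\<^sub>\<ge>\<^sub>0" for c using E.P.A_pos[of "%p. s (fst p) (snd p) c"] s by (simp add: r_def)
  then show "(\<Sum>x\<in>UNIV. \<Sum>a\<in>UNIV. \<Sum>x'\<in>UNIV. \<Sum>a'\<in>UNIV. iprod K (E1 x x' a a' (v x' a')) (v x a)) \<in> \<real>\<^sub>\<ge>\<^sub>0"
    unfolding e by (auto simp: complex_nonneg_Reals_iff intro!: sum_nonneg)
next
  fix x x' z assume z: "z \<in> carrier K"
  obtain s where s: "!!c. s c \<in> carrier H1" "z = (\<Oplus>\<^bsub>K\<^esub>c\<in>C. t (s c) c)" using slices[OF z] by blast
  have c: "(%a. E1 x x' a a z) \<in> UNIV \<rightarrow> carrier K" using K.bounded_operatorD(1)[OF E1_bounded] z by auto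
  show "(\<Oplus>\<^bsub>K\<^esub>a\<in>UNIV. E1 x x' a a z) = (if x = x' then z else \<zero>\<^bsub>K\<^esub>)"
  proof (rule K.hilbert_eqI[OF K.M.finsum_closed[OF c]])
    fix w assume w: "w \<in> carrier K"
    obtain r where r: "!!c. r c \<in> carrier H1" "w = (\<Oplus>\<^bsub>K\<^esub>c\<in>C. t (r c) c)" using slices[OF w] by blast
    have "iprod K (\<Oplus>\<^bsub>K\<^esub>a\<in>UNIV. E1 x x' a a z) w = (\<Sum>a\<in>UNIV. \<Sum>c\<in>C. iprod H1 (E x x' a a (s c)) (r c))"
      unfolding K.ip_finsum_left[OF c w] using s r by (simp add: E1_slices iprod_slices)
    also have "\<dots> = (\<Sum>c\<in>C. \<Sum>a\<in>UNIV. iprod H1 (E x x' a a (s c)) (r c))" by (rule sum.swap)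
    also have "\<dots> = (if x = x' then iprod K z w else 0)" using s r by (simp add: E.E_sum_iprod iprod_slices)
    finally show "iprod K (\<Oplus>\<^bsub>K\<^esub>a\<in>UNIV. E1 x x' a a z) w = iprod K (if x = x' then z else \<zero>\<^bsub>K\<^esub>) w" using w by simp
  qed (use z in simp)
qed

end

lemma is_tensor_product_swap: "is_tensor_product H1 H2 K t ==> is_tensor_product H2 H1 K (%k h. t h k)"
proof -
  assume t: "is_tensor_product H1 H2 K t"
  have u: "\<forall>z\<in>carrier K. \<exists>(n::nat) f g. f \<in> {..<n} \<rightarrow> carrier H1 & g \<in> {..<n} \<rightarrow> carrier H2
      & z = (\<Oplus>\<^bsub>K\<^esub>i\<in>{..<n}. t (f i) (g i))" using t unfolding is_tensor_product_def by (elim conjE)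
  have s: "\<forall>z\<in>carrier K. \<exists>(n::nat) g f. g \<in> {..<n} \<rightarrow> carrier H2 & f \<in> {..<n} \<rightarrow> carrier H1
      & z = (\<Oplus>\<^bsub>K\<^esub>i\<in>{..<n}. t (f i) (g i))"
    by (rule ballI, drule u[rule_format], elim exE conjE, intro exI conjI)
  show ?thesis using t s unfolding is_tensor_product_def
    by (elim conjE, intro conjI) (assumption | simp add: mult.commute)+
qed

text \<open>The amplifications of \<open>E\<close> and \<open>F\<close> compose to \<open>G\<close>
  in either order, so they form a commuting pair. The rank is finite because the tensors of basis
  vectors satisfy Parseval's identity in \<open>K\<close>.\<close>

lemma word_trace_of_tensor:
  fixes E F :: "'x::finite => 'x => 'x => 'x => 'h => 'h" and H1 H2 K :: "'h hspace"
  assumes fd: "finite_dimensional H1" "finite_dimensional H2" and t: "is_tensor_product H1 H2 K t"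
    and E: "stochastic_operator_matrix H1 E" and F: "stochastic_operator_matrix H2 F"
    and G: "!!x x' a a' y y' b b'. is_operator_tensor H1 H2 K t (E x x' a a') (F y y' b b') (G x x' a a' y y' b b')"
    and \<xi>: "\<xi> \<in> carrier K" "hnorm K \<xi> = 1"
    and total: "(\<Sum>(x, x', a, a')\<in>UNIV. iprod K (G x x' a a' x x' a a' \<xi>) \<xi>) = (of_nat CARD('x))\<^sup>2"
  obtains r where "word_trace r" "finite_rank r"
    "!!x x' a a' y y' b b'. r [(x, x', a, a'), (y', y, b', b)] = iprod K (G x x' a a' y y' b b' \<xi>) \<xi>"
proof -
  have H: "hilbert_space H1" "hilbert_space H2" "hilbert_space K" using t by (auto simp: is_tensor_product_def)
  obtain B where B: "orthonormal_basis H1 B" using hilbert_space.finite_dimensional_orthonormal_basis[OF H(1) fd(1)] .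
  obtain C where C: "orthonormal_basis H2 C" using hilbert_space.finite_dimensional_orthonormal_basis[OF H(2) fd(2)] .
  interpret L: tensor_blocks K H1 H2 E F t G C
    using H E F t C G by (simp add: tensor_blocks_def stochastic_def stochastic_axioms_def tensor_blocks_axioms_def)
  have G': "is_operator_tensor H2 H1 K (%k h. t h k) (F y y' b b') (E x x' a a') (G x x' a a' y y' b b')" for x x' a a' y y' b b'
    using G[of x x' a a' y y' b b'] by (auto simp: is_operator_tensor_def)
  interpret R: tensor_blocks K H2 H1 F E "%k h. t h k" "%y y' b b' x x' a a'. G x x' a a' y y' b b'" B
    using H E F is_tensor_product_swap[OF t] B G'
    by (simp add: tensor_blocks_def stochastic_def stochastic_axioms_def tensor_blocks_axioms_def)
  have b: "bounded_operator K (%z. S (T z))" if S: "bounded_operator K S" and T: "bounded_operator K T" for S T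
  proof -
    obtain c d where cd: "!!z. z \<in> carrier K ==> hnorm K (S z) <= c * hnorm K z"
      "!!z. z \<in> carrier K ==> hnorm K (T z) <= d * hnorm K z"
      using L.K.bounded_operatorD(4)[OF S] L.K.bounded_operatorD(4)[OF T] by blast
    have "hnorm K (S (T z)) <= (\<bar>c\<bar> * d) * hnorm K z" if z: "z \<in> carrier K" for z
    proof -
      have Tz: "T z \<in> carrier K" using L.K.bounded_operatorD(1)[OF T z] .
      have "hnorm K (S (T z)) <= c * hnorm K (T z)" using cd(1)[OF Tz] .
      also have "\<dots> <= \<bar>c\<bar> * hnorm K (T z)" using L.K.hnorm_nonneg[OF Tz] by (simp add: mult_right_mono)
      also have "\<dots> <= \<bar>c\<bar> * (d * hnorm K z)" by (rule mult_left_mono[OF cd(2)[OF z]]) simp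
      finally show ?thesis by (simp add: mult.assoc)
    qed
    then have "EX C. \<forall>z\<in>carrier K. hnorm K (S (T z)) <= C * hnorm K z" by blast
    then show ?thesis using S T unfolding bounded_operator_def by (auto simp: Pi_iff)
  qed
  have EF: "L.E1 x x' a a' (R.E1 y y' b b' z) = G x x' a a' y y' b b' z"
    "R.E1 y y' b b' (L.E1 x x' a a' z) = G x x' a a' y y' b b' z" if z: "z \<in> carrier K" for x x' a a' y y' b b' z
    by (rule L.operator_eqI[OF b[OF L.E1_bounded R.E1_bounded] L.G_bounded _ z], simp add: L.E1_apply R.E1_apply L.G_apply)
      (rule L.operator_eqI[OF b[OF R.E1_bounded L.E1_bounded] L.G_bounded _ z], simp add: L.E1_apply R.E1_apply L.G_apply)
  interpret P: commuting_pair K L.E1 R.E1 \<xi>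
  proof
    show "stochastic_operator_matrix K L.E1" "stochastic_operator_matrix K R.E1" by (rule L.E1_stochastic R.E1_stochastic)+
    show "(\<Sum>(x, x', a, a')\<in>UNIV. iprod K (L.E1 x x' a a' (R.E1 x x' a a' \<xi>)) \<xi>) = (of_nat CARD('x))\<^sup>2"
      unfolding total[symmetric] using \<xi> by (simp add: EF)
  qed (use \<xi> EF in auto)
  note DB = L.E.orthonormal_basisD(1-3)[OF B] and DC = L.H2.orthonormal_basisD(1-3)[OF C]
  have "iprod K z w = (\<Sum>p\<in>B \<times> C. iprod K z (t (fst p) (snd p)) * iprod K (t (fst p) (snd p)) w)"
    if zw: "z \<in> carrier K" "w \<in> carrier K" for z w
  proof -
    obtain s where s: "!!c. s c \<in> carrier H1" "z = (\<Oplus>\<^bsub>K\<^esub>c\<in>C. t (s c) c)" using L.slices[OF zw(1)] by blast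
    obtain r where r: "!!c. r c \<in> carrier H1" "w = (\<Oplus>\<^bsub>K\<^esub>c\<in>C. t (r c) c)" using L.slices[OF zw(2)] by blast
    have ip: "iprod K (\<Oplus>\<^bsub>K\<^esub>c\<in>C. t (u c) c) (t b c) = iprod H1 (u c) b"
      if u: "!!c. u c \<in> carrier H1" and b: "b \<in> B" and c: "c \<in> C" for u b c
    proof -
      have cl: "(%c. t (u c) c) \<in> C \<rightarrow> carrier K" using u DC by auto
      have "iprod K (\<Oplus>\<^bsub>K\<^esub>c\<in>C. t (u c) c) (t b c) = (\<Sum>d\<in>C. if d = c then iprod H1 (u c) b else 0)"
        unfolding L.K.ip_finsum_left[OF cl L.t_closed[OF DB(2)[OF b] DC(2)[OF c]]]
        using u b c DB(2) DC(2) by (intro sum.cong) (auto simp: L.t_iprod DC(3))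
      then show ?thesis using DC(1) c by simp
    qed
    have ip': "iprod K (t b c) w = iprod H1 b (r c)" if "b \<in> B" "c \<in> C" for b c
      using ip[OF r(1) that] r that zw DB DC L.K.ip_cnj[of w "t b c"] L.E.ip_cnj[of "r c" b] by (simp add: r(2))
    have "iprod K z w = (\<Sum>c\<in>C. \<Sum>b\<in>B. iprod H1 (s c) b * iprod H1 b (r c))"
      unfolding s(2) r(2) L.iprod_slices[OF s(1) r(1)] by (intro sum.cong refl L.E.orthonormal_basisD(4)[OF B s(1) r(1)])
    also have "\<dots> = (\<Sum>b\<in>B. \<Sum>c\<in>C. iprod H1 (s c) b * iprod H1 b (r c))" by (rule sum.swap)
    also have "\<dots> = (\<Sum>p\<in>B \<times> C. iprod H1 (s (snd p)) (fst p) * iprod H1 (fst p) (r (snd p)))"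
      by (simp add: sum.cartesian_product case_prod_unfold)
    also have "\<dots> = (\<Sum>p\<in>B \<times> C. iprod K z (t (fst p) (snd p)) * iprod K (t (fst p) (snd p)) w)"
      using ip[of s] ip' s by (intro sum.cong) auto
    finally show ?thesis .
  qed
  then have "finite_rank P.t"
    using DB(1) DC(1) by (intro P.t_finite_rank[of "B \<times> C"]) auto
  then show ?thesis by (rule that[OF P.word_trace]) (simp add: P.t_value EF \<xi>)
qed

section \<open>The Hilbert space trace and the inverse root of its density\<close>

context hilbert_space
begin

lemma orthonormal_basis_trace_commute:
  assumes B: "orthonormal_basis H B" and S: "adj_pair H S S'" and T: "adj_pair H T T'"
  shows "(\<Sum>b\<in>B. iprod H (S (T b)) b) = (\<Sum>b\<in>B. iprod H (T (S b)) b)"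
proof -
  note D = orthonormal_basisD[OF B]
  have e: "(\<Sum>b\<in>B. iprod H (S (T b)) b) = (\<Sum>b\<in>B. \<Sum>c\<in>B. iprod H (T b) c * iprod H (S c) b)"
    if S: "adj_pair H S S'" and T: "adj_pair H T T'" for S T S' T'
  proof (rule sum.cong[OF refl])
    fix b assume b: "b \<in> B"
    have "iprod H (S (T b)) b = iprod H (T b) (S' b)"
      using adj_pair_iprod[OF S adj_pair_closed(1)[OF T]] D(2)[OF b] by blast
    also have "\<dots> = (\<Sum>c\<in>B. iprod H (T b) c * iprod H c (S' b))"
      by (rule D(4)[OF adj_pair_closed(1)[OF T D(2)[OF b]] adj_pair_closed(2)[OF S D(2)[OF b]]])
    also have "\<dots> = (\<Sum>c\<in>B. iprod H (T b) c * iprod H (S c) b)"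
      by (intro sum.cong refl) (simp add: adj_pair_iprod[OF S] D(2) b)
    finally show "iprod H (S (T b)) b = (\<Sum>c\<in>B. iprod H (T b) c * iprod H (S c) b)" .
  qed
  have "(\<Sum>b\<in>B. iprod H (S (T b)) b) = (\<Sum>b\<in>B. \<Sum>c\<in>B. iprod H (T b) c * iprod H (S c) b)" by (rule e[OF S T])
  also have "\<dots> = (\<Sum>c\<in>B. \<Sum>b\<in>B. iprod H (T b) c * iprod H (S c) b)" by (rule sum.swap)
  also have "\<dots> = (\<Sum>b\<in>B. iprod H (T (S b)) b)" unfolding e[OF T S] by (intro sum.cong refl mult.commute)
  finally show ?thesis .
qed

text \<open>With \<open>b = T\<^sub>b \<eta>\<close>, the Hilbert space trace is \<open>A \<mapsto> \<langle>A z \<eta>, \<eta>\<rangle>\<close> for \<open>z = \<Sum>\<^sub>b T\<^sub>b T\<^sub>b\<^sup>*\<close>, which is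
  central and at least \<open>1\<close>; the operator \<open>c\<close> is \<open>z\<close> to the power \<open>-1/2\<close>.\<close>

lemma central_inverse_root:
  assumes Z: "self_adjoint_set H Z" and \<eta>: "\<eta> \<in> carrier H" "\<eta> ~= \<zero>"
    and tr: "!!S T. S \<in> commutant H Z ==> T \<in> commutant H Z ==> iprod H (S (T \<eta>)) \<eta> = iprod H (T (S \<eta>)) \<eta>"
    and faithful: "!!T x. T \<in> commutant H Z ==> T \<eta> = \<zero> ==> x \<in> carrier H ==> T x = \<zero>"
    and B: "orthonormal_basis H B" "\<eta> \<in> B" "!!b. b \<in> B ==> \<exists>T\<in>commutant H Z. T \<eta> = b"
  obtains c where "adj_pair H c c" "!!A x. A \<in> commutant H Z ==> x \<in> carrier H ==> c (A x) = A (c x)"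
    "!!A A'. A \<in> commutant H Z ==> A' \<in> commutant H Z
      ==> (\<Sum>b\<in>B. iprod H (A (c b)) (A' (c b))) = iprod H (A \<eta>) (A' \<eta>)"
proof -
  let ?C = "commutant H Z"
  define mul where "mul S T = (\<lambda>x\<in>carrier H. S (T x))" for S T :: "'a => 'a"
  have mulC: "mul S T \<in> ?C" if "S \<in> ?C" "T \<in> ?C" for S T unfolding mul_def using commutant_ops(1)[OF Z that] .
  have mulx: "mul S T x = S (T x)" if "x \<in> carrier H" for S T x using that by (simp add: mul_def)
  note cl = commutantD(2)
  note ap = hadjoint_pair and hC = hadjoint_commutant[OF _ Z]
  note D = orthonormal_basisD[OF B(1)]
  \<comment> \<open>For \<open>b = \<eta>\<close> the identity operator is chosen, so that its term
    alone makes \<open>z\<close> at least 1.\<close>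
  have "EX T. T \<in> ?C & T \<eta> = b & (b = \<eta> --> T = (\<lambda>x\<in>carrier H. x))" if b: "b \<in> B" for b
  proof (cases "b = \<eta>")
    case True
    then show ?thesis using commutant_ops(4)[OF Z] \<eta> by (intro exI[of _ "\<lambda>x\<in>carrier H. x"]) auto
  qed (use B(3)[OF b] in blast)
  then obtain T where T: "!!b. b \<in> B ==> T b \<in> ?C" "!!b. b \<in> B ==> T b \<eta> = b" "T \<eta> = (\<lambda>x\<in>carrier H. x)"
    using B(2) by metis
  define T' where "T' b = hadjoint H (T b)" for b
  have T': "T' b \<in> ?C" "adj_pair H (T b) (T' b)" if "b \<in> B" for b
    using T(1)[OF that] by (auto simp: T'_def ap hC)
  define z where "z = (\<lambda>x\<in>carrier H. \<Oplus>b\<in>B. T b (T' b x))"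
  have zC: "z \<in> ?C"
  proof -
    interpret AM: abelian_group "op_algebra H Z" by (rule op_cnormed(2)[OF Z])
    have "finsum (op_algebra H Z) (%b. mul (T b) (T' b)) B \<in> carrier (op_algebra H Z)"
      by (rule AM.finsum_closed) (simp add: mulC T T')
    moreover have "finsum (op_algebra H Z) (%b. mul (T b) (T' b)) B = (\<lambda>x\<in>carrier H. finsum H (%b. mul (T b) (T' b) x) B)"
      by (rule finsum_op_algebra[OF Z D(1)]) (simp add: mulC T T')
    moreover have "\<dots> = z" by (simp add: z_def mulx cong: restrict_cong)
    ultimately show ?thesis by simp
  qed
  have TT: "(%b. T b (T' b x)) \<in> B \<rightarrow> carrier H" if "x \<in> carrier H" for x
    using cl[OF T(1)] cl[OF T'(1)] that by auto
  have iz: "iprod H (z x) y = (\<Sum>b\<in>B. iprod H (T' b x) (T' b y))" if xy: "x \<in> carrier H" "y \<in> carrier H" for x y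
  proof -
    have "iprod H (z x) y = (\<Sum>b\<in>B. iprod H (T b (T' b x)) y)"
      using xy ip_finsum_left[OF TT[OF xy(1)] xy(2)] by (simp add: z_def)
    also have "\<dots> = (\<Sum>b\<in>B. iprod H (T' b x) (T' b y))"
      using xy by (intro sum.cong refl adj_pair_iprod[OF T'(2)] cl[OF T'(1)]) auto
    finally show ?thesis .
  qed
  have zz: "adj_pair H z z"
  proof -
    have "iprod H (z x) y = iprod H x (z y)" if xy: "x \<in> carrier H" "y \<in> carrier H" for x y
    proof -
      have "iprod H x (z y) = cnj (iprod H (z y) x)" using ip_cnj[OF cl[OF zC xy(2)] xy(1)] by simp
      also have "\<dots> = (\<Sum>b\<in>B. iprod H (T' b x) (T' b y))"
        unfolding iz[OF xy(2,1)] using xy by (simp add: ip_cnj cl[OF T'(1)])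
      finally show ?thesis using iz[OF xy] by simp
    qed
    then show ?thesis using cl[OF zC] by (auto simp: adj_pair_def)
  qed
  \<comment> \<open>Write \<open>b\<close> as \<open>T_b \<eta>\<close>, move \<open>T_b\<close>
    across the inner product, and use the trace property at \<open>\<eta>\<close> to bring
    \<open>T_b\<close> and its adjoint together next to \<open>\<eta>\<close>.\<close>
  have Tr: "(\<Sum>b\<in>B. iprod H (A b) b) = iprod H (A (z \<eta>)) \<eta>" if A: "A \<in> ?C" for A
  proof -
    have "iprod H (A b) b = iprod H (T b (T' b \<eta>)) (hadjoint H A \<eta>)" if b: "b \<in> B" for b
    proof -
      have c: "T b \<eta> \<in> carrier H" "A (T b \<eta>) \<in> carrier H" "T' b \<eta> \<in> carrier H" "T b (T' b \<eta>) \<in> carrier H"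
        using \<eta> by (auto intro!: cl[OF A] cl[OF T(1)[OF b]] cl[OF T'(1)[OF b]])
      have "iprod H (A b) b = iprod H (A (T b \<eta>)) (T b \<eta>)" using T(2)[OF b] by simp
      also have "\<dots> = iprod H (T' b (A (T b \<eta>))) \<eta>"
        using adj_pair_iprod[OF adj_pair_sym[OF T'(2)[OF b]] c(2) \<eta>(1)] by simp
      also have "\<dots> = iprod H (mul A (T b) (T' b \<eta>)) \<eta>"
        using tr[OF T'(1)[OF b] mulC[OF A T(1)[OF b]]] \<eta> by (simp add: mulx)
      also have "\<dots> = iprod H (T b (T' b \<eta>)) (hadjoint H A \<eta>)"
        using adj_pair_iprod[OF ap[OF A] c(4) \<eta>(1)] c by (simp add: mulx)
      finally show ?thesis .
    qed
    then have "(\<Sum>b\<in>B. iprod H (A b) b) = (\<Sum>b\<in>B. iprod H (T b (T' b \<eta>)) (hadjoint H A \<eta>))" by simp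
    also have "\<dots> = iprod H (z \<eta>) (hadjoint H A \<eta>)"
      using ip_finsum_left[OF TT[OF \<eta>(1)] cl[OF hC[OF A] \<eta>(1)]] \<eta> by (simp add: z_def)
    also have "\<dots> = iprod H (A (z \<eta>)) \<eta>" using adj_pair_iprod[OF ap[OF A] cl[OF zC \<eta>(1)] \<eta>(1)] by simp
    finally show ?thesis .
  qed
  have central: "A (z x) = z (A x)" if A: "A \<in> ?C" and x: "x \<in> carrier H" for A x
  proof -
    \<comment> \<open>\<open>Q\<close> is the commutator of \<open>A\<close> and \<open>z\<close>.
      Cyclicity of the Hilbert space trace, rewritten by \<open>Tr\<close>, shows that
      \<open>Q \<eta>\<close> is orthogonal to itself, and \<open>faithful\<close> then gives
      \<open>Q = 0\<close>.\<close>
    define Q where "Q = (\<lambda>x\<in>carrier H. mul A z x \<oplus> (\<lambda>x\<in>carrier H. (-1) \<odot> mul z A x) x)"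
    have QC: "Q \<in> ?C" unfolding Q_def
      by (rule commutant_ops(2)[OF Z mulC[OF A zC] commutant_ops(3)[OF Z mulC[OF zC A]]])
    have Qx: "Q x = A (z x) \<oplus> (-1) \<odot> z (A x)" if "x \<in> carrier H" for x
      using that by (simp add: Q_def mulx)
    have c: "A (z x) \<in> carrier H" "z (A x) \<in> carrier H" if "x \<in> carrier H" for x
      using that by (auto intro!: cl[OF A] cl[OF zC])
    let ?Q = "hadjoint H Q"
    have Q'C: "?Q \<in> ?C" by (rule hC[OF QC])
    have "iprod H (?Q (A (z \<eta>))) \<eta> = (\<Sum>b\<in>B. iprod H (mul ?Q A b) b)"
      using Tr[OF mulC[OF Q'C A]] cl[OF zC \<eta>(1)] by (simp add: mulx)
    also have "\<dots> = (\<Sum>b\<in>B. iprod H (?Q (A b)) b)" by (intro sum.cong refl) (simp add: mulx D(2))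
    also have "\<dots> = (\<Sum>b\<in>B. iprod H (A (?Q b)) b)" by (rule orthonormal_basis_trace_commute[OF B(1) ap[OF Q'C] ap[OF A]])
    also have "\<dots> = (\<Sum>b\<in>B. iprod H (mul A ?Q b) b)" by (intro sum.cong refl) (simp add: mulx D(2))
    also have "\<dots> = iprod H (A (mul ?Q z \<eta>)) \<eta>"
      using Tr[OF mulC[OF A Q'C]] \<eta> cl[OF zC \<eta>(1)] by (simp add: mulx)
    also have "\<dots> = iprod H (?Q (z (A \<eta>))) \<eta>"
      using tr[OF A mulC[OF Q'C zC]] \<eta> cl[OF A \<eta>(1)] by (simp add: mulx)
    finally have "iprod H (?Q (A (z \<eta>))) \<eta> = iprod H (?Q (z (A \<eta>))) \<eta>" .
    then have "iprod H (A (z \<eta>)) (Q \<eta>) = iprod H (z (A \<eta>)) (Q \<eta>)"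
      using adj_pair_iprod[OF adj_pair_sym[OF ap[OF QC]] c(1)[OF \<eta>(1)] \<eta>(1)]
        adj_pair_iprod[OF adj_pair_sym[OF ap[OF QC]] c(2)[OF \<eta>(1)] \<eta>(1)] by simp
    then have "iprod H (A (z \<eta>) \<oplus> (-1) \<odot> z (A \<eta>)) (Q \<eta>) = 0"
      by (simp add: iprod_add iprod_smult c[OF \<eta>(1)] cl[OF QC \<eta>(1)])
    then have "iprod H (Q \<eta>) (Q \<eta>) = 0" by (simp only: Qx[OF \<eta>(1)])
    then have "Q \<eta> = \<zero>" using iprod_definite[OF cl[OF QC \<eta>(1)]] by simp
    then have "Q x = \<zero>" using faithful[OF QC _ x] by simp
    then have "A (z x) \<ominus> z (A x) = \<zero>" using Qx[OF x] minus_csm[OF c[OF x]] by simp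
    then show ?thesis using c[OF x] by (intro eq_of_minus) simp_all
  qed
  \<comment> \<open>Enlarging \<open>Z\<close> by its commutant makes the new commutant the centre
    of the old one, so an inverse root found there commutes with every \<open>A\<close>.\<close>
  define Z2 where "Z2 = Z \<union> ?C"
  have Z2: "self_adjoint_set H Z2" using Z ap hC unfolding self_adjoint_set_def Z2_def by blast
  have sub: "commutant H Z2 \<subseteq> ?C" unfolding commutant_def Z2_def by blast
  have zC2: "z \<in> commutant H Z2"
    by (rule commutantI[OF commutantD(1)[OF zC] commutantD(3)[OF zC] zz])
      (use commutantD(6)[OF zC] central in \<open>auto simp: Z2_def\<close>)
  define n where "n = op_norm H z"
  \<comment> \<open>\<open>M\<close> is chosen so that \<open>1 - z / M\<close> has norm below 1:
    since \<open>z\<close> is at least 1, the squared norm is at most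
    \<open>1 - 2 / M + n^2 / M^2\<close>, hence at most \<open>1 - 1 / M\<close>.\<close>
  define M where "M = n\<^sup>2 + 1"
  have M: "M \<ge> 1" by (simp add: M_def)
  define a where "a = (\<lambda>x\<in>carrier H. (\<lambda>x\<in>carrier H. x) x \<oplus> (\<lambda>x\<in>carrier H. complex_of_real (- 1 / M) \<odot> z x) x)"
  have aC: "a \<in> commutant H Z2" unfolding a_def
    by (rule commutant_ops(2)[OF Z2 commutant_ops(4)[OF Z2] commutant_ops(3)[OF Z2 zC2]])
  have ax: "a x = x \<oplus> complex_of_real (- 1 / M) \<odot> z x" if "x \<in> carrier H" for x using that by (simp add: a_def)
  have aa: "adj_pair H a a" unfolding adj_pair_def
    using cl[OF zC] adj_pair_iprod[OF zz] cl[OF aC] by (auto simp: ax ip_simps simp del: of_real_divide)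
  have ha: "hadjoint H a = a" by (rule hadjoint_eqI[OF aa]) (use commutantD(1)[OF aC] in simp)
  have zge: "(hnorm H x)\<^sup>2 <= Re (iprod H (z x) x)" if x: "x \<in> carrier H" for x
  proof -
    have "iprod H (T' \<eta> x) w = iprod H x w" if "w \<in> carrier H" for w
      using adj_pair_iprod[OF adj_pair_sym[OF T'(2)[OF B(2)]] x that] that by (simp add: T(3))
    then have "T' \<eta> x = x" using x cl[OF T'(1)[OF B(2)] x] by (intro hilbert_eqI) simp_all
    then have "(hnorm H x)\<^sup>2 = Re (iprod H (T' \<eta> x) (T' \<eta> x))" using hnorm_sq[OF x] by simp
    also have "\<dots> <= (\<Sum>b\<in>B. Re (iprod H (T' b x) (T' b x)))"
      by (rule member_le_sum[OF B(2) _ D(1)]) (use iprod_nonneg[OF cl[OF T'(1) x]] in \<open>auto simp: complex_nonneg_Reals_iff\<close>)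
    finally show ?thesis using iz[OF x x] by simp
  qed
  have an: "(hnorm H (a x))\<^sup>2 <= (1 - 1 / M) * (hnorm H x)\<^sup>2" if x: "x \<in> carrier H" for x
  proof -
    have zx: "z x \<in> carrier H" "hnorm H (z x) <= n * hnorm H x" using cl[OF zC x] commutantD(5)[OF zC x] by (auto simp: n_def)
    have "Re (iprod H x (z x)) = Re (iprod H (z x) x)" using adj_pair_iprod[OF zz x x] by simp
    then have "(hnorm H (a x))\<^sup>2 = (hnorm H x)\<^sup>2 - 2 / M * Re (iprod H (z x) x) + (hnorm H (z x))\<^sup>2 / M\<^sup>2"
    proof -
      define k where "k = - 1 / M"
      have "Re (iprod H (a x) (a x)) = (hnorm H x)\<^sup>2 + 2 * k * Re (iprod H (z x) x) + k\<^sup>2 * (hnorm H (z x))\<^sup>2"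
        unfolding ax[OF x] k_def[symmetric] using x zx \<open>Re (iprod H x (z x)) = _\<close>
        by (simp add: hnorm_sq ip_simps algebra_simps) (simp add: power2_eq_square algebra_simps)
      then show ?thesis unfolding hnorm_sq[OF cl[OF aC x]] by (simp add: k_def power_divide)
    qed
    also have "\<dots> <= (hnorm H x)\<^sup>2 - 2 / M * (hnorm H x)\<^sup>2 + (n * hnorm H x)\<^sup>2 / M\<^sup>2"
      using zge[OF x] M power_mono[OF zx(2) hnorm_nonneg[OF zx(1)], of 2]
      by (intro add_mono diff_mono order_refl mult_left_mono divide_right_mono) auto
    also have "\<dots> = (1 - 2 / M + n\<^sup>2 / M\<^sup>2) * (hnorm H x)\<^sup>2" by (simp add: algebra_simps power_mult_distrib)
    also have "\<dots> <= (1 - 1 / M) * (hnorm H x)\<^sup>2"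
    proof (rule mult_right_mono)
      have "n\<^sup>2 / M\<^sup>2 <= M / M\<^sup>2" by (rule divide_right_mono) (simp_all add: M_def)
      also have "\<dots> = 1 / M" by (simp add: power2_eq_square)
      finally show "1 - 2 / M + n\<^sup>2 / M\<^sup>2 <= 1 - 1 / M" by simp
    qed simp
    finally show ?thesis .
  qed
  have "op_bound H a (sqrt (1 - 1 / M))" unfolding op_bound_def
  proof (intro conjI ballI)
    show "0 <= sqrt (1 - 1 / M)" using M by simp
    show "hnorm H (a x) <= sqrt (1 - 1 / M) * hnorm H x" if x: "x \<in> carrier H" for x
      by (rule power2_le_imp_le) (use an[OF x] M hnorm_nonneg[OF x] in \<open>simp_all add: power_mult_distrib\<close>)
  qed
  then have "op_norm H a <= sqrt (1 - 1 / M)" by (rule op_bound_norm(2))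
  also have "\<dots> < 1" using M by simp
  finally have norm_a: "op_norm H a < 1" .
  interpret A2: cstar_algebra "op_algebra H Z2" by (rule cstar_op_algebra[OF Z2]) (use \<eta> in blast)
  obtain c0 where c0: "c0 \<in> carrier (op_algebra H Z2)" "star (op_algebra H Z2) c0 = c0"
    "c0 \<otimes>\<^bsub>op_algebra H Z2\<^esub> c0 \<otimes>\<^bsub>op_algebra H Z2\<^esub> (\<one>\<^bsub>op_algebra H Z2\<^esub> \<ominus>\<^bsub>op_algebra H Z2\<^esub> a) = \<one>\<^bsub>op_algebra H Z2\<^esub>"
    by (rule A2.inv_sqrt_one_minus[of a]) (use aC ha norm_a in simp_all)
  have c0C: "c0 \<in> commutant H Z2" "adj_pair H c0 c0" using c0(1,2) ap by auto (metis ap)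
  have inv: "c0 (c0 (complex_of_real (1 / M) \<odot> z x)) = x" if x: "x \<in> carrier H" for x
  proof -
    have zx: "z x \<in> carrier H" by (rule cl[OF zC x])
    have "(\<one>\<^bsub>op_algebra H Z2\<^esub> \<ominus>\<^bsub>op_algebra H Z2\<^esub> a) x = x \<oplus> (-1) \<odot> a x"
      using A2.minus_csm[of "\<one>\<^bsub>op_algebra H Z2\<^esub>" a] commutant_ops(4)[OF Z2] aC x by simp
    also have "\<dots> = complex_of_real (1 / M) \<odot> z x"
      using x zx by (intro hilbert_eqI) (simp_all add: ax ip_simps)
    finally have m: "(\<one>\<^bsub>op_algebra H Z2\<^esub> \<ominus>\<^bsub>op_algebra H Z2\<^esub> a) x = complex_of_real (1 / M) \<odot> z x" .
    show ?thesis using fun_cong[OF c0(3), of x] x zx by (simp add: m[unfolded op_algebra_simps] del: of_real_divide)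
  qed
  \<comment> \<open>\<open>c0\<close> is an inverse root of \<open>z / M\<close>; the factor
    \<open>1 / sqrt M\<close> turns it into one of \<open>z\<close>.\<close>
  define c where "c = (\<lambda>x\<in>carrier H. complex_of_real (1 / sqrt M) \<odot> c0 x)"
  have cC2: "c \<in> commutant H Z2" unfolding c_def by (rule commutant_ops(3)[OF Z2 c0C(1)])
  have cC: "c \<in> ?C" using cC2 sub by blast
  have c0cl: "c0 x \<in> carrier H" if "x \<in> carrier H" for x by (rule cl[OF c0C(1) that])
  have cx: "c x = complex_of_real (1 / sqrt M) \<odot> c0 x" if "x \<in> carrier H" for x using that by (simp add: c_def)
  have cc: "adj_pair H c c" unfolding adj_pair_def
    using c0cl adj_pair_iprod[OF c0C(2)] cl[OF cC] by (auto simp: cx ip_simps simp del: of_real_divide)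
  have ccz: "c (c (z x)) = x" if x: "x \<in> carrier H" for x
  proof -
    have zx: "z x \<in> carrier H" by (rule cl[OF zC x])
    have ss: "k \<odot> (k \<odot> y) = (k * k) \<odot> y" if "y \<in> carrier H" for k y
      by (rule hilbert_eqI) (simp_all add: iprod_smult that)
    have "c (c (z x)) = (complex_of_real (1 / sqrt M) * complex_of_real (1 / sqrt M)) \<odot> c0 (c0 (z x))"
      using zx c0cl by (simp add: cx adj_pair_smult[OF c0C(2)] ss del: of_real_divide)
    also have "complex_of_real (1 / sqrt M) * complex_of_real (1 / sqrt M) = complex_of_real (1 / M)"
      using M by (simp flip: of_real_mult)
    also have "\<dots> \<odot> c0 (c0 (z x)) = c0 (c0 (complex_of_real (1 / M) \<odot> z x))"
      using zx c0cl by (simp add: adj_pair_smult[OF c0C(2)] del: of_real_divide)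
    finally show ?thesis using inv[OF x] by simp
  qed
  have com: "c (A x) = A (c x)" if "A \<in> ?C" "x \<in> carrier H" for A x
    using commutantD(6)[OF cC2, of A x] that by (simp add: Z2_def)
  show ?thesis
  proof (rule that[OF cc com])
    fix A A' assume A: "A \<in> ?C" and A': "A' \<in> ?C"
    let ?A = "hadjoint H A'"
    have "iprod H (A (c b)) (A' (c b)) = iprod H (mul (mul ?A A) (mul c c) b) b" if b: "b \<in> B" for b
    proof -
      have x: "b \<in> carrier H" "c b \<in> carrier H" "c (c b) \<in> carrier H" "A (c b) \<in> carrier H" "?A (A (c b)) \<in> carrier H"
        using D(2)[OF b] by (auto intro!: cl[OF cC] cl[OF A] cl[OF hC[OF A']])
      have "iprod H (A (c b)) (A' (c b)) = iprod H (?A (A (c b))) (c b)"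
        using adj_pair_iprod[OF adj_pair_sym[OF ap[OF A']] x(4,2)] by simp
      also have "\<dots> = iprod H (c (?A (A (c b)))) b" using adj_pair_iprod[OF cc x(5,1)] by simp
      also have "c (?A (A (c b))) = ?A (A (c (c b)))" using com[OF hC[OF A'] x(4)] com[OF A x(2)] by simp
      finally show ?thesis using x by (simp add: mulx)
    qed
    then have "(\<Sum>b\<in>B. iprod H (A (c b)) (A' (c b))) = (\<Sum>b\<in>B. iprod H (mul (mul ?A A) (mul c c) b) b)" by simp
    also have "\<dots> = iprod H (mul (mul ?A A) (mul c c) (z \<eta>)) \<eta>"
      by (rule Tr) (intro mulC hC A A' cC)
    also have "\<dots> = iprod H (?A (A \<eta>)) \<eta>"
      by (simp only: mulx[OF cl[OF zC \<eta>(1)]] mulx[OF \<eta>(1)] ccz[OF \<eta>(1)])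
    also have "\<dots> = iprod H (A \<eta>) (A' \<eta>)"
      using adj_pair_iprod[OF adj_pair_sym[OF ap[OF A']] cl[OF A \<eta>(1)] \<eta>(1)] .
    finally show "(\<Sum>b\<in>B. iprod H (A (c b)) (A' (c b))) = iprod H (A \<eta>) (A' \<eta>)" .
  qed
qed

end

section \<open>Coordinate models of finite dimensional spaces and of tensor squares\<close>

lemma finite_coordinate_space:
  assumes S: "finite S"
  shows "fun_hilbert {f. ALL i. i \<notin> S --> f i = 0} (%f g. \<Sum>i\<in>S. f i * cnj (g i))"
    (is "fun_hilbert ?F ?ip")
proof
  show "?ip g f = cnj (?ip f g)" for f g :: "'a => complex" by (simp add: mult.commute)
  have sq: "?ip f f = of_real (\<Sum>i\<in>S. (cmod (f i))\<^sup>2)" for f by (simp add: complex_norm_square del: of_real_power)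
  have nrm: "nrm ?ip f = sqrt (\<Sum>i\<in>S. (cmod (f i))\<^sup>2)" for f by (simp only: nrm_def sq Re_complex_of_real)
  show "?ip f f \<in> \<real>\<^sub>\<ge>\<^sub>0" for f unfolding sq nonneg_Reals_of_real_iff by (simp add: sum_nonneg)
  show "f = (%_. 0)" if f: "f \<in> ?F" "?ip f f = 0" for f
  proof -
    have "(\<Sum>i\<in>S. (cmod (f i))\<^sup>2) = 0" using f(2) unfolding sq of_real_eq_0_iff .
    then have "f i = 0" if "i \<in> S" for i using S that by (simp add: sum_nonneg_eq_0_iff)
    then show ?thesis using f(1) by auto
  qed
  fix sg :: "nat => 'a => complex"
  assume F: "!!n. sg n \<in> ?F" and C: "!!e. e > 0 ==> EX M. \<forall>m\<ge>M. \<forall>n\<ge>M. nrm ?ip (%i. sg m i - sg n i) < e"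
  have "Cauchy (%n. sg n i)" if i: "i \<in> S" for i
  proof (rule CauchyI)
    fix \<epsilon> :: real assume "\<epsilon> > 0"
    then obtain M where M: "!!m n. m \<ge> M ==> n \<ge> M ==> nrm ?ip (%i. sg m i - sg n i) < \<epsilon>" using C by blast
    have "norm (sg m i - sg n i) < \<epsilon>" if "m \<ge> M" "n \<ge> M" for m n
    proof -
      have "(cmod (sg m i - sg n i))\<^sup>2 <= (\<Sum>i\<in>S. (cmod (sg m i - sg n i))\<^sup>2)" by (rule member_le_sum[OF i _ S]) simp
      then have "cmod (sg m i - sg n i) <= nrm ?ip (%i. sg m i - sg n i)" unfolding nrm by (rule real_le_rsqrt)
      then show ?thesis using M[OF that] by simp
    qed
    then show "EX M. \<forall>m\<ge>M. \<forall>n\<ge>M. norm (sg m i - sg n i) < \<epsilon>" by blast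
  qed
  then have "EX l. (%n. sg n i) \<longlonglongrightarrow> l" if "i \<in> S" for i using that Cauchy_convergent convergent_def by blast
  then obtain l where l: "!!i. i \<in> S ==> (%n. sg n i) \<longlonglongrightarrow> l i" by metis
  define l' where "l' i = (if i \<in> S then l i else 0)" for i
  have "(%n. sqrt (\<Sum>i\<in>S. (cmod (sg n i - l' i))\<^sup>2)) \<longlonglongrightarrow> sqrt (\<Sum>i\<in>S. (cmod (l' i - l' i))\<^sup>2)"
    by (intro tendsto_intros) (simp add: l'_def l)
  then show "\<exists>l\<in>?F. (%n. nrm ?ip (%i. sg n i - l i)) \<longlonglongrightarrow> 0"
    by (intro bexI[of _ l']) (simp_all add: nrm l'_def)
qed (auto simp: sum.distrib sum_distrib_left algebra_simps)

text \<open>The tensor square is modelled by coordinates with respect to \<open>B\<close>, that is,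
  by functions on pairs of numbers below \<open>n\<close>, so that its carrier again fits into
  \<open>'h\<close>. A tensor product of operators becomes the Kronecker product of their
  matrices.\<close>

lemma tensor_square:
  fixes H :: "'h hspace" (structure) and e :: "(nat \<times> nat => complex) => 'h"
  assumes H: "hilbert_space H" and B: "orthonormal_basis H B" and e: "inj e"
  shows "\<exists>(K :: 'h hspace) t. is_tensor_product H H K t
    & (ALL T1 S1 T2 S2. adj_pair H T1 S1 --> adj_pair H T2 S2 --> (EX G. is_operator_tensor H H K t T1 T2 G))"
proof -
  interpret hilbert_space H by fact
  note D = orthonormal_basisD[OF B]
  define n where "n = card B"
  obtain b where b: "bij_betw b {..<n} B" using ex_bij_betw_nat_finite[OF D(1)] unfolding n_def atLeast0LessThan by blast
  have bc [simp]: "b i \<in> carrier H" if "i < n" for i using D(2) bij_betwE[OF b] that by blast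
  have bb: "iprod H (b i) (b j) = (if i = j then 1 else 0)" if "i < n" "j < n" for i j
    using D(3)[of "b i" "b j"] bij_betwE[OF b] that bij_betw_imp_inj_on[OF b] by (auto simp: inj_on_eq_iff)
  have pars: "(\<Sum>i<n. iprod H h (b i) * iprod H (b i) k) = iprod H h k" if "h \<in> carrier H" "k \<in> carrier H" for h k
    using sum.reindex_bij_betw[OF b, of "%b. iprod H h b * iprod H b k"] D(4)[OF that] by simp
  define S where "S = {..<n} \<times> {..<n}"
  define F where "F = {f :: nat \<times> nat => complex. ALL p. p \<notin> S --> f p = 0}"
  define ip where "ip f g = (\<Sum>p\<in>S. f p * cnj (g p))" for f g :: "nat \<times> nat => complex"
  have S: "finite S" by (simp add: S_def)
  interpret C: fun_hilbert F ip
    using finite_coordinate_space[OF S] by (simp add: F_def ip_def[abs_def])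
  define K where "K = fun_hspace e F ip"
  interpret K: hilbert_space K unfolding K_def by (rule C.hilbert[OF e])
  define \<iota> where "\<iota> h k = (%p. if p \<in> S then iprod H h (b (fst p)) * iprod H k (b (snd p)) else 0)" for h k
  define t where "t h k = e (\<iota> h k)" for h k
  have \<iota>F: "\<iota> h k \<in> F" for h k by (simp add: \<iota>_def F_def)
  have de [simp]: "dec e (e f) = f" for f by (rule inv_f_f[OF e])
  have prod: "(\<Sum>p\<in>S. u (fst p) * v (snd p)) = (\<Sum>i<n. u i) * (\<Sum>j<n. v j)" for u v :: "nat => complex"
    by (simp add: S_def sum_product sum.cartesian_product case_prod_unfold)
  have t_ip: "iprod K (t h k) (t h' k') = iprod H h h' * iprod H k k'"
    if c: "h \<in> carrier H" "h' \<in> carrier H" "k \<in> carrier H" "k' \<in> carrier H" for h h' k k'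
  proof -
    have "iprod K (t h k) (t h' k') =
        (\<Sum>p\<in>S. (iprod H h (b (fst p)) * iprod H (b (fst p)) h') * (iprod H k (b (snd p)) * iprod H (b (snd p)) k'))"
      using c by (auto simp: K_def t_def ip_def \<iota>_def S_def ip_cnj intro!: sum.cong)
    then show ?thesis
      unfolding prod[of "%i. iprod H h (b i) * iprod H (b i) h'" "%j. iprod H k (b j) * iprod H (b j) k'"]
      using c by (simp add: pars)
  qed
  have span: "\<exists>(m::nat) f g. f \<in> {..<m} \<rightarrow> carrier H & g \<in> {..<m} \<rightarrow> carrier H & z = (\<Oplus>\<^bsub>K\<^esub>i\<in>{..<m}. t (f i) (g i))"
    if z: "z \<in> carrier K" for z
  proof -
    obtain f where f: "f \<in> F" "z = e f" using z by (auto simp: K_def)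
    define g where "g i = (\<Oplus>j\<in>{..<n}. f (i, j) \<odot> b j)" for i
    have cl: "(%j. f (i, j) \<odot> b j) \<in> {..<n} \<rightarrow> carrier H" for i by auto
    have g: "g i \<in> carrier H" for i unfolding g_def by (rule M.finsum_closed[OF cl])
    have gb: "iprod H (g i) (b j) = f (i, j)" if "j < n" for i j
    proof -
      have "iprod H (g i) (b j) = (\<Sum>j'<n. if j' = j then f (i, j) else 0)"
        unfolding g_def ip_finsum_left[OF cl bc[OF that]] using that by (intro sum.cong) (auto simp: iprod_smult bb)
      then show ?thesis using that by simp
    qed
    have "(%p. \<Sum>i<n. \<iota> (b i) (g i) p) = f"
    proof
      fix p show "(\<Sum>i<n. \<iota> (b i) (g i) p) = f p"
      proof (cases "p \<in> S")
        case True
        then obtain i' j where p: "p = (i', j)" "i' < n" "j < n" by (auto simp: S_def)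
        have "(\<Sum>i<n. \<iota> (b i) (g i) p) = (\<Sum>i<n. if i = i' then f p else 0)"
          using p True by (intro sum.cong) (auto simp: \<iota>_def bb gb)
        then show ?thesis using p by simp
      next
        case False
        then have "f p = 0" using f(1) unfolding F_def by blast
        then show ?thesis using False by (simp add: \<iota>_def)
      qed
    qed
    then have "z = (\<Oplus>\<^bsub>K\<^esub>i\<in>{..<n}. t (b i) (g i))"
      using C.finsum_fun_hspace[OF e, of "{..<n}" "%i. \<iota> (b i) (g i)"] \<iota>F f(2) by (simp add: K_def t_def)
    then show ?thesis using g by (intro exI[of _ n] exI[of _ b] exI[of _ g]) auto
  qed
  have T: "is_tensor_product H H K t" unfolding is_tensor_product_def
  proof (intro conjI ballI allI)
    show "t h k \<in> carrier K" for h k by (simp add: K_def t_def \<iota>F)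
    show "t (h \<oplus> h') k = t h k \<oplus>\<^bsub>K\<^esub> t h' k" if "h \<in> carrier H" "h' \<in> carrier H" "k \<in> carrier H" for h h' k
      using that by (auto simp: K_def t_def \<iota>_def fun_eq_iff S_def iprod_add algebra_simps intro!: arg_cong[of _ _ e])
    show "t h (k \<oplus> k') = t h k \<oplus>\<^bsub>K\<^esub> t h k'" if "h \<in> carrier H" "k \<in> carrier H" "k' \<in> carrier H" for h k k'
      using that by (auto simp: K_def t_def \<iota>_def fun_eq_iff S_def iprod_add algebra_simps intro!: arg_cong[of _ _ e])
    show "t (c \<odot> h) k = c \<odot>\<^bsub>K\<^esub> t h k" "t h (c \<odot> k) = c \<odot>\<^bsub>K\<^esub> t h k" if "h \<in> carrier H" "k \<in> carrier H" for c h k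
      using that by (auto simp: K_def t_def \<iota>_def fun_eq_iff S_def iprod_smult intro!: arg_cong[of _ _ e])
  qed (use H K.hilbert_space_axioms t_ip span in blast)+
  have G: "EX G. is_operator_tensor H H K t T1 T2 G" if p: "adj_pair H T1 S1" "adj_pair H T2 S2" for T1 S1 T2 S2
  proof -
    define m where "m p q = iprod H (T1 (b (fst q))) (b (fst p)) * iprod H (T2 (b (snd q))) (b (snd p))" for p q
    define R where "R f p = (if p \<in> S then \<Sum>q\<in>S. m p q * f q else 0)" for f p
    have RF: "R f \<in> F" for f by (simp add: R_def F_def)
    have R\<iota>: "R (\<iota> h k) = \<iota> (T1 h) (T2 k)" if hk: "h \<in> carrier H" "k \<in> carrier H" for h k
    proof
      fix p
      have s: "(\<Sum>i<n. iprod H (T (b i)) (b j) * iprod H h (b i)) = iprod H (T h) (b j)"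
        if j: "j < n" and T: "adj_pair H T T'" and h: "h \<in> carrier H" for j T T' h
      proof -
        have "(\<Sum>i<n. iprod H (T (b i)) (b j) * iprod H h (b i)) = (\<Sum>i<n. iprod H h (b i) * iprod H (b i) (T' (b j)))"
          using j by (intro sum.cong refl) (simp add: adj_pair_iprod[OF T])
        also have "\<dots> = iprod H (T h) (b j)"
          using j h adj_pair_closed(2)[OF T] by (simp add: pars adj_pair_iprod[OF T])
        finally show ?thesis .
      qed
      show "R (\<iota> h k) p = \<iota> (T1 h) (T2 k) p"
      proof (cases "p \<in> S")
        case True
        have "R (\<iota> h k) p = (\<Sum>q\<in>S. (iprod H (T1 (b (fst q))) (b (fst p)) * iprod H h (b (fst q)))
            * (iprod H (T2 (b (snd q))) (b (snd p)) * iprod H k (b (snd q))))"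
          using True by (simp add: R_def m_def \<iota>_def mult_ac)
        also have "\<dots> = iprod H (T1 h) (b (fst p)) * iprod H (T2 k) (b (snd p))"
          unfolding prod[of "%i. iprod H (T1 (b i)) (b (fst p)) * iprod H h (b i)" "%i. iprod H (T2 (b i)) (b (snd p)) * iprod H k (b i)"]
          using True hk p by (auto simp: S_def s)
        finally show ?thesis using True by (simp add: \<iota>_def)
      qed (simp add: R_def \<iota>_def)
    qed
    define c where "c = sqrt (\<Sum>p\<in>S. (\<Sum>q\<in>S. cmod (m p q))\<^sup>2)"
    have nrm: "nrm ip f = sqrt (\<Sum>i\<in>S. (cmod (f i))\<^sup>2)" for f
    proof -
      have "ip f f = of_real (\<Sum>i\<in>S. (cmod (f i))\<^sup>2)" by (simp add: ip_def complex_norm_square del: of_real_power)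
      then show ?thesis by (simp only: nrm_def Re_complex_of_real)
    qed
    have "nrm ip (R f) <= c * nrm ip f" for f
    proof -
      have le: "cmod (f q) <= nrm ip f" if "q \<in> S" for q
        unfolding nrm by (rule real_le_rsqrt) (rule member_le_sum[OF that _ S], simp)
      have "cmod (R f p) <= (\<Sum>q\<in>S. cmod (m p q)) * nrm ip f" if "p \<in> S" for p
        using that unfolding R_def sum_distrib_right
        by (auto simp: norm_mult intro!: order_trans[OF norm_sum] sum_mono mult_left_mono le)
      then have "(\<Sum>p\<in>S. (cmod (R f p))\<^sup>2) <= (\<Sum>p\<in>S. ((\<Sum>q\<in>S. cmod (m p q)) * nrm ip f)\<^sup>2)"
        by (intro sum_mono power_mono) auto
      also have "\<dots> = (\<Sum>p\<in>S. (\<Sum>q\<in>S. cmod (m p q))\<^sup>2) * (nrm ip f)\<^sup>2" by (simp add: power_mult_distrib flip: sum_distrib_right)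
      finally have "nrm ip (R f) <= sqrt ((\<Sum>p\<in>S. (\<Sum>q\<in>S. cmod (m p q))\<^sup>2) * (nrm ip f)\<^sup>2)" unfolding nrm[of "R f"] by simp
      also have "\<dots> = c * nrm ip f" by (simp add: c_def real_sqrt_mult nrm sum_nonneg)
      finally show ?thesis .
    qed
    moreover have "R (%p. f p + g p) = (%p. R f p + R g p)" "R (%p. k * f p) = (%p. k * R f p)" for f g k
      by (auto simp: R_def fun_eq_iff sum.distrib sum_distrib_left algebra_simps)
    ultimately have "bounded_operator K (fun_op e F R)"
      using e RF C.F_add C.F_smult unfolding bounded_operator_def K_def
      by (auto intro!: exI[of _ c])
    then have "is_operator_tensor H H K t T1 T2 (fun_op e F R)"
      using e \<iota>F R\<iota> unfolding is_operator_tensor_def t_def by simp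
    then show ?thesis by blast
  qed
  show ?thesis by (rule exI[of _ K], rule exI[of _ t]) (use T G in blast)
qed

lemma (in hilbert_space) orthonormal_basis_finite_dimensional:
  assumes B: "orthonormal_basis H B" shows "finite_dimensional H"
  unfolding finite_dimensional_def
proof (intro exI[of _ B] conjI ballI)
  note D = orthonormal_basisD[OF B]
  show "finite B" by (rule D(1))
  show "B \<subseteq> carrier H" using D(2) by blast
  fix h assume h: "h \<in> carrier H"
  have c: "(%b. iprod H h b \<odot> b) \<in> B \<rightarrow> carrier H" using D(2) by blast
  have "h = (\<Oplus>b\<in>B. iprod H h b \<odot> b)"
  proof (rule hilbert_eqI[OF h M.finsum_closed[OF c]])
    fix k assume k: "k \<in> carrier H"
    have "iprod H h k = (\<Sum>b\<in>B. iprod H h b * iprod H b k)" by (rule D(4)[OF h k])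
    also have "\<dots> = iprod H (\<Oplus>b\<in>B. iprod H h b \<odot> b) k"
      unfolding ip_finsum_left[OF c k] by (intro sum.cong refl) (simp add: iprod_smult D(2) k)
    finally show "iprod H h k = iprod H (\<Oplus>b\<in>B. iprod H h b \<odot> b) k" .
  qed
  then show "EX c. h = (\<Oplus>b\<in>B. c b \<odot> b)"
    by (rule exI[of "%c. h = (\<Oplus>b\<in>B. c b \<odot> b)" "%b. iprod H h b"])
qed

text \<open>The vector of the tensor square is the sum of \<open>t (c b) (J b)\<close> over the
  basis, the one that corresponds to the operator \<open>c\<close>. As \<open>c\<close> commutes
  with the algebra and \<open>J\<close> carries \<open>E\<close> to \<open>F\<close>, applying
  \<open>A\<close> on the left and the conjugate of \<open>A'\<close> on the right gives the sum of
  \<open>iprod H (A (c b)) (A' (c b))\<close>, and \<open>c\<close> was made so that this equals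
  \<open>iprod H (A \<eta>) (A' \<eta>)\<close>.\<close>

lemma quantum_correlation_of_tracial_vector:
  fixes H :: "'h hspace" and e :: "(nat \<times> nat => complex) => 'h"
    and E F :: "'x::finite => 'x => 'x => 'x => 'h => 'h"
  assumes H: "hilbert_space H" and e: "inj e"
    and Z: "self_adjoint_set H Z" and \<eta>: "\<eta> \<in> carrier H" "hnorm H \<eta> = 1"
    and tr: "!!S T. S \<in> commutant H Z ==> T \<in> commutant H Z ==> iprod H (S (T \<eta>)) \<eta> = iprod H (T (S \<eta>)) \<eta>"
    and faithful: "!!T x. T \<in> commutant H Z ==> T \<eta> = \<zero>\<^bsub>H\<^esub> ==> x \<in> carrier H ==> T x = \<zero>\<^bsub>H\<^esub>"
    and B: "orthonormal_basis H B" "\<eta> \<in> B" "!!b. b \<in> B ==> \<exists>T\<in>commutant H Z. T \<eta> = b"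
    and J: "!!h. h \<in> carrier H ==> J h \<in> carrier H"
      "!!h k. h \<in> carrier H ==> k \<in> carrier H ==> iprod H (J h) (J k) = iprod H k h"
    and E: "stochastic_operator_matrix H E" "!!x x' a a'. E x x' a a' \<in> commutant H Z"
    and F: "stochastic_operator_matrix H F" "!!x x' a a'. EX S. adj_pair H (F x x' a a') S"
    and FJ: "!!x x' a a' h. h \<in> carrier H ==> F x x' a a' (J h) = J (E x x' a a' h)"
    and \<Gamma>: "!!x x' y y'. \<Gamma> (kron (mat_unit x x') (mat_unit y y')) =
      (\<Sum>a\<in>UNIV. \<Sum>a'\<in>UNIV. \<Sum>b\<in>UNIV. \<Sum>b'\<in>UNIV.
        cscale (iprod H (E x x' a a' \<eta>) (E y y' b b' \<eta>)) (kron (mat_unit a a') (mat_unit b b')))"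
  shows "quantum_correlation TYPE('h) \<Gamma>"
proof -
  interpret hilbert_space H by fact
  have \<eta>0: "\<eta> ~= \<zero>\<^bsub>H\<^esub>" using \<eta> by auto
  have "EX c. adj_pair H c c & (ALL A x. A \<in> commutant H Z --> x \<in> carrier H --> c (A x) = A (c x))
    & (ALL A A'. A \<in> commutant H Z --> A' \<in> commutant H Z
      --> (\<Sum>b\<in>B. iprod H (A (c b)) (A' (c b))) = iprod H (A \<eta>) (A' \<eta>))"
    by (rule central_inverse_root[where Z = Z and \<eta> = \<eta> and B = B])
      (fact Z \<eta> \<eta>0 tr faithful B | blast)+
  then obtain c where c: "adj_pair H c c" "!!A x. A \<in> commutant H Z ==> x \<in> carrier H ==> c (A x) = A (c x)"
    "!!A A'. A \<in> commutant H Z ==> A' \<in> commutant H Z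
      ==> (\<Sum>b\<in>B. iprod H (A (c b)) (A' (c b))) = iprod H (A \<eta>) (A' \<eta>)" by blast
  obtain K :: "'h hspace" and t where t: "is_tensor_product H H K t"
    "!!T1 S1 T2 S2. adj_pair H T1 S1 ==> adj_pair H T2 S2 ==> EX G. is_operator_tensor H H K t T1 T2 G"
    using tensor_square[OF H B(1) e] by blast
  interpret K: hilbert_space K using t(1) by (simp add: is_tensor_product_def)
  have tc: "t h k \<in> carrier K" if "h \<in> carrier H" "k \<in> carrier H" for h k
    using t(1) that unfolding is_tensor_product_def by blast
  have tip: "iprod K (t h k) (t h' k') = iprod H h h' * iprod H k k'"
    if "h \<in> carrier H" "k \<in> carrier H" "h' \<in> carrier H" "k' \<in> carrier H" for h k h' k'
    using t(1) that unfolding is_tensor_product_def by blast+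
  define G where "G x x' a a' y y' b b' = (SOME G. is_operator_tensor H H K t (E x x' a a') (F y y' b b') G)" for x x' a a' y y' b b'
  have "EX G. is_operator_tensor H H K t (E x x' a a') (F y y' b b') G" for x x' a a' y y' b b'
    using t(2)[OF hadjoint_pair[OF E(2)]] F(2) by blast
  then have G: "is_operator_tensor H H K t (E x x' a a') (F y y' b b') (G x x' a a' y y' b b')" for x x' a a' y y' b b'
    unfolding G_def by (rule someI_ex)
  note D = orthonormal_basisD[OF B(1)]
  have cc: "c b \<in> carrier H" if "b \<in> B" for b using adj_pair_closed(1)[OF c(1) D(2)[OF that]] .
  define \<xi> where "\<xi> = (\<Oplus>\<^bsub>K\<^esub>b\<in>B. t (c b) (J b))"
  have cl: "(%b. t (c b) (J b)) \<in> B \<rightarrow> carrier K" using tc cc J(1) D(2) by blast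
  have \<xi>: "\<xi> \<in> carrier K" unfolding \<xi>_def by (rule K.M.finsum_closed[OF cl])
  have val: "iprod K (\<Oplus>\<^bsub>K\<^esub>b\<in>B. t (A (c b)) (J (A' b))) \<xi> = iprod H (A \<eta>) (A' \<eta>)"
    if A: "A \<in> commutant H Z" and A': "A' \<in> commutant H Z" for A A'
  proof -
    have Ac: "A (c b) \<in> carrier H" and Ab: "A' b \<in> carrier H" if "b \<in> B" for b
      using commutantD(2)[OF A cc[OF that]] commutantD(2)[OF A' D(2)[OF that]] .
    have cl': "(%b. t (A (c b)) (J (A' b))) \<in> B \<rightarrow> carrier K" using tc Ac Ab J(1) by blast
    have "iprod K (t (A (c b)) (J (A' b))) \<xi> = iprod H (A (c b)) (A' (c b))" if b: "b \<in> B" for b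
    proof -
      have tK: "t (A (c b)) (J (A' b)) \<in> carrier K" using tc Ac Ab J(1) b by blast
      have "iprod K (t (A (c b)) (J (A' b))) \<xi> = (\<Sum>d\<in>B. iprod H (A (c b)) (c d) * iprod H d (A' b))"
        unfolding \<xi>_def K.ip_finsum_right[OF cl tK]
        by (intro sum.cong refl) (simp add: tip Ac[OF b] Ab[OF b] J cc D(2))
      also have "\<dots> = (\<Sum>d\<in>B. iprod H (c (A (c b))) d * iprod H d (A' b))"
        by (intro sum.cong refl) (simp add: adj_pair_iprod[OF c(1)] Ac[OF b] D(2))
      also have "\<dots> = iprod H (c (A (c b))) (A' b)"
        by (rule D(4)[symmetric]) (rule adj_pair_closed(1)[OF c(1) Ac[OF b]], rule Ab[OF b])
      also have "\<dots> = iprod H (A (c b)) (c (A' b))" by (rule adj_pair_iprod[OF c(1) Ac[OF b] Ab[OF b]])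
      also have "c (A' b) = A' (c b)" by (rule c(2)[OF A' D(2)[OF b]])
      finally show ?thesis .
    qed
    then have "iprod K (\<Oplus>\<^bsub>K\<^esub>b\<in>B. t (A (c b)) (J (A' b))) \<xi> = (\<Sum>b\<in>B. iprod H (A (c b)) (A' (c b)))"
      unfolding K.ip_finsum_left[OF cl' \<xi>] by simp
    then show ?thesis using c(3)[OF A A'] by simp
  qed
  have "(\<Oplus>\<^bsub>K\<^esub>b\<in>B. t ((\<lambda>x\<in>carrier H. x) (c b)) (J ((\<lambda>x\<in>carrier H. x) b))) = \<xi>"
    unfolding \<xi>_def using cl by (intro K.M.finsum_cong') (auto simp: cc D(2))
  then have "iprod K \<xi> \<xi> = 1"
    using val[OF commutant_ops(4)[OF Z] commutant_ops(4)[OF Z]] \<eta> ip_self[OF \<eta>(1)] by simp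
  then have norm: "hnorm K \<xi> = 1" by (simp add: hnorm_def)
  have G\<xi>: "iprod K (G x x' a a' y y' b b' \<xi>) \<xi> = iprod H (E x x' a a' \<eta>) (E y y' b b' \<eta>)" for x x' a a' y y' b b'
  proof -
    have g: "bounded_operator K (G x x' a a' y y' b b')"
      "!!h k. h \<in> carrier H ==> k \<in> carrier H ==> G x x' a a' y y' b b' (t h k) = t (E x x' a a' h) (F y y' b b' k)"
      using G[of x x' a a' y y' b b'] unfolding is_operator_tensor_def by blast+
    have "G x x' a a' y y' b b' \<xi> = (\<Oplus>\<^bsub>K\<^esub>d\<in>B. G x x' a a' y y' b b' (t (c d) (J d)))"
      unfolding \<xi>_def by (rule K.bounded_operator_finsum[OF g(1) cl])
    also have "\<dots> = (\<Oplus>\<^bsub>K\<^esub>d\<in>B. t (E x x' a a' (c d)) (J (E y y' b b' d)))"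
    proof (rule K.M.finsum_cong'[OF refl])
      show "(%d. t (E x x' a a' (c d)) (J (E y y' b b' d))) \<in> B \<rightarrow> carrier K"
        by (intro funcsetI tc commutantD(2)[OF E(2)] cc J(1) D(2))
    qed (simp add: g(2) cc J(1) D(2) FJ)
    finally show ?thesis using val[OF E(2) E(2)] by simp
  qed
  have fd: "finite_dimensional H" by (rule orthonormal_basis_finite_dimensional[OF B(1)])
  show ?thesis unfolding quantum_correlation_def
    by (rule exI[of _ H], rule exI[of _ H], rule exI[of _ K], rule exI[of _ t], rule exI[of _ E], rule exI[of _ F],
        rule exI[of _ G], rule exI[of _ \<xi>], intro conjI fd t(1) E(1) F(1) allI G \<xi> norm) (simp only: \<Gamma> G\<xi>)
qed

text \<open>The basis is chosen inside the orbit of \<open>\<eta>\<close> under the commutant and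
  contains \<open>\<eta>\<close>, as \<open>central_inverse_root\<close> demands; finitely many
  words suffice by \<open>finite_rank_functions\<close>. The conjugation \<open>J\<close> is
  \<open>flip\<close>, which turns left into right multiplication.\<close>

theorem quantum_of_finite_rank:
  fixes emb :: "(nat => complex) => 'h" and t :: "'x::finite letter list => complex"
  assumes emb: "inj emb" and t: "word_trace t" "finite_rank t" "word_represents t \<Gamma>"
  shows "quantum_correlation TYPE('h) \<Gamma>"
proof -
  obtain e :: "(unit \<times> 'x letter list => complex) => 'h" where e: "inj e"
    using exists_coding[OF emb countable_letter_lists] by blast
  have "countable (UNIV :: (nat \<times> nat) set)" by simp
  then obtain e2 :: "(nat \<times> nat => complex) => 'h" where e2: "inj e2" using exists_coding[OF emb] by blast
  interpret coded_space t "TYPE(unit)" e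
    using t(1) e by (simp add: coded_space_def coded_space_axioms_def word_space_def)
  let ?C = "commutant H RM"
  have kw: "K (c0, w) \<in> kspace K" for w by simp
  have \<eta>: "\<eta> \<in> carrier H" "hnorm H \<eta> = 1" using quantum_commuting_data(4,5) by auto
  have X: "\<exists>X\<in>?C. X \<eta> = e (K (c0, w))" for w
  proof (induct w)
    case Nil
    show ?case by (rule bexI[OF _ H.commutant_ops(4)[OF RM_self_adjoint]]) simp
  next
    case (Cons g w)
    then obtain X where X: "X \<in> ?C" "X \<eta> = e (K (c0, w))" by blast
    have "(\<lambda>x\<in>carrier H. Op (rowL g) (X x)) \<eta> = e (K (c0, g # w))"
      by (simp only: restrict_apply \<eta>(1) if_True X(2) Op_e[OF kw] row_kernel)
    then show ?case by (rule bexI[OF _ H.commutant_ops(1)[OF RM_self_adjoint L_commutant X(1)]])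
  qed
  obtain W where W: "finite W" "!!f c w. f \<in> kspace K ==> (!!s. s \<in> W ==> f (c, s) = 0) ==> f (c, w) = 0"
    using finite_rank_functions[OF t(2)] by metis
  define V where "V = {T \<eta> |T. T \<in> ?C}"
  have \<eta>V: "\<eta> \<in> V"
  proof -
    obtain X where "X \<in> ?C" "X \<eta> = \<eta>" using X[of "[]"] by blast
    then show ?thesis unfolding V_def by (intro CollectI exI[of _ X] conjI) (rule sym)
  qed
  have "EX B. {\<eta>} \<subseteq> B & B \<subseteq> V & orthonormal H B
    & (\<forall>h\<in>carrier H. (\<forall>b\<in>B. iprod H h b = 0) --> (\<forall>s\<in>(%w. e (K (c0, w))) ` W. iprod H h s = 0))"
  proof (rule H.gram_schmidt)
    show "V \<subseteq> carrier H" unfolding V_def using H.commutantD(2) \<eta>(1) by blast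
    show "x \<oplus>\<^bsub>H\<^esub> y \<in> V" if "x \<in> V" "y \<in> V" for x y
    proof -
      obtain S T where ST: "S \<in> ?C" "T \<in> ?C" "x = S \<eta>" "y = T \<eta>" using \<open>x \<in> V\<close> \<open>y \<in> V\<close> by (auto simp: V_def)
      have "x \<oplus>\<^bsub>H\<^esub> y = (\<lambda>x\<in>carrier H. S x \<oplus>\<^bsub>H\<^esub> T x) \<eta>" using ST(3,4) \<eta>(1) by (simp only: restrict_apply if_True)
      then show ?thesis using H.commutant_ops(2)[OF RM_self_adjoint ST(1,2)] unfolding V_def by blast
    qed
    show "c \<odot>\<^bsub>H\<^esub> x \<in> V" if "x \<in> V" for c x
    proof -
      obtain T where T: "T \<in> ?C" "x = T \<eta>" using \<open>x \<in> V\<close> by (auto simp: V_def)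
      have "c \<odot>\<^bsub>H\<^esub> x = (\<lambda>x\<in>carrier H. c \<odot>\<^bsub>H\<^esub> T x) \<eta>" using T(2) \<eta>(1) by (simp only: restrict_apply if_True)
      then show ?thesis using H.commutant_ops(3)[OF RM_self_adjoint T(1)] unfolding V_def by blast
    qed
    show "orthonormal H {\<eta>}" using \<eta> H.ip_self[OF \<eta>(1)] unfolding orthonormal_def by (simp del: fun_hspace_simps(1,5))
    show "{\<eta>} \<subseteq> V" using \<eta>V by blast
    show "finite ((%w. e (K (c0, w))) ` W)" using W(1) by blast
    show "(%w. e (K (c0, w))) ` W \<subseteq> V" unfolding V_def using X by (metis (mono_tags, lifting) image_subsetI mem_Collect_eq)
  qed
  then obtain B where B: "{\<eta>} \<subseteq> B" "B \<subseteq> V" "orthonormal H B"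
    and sep: "\<forall>h\<in>carrier H. (\<forall>b\<in>B. iprod H h b = 0) --> (\<forall>s\<in>(%w. e (K (c0, w))) ` W. iprod H h s = 0)" by (elim exE conjE)
  have onb: "orthonormal_basis H B"
  proof (rule H.orthonormal_basisI[OF B(3)])
    fix h assume h: "h \<in> carrier H" and z: "!!b. b \<in> B ==> iprod H h b = 0"
    obtain f where f: "f \<in> kspace K" "h = e f" using carrier_H[OF h] by blast
    have "iprod H h (e (K (c0, w))) = 0" if "w \<in> W" for w using sep h z that by blast
    then have "f (c0, w) = 0" if "w \<in> W" for w using f that by (simp add: reproducing)
    then have "f (c0, w) = 0" for w by (rule W(2)[OF f(1)])
    then have "f = (%_. 0)" by (intro ext) (auto simp: split_paired_all)
    then show "h = \<zero>\<^bsub>H\<^esub>" using f(2) by simp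
  qed
  define J where "J h = e (flip (dec e h))" for h
  have Je: "J (e f) = e (flip f)" for f by (simp add: J_def)
  have gs: "gstar (y, y', b, b') = (y', y, b', b)" for y y' b b' :: 'x by simp
  have LR: "mop (rowR (y', y, b', b)) (flip f) = flip (mop (rowL (y, y', b, b')) f)" for y y' b b' f
    by (auto simp: fun_eq_iff)
  show ?thesis
  proof (rule quantum_correlation_of_tracial_vector[OF H.hilbert_space_axioms e2 RM_self_adjoint \<eta> _ _ onb _ _ _ _
      quantum_commuting_data(1) L_commutant quantum_commuting_data(2), where J = J])
    show "iprod H (S (T \<eta>)) \<eta> = iprod H (T (S \<eta>)) \<eta>" if "S \<in> ?C" "T \<in> ?C" for S T
      using tau0_commute[OF that] \<eta>(1) unfolding tau0_def by (simp only: restrict_apply if_True)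
    show "T h = \<zero>\<^bsub>H\<^esub>" if T: "T \<in> ?C" "T \<eta> = \<zero>\<^bsub>H\<^esub>" and x: "h \<in> carrier H" for T h
    proof -
      have "vec T (c0, w) = 0" for w using T(2) by (simp add: vec_def)
      then show ?thesis using commutant_zero[OF T(1)] x by (simp only: restrict_apply if_True)
    qed
    show "\<eta> \<in> B" using B(1) by blast
    show "\<exists>T\<in>?C. T \<eta> = b" if "b \<in> B" for b using B(2) that by (auto simp: V_def)
    show "J h \<in> carrier H" if "h \<in> carrier H" for h using carrier_H[OF that] by (auto simp: Je flip_in)
    show "iprod H (J h) (J k) = iprod H k h" if hk: "h \<in> carrier H" "k \<in> carrier H" for h k
    proof -
      obtain f g where fg: "f \<in> kspace K" "h = e f" "g \<in> kspace K" "k = e g" using hk carrier_H by blast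
      then show ?thesis using kip_flip[OF fg(1,3)] H.ip_cnj[OF hk] by (simp add: Je)
    qed
    show "EX S. adj_pair H (Op (rowR (y', y, b', b))) S" for y y' b b' using adj_Op(2) by blast
    show "Op (rowR (y', y, b', b)) (J h) = J (Op (rowL (y, y', b, b')) h)" if h: "h \<in> carrier H" for y y' b b' h
    proof -
      obtain f where f: "f \<in> kspace K" "h = e f" using carrier_H[OF h] by blast
      show ?thesis unfolding f(2) Je Op_e[OF f(1)] Op_e[OF flip_in[OF f(1)]] LR ..
    qed
    fix x x' y y' :: 'x
    have "iprod H (Op (rowL (x, x', a, a')) \<eta>) (Op (rowL (y, y', b, b')) \<eta>) = t [(x, x', a, a'), (y', y, b', b)]" for a a' b b'
      using t_cyclic[of "[(y', y, b', b)]" "[(x, x', a, a')]"] by (simp add: row_kernel reproducing)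
    then show "\<Gamma> (kron (mat_unit x x') (mat_unit y y')) =
      (\<Sum>a\<in>UNIV. \<Sum>a'\<in>UNIV. \<Sum>b\<in>UNIV. \<Sum>b'\<in>UNIV.
        cscale (iprod H (Op (rowL (x, x', a, a')) \<eta>) (Op (rowL (y, y', b, b')) \<eta>)) (kron (mat_unit a a') (mat_unit b b')))"
      using t(3) unfolding word_represents_def by (simp only:)
  qed
qed

section \<open>Correlations and their matrix coefficients\<close>

lemma sum_units_component:
  "(\<Sum>a\<in>UNIV. \<Sum>a'\<in>UNIV. \<Sum>b\<in>UNIV. \<Sum>b'\<in>UNIV. cscale (c a a' b b') (kron (mat_unit a a') (mat_unit b b'))) $ (p, q) $ (p', q')
    = c p p' q q'"
proof -
  have d: "cscale (c a a' b b') (kron (mat_unit a a') (mat_unit b b')) $ (p, q) $ (p', q')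
      = (if b' = q' then if b = q then if a' = p' then if a = p then c p p' q q' else 0 else 0 else 0 else 0)" for a a' b b'
    by (auto simp: cscale_def kron_def mat_unit_def)
  show ?thesis by (simp add: d)
qed

lemma word_represents_iff:
  "word_represents t \<Gamma> \<longleftrightarrow> (ALL x x' y y' a a' b b'.
    \<Gamma> (kron (mat_unit x x') (mat_unit y y')) $ (a, b) $ (a', b') = t [(x, x', a, a'), (y', y, b', b)])"
  unfolding word_represents_def vec_eq_iff split_paired_All sum_units_component by blast

lemma trace_mult_commute: "trace (A ** B) = trace (B ** (A :: 'i::finite cmat))"
  unfolding trace_def matrix_matrix_mult_def by (simp add: mult.commute) (rule sum.swap)

lemma max_ent_component: "(max_ent :: ('x::finite \<times> 'x) cmat) $ (x, y) $ (x', y') = (if x = y & x' = y' then 1 / of_nat CARD('x) else 0)"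
proof -
  have d: "kron (mat_unit z z') (mat_unit z z') $ (x, y) $ (x', y') = (if z' = x' then if z = x then if x = y & x' = y' then 1 else 0 else 0 else (0 :: complex))" for z z'
    by (auto simp: kron_def mat_unit_def)
  show ?thesis by (simp add: max_ent_def cscale_def d)
qed

lemma max_ent_projection: "(max_ent :: ('x::finite \<times> 'x) cmat) \<in> projections"
proof -
  have s: "(\<Sum>z\<in>(UNIV :: 'x set). \<Sum>w\<in>UNIV. (if x = y & z = w then 1 / of_nat CARD('x) else 0) * (if z = w & x' = y' then 1 / of_nat CARD('x) else 0))
      = (if x = y & x' = y' then 1 / of_nat CARD('x) else (0 :: complex))" for x y x' y' :: 'x
  proof -
    have q: "(if x = y & z = w then 1 / of_nat CARD('x) else 0) * (if z = w & x' = y' then 1 / of_nat CARD('x) else 0)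
      = (if w = z then if x = y & x' = y' then 1 / of_nat CARD('x) * (1 / of_nat CARD('x)) else 0 else (0 :: complex))" for z w :: 'x by auto
    show ?thesis by (simp only: q, cases "x = y & x' = y'") simp_all
  qed
  have "(max_ent ** max_ent :: ('x \<times> 'x) cmat) $ (x, y) $ (x', y') = max_ent $ (x, y) $ (x', y')" for x y x' y'
    unfolding matrix_matrix_mult_def vec_lambda_beta sum_UNIV_pair max_ent_component by (rule s)
  moreover have "mat_adj (max_ent :: ('x \<times> 'x) cmat) $ (x, y) $ (x', y') = max_ent $ (x, y) $ (x', y')" for x y x' y'
    by (auto simp: mat_adj_def max_ent_component)
  ultimately show ?thesis unfolding projections_def by (auto simp: vec_eq_iff)
qed

text \<open>Perfectness at J, where concurrence gives \<open>\<phi> J = J\<close>, and preservation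
  of the trace make the trace of \<open>\<Gamma> J J\<close> equal to 1. Expanding both copies of J
  in matrix units produces the factor 1/|X|^2.\<close>

lemma total_of_perfect:
  fixes \<phi> \<Gamma> :: "('x::finite \<times> 'x) cmat => ('x \<times> 'x) cmat"
  assumes p: "perfect_strategy \<phi> \<Gamma>" and c: "concurrent \<phi>" and q: "qns_correlation \<Gamma>"
  shows "(\<Sum>(x, x', a, a')\<in>UNIV. \<Gamma> (kron (mat_unit x x') (mat_unit x x')) $ (a, a) $ (a', a')) = (of_nat CARD('x))\<^sup>2"
proof -
  let ?J = "max_ent :: ('x \<times> 'x) cmat"
  have lin: "clinear_mat \<Gamma>" and tr: "!!A. trace (\<Gamma> A) = trace A"
    using q by (auto simp: qns_correlation_def quantum_channel_def)
  have sc: "\<Gamma> (cscale c A) = cscale c (\<Gamma> A)" for c A using lin by (auto simp: clinear_mat_def)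
  have J: "trace (\<Gamma> ?J ** proj_perp ?J) = 0"
    using p c max_ent_projection by (auto simp: perfect_strategy_def concurrent_def)
  have "\<Gamma> ?J = \<Gamma> ?J ** proj_perp ?J + \<Gamma> ?J ** ?J"
    using matrix_add_ldistrib[of "\<Gamma> ?J" "proj_perp ?J" ?J] by (simp add: proj_perp_def)
  then have "trace (\<Gamma> ?J) = trace (\<Gamma> ?J ** proj_perp ?J) + trace (\<Gamma> ?J ** ?J)" by (metis trace_add)
  moreover have "trace ?J = 1" by (simp add: trace_def sum_UNIV_pair max_ent_component if_distrib cong: if_cong)
  ultimately have 1: "trace (\<Gamma> ?J ** ?J) = 1" using J tr by simp
  define G where "G = \<Gamma> ?J"
  define g where "g x x' a a' = \<Gamma> (kron (mat_unit x x') (mat_unit x x')) $ (a, a) $ (a', a')" for x x' a a'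
  have "G = cscale (1 / of_nat CARD('x)) (\<Sum>x\<in>UNIV. \<Sum>x'\<in>UNIV. \<Gamma> (kron (mat_unit x x') (mat_unit x x')))"
    by (simp add: G_def max_ent_def sc clinear_mat_sum[OF lin])
  then have G: "G $ (a, a) $ (a', a') = 1 / of_nat CARD('x) * (\<Sum>x\<in>UNIV. \<Sum>x'\<in>UNIV. g x x' a a')" for a a'
    by (simp add: cscale_def g_def)
  have "1 = trace (?J ** G)" using 1 trace_mult_commute[of G ?J] by (simp add: G_def)
  also have "\<dots> = 1 / of_nat CARD('x) * (\<Sum>a'\<in>UNIV. \<Sum>a\<in>UNIV. G $ (a, a) $ (a', a'))"
    unfolding max_ent_def by (simp add: trace_cscale_mult trace_sum_mult trace_units)
  also have "(\<Sum>a'\<in>UNIV. \<Sum>a\<in>UNIV. G $ (a, a) $ (a', a')) = (\<Sum>a\<in>UNIV. \<Sum>a'\<in>UNIV. G $ (a, a) $ (a', a'))" by (rule sum.swap)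
  also have "\<dots> = 1 / of_nat CARD('x) * (\<Sum>a\<in>UNIV. \<Sum>a'\<in>UNIV. \<Sum>x\<in>UNIV. \<Sum>x'\<in>UNIV. g x x' a a')"
    by (simp add: G sum_distrib_left)
  also have "(\<Sum>a\<in>UNIV. \<Sum>a'\<in>UNIV. \<Sum>x\<in>UNIV. \<Sum>x'\<in>UNIV. g x x' a a') = (\<Sum>x\<in>UNIV. \<Sum>x'\<in>UNIV. \<Sum>a\<in>UNIV. \<Sum>a'\<in>UNIV. g x x' a a')"
    using sum.swap[of "%p q. g (fst q) (snd q) (fst p) (snd p)" UNIV UNIV] by (simp add: sum_UNIV_pair)
  finally have "1 / of_nat CARD('x) * (1 / of_nat CARD('x) *
      (\<Sum>(x, x', a, a')\<in>UNIV. \<Gamma> (kron (mat_unit x x') (mat_unit x x')) $ (a, a) $ (a', a'))) = 1"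
    by (simp add: sum_UNIV_pair g_def)
  then show ?thesis by (simp add: power2_eq_square field_simps)
qed

lemma word_trace_of_quantum_commuting:
  fixes \<Gamma> :: "('x::finite \<times> 'x) cmat => ('x \<times> 'x) cmat"
  assumes q: "quantum_commuting TYPE('h) \<Gamma>"
    and total: "(\<Sum>(x, x', a, a')\<in>UNIV. \<Gamma> (kron (mat_unit x x') (mat_unit x x')) $ (a, a) $ (a', a')) = (of_nat CARD('x))\<^sup>2"
  obtains t where "word_trace t" "word_represents t \<Gamma>"
proof -
  obtain H :: "'h hspace" and E F :: "'x => 'x => 'x => 'x => 'h => 'h" and \<xi> where H: "hilbert_space H"
    "stochastic_operator_matrix H E" "stochastic_operator_matrix H F"
    and c: "ALL x x' a a' y y' b b'. \<forall>h\<in>carrier H. E x x' a a' (F y y' b b' h) = F y y' b b' (E x x' a a' h)"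
    and \<xi>: "\<xi> \<in> carrier H" "hnorm H \<xi> = 1"
    and \<Gamma>: "ALL x x' y y'. \<Gamma> (kron (mat_unit x x') (mat_unit y y')) =
             (\<Sum>a\<in>UNIV. \<Sum>a'\<in>UNIV. \<Sum>b\<in>UNIV. \<Sum>b'\<in>UNIV.
                cscale (iprod H (E x x' a a' (F y y' b b' \<xi>)) \<xi>) (kron (mat_unit a a') (mat_unit b b')))"
    using q unfolding quantum_commuting_def by (elim exE conjE)
  have G: "\<Gamma> (kron (mat_unit x x') (mat_unit y y')) $ (a, b) $ (a', b') = iprod H (E x x' a a' (F y y' b b' \<xi>)) \<xi>" for x x' y y' a a' b b'
    using \<Gamma> by (simp only: sum_units_component)
  interpret commuting_pair H E F \<xi>
  proof (unfold commuting_pair_def commuting_pair_axioms_def stochastic_def stochastic_axioms_def, intro conjI allI impI H \<xi>)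
    show "E x x' a a' (F y y' b b' h) = F y y' b b' (E x x' a a' h)" if "h \<in> carrier H" for h x x' a a' y y' b b' using c that by blast
    show "(\<Sum>(x, x', a, a')\<in>UNIV. iprod H (E x x' a a' (F x x' a a' \<xi>)) \<xi>) = (of_nat CARD('x))\<^sup>2" using total by (simp only: G)
  qed
  show ?thesis by (rule that[OF word_trace]) (simp only: word_represents_iff G t_value simp_thms)
qed

lemma word_trace_of_quantum:
  fixes \<Gamma> :: "('x::finite \<times> 'x) cmat => ('x \<times> 'x) cmat"
  assumes q: "quantum_correlation TYPE('h) \<Gamma>"
    and total: "(\<Sum>(x, x', a, a')\<in>UNIV. \<Gamma> (kron (mat_unit x x') (mat_unit x x')) $ (a, a) $ (a', a')) = (of_nat CARD('x))\<^sup>2"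
  obtains t where "word_trace t" "finite_rank t" "word_represents t \<Gamma>"
proof -
  obtain H1 H2 K :: "'h hspace" and r and E F :: "'x => 'x => 'x => 'x => 'h => 'h" and G \<xi> where
    H: "finite_dimensional H1" "finite_dimensional H2" "is_tensor_product H1 H2 K r"
      "stochastic_operator_matrix H1 E" "stochastic_operator_matrix H2 F"
    and c: "ALL x x' a a' y y' b b'. is_operator_tensor H1 H2 K r (E x x' a a') (F y y' b b') (G x x' a a' y y' b b')"
    and \<xi>: "\<xi> \<in> carrier K" "hnorm K \<xi> = 1"
    and \<Gamma>: "ALL x x' y y'. \<Gamma> (kron (mat_unit x x') (mat_unit y y')) =
             (\<Sum>a\<in>UNIV. \<Sum>a'\<in>UNIV. \<Sum>b\<in>UNIV. \<Sum>b'\<in>UNIV.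
                cscale (iprod K (G x x' a a' y y' b b' \<xi>) \<xi>) (kron (mat_unit a a') (mat_unit b b')))"
    using q unfolding quantum_correlation_def by (elim exE conjE)
  have G: "\<Gamma> (kron (mat_unit x x') (mat_unit y y')) $ (a, b) $ (a', b') = iprod K (G x x' a a' y y' b b' \<xi>) \<xi>" for x x' y y' a a' b b'
    using \<Gamma> by (simp only: sum_units_component)
  have c': "is_operator_tensor H1 H2 K r (E x x' a a') (F y y' b b') (G x x' a a' y y' b b')" for x x' a a' y y' b b'
    using c by blast
  have total': "(\<Sum>(x, x', a, a')\<in>UNIV. iprod K (G x x' a a' x x' a a' \<xi>) \<xi>) = (of_nat CARD('x))\<^sup>2" using total by (simp only: G)
  obtain t where t: "word_trace t" "finite_rank t"
    "ALL x x' a a' y y' b b'. t [(x, x', a, a'), (y', y, b', b)] = iprod K (G x x' a a' y y' b b' \<xi>) \<xi>"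
    by (rule word_trace_of_tensor[OF H c' \<xi> total']) blast
  show ?thesis by (rule that[OF t(1,2)]) (simp only: word_represents_iff G t(3)[rule_format] simp_thms)
qed

lemma quantum_commuting_of_word_trace:
  fixes emb :: "(nat => complex) => 'h" and t :: "'x::finite letter list => complex"
  assumes emb: "inj emb" and t: "word_trace t" "word_represents t \<Gamma>"
  shows "quantum_commuting TYPE('h) \<Gamma>"
proof -
  obtain e :: "(unit \<times> 'x letter list => complex) => 'h" where e: "inj e"
    using exists_coding[OF emb countable_letter_lists] by blast
  interpret coded_space t "TYPE(unit)" e
    using t(1) e by (simp add: coded_space_def coded_space_axioms_def word_space_def)
  define E where "E x x' a a' = Op (rowL (x, x', a, a'))" for x x' a a'
  define G where "G y y' b b' = Op (rowR (y', y, b', b))" for y y' b b'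
  note Q = quantum_commuting_data[folded E_def G_def]
  have 1: "ALL x x' a a' y y' b b'. \<forall>h\<in>carrier H. E x x' a a' (G y y' b b' h) = G y y' b b' (E x x' a a' h)"
    by (intro allI ballI Q(3))
  have 2: "ALL x x' y y'. \<Gamma> (kron (mat_unit x x') (mat_unit y y')) =
       (\<Sum>a\<in>UNIV. \<Sum>a'\<in>UNIV. \<Sum>b\<in>UNIV. \<Sum>b'\<in>UNIV.
          cscale (iprod H (E x x' a a' (G y y' b b' \<eta>)) \<eta>) (kron (mat_unit a a') (mat_unit b b')))"
    unfolding Q(6) using t(2) unfolding word_represents_def .
  have E': "E = (%x x' a a'. Op (rowL (x, x', a, a')))" "G = (%y y' b b'. Op (rowR (y', y, b', b)))"
    by (intro ext, simp only: E_def G_def)+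
  have sE: "stochastic_operator_matrix H E" "stochastic_operator_matrix H G"
    unfolding E' by (rule quantum_commuting_data(1), rule quantum_commuting_data(2))
  show ?thesis unfolding quantum_commuting_def
    by (rule exI[of _ H], rule exI[of _ E], rule exI[of _ G], rule exI[of _ \<eta>], intro conjI H.hilbert_space_axioms sE 1 Q(4,5) 2)
qed

section \<open>Local correlations\<close>

lemma cinner_mat_unit: "cinner (mat_unit x y *v v) w = v $ y * cnj (w $ x)"
proof -
  have "(mat_unit x y *v v) $ i = (if i = x then v $ y else 0)" for i
  proof -
    have q: "mat_unit x y $ i $ j * v $ j = (if j = y then if i = x then v $ y else 0 else 0)" for j
      by (auto simp: mat_unit_def)
    show ?thesis unfolding matrix_vector_mult_def by (simp add: q)
  qed
  then have "(mat_unit x y *v v) $ i * cnj (w $ i) = (if i = x then v $ y * cnj (w $ x) else 0)" for i by simp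
  then show ?thesis by (simp add: cinner_def)
qed

text \<open>Complete positivity applied to the positive block matrix of all matrix units gives
  positivity of the Choi matrix. With preservation of the trace, a channel is thus a stochastic
  matrix of scalars.\<close>

lemma channel_choi:
  fixes \<Phi> :: "'x::finite cmat => 'a::finite cmat" and v :: "'x => 'a => complex"
  assumes "quantum_channel \<Phi>"
  shows "(\<Sum>x\<in>UNIV. \<Sum>a\<in>UNIV. \<Sum>x'\<in>UNIV. \<Sum>a'\<in>UNIV. \<Phi> (mat_unit x x') $ a $ a' * v x' a' * cnj (v x a)) \<in> \<real>\<^sub>\<ge>\<^sub>0"
    and "(\<Sum>a\<in>UNIV. \<Phi> (mat_unit x x') $ a $ a) = (if x = x' then 1 else 0)"
proof -
  define n where "n = CARD('x)"
  obtain b :: "nat => 'x" where b: "bij_betw b {..<n} UNIV"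
    using ex_bij_betw_nat_finite[of "UNIV :: 'x set"] unfolding n_def atLeast0LessThan by auto
  have "block_psd n (%i j. mat_unit (b i) (b j) :: 'x cmat)" unfolding block_psd_def
  proof
    fix w :: "nat => complex^'x"
    define s where "s = (\<Sum>j<n. w j $ b j)"
    have "(\<Sum>i<n. \<Sum>j<n. cinner (mat_unit (b i) (b j) *v w j) (w i)) = s * cnj s"
      by (simp add: cinner_mat_unit s_def sum_product mult.commute) (rule sum.swap)
    then show "(\<Sum>i<n. \<Sum>j<n. cinner (mat_unit (b i) (b j) *v w j) (w i)) \<in> \<real>\<^sub>\<ge>\<^sub>0" by (simp only: nonneg_Reals_square)
  qed
  then have "block_psd n (%i j. \<Phi> (mat_unit (b i) (b j)))"
    using assms by (simp add: quantum_channel_def completely_positive_def)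
  then have p: "(\<Sum>i<n. \<Sum>j<n. cinner (\<Phi> (mat_unit (b i) (b j)) *v (\<chi> a. v (b j) a)) (\<chi> a. v (b i) a)) \<in> \<real>\<^sub>\<ge>\<^sub>0"
    unfolding block_psd_def by (rule spec[of _ "%i. \<chi> a. v (b i) a"])
  have "(\<Sum>i<n. \<Sum>j<n. cinner (\<Phi> (mat_unit (b i) (b j)) *v (\<chi> a. v (b j) a)) (\<chi> a. v (b i) a))
      = (\<Sum>x\<in>UNIV. \<Sum>x'\<in>UNIV. cinner (\<Phi> (mat_unit x x') *v (\<chi> a. v x' a)) (\<chi> a. v x a))"
    by (simp add: sum.reindex_bij_betw[OF b, of "%x'. cinner (\<Phi> (mat_unit (_ :: 'x) x') *v (\<chi> a. v x' a)) (_ :: complex^'a)"]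
        sum.reindex_bij_betw[OF b, of "%x. \<Sum>x'\<in>UNIV. cinner (\<Phi> (mat_unit x x') *v (\<chi> a. v x' a)) (\<chi> a. v x a)"])
  also have "\<dots> = (\<Sum>x\<in>UNIV. \<Sum>x'\<in>UNIV. \<Sum>a\<in>UNIV. \<Sum>a'\<in>UNIV. \<Phi> (mat_unit x x') $ a $ a' * v x' a' * cnj (v x a))"
    by (simp add: cinner_def matrix_vector_mult_def sum_distrib_right)
  also have "\<dots> = (\<Sum>x\<in>UNIV. \<Sum>a\<in>UNIV. \<Sum>x'\<in>UNIV. \<Sum>a'\<in>UNIV. \<Phi> (mat_unit x x') $ a $ a' * v x' a' * cnj (v x a))"
    by (intro sum.cong refl sum.swap)
  finally show "(\<Sum>x\<in>UNIV. \<Sum>a\<in>UNIV. \<Sum>x'\<in>UNIV. \<Sum>a'\<in>UNIV. \<Phi> (mat_unit x x') $ a $ a' * v x' a' * cnj (v x a)) \<in> \<real>\<^sub>\<ge>\<^sub>0"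
    using p by simp
  have "trace (\<Phi> (mat_unit x x')) = trace (mat_unit x x')" using assms by (simp add: quantum_channel_def)
  also have "\<dots> = (if x = x' then 1 else 0)"
    by (cases "x = x'") (auto simp: trace_def mat_unit_def intro!: sum.neutral)
  finally show "(\<Sum>a\<in>UNIV. \<Phi> (mat_unit x x') $ a $ a) = (if x = x' then 1 else 0)" by (simp add: trace_def)
qed

lemma channel_tensor_units: "channel_tensor \<Phi> \<Psi> (kron (mat_unit p p') (mat_unit q q')) = kron (\<Phi> (mat_unit p p')) (\<Psi> (mat_unit q q'))"
proof -
  have "cscale (kron (mat_unit p p') (mat_unit q q') $ (x, y) $ (x', y')) (kron (\<Phi> (mat_unit x x')) (\<Psi> (mat_unit y y')))
      = (if y' = q' then if y = q then if x' = p' then if x = p then kron (\<Phi> (mat_unit p p')) (\<Psi> (mat_unit q q')) else 0 else 0 else 0 else 0)" for x y x' y'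
    by (auto simp: cscale_def kron_def mat_unit_def vec_eq_iff)
  then show ?thesis by (simp add: channel_tensor_def)
qed

text \<open>On complex n-space, let the i-th coordinate be multiplied by matrix entries of the i-th
  channel, and let \<open>\<xi>\<close> have the coordinates \<open>sqrt (w i)\<close>. All
  operators are diagonal, so the two families commute with each other, and the first one within
  itself, which gives \<open>comm_trace\<close>.\<close>

lemma word_trace_of_local:
  fixes \<Gamma> :: "('x::finite \<times> 'x) cmat => ('x \<times> 'x) cmat"
  assumes l: "local_correlation \<Gamma>"
    and total: "(\<Sum>(x, x', a, a')\<in>UNIV. \<Gamma> (kron (mat_unit x x') (mat_unit x x')) $ (a, a) $ (a', a')) = (of_nat CARD('x))\<^sup>2"
  obtains t where "word_trace t" "comm_trace t" "word_represents t \<Gamma>"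
proof -
  obtain n :: nat and w \<Phi> \<Psi> where w: "!!i. i < n ==> 0 <= w i" "(\<Sum>i<n. w i) = (1 :: real)"
    and ch: "!!i. i < n ==> quantum_channel (\<Phi> i)" "!!i. i < n ==> quantum_channel (\<Psi> i)"
    and \<Gamma>: "!!W. \<Gamma> W = (\<Sum>i<n. cscale (of_real (w i)) (channel_tensor (\<Phi> i) (\<Psi> i) W))"
    using l unfolding local_correlation_def by blast
  define F where "F = {f :: nat => complex. ALL i. i \<notin> {..<n} --> f i = 0}"
  define ip where "ip f g = (\<Sum>i<n. f i * cnj (g i))" for f g :: "nat => complex"
  interpret C: fun_hilbert F ip
    using finite_coordinate_space[of "{..<n}"] by (simp add: F_def ip_def[abs_def])
  have idi: "inj (id :: (nat => complex) => nat => complex)" and dec_id: "dec (id :: (nat => complex) => nat => complex) f = f" for f by auto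
  define H where "H = fun_hspace (id :: (nat => complex) => nat => complex) F ip"
  interpret H: hilbert_space H unfolding H_def by (rule C.hilbert[OF idi])
  have Hs: "carrier H = F" "\<zero>\<^bsub>H\<^esub> = (%_. 0)" "f \<oplus>\<^bsub>H\<^esub> g = (%i. f i + g i)" "c \<odot>\<^bsub>H\<^esub> f = (%i. c * f i)" "iprod H f g = ip f g" for f g c
    by (simp_all add: H_def dec_id)
  have fin: "finsum H g A = (%i. \<Sum>a\<in>A. g a i)" if "finite A" "!!a. a \<in> A ==> g a \<in> F" for g and A :: "'x set"
    using C.finsum_fun_hspace[OF idi that] by (simp add: H_def)
  define T where "T \<Theta> x x' a a' f = (%i. if i < n then \<Theta> i (mat_unit x x') $ a $ a' * f i else 0)"
    for \<Theta> :: "nat => 'x cmat => 'x cmat" and x x' a a' :: 'x and f :: "nat => complex"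
  have TF: "T \<Theta> x x' a a' f \<in> F" for \<Theta> x x' a a' f by (simp add: T_def F_def)
  have st: "stochastic_operator_matrix H (T \<Theta>)" if \<Theta>: "!!i. i < n ==> quantum_channel (\<Theta> i)" for \<Theta>
    unfolding stochastic_operator_matrix_def
  proof (intro conjI allI impI ballI)
    fix x x' a a'
    define c where "c = (\<Sum>i<n. cmod (\<Theta> i (mat_unit x x') $ a $ a'))"
    have nrm: "hnorm H f = sqrt (\<Sum>i<n. (cmod (f i))\<^sup>2)" for f
    proof -
      have "ip f f = of_real (\<Sum>i<n. (cmod (f i))\<^sup>2)" by (simp add: ip_def complex_norm_square del: of_real_power)
      then show ?thesis by (simp only: hnorm_def Hs Re_complex_of_real)
    qed
    have "hnorm H (T \<Theta> x x' a a' f) <= c * hnorm H f" for f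
    proof -
      have "(cmod (T \<Theta> x x' a a' f i))\<^sup>2 <= c\<^sup>2 * (cmod (f i))\<^sup>2" if "i < n" for i
      proof -
        have "cmod (\<Theta> i (mat_unit x x') $ a $ a') <= c" unfolding c_def by (rule member_le_sum) (use that in auto)
        then show ?thesis using that by (simp add: T_def norm_mult power_mult_distrib mult_right_mono power_mono)
      qed
      then have "(\<Sum>i<n. (cmod (T \<Theta> x x' a a' f i))\<^sup>2) <= c\<^sup>2 * (\<Sum>i<n. (cmod (f i))\<^sup>2)"
        unfolding sum_distrib_left by (intro sum_mono) auto
      then have "sqrt (\<Sum>i<n. (cmod (T \<Theta> x x' a a' f i))\<^sup>2) <= sqrt (c\<^sup>2 * (\<Sum>i<n. (cmod (f i))\<^sup>2))" by (rule real_sqrt_le_mono)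
      also have "\<dots> = c * sqrt (\<Sum>i<n. (cmod (f i))\<^sup>2)" by (simp add: real_sqrt_mult c_def sum_nonneg)
      finally show ?thesis unfolding nrm .
    qed
    moreover have "T \<Theta> x x' a a' (%i. f i + g i) = (%i. T \<Theta> x x' a a' f i + T \<Theta> x x' a a' g i)"
      "T \<Theta> x x' a a' (%i. k * f i) = (%i. k * T \<Theta> x x' a a' f i)" for f g k
      by (auto simp: T_def algebra_simps)
    ultimately show "bounded_operator H (T \<Theta> x x' a a')"
      unfolding bounded_operator_def by (auto simp: Hs(1,3,4) TF)
  next
    fix v :: "'x => 'x => nat => complex"
    define r where "r i = (\<Sum>p\<in>UNIV. \<Sum>q\<in>UNIV. \<Theta> i (mat_unit (fst p) (fst q)) $ (snd p) $ (snd q) * v (fst q) (snd q) i * cnj (v (fst p) (snd p) i))" for i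
    have "(\<Sum>x\<in>UNIV. \<Sum>a\<in>UNIV. \<Sum>x'\<in>UNIV. \<Sum>a'\<in>UNIV. iprod H (T \<Theta> x x' a a' (v x' a')) (v x a))
      = (\<Sum>p\<in>UNIV. \<Sum>q\<in>UNIV. \<Sum>i<n. \<Theta> i (mat_unit (fst p) (fst q)) $ (snd p) $ (snd q) * v (fst q) (snd q) i * cnj (v (fst p) (snd p) i))"
      by (simp add: Hs ip_def T_def sum_UNIV_pair)
    also have "\<dots> = (\<Sum>i<n. \<Sum>p\<in>UNIV. \<Sum>q\<in>UNIV. \<Theta> i (mat_unit (fst p) (fst q)) $ (snd p) $ (snd q) * v (fst q) (snd q) i * cnj (v (fst p) (snd p) i))"
      by (simp only: sum.swap[of _ "{..<n}" UNIV])
    finally have e: "(\<Sum>x\<in>UNIV. \<Sum>a\<in>UNIV. \<Sum>x'\<in>UNIV. \<Sum>a'\<in>UNIV. iprod H (T \<Theta> x x' a a' (v x' a')) (v x a)) = (\<Sum>i<n. r i)"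
      unfolding r_def .
    have "r i \<in> \<real>\<^sub>\<ge>\<^sub>0" if "i < n" for i
      using channel_choi(1)[OF \<Theta>[OF that], of "%x a. v x a i"] by (simp add: r_def sum_UNIV_pair)
    then show "(\<Sum>x\<in>UNIV. \<Sum>a\<in>UNIV. \<Sum>x'\<in>UNIV. \<Sum>a'\<in>UNIV. iprod H (T \<Theta> x x' a a' (v x' a')) (v x a)) \<in> \<real>\<^sub>\<ge>\<^sub>0"
      unfolding e by (auto simp: complex_nonneg_Reals_iff intro!: sum_nonneg)
  next
    fix x x' f assume "f \<in> carrier H"
    then have f: "f \<in> F" by (simp add: Hs)
    have "(\<Sum>a\<in>UNIV. T \<Theta> x x' a a f i) = (if x = x' then f i else 0)" for i
      using f channel_choi(2)[OF \<Theta>, of i x x'] by (cases "i < n") (simp_all add: T_def F_def flip: sum_distrib_right)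
    then show "(\<Oplus>\<^bsub>H\<^esub>a\<in>UNIV. T \<Theta> x x' a a f) = (if x = x' then f else \<zero>\<^bsub>H\<^esub>)"
      by (subst fin) (auto simp: TF Hs fun_eq_iff)
  qed
  define \<xi> where "\<xi> i = (if i < n then complex_of_real (sqrt (w i)) else 0)" for i
  have \<xi>F: "\<xi> \<in> F" by (simp add: \<xi>_def F_def)
  have \<xi>2: "\<xi> i * cnj (\<xi> i) = of_real (w i)" if "i < n" for i
    using w(1)[OF that] that by (simp add: \<xi>_def flip: of_real_mult)
  have value': "iprod H (T \<Phi> x x' a a' (T \<Psi> y y' b b' \<xi>)) \<xi> = \<Gamma> (kron (mat_unit x x') (mat_unit y y')) $ (a, b) $ (a', b')" for x x' a a' y y' b b'
  proof -
    have "T \<Phi> x x' a a' (T \<Psi> y y' b b' \<xi>) i * cnj (\<xi> i) = of_real (w i) * (\<Phi> i (mat_unit x x') $ a $ a' * \<Psi> i (mat_unit y y') $ b $ b')" if "i < n" for i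
      unfolding \<xi>2[OF that, symmetric] using that by (simp add: T_def)
    then have "iprod H (T \<Phi> x x' a a' (T \<Psi> y y' b b' \<xi>)) \<xi> = (\<Sum>i<n. of_real (w i) * (\<Phi> i (mat_unit x x') $ a $ a' * \<Psi> i (mat_unit y y') $ b $ b'))"
      by (simp add: Hs ip_def)
    then show ?thesis unfolding \<Gamma> channel_tensor_units by (simp add: cscale_def kron_def)
  qed
  interpret P: commuting_pair H "T \<Phi>" "T \<Psi>" \<xi>
  proof
    show "stochastic_operator_matrix H (T \<Phi>)" "stochastic_operator_matrix H (T \<Psi>)" using st[OF ch(1)] st[OF ch(2)] by auto
    show "T \<Phi> x x' a a' (T \<Psi> y y' b b' h) = T \<Psi> y y' b b' (T \<Phi> x x' a a' h)" for h x x' a a' y y' b b'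
      by (auto simp: T_def fun_eq_iff)
    show "\<xi> \<in> carrier H" using \<xi>F by (simp add: Hs)
    have "ip \<xi> \<xi> = of_real (\<Sum>i<n. w i)" unfolding ip_def of_real_sum by (intro sum.cong) (auto simp: \<xi>2)
    then show "hnorm H \<xi> = 1" by (simp add: hnorm_def Hs w(2))
    show "(\<Sum>(x, x', a, a')\<in>UNIV. iprod H (T \<Phi> x x' a a' (T \<Psi> x x' a a' \<xi>)) \<xi>) = (of_nat CARD('x))\<^sup>2"
      unfolding value' by (rule total)
  qed
  show ?thesis
  proof (rule that[OF P.word_trace])
    show "comm_trace P.t"
    proof (rule P.t_comm)
      fix g g' h show "P.EL g (P.EL g' h) = P.EL g' (P.EL g h)" by (cases g, cases g') (auto simp: T_def fun_eq_iff)
    qed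
    show "word_represents P.t \<Gamma>" unfolding word_represents_iff P.t_value value' by simp
  qed
qed

section \<open>Commutative word traces and characters\<close>

text \<open>What a *-homomorphism from \<open>brown_sub\<close> to the complex numbers does to the
  generators: the relations of a word trace, with products of numbers in place of words.\<close>

definition character :: "('x::finite letter => complex) => bool" where
  "character e \<longleftrightarrow> (ALL g. e (gstar g) = cnj (e g))
     & (ALL x x'. (\<Sum>a\<in>UNIV. e (x, x', a, a)) = (if x = x' then 1 else 0))
     & (ALL y b c y' a b'. (\<Sum>x\<in>UNIV. e (y, x, b, c) * e (x, y', a, b')) = (if c = a then e (y, y', b, b') else 0))"

lemma characterD:
  assumes "character e"
  shows "e (gstar g) = cnj (e g)" "e (x', x, a', a) = cnj (e (x, x', a, a'))"
    "(\<Sum>a\<in>UNIV. e (x, x', a, a)) = (if x = x' then 1 else 0)"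
    "(\<Sum>x\<in>UNIV. e (y, x, b, c) * e (x, y', a, b')) = (if c = a then e (y, y', b, b') else 0)"
proof -
  note e = assms[unfolded character_def]
  show g: "e (gstar g) = cnj (e g)" for g using e by (elim conjE) (rule spec)
  show "e (x', x, a', a) = cnj (e (x, x', a, a'))" using g[of "(x, x', a, a')"] by (simp only: gstar_simp)
  show "(\<Sum>a\<in>UNIV. e (x, x', a, a)) = (if x = x' then 1 else 0)" using e by (elim conjE) blast
  show "(\<Sum>x\<in>UNIV. e (y, x, b, c) * e (x, y', a, b')) = (if c = a then e (y, y', b, b') else 0)" using e by (elim conjE) blast
qed

definition lcons :: "'x letter => (complex \<times> 'x letter list) list => (complex \<times> 'x letter list) list" where
  "lcons g v = map (%(a, w). (a, g # w)) v"

lemma lcons_simps: "lcons g [] = []" "lcons g ((a, w) # v) = (a, g # w) # lcons g v"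
  by (auto simp: lcons_def)

lemma lip_wkernel_add: "lip (wkernel (%w. \<alpha> * s w + \<beta> * r w)) u v = \<alpha> * lip (wkernel s) u v + \<beta> * lip (wkernel r) u v"
proof -
  have k: "kfun (wkernel (%w. \<alpha> * s w + \<beta> * r w)) u w = \<alpha> * kfun (wkernel s) u w + \<beta> * kfun (wkernel r) u w" for w
    by (induct u) (auto simp: wkernel_def algebra_simps)
  show ?thesis by (induct v) (auto simp: k algebra_simps)
qed

section \<open>Perturbing a commutative word trace by a self-adjoint combination of letters\<close>

context word_trace
begin

lemma wkernel_pd: "pd_kernel (wkernel t)" by (rule pd_kernel.intro) (rule t_pos)

sublocale wk: pd_kernel "wkernel t" by (rule wkernel_pd)

lemma t_wstar: "t (wstar w) = cnj (t w)"
  using wk.lip_herm[of "[(1, w)]" "[(1, [])]"] by (simp add: wkernel_def)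

text \<open>The sum of squares behind \<open>contractions\<close>, now for formal combinations: the
  forms obtained by prefixing the letters (z, x', a, b) are nonnegative and add up over z and b to
  the form of \<open>v\<close>.\<close>

lemma lcons_bound: "wk.vn (lcons g v) <= wk.vn v"
proof -
  obtain x x' a a' where g: "g = (x, x', a, a')" by (cases g)
  define q where "q z b = lip (wkernel t) (lcons (z, x', a, b) v) (lcons (z, x', a, b) v)" for z b
  have k: "(\<Sum>b\<in>UNIV. \<Sum>z\<in>UNIV. kfun (wkernel t) (lcons (z, x', a, b) v) ((z, x', a, b) # w)) = kfun (wkernel t) v w" for w
  proof (induct v)
    case (Cons p v)
    obtain c u where p: "p = (c, u)" by (cases p)
    have "(\<Sum>b\<in>UNIV. \<Sum>z\<in>UNIV. t (wstar w @ (x', z, b, a) # (z, x', a, b) # u)) = t (wstar w @ u)"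
      by (simp add: t_coisometry t_isometry)
    then show ?case using Cons by (simp add: p lcons_def wkernel_def sum.distrib flip: sum_distrib_left)
  qed (simp add: lcons_def)
  have l: "(\<Sum>b\<in>UNIV. \<Sum>z\<in>UNIV. lip (wkernel t) (lcons (z, x', a, b) v) (lcons (z, x', a, b) u)) = lip (wkernel t) v u" for u
  proof (induct u)
    case (Cons p u)
    obtain c w where p: "p = (c, w)" by (cases p)
    have "lcons h (p # u) = (c, h # w) # lcons h u" for h by (simp add: lcons_def p)
    then show ?case using Cons k[of w] by (simp add: p sum.distrib flip: sum_distrib_left)
  qed (simp add: lcons_def)
  have pos: "0 <= Re (q z b)" for z b using t_pos by (simp add: q_def complex_nonneg_Reals_iff)
  have "Re (q x a') <= (\<Sum>z\<in>UNIV. Re (q z a'))" by (rule member_le_sum) (use pos in auto)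
  also have "\<dots> <= (\<Sum>b\<in>UNIV. \<Sum>z\<in>UNIV. Re (q z b))" by (rule member_le_sum) (use pos in \<open>auto intro: sum_nonneg\<close>)
  also have "\<dots> = Re (lip (wkernel t) v v)" unfolding l[of v, symmetric] by (simp add: q_def)
  finally show ?thesis by (simp add: nrm_def q_def g)
qed

lemma lcons_pairing: "cmod (lip (wkernel t) (lcons g v) v) <= Re (lip (wkernel t) v v)"
proof -
  have "cmod (lip (wkernel t) (lcons g v) v) <= wk.vn (lcons g v) * wk.vn v" by (rule wk.lip_Cauchy_Schwarz)
  also have "\<dots> <= wk.vn v * wk.vn v" by (rule mult_right_mono[OF lcons_bound wk.vn_nonneg])
  finally show ?thesis by (simp flip: power2_eq_square add: wk.vn_sq)
qed

lemma t_letter_bound: "cmod (t [g]) <= 1"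
  using lcons_pairing[of g "[(1, [])]"] by (simp add: lcons_def wkernel_def t_one)

end

text \<open>The functional \<open>w -> t (h w)\<close> for the self-adjoint element h that is the
  mean of \<open>c g\<close> and its adjoint.\<close>

definition shift :: "('x letter list => complex) => complex => 'x letter => 'x letter list => complex" where
  "shift t c g w = (c * t (g # w) + cnj c * t (gstar g # w)) / 2"

text \<open>\<open>t\<close> is reweighted by \<open>2 + h\<close> and normalised. For
  \<open>cmod c = 1\<close> the element h is bounded by 1, so the weight stays positive; replacing
  \<open>c\<close> by \<open>- c\<close> gives the weight \<open>2 - h\<close>.\<close>

definition tilt :: "('x letter list => complex) => complex => 'x letter => 'x letter list => complex" where
  "tilt t c g w = (2 * t w + shift t c g w) / (2 + shift t c g [])"

locale comm_word_trace = word_trace +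
  assumes comm: "comm_trace t"
begin

lemma t_move: "t (u @ g # v) = t (g # u @ v)" using comm unfolding comm_trace_def by blast

lemma lip_lcons: "lip (wkernel (%w. t (g # w))) u v = lip (wkernel t) (lcons g u) v"
proof -
  have k: "kfun (wkernel (%w. t (g # w))) u w = kfun (wkernel t) (lcons g u) w" for w
    by (induct u) (auto simp: wkernel_def lcons_def t_move)
  show ?thesis by (induct v) (auto simp: k)
qed

lemma shift_real: assumes "cmod c = 1"
  shows "shift t c g [] = of_real (Re (c * t [g]))" "\<bar>Re (c * t [g])\<bar> <= 1"
proof -
  have "t [gstar g] = cnj (t [g])" using t_wstar[of "[g]"] by simp
  then show "shift t c g [] = of_real (Re (c * t [g]))"
    by (simp add: shift_def complex_eq_iff)
  show "\<bar>Re (c * t [g])\<bar> <= 1"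
    using abs_Re_le_cmod[of "c * t [g]"] t_letter_bound[of g] assms by (simp add: norm_mult)
qed

lemma comm_word_trace_tilt: assumes c: "cmod c = 1"
  shows "comm_word_trace (tilt t c g)"
proof -
  define s where "s = Re (c * t [g])"
  have s: "shift t c g [] = of_real s" "\<bar>s\<bar> <= 1" using shift_real[OF c] by (simp_all add: s_def)
  have s0: "2 + complex_of_real s ~= 0" using s(2) by (simp add: complex_eq_iff)
  have T: "tilt t c g = (%w. (1 / (2 + of_real s)) * (2 * t w + 1 * shift t c g w) + 0 * t w)" by (auto simp: tilt_def s)
  have Sh: "shift t c g = (%w. c / 2 * t (g # w) + cnj c / 2 * t (gstar g # w))" by (auto simp: shift_def field_simps)
  have com: "t (g' # u @ h # v) = t (g' # h # u @ v)" for g' u h v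
    using t_move[of "g' # u" h v] t_move[of "[g']" h "u @ v"] by simp
  have pos: "lip (wkernel (tilt t c g)) r r \<in> \<real>\<^sub>\<ge>\<^sub>0" for r
  proof -
    let ?l = "lip (wkernel t) r r" and ?m = "lip (wkernel t) (lcons g r) r" and ?n = "lip (wkernel t) (lcons (gstar g) r) r"
    have l: "0 <= Re ?l" "Im ?l = 0" using t_pos[of r] by (auto simp: complex_nonneg_Reals_iff)
    have kk: "kfun (wkernel t) (lcons (gstar g) u) w = kfun (wkernel t) u (g # w)" for u w
      by (induct u) (auto simp: lcons_simps wkernel_def)
    have "lip (wkernel t) (lcons (gstar g) u) v = lip (wkernel t) u (lcons g v)" for u v
      by (induct v) (auto simp: kk lcons_simps)
    then have n: "?n = cnj ?m" using wk.lip_herm[of r "lcons g r"] by simp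
    have "lip (wkernel (tilt t c g)) r r = 1 / (2 + of_real s) * (2 * ?l + (c / 2 * ?m + cnj c / 2 * ?n))"
      unfolding T lip_wkernel_add Sh lip_lcons by simp
    also have "c / 2 * ?m + cnj c / 2 * ?n = of_real (Re (c * ?m))" unfolding n by (simp add: complex_eq_iff) (simp add: add_divide_distrib diff_divide_distrib)
    also have "?l = of_real (Re ?l)" using l by (simp add: complex_eq_iff)
    finally have e: "lip (wkernel (tilt t c g)) r r = of_real (1 / (2 + s) * (2 * Re ?l + Re (c * ?m)))" by simp
    \<comment> \<open>By \<open>lcons_pairing\<close> the perturbation is dominated by the form of
      \<open>t\<close>, which enters with the factor 2.\<close>
    have "\<bar>Re (c * ?m)\<bar> <= Re ?l"
      using abs_Re_le_cmod[of "c * ?m"] lcons_pairing[of g r] c by (simp add: norm_mult)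
    then have "0 <= 1 / (2 + s) * (2 * Re ?l + Re (c * ?m))" using l s(2) by (intro mult_nonneg_nonneg) auto
    then show ?thesis unfolding e nonneg_Reals_of_real_iff .
  qed
  have td: "tilt t c g w = (2 * t w + (c * t (g # w) + cnj c * t (gstar g # w)) / 2) / (2 + of_real s)" for w
    by (simp only: tilt_def s) (simp only: shift_def)
  have lin: "(\<Sum>i\<in>UNIV. tilt t c g (f i)) = (2 * (\<Sum>i\<in>UNIV. t (f i)) + (c * (\<Sum>i\<in>UNIV. t (g # f i)) + cnj c * (\<Sum>i\<in>UNIV. t (gstar g # f i))) / 2) / (2 + of_real s)"
    for f :: "'a => 'a letter list"
    unfolding td by (simp add: sum.distrib sum_distrib_left flip: sum_divide_distrib)
  show ?thesis
  proof
    show "tilt t c g [] = 1" using s0 by (simp add: tilt_def s t_one)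
    show "tilt t c g (u @ v) = tilt t c g (v @ u)" for u v
    proof -
      have "t (h # u @ v) = t (h # v @ u)" for h
        using t_cyclic[of "h # u" v] t_move[of v h u] by simp
      then show ?thesis using t_cyclic[of u v] by (simp add: tilt_def shift_def)
    qed
    show "lip (wkernel (tilt t c g)) r r \<in> \<real>\<^sub>\<ge>\<^sub>0" for r by (rule pos)
    show "(\<Sum>a\<in>UNIV. tilt t c g (u @ (x, x', a, a) # v)) = (if x = x' then tilt t c g (u @ v) else 0)" for u x x' v
      using t_isometry[of u x x' v] t_isometry[of "g # u" x x' v] t_isometry[of "gstar g # u" x x' v]
      unfolding lin by (simp add: td)
    show "(\<Sum>x\<in>UNIV. tilt t c g (u @ (y, x, b, d) # (x, y', a, b') # v)) = (if d = a then tilt t c g (u @ (y, y', b, b') # v) else 0)" for u y b d y' a b' v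
      using t_coisometry[of u y b d y' a b' v] t_coisometry[of "g # u" y b d y' a b' v] t_coisometry[of "gstar g # u" y b d y' a b' v]
      unfolding lin by (simp add: td)
    show "comm_trace (tilt t c g)" unfolding comm_trace_def
      using t_move com by (simp add: tilt_def shift_def)
  qed
qed

text \<open>The weights \<open>2 + h\<close> and \<open>2 - h\<close> have mean 2, which gives the
  convex combination. The covariance with h is the difference of the two tilts times
  \<open>(4 - s^2) / 4\<close>, a number between 3/4 and 1.\<close>

lemma tilt_average:
  assumes c: "cmod c = 1" and s: "s = Re (c * t [g])"
  shows "t w = of_real ((2 + s) / 4) * tilt t c g w + of_real ((2 - s) / 4) * tilt t (- c) g w"
    "cmod (shift t c g w - of_real s * t w) <= cmod (tilt t c g w - tilt t (- c) g w)"
proof -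
  have sh: "shift t c g [] = of_real s" "shift t (- c) g v = - shift t c g v" "\<bar>s\<bar> <= 1" for v
    using shift_real[OF c] by (simp_all add: s shift_def field_simps)
  have 0: "2 + complex_of_real s ~= 0" "2 - complex_of_real s ~= 0" using sh(3) by (auto simp: complex_eq_iff)
  have p: "(2 + of_real s) * tilt t c g w = 2 * t w + shift t c g w"
    "(2 - of_real s) * tilt t (- c) g w = 2 * t w - shift t c g w"
    using 0 by (simp_all add: tilt_def sh)
  have "of_real ((2 + s) / 4) * tilt t c g w + of_real ((2 - s) / 4) * tilt t (- c) g w
      = ((2 + of_real s) * tilt t c g w + (2 - of_real s) * tilt t (- c) g w) / 4" by (simp add: field_simps)
  then show "t w = of_real ((2 + s) / 4) * tilt t c g w + of_real ((2 - s) / 4) * tilt t (- c) g w" unfolding p by simp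
  have "4 * (shift t c g w - of_real s * t w) = (2 - of_real s) * (2 * t w + shift t c g w) - (2 + of_real s) * (2 * t w - shift t c g w)"
    by (simp add: algebra_simps)
  also have "\<dots> = (2 - of_real s) * (2 + of_real s) * (tilt t c g w - tilt t (- c) g w)" unfolding p[symmetric] by (simp add: algebra_simps)
  also have "(2 - of_real s) * (2 + of_real s) = complex_of_real (4 - s\<^sup>2)" by (simp add: algebra_simps power2_eq_square)
  finally have "4 * cmod (shift t c g w - of_real s * t w) = \<bar>4 - s\<^sup>2\<bar> * cmod (tilt t c g w - tilt t (- c) g w)"
    by (metis norm_mult norm_numeral norm_of_real)
  also have "\<dots> <= 4 * cmod (tilt t c g w - tilt t (- c) g w)"
  proof (rule mult_right_mono)
    have "s\<^sup>2 <= 1" using sh(3) by (simp add: abs_square_le_1)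
    then show "\<bar>4 - s\<^sup>2\<bar> <= 4" by simp
  qed simp
  finally show "cmod (shift t c g w - of_real s * t w) <= cmod (tilt t c g w - tilt t (- c) g w)" by simp
qed

text \<open>A letter is recovered from two self-adjoint parts, those for \<open>c = 1\<close> and
  \<open>c = \<i>\<close>.\<close>

lemma covariance_bound:
  assumes "!!c. cmod c = 1 ==> cmod (tilt t c g [h] - tilt t (- c) g [h]) <= d"
  shows "cmod (t [g, h] - t [g] * t [h]) <= 2 * d"
proof -
  have b: "cmod (shift t c g [h] - of_real (Re (c * t [g])) * t [h]) <= d" if "cmod c = 1" for c
    using tilt_average(2)[OF that refl, of g "[h]"] assms[OF that] by simp
  have st: "t [gstar g] = cnj (t [g])" using t_wstar[of "[g]"] by simp
  have e: "t [g, h] - t [g] * t [h] = (shift t 1 g [h] - of_real (Re (1 * t [g])) * t [h])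
      - \<i> * (shift t \<i> g [h] - of_real (Re (\<i> * t [g])) * t [h])"
    by (simp add: shift_def complex_eq_iff algebra_simps) (simp add: diff_divide_distrib)
  have "cmod (t [g, h] - t [g] * t [h]) <= d + d"
    unfolding e by (rule order_trans[OF norm_triangle_ineq4 add_mono]) (use b[of 1] b[of \<i>] in \<open>simp_all add: norm_mult\<close>)
  then show ?thesis by simp
qed

end

text \<open>A real linear functional of the second moments, made strictly concave in the values on
  letters; letting \<open>\<epsilon>\<close> tend to 0 later restores the linear functional.\<close>

definition min_penalty :: "('x::finite letter => 'x letter => complex) => real => ('x letter list => complex) => real" where
  "min_penalty q \<epsilon> t = (\<Sum>g\<in>UNIV. \<Sum>h\<in>UNIV. Re (q g h * t [g, h])) - \<epsilon> * (\<Sum>g\<in>UNIV. (cmod (t [g]))\<^sup>2)"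

lemma strict_concavity:
  assumes l: "x = of_real l * y + of_real (1 - l) * (z :: complex)"
  shows "(cmod x)\<^sup>2 = l * (cmod y)\<^sup>2 + (1 - l) * (cmod z)\<^sup>2 - l * (1 - l) * (cmod (y - z))\<^sup>2"
  unfolding l by (simp add: cmod_power2) (simp add: power2_eq_square algebra_simps)

lemma min_penalty_average:
  assumes t: "!!w. t w = of_real l * r w + of_real (1 - l) * (s w :: complex)"
  shows "min_penalty q \<epsilon> t = l * min_penalty q \<epsilon> r + (1 - l) * min_penalty q \<epsilon> s
    + \<epsilon> * (l * (1 - l)) * (\<Sum>g\<in>UNIV. (cmod (r [g] - s [g]))\<^sup>2)"
proof -
  have "Re (q g h * t [g, h]) = l * Re (q g h * r [g, h]) + (1 - l) * Re (q g h * s [g, h])" for g h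
    unfolding t by (simp add: algebra_simps)
  moreover have "(cmod (t [g]))\<^sup>2 = l * (cmod (r [g]))\<^sup>2 + (1 - l) * (cmod (s [g]))\<^sup>2 - l * (1 - l) * (cmod (r [g] - s [g]))\<^sup>2" for g
    by (rule strict_concavity[OF t])
  ultimately show ?thesis unfolding min_penalty_def
    by (simp add: sum.distrib sum_subtractf flip: sum_distrib_left) (simp add: algebra_simps)
qed

lemma (in comm_word_trace) t_pair_bound: "cmod (t [g, h]) <= 1"
proof -
  have "cmod (t [g, h]) = cmod (lip (wkernel t) (lcons h [(1, [])]) (lcons (gstar g) [(1, [])]))"
    by (simp add: lcons_simps wkernel_def)
  also have "\<dots> <= wk.vn (lcons h [(1, [])]) * wk.vn (lcons (gstar g) [(1, [])])" by (rule wk.lip_Cauchy_Schwarz)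
  also have "\<dots> <= wk.vn [(1, [])] * wk.vn [(1, [])]" by (intro mult_mono lcons_bound wk.vn_nonneg)
  also have "\<dots> = 1" by (simp add: nrm_def wkernel_def t_one)
  finally show ?thesis .
qed

text \<open>The penalty is strictly concave in the values on letters, so an approximate minimiser cannot be
  split along \<open>tilt\<close> into two traces that differ much on letters; hence it is nearly multiplicative.\<close>

lemma approximate_minimiser:
  fixes t :: "'x::finite letter list => complex" and q :: "'x letter => 'x letter => complex"
  assumes t: "comm_word_trace t" and \<epsilon>: "0 < \<epsilon>" "\<epsilon> <= 1"
  shows "EX r. comm_word_trace r & (ALL g h. cmod (r [g, h] - r [g] * r [h]) <= 2 * \<epsilon>)
    & (\<Sum>g\<in>UNIV. \<Sum>h\<in>UNIV. Re (q g h * r [g, h]))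
       <= (\<Sum>g\<in>UNIV. \<Sum>h\<in>UNIV. Re (q g h * t [g, h])) + \<epsilon> * (1 + real CARD('x letter))"
proof -
  define X where "X = min_penalty q \<epsilon> ` {t :: 'x letter list => complex. comm_word_trace t}"
  define N where "N = real CARD('x letter)"
  have sq: "(\<Sum>g\<in>UNIV. (cmod (s [g]))\<^sup>2) <= N" if "comm_word_trace s" for s :: "'x letter list => complex"
  proof -
    interpret s: comm_word_trace s by fact
    have "(\<Sum>g\<in>UNIV. (cmod (s [g]))\<^sup>2) <= (\<Sum>g\<in>(UNIV :: 'x letter set). 1)"
      by (rule sum_mono) (simp add: s.t_letter_bound abs_square_le_1)
    then show ?thesis by (simp add: N_def)
  qed
  have bdd: "bdd_below X"
  proof (rule bdd_belowI)
    fix y assume "y \<in> X"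
    then obtain s where s: "comm_word_trace s" "y = min_penalty q \<epsilon> s" by (auto simp: X_def)
    interpret s: comm_word_trace s by fact
    have "- cmod (q g h) <= Re (q g h * s [g, h])" for g h
    proof -
      have "\<bar>Re (q g h * s [g, h])\<bar> <= cmod (q g h * s [g, h])" by (rule abs_Re_le_cmod)
      also have "\<dots> <= cmod (q g h)" using s.t_pair_bound[of g h] by (simp add: norm_mult mult_left_le)
      finally show ?thesis by simp
    qed
    then have "(\<Sum>g\<in>UNIV. \<Sum>h\<in>UNIV. - cmod (q g h)) <= (\<Sum>g\<in>UNIV. \<Sum>h\<in>UNIV. Re (q g h * s [g, h]))" by (intro sum_mono)
    moreover have "\<epsilon> * (\<Sum>g\<in>UNIV. (cmod (s [g]))\<^sup>2) <= 1 * N" using \<epsilon> sq[OF s(1)] by (intro mult_mono sum_nonneg) auto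
    ultimately show "(\<Sum>g\<in>UNIV. \<Sum>h\<in>UNIV. - cmod (q g h)) - N <= y" unfolding s(2) min_penalty_def by simp
  qed
  have ne: "X ~= {}" using t by (auto simp: X_def)
  \<comment> \<open>Only an infimum is at hand. A trace within \<open>\<delta>\<close> of it splits
    with \<open>D < \<epsilon>^2\<close>; the number 3/16 bounds
    \<open>l (1 - l) = (4 - s^2) / 16\<close> from below when \<open>|s| <= 1\<close>.\<close>
  define \<delta> where "\<delta> = \<epsilon> * (3 / 16) * \<epsilon>\<^sup>2"
  have \<delta>: "0 < \<delta>" "\<delta> <= \<epsilon>"
  proof -
    show "0 < \<delta>" using \<epsilon> by (simp add: \<delta>_def)
    have "(3 / 16) * \<epsilon>\<^sup>2 <= 1" using \<epsilon> power_le_one[of \<epsilon> 2] by simp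
    then show "\<delta> <= \<epsilon>" using mult_left_le[of "(3 / 16) * \<epsilon>\<^sup>2" \<epsilon>] \<epsilon> by (simp add: \<delta>_def mult.assoc)
  qed
  have "Inf X < Inf X + \<delta>" using \<delta> by simp
  then obtain y where "y \<in> X" "y < Inf X + \<delta>" using cInf_less_iff[OF ne bdd] by blast
  then obtain r where r: "comm_word_trace r" "min_penalty q \<epsilon> r < Inf X + \<delta>" by (auto simp: X_def)
  have low: "Inf X <= min_penalty q \<epsilon> s" if "comm_word_trace s" for s
    by (rule cInf_lower[OF _ bdd]) (use that in \<open>auto simp: X_def\<close>)
  interpret r: comm_word_trace r by (rule r(1))
  have close: "cmod (tilt r c g [h] - tilt r (- c) g [h]) <= \<epsilon>" if c: "cmod c = 1" for c g h
  proof -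
    define s where "s = Re (c * r [g])"
    define l where "l = (2 + s) / 4"
    have s: "\<bar>s\<bar> <= 1" using r.shift_real(2)[OF c] by (simp add: s_def)
    have l1: "1 - l = (2 - s) / 4" by (simp add: l_def field_simps)
    have avg: "r w = of_real l * tilt r c g w + of_real (1 - l) * tilt r (- c) g w" for w
      unfolding l1 unfolding l_def by (rule r.tilt_average(1)[OF c s_def])
    define D where "D = (\<Sum>h\<in>UNIV. (cmod (tilt r c g [h] - tilt r (- c) g [h]))\<^sup>2)"
    have D0: "0 <= D" by (simp add: D_def sum_nonneg)
    have cw: "comm_word_trace (tilt r c g)" "comm_word_trace (tilt r (- c) g)"
      using r.comm_word_trace_tilt[of c g] r.comm_word_trace_tilt[of "- c" g] c by auto
    have l0: "0 <= l" "0 <= 1 - l" using s by (auto simp: l_def)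
    \<comment> \<open>Both tilts compete for the infimum, so the concavity gain
      \<open>\<epsilon> l (1 - l) D\<close> has to stay below \<open>\<delta>\<close>.\<close>
    have "l * Inf X + (1 - l) * Inf X <= l * min_penalty q \<epsilon> (tilt r c g) + (1 - l) * min_penalty q \<epsilon> (tilt r (- c) g)"
      using low[OF cw(1)] low[OF cw(2)] l0 by (intro add_mono mult_left_mono)
    moreover have "l * Inf X + (1 - l) * Inf X = Inf X" by (simp add: algebra_simps)
    ultimately have "Inf X + \<epsilon> * (l * (1 - l)) * D <= min_penalty q \<epsilon> r"
      using min_penalty_average[OF avg, of q \<epsilon>] by (simp add: D_def)
    then have "\<epsilon> * (l * (1 - l)) * D < \<delta>" using r(2) by simp
    moreover have "\<epsilon> * (3 / 16) * D <= \<epsilon> * (l * (1 - l)) * D"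
    proof (intro mult_right_mono mult_left_mono)
      have "s\<^sup>2 <= 1" using s by (simp add: abs_square_le_1)
      moreover have "l * (1 - l) = (4 - s\<^sup>2) / 16" unfolding l1 by (simp add: l_def power2_eq_square algebra_simps)
      ultimately show "3 / 16 <= l * (1 - l)" by simp
    qed (use \<epsilon> D0 in auto)
    ultimately have "\<epsilon> * (3 / 16) * D < \<epsilon> * (3 / 16) * \<epsilon>\<^sup>2" unfolding \<delta>_def by (rule le_less_trans[rotated])
    then have "D < \<epsilon>\<^sup>2" by (rule iffD1[OF mult_less_cancel_left_pos, rotated]) (use \<epsilon> in simp)
    moreover have "(cmod (tilt r c g [h] - tilt r (- c) g [h]))\<^sup>2 <= D" unfolding D_def by (rule member_le_sum) auto
    ultimately have "(cmod (tilt r c g [h] - tilt r (- c) g [h]))\<^sup>2 <= \<epsilon>\<^sup>2" by simp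
    then show ?thesis by (rule power2_le_imp_le) (use \<epsilon> in simp)
  qed
  have val: "(\<Sum>g\<in>UNIV. \<Sum>h\<in>UNIV. Re (q g h * r [g, h]))
       <= (\<Sum>g\<in>UNIV. \<Sum>h\<in>UNIV. Re (q g h * t [g, h])) + \<epsilon> * (1 + N)"
  proof -
    have "\<epsilon> * (\<Sum>g\<in>UNIV. (cmod (r [g]))\<^sup>2) <= \<epsilon> * N" using \<epsilon> sq[OF r(1)] by simp
    moreover have "0 <= \<epsilon> * (\<Sum>g\<in>UNIV. (cmod (t [g]))\<^sup>2)" using \<epsilon> by (simp add: sum_nonneg)
    moreover have "min_penalty q \<epsilon> r <= min_penalty q \<epsilon> t + \<epsilon>" using r(2) low[OF t] \<delta> by simp
    ultimately show ?thesis unfolding min_penalty_def by (simp add: algebra_simps)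
  qed
  show ?thesis
    by (rule exI[of _ r], intro conjI allI r(1) r.covariance_bound close val[unfolded N_def])
qed

text \<open>The squared moduli of e(z,x',b,c) add up over z to e(x',x',c,c), and these numbers are
  nonnegative with sum 1 over c.\<close>

lemma character_le_1: assumes "character e" shows "cmod (e g) <= 1"
proof -
  obtain x x' a a' where g: "g = (x, x', a, a')" by (cases g)
  have s: "(\<Sum>z\<in>UNIV. (cmod (e (z, x', b, c)))\<^sup>2) = Re (e (x', x', c, c))" for b c
  proof -
    have "e (x', x', c, c) = (\<Sum>z\<in>UNIV. e (x', z, c, b) * e (z, x', b, c))" by (simp add: characterD(4)[OF assms])
    also have "\<dots> = (\<Sum>z\<in>UNIV. of_real ((cmod (e (z, x', b, c)))\<^sup>2))"
      unfolding complex_norm_square characterD(2)[OF assms, of x' _ c b] by (simp add: mult.commute)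
    finally show ?thesis by (simp flip: of_real_sum)
  qed
  have p: "0 <= Re (e (x', x', c, c))" for c unfolding s[symmetric, of c c] by (simp add: sum_nonneg)
  have "(\<Sum>c\<in>UNIV. e (x', x', c, c)) = 1" by (simp add: characterD(3)[OF assms])
  then have "(\<Sum>c\<in>UNIV. Re (e (x', x', c, c))) = 1" by (metis Re_sum one_complex.sel(1))
  moreover have "Re (e (x', x', a', a')) <= (\<Sum>c\<in>UNIV. Re (e (x', x', c, c)))" by (rule member_le_sum) (use p in auto)
  moreover have "(cmod (e g))\<^sup>2 <= (\<Sum>z\<in>UNIV. (cmod (e (z, x', a, a')))\<^sup>2)" unfolding g by (rule member_le_sum) auto
  ultimately have "(cmod (e g))\<^sup>2 <= 1" using s by simp
  then show ?thesis by (simp add: abs_square_le_1)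
qed

section \<open>Compactness of the characters and separation of second moments\<close>

definition character_set :: "(complex ^ 'x::finite letter) set" where
  "character_set = {e. character (($) e)}"

lemma compact_character_set: "compact (character_set :: (complex ^ 'x::finite letter) set)"
proof (rule compact_eq_bounded_closed[THEN iffD2], intro conjI)
  show "bounded (character_set :: (complex ^ 'x letter) set)"
  proof (rule boundedI)
    fix e :: "complex ^ 'x letter" assume "e \<in> character_set"
    then have "norm (e $ g) <= 1" for g using character_le_1[of "($) e" g] by (simp add: character_set_def)
    then have "(\<Sum>g\<in>UNIV. norm (e $ g)) <= (\<Sum>g\<in>(UNIV :: 'x letter set). 1)" by (intro sum_mono)
    moreover have "norm e <= (\<Sum>g\<in>UNIV. norm (e $ g))" unfolding norm_vec_def by (rule L2_set_le_sum) simp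
    ultimately show "norm e <= real CARD('x letter)" by simp
  qed
  have c: "continuous_on UNIV (%x :: complex ^ 'x letter. if P then x $ i else 0)" for P i
    by (cases P) (auto intro!: continuous_intros)
  show "closed (character_set :: (complex ^ 'x letter) set)"
    unfolding character_set_def character_def
    by (intro closed_Collect_conj closed_Collect_all closed_Collect_eq c continuous_intros)
qed

definition moment :: "complex ^ 'x::finite letter => complex ^ 'x letter ^ 'x letter" where
  "moment e = (\<chi> g h. e $ g * e $ h)"

text \<open>Otherwise a hyperplane separates the moments of \<open>t\<close> from those of the
  characters. Approximate minimisers of the separating functional, with \<open>\<epsilon>\<close>
  tending to 0, have convergent values on letters along a subsequence. Being nearly multiplicative,
  they converge to products on words of two letters, so the limit is a character, and its moment
  violates the separation.\<close>

lemma comm_word_trace_moments: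
  assumes t: "comm_word_trace t"
  shows "(\<chi> g h. t [g, h]) \<in> convex hull (moment ` (character_set :: (complex ^ 'x::finite letter) set))"
proof (rule ccontr)
  let ?A = "moment ` (character_set :: (complex ^ 'x letter) set)"
  let ?p = "(\<chi> g h. t [g, h]) :: complex ^ 'x letter ^ 'x letter"
  assume n: "?p \<notin> convex hull ?A"
  have "compact ?A"
    by (rule compact_continuous_image[OF _ compact_character_set]) (auto simp: moment_def[abs_def] intro!: continuous_intros)
  then have "compact (convex hull ?A)" by (rule compact_convex_hull)
  then have cl: "closed (convex hull ?A)" by (rule compact_imp_closed)
  obtain d b where d: "d \<bullet> ?p < b" "!!x. x \<in> convex hull ?A ==> b < d \<bullet> x"
    using separating_hyperplane_closed_point[OF convex_convex_hull cl n] by blast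
  \<comment> \<open>The real inner product of complex numbers d and f is
    \<open>Re (cnj d * f)\<close>, hence the conjugate.\<close>
  define q where "q g h = cnj (d $ g $ h)" for g h
  have ip: "d \<bullet> (\<chi> g h. f g h) = (\<Sum>g\<in>UNIV. \<Sum>h\<in>UNIV. Re (q g h * f g h))" for f
    by (simp add: inner_vec_def inner_complex_def q_def)
  define \<epsilon> where "\<epsilon> n = 1 / real (Suc n)" for n
  have eps: "0 < \<epsilon> n" "\<epsilon> n <= 1" for n by (auto simp: \<epsilon>_def)
  have "ALL n. EX r. comm_word_trace r & (ALL g h. cmod (r [g, h] - r [g] * r [h]) <= 2 * \<epsilon> n)
    & (\<Sum>g\<in>UNIV. \<Sum>h\<in>UNIV. Re (q g h * r [g, h])) <= d \<bullet> ?p + \<epsilon> n * (1 + real CARD('x letter))"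
    unfolding ip by (rule allI) (rule approximate_minimiser[OF t eps])
  from choice[OF this] obtain r where R: "ALL n. comm_word_trace (r n) & (ALL g h. cmod (r n [g, h] - r n [g] * r n [h]) <= 2 * \<epsilon> n)
    & (\<Sum>g\<in>UNIV. \<Sum>h\<in>UNIV. Re (q g h * r n [g, h])) <= d \<bullet> ?p + \<epsilon> n * (1 + real CARD('x letter))" by (elim exE)
  note r = conjunct1[OF spec[OF R]] conjunct1[OF conjunct2[OF spec[OF R]], rule_format] conjunct2[OF conjunct2[OF spec[OF R]]]
  define v where "v n = (\<chi> g. r n [g])" for n
  have "bounded (range v)"
  proof (rule boundedI)
    fix e assume "e \<in> range v"
    then obtain n where e: "e = v n" by blast
    interpret comm_word_trace "r n" by (rule r(1))
    have "(\<Sum>g\<in>UNIV. norm (e $ g)) <= (\<Sum>g\<in>(UNIV :: 'x letter set). 1)" by (intro sum_mono) (simp add: e v_def t_letter_bound)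
    moreover have "norm e <= (\<Sum>g\<in>UNIV. norm (e $ g))" unfolding norm_vec_def by (rule L2_set_le_sum) simp
    ultimately show "norm e <= real CARD('x letter)" by simp
  qed
  then obtain l \<rho> where \<rho>: "strict_mono \<rho>" "(v \<circ> \<rho>) \<longlonglongrightarrow> l" using bounded_imp_convergent_subsequence by blast
  have lim: "(%n. r (\<rho> n) [g]) \<longlonglongrightarrow> l $ g" for g
    using tendsto_vec_nth[OF \<rho>(2), of g] by (simp add: v_def o_def)
  have e0: "(%n. \<epsilon> (\<rho> n)) \<longlonglongrightarrow> 0"
    using LIMSEQ_subseq_LIMSEQ[OF LIMSEQ_inverse_real_of_nat \<rho>(1)] by (simp add: \<epsilon>_def[abs_def] o_def inverse_eq_divide)
  have lim2: "(%n. r (\<rho> n) [g, h]) \<longlonglongrightarrow> l $ g * l $ h" for g h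
  proof -
    have "(%n. 2 * \<epsilon> (\<rho> n)) \<longlonglongrightarrow> 0" using tendsto_mult_right_zero[OF e0] .
    then have "(%n. r (\<rho> n) [g, h] - r (\<rho> n) [g] * r (\<rho> n) [h]) \<longlonglongrightarrow> 0"
      by (rule Lim_null_comparison[rotated]) (use r(2) in simp)
    from tendsto_add[OF this tendsto_mult[OF lim[of g] lim[of h]]] show ?thesis by simp
  qed
  have "character (($) l)" unfolding character_def
  proof (intro conjI allI)
    fix g
    have "r n [gstar g] = cnj (r n [g])" for n
    proof -
      interpret comm_word_trace "r n" by (rule r(1))
      show ?thesis using t_wstar[of "[g]"] by simp
    qed
    then show "l $ gstar g = cnj (l $ g)" using LIMSEQ_unique[OF lim[of "gstar g"]] tendsto_cnj[OF lim[of g]] by simp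
  next
    fix x x'
    have "(\<Sum>a\<in>UNIV. r n [(x, x', a, a)]) = (if x = x' then 1 else 0)" for n
    proof -
      interpret comm_word_trace "r n" by (rule r(1))
      show ?thesis using t_isometry[of "[]" x x' "[]"] by (simp add: t_one)
    qed
    moreover have "(%n. \<Sum>a\<in>UNIV. r (\<rho> n) [(x, x', a, a)]) \<longlonglongrightarrow> (\<Sum>a\<in>UNIV. l $ (x, x', a, a))" by (intro tendsto_sum lim)
    ultimately show "(\<Sum>a\<in>UNIV. l $ (x, x', a, a)) = (if x = x' then 1 else 0)" by (simp add: LIMSEQ_const_iff)
  next
    fix y b c y' a b'
    have "(\<Sum>x\<in>UNIV. r n [(y, x, b, c), (x, y', a, b')]) = (if c = a then r n [(y, y', b, b')] else 0)" for n
    proof -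
      interpret comm_word_trace "r n" by (rule r(1))
      show ?thesis using t_coisometry[of "[]" y b c y' a b' "[]"] by simp
    qed
    moreover have "(%n. \<Sum>x\<in>UNIV. r (\<rho> n) [(y, x, b, c), (x, y', a, b')]) \<longlonglongrightarrow> (\<Sum>x\<in>UNIV. l $ (y, x, b, c) * l $ (x, y', a, b'))"
      by (intro tendsto_sum lim2)
    ultimately have "(%n. if c = a then r (\<rho> n) [(y, y', b, b')] else 0) \<longlonglongrightarrow> (\<Sum>x\<in>UNIV. l $ (y, x, b, c) * l $ (x, y', a, b'))" by simp
    moreover have "(%n. if c = a then r (\<rho> n) [(y, y', b, b')] else 0) \<longlonglongrightarrow> (if c = a then l $ (y, y', b, b') else 0)"
      using lim by simp
    ultimately show "(\<Sum>x\<in>UNIV. l $ (y, x, b, c) * l $ (x, y', a, b')) = (if c = a then l $ (y, y', b, b') else 0)" by (rule LIMSEQ_unique)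
  qed
  then have "moment l \<in> convex hull ?A" by (intro hull_inc) (auto simp: character_set_def)
  then have "b < d \<bullet> moment l" by (rule d(2))
  also have "d \<bullet> moment l = (\<Sum>g\<in>UNIV. \<Sum>h\<in>UNIV. Re (q g h * (l $ g * l $ h)))" unfolding moment_def by (rule ip)
  also have "\<dots> <= d \<bullet> ?p + 0 * (1 + real CARD('x letter))"
  proof (rule LIMSEQ_le)
    show "(%n. \<Sum>g\<in>UNIV. \<Sum>h\<in>UNIV. Re (q g h * r (\<rho> n) [g, h])) \<longlonglongrightarrow> (\<Sum>g\<in>UNIV. \<Sum>h\<in>UNIV. Re (q g h * (l $ g * l $ h)))"
      by (intro tendsto_intros lim2)
    show "(%n. d \<bullet> ?p + \<epsilon> (\<rho> n) * (1 + real CARD('x letter))) \<longlonglongrightarrow> d \<bullet> ?p + 0 * (1 + real CARD('x letter))"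
      by (intro tendsto_intros e0)
    show "EX N. \<forall>n\<ge>N. (\<Sum>g\<in>UNIV. \<Sum>h\<in>UNIV. Re (q g h * r (\<rho> n) [g, h])) <= d \<bullet> ?p + \<epsilon> (\<rho> n) * (1 + real CARD('x letter))"
      using r(3) by blast
  qed
  finally show False using d(1) by simp
qed

section \<open>Channels of characters and local correlations\<close>

definition char_channel :: "('x::finite letter => complex) => 'x cmat => 'x cmat" where
  "char_channel e A = (\<chi> a a'. \<Sum>x\<in>UNIV. \<Sum>x'\<in>UNIV. A $ x $ x' * e (x, x', a, a'))"

text \<open>For fixed \<open>c\<close>, the matrices \<open>(e (z, x, c, a))\<close> indexed by \<open>z\<close> form a Kraus decomposition.\<close>

lemma quantum_channel_character:
  assumes "character e" shows "quantum_channel (char_channel e)"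
  unfolding quantum_channel_def
proof (intro conjI allI)
  show "clinear_mat (char_channel e)" unfolding clinear_mat_def
    by (auto simp: char_channel_def cscale_def vec_eq_iff distrib_right sum.distrib sum_distrib_left mult.assoc)
  show "trace (char_channel e A) = trace A" for A
  proof -
    have "trace (char_channel e A) = (\<Sum>a\<in>UNIV. \<Sum>x\<in>UNIV. \<Sum>x'\<in>UNIV. A $ x $ x' * e (x, x', a, a))"
      by (simp add: trace_def char_channel_def)
    also have "\<dots> = (\<Sum>x\<in>UNIV. \<Sum>x'\<in>UNIV. \<Sum>a\<in>UNIV. A $ x $ x' * e (x, x', a, a))"
      by (subst sum.swap) (intro sum.cong refl sum.swap)
    also have "\<dots> = trace A" by (simp add: trace_def characterD(3)[OF assms] if_distrib flip: sum_distrib_left cong: if_cong)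
    finally show ?thesis .
  qed
  show "completely_positive (char_channel e)" unfolding completely_positive_def
  proof (intro allI impI)
    fix n and R :: "nat => nat => 'a cmat"
    assume R: "block_psd n R"
    show "block_psd n (%i j. char_channel e (R i j))" unfolding block_psd_def
    proof
      fix v :: "nat => complex^'a"
      define c :: 'a where "c = undefined"
      define w where "w z i = (\<chi> x. \<Sum>a\<in>UNIV. e (z, x, c, a) * v i $ a)" for z i
      have kr: "e (x, x', a, a') = (\<Sum>z\<in>UNIV. cnj (e (z, x, c, a)) * e (z, x', c, a'))" for x x' a a'
      proof -
        have "cnj (e (z, x, c, a)) = e (x, z, a, c)" for z by (rule characterD(2)[OF assms, symmetric])
        then show ?thesis by (simp add: characterD(4)[OF assms])
      qed
      have ci: "cinner (char_channel e (R i j) *v v j) (v i) = (\<Sum>z\<in>UNIV. cinner (R i j *v w z j) (w z i))" for i j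
      proof -
        have "(\<Sum>z\<in>UNIV. cinner (R i j *v w z j) (w z i)) =
            (\<Sum>z\<in>UNIV. \<Sum>x\<in>UNIV. \<Sum>x'\<in>UNIV. \<Sum>a'\<in>UNIV. \<Sum>a\<in>UNIV. R i j $ x $ x' * (cnj (e (z, x, c, a)) * e (z, x', c, a')) * v j $ a' * cnj (v i $ a))"
          by (simp add: cinner_def matrix_vector_mult_def w_def sum_distrib_left sum_distrib_right mult_ac)
        also have "\<dots> = (\<Sum>z\<in>UNIV. \<Sum>p\<in>UNIV. R i j $ fst p $ fst (snd p) * (cnj (e (z, fst p, c, snd (snd (snd p)))) * e (z, fst (snd p), c, fst (snd (snd p)))) * v j $ fst (snd (snd p)) * cnj (v i $ snd (snd (snd p))))"
          by (simp add: sum_UNIV_pair)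
        also have "\<dots> = (\<Sum>p\<in>UNIV. \<Sum>z\<in>UNIV. R i j $ fst p $ fst (snd p) * (cnj (e (z, fst p, c, snd (snd (snd p)))) * e (z, fst (snd p), c, fst (snd (snd p)))) * v j $ fst (snd (snd p)) * cnj (v i $ snd (snd (snd p))))"
          by (rule sum.swap)
        also have "\<dots> = (\<Sum>p\<in>UNIV. R i j $ fst p $ fst (snd p) * e (fst p, fst (snd p), snd (snd (snd p)), fst (snd (snd p))) * v j $ fst (snd (snd p)) * cnj (v i $ snd (snd (snd p))))"
          unfolding kr[of "fst _"] by (simp add: sum_distrib_left sum_distrib_right)
        also have "\<dots> = (\<Sum>q\<in>UNIV. \<Sum>r\<in>UNIV. R i j $ fst q $ snd q * e (fst q, snd q, snd r, fst r) * v j $ fst r * cnj (v i $ snd r))"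
          by (simp add: sum_UNIV_pair)
        also have "\<dots> = (\<Sum>r\<in>UNIV. \<Sum>q\<in>UNIV. R i j $ fst q $ snd q * e (fst q, snd q, snd r, fst r) * v j $ fst r * cnj (v i $ snd r))"
          by (rule sum.swap)
        also have "\<dots> = (\<Sum>a'\<in>UNIV. \<Sum>a\<in>UNIV. \<Sum>x\<in>UNIV. \<Sum>x'\<in>UNIV. R i j $ x $ x' * e (x, x', a, a') * v j $ a' * cnj (v i $ a))"
          by (simp add: sum_UNIV_pair)
        also have "\<dots> = (\<Sum>a\<in>UNIV. \<Sum>a'\<in>UNIV. \<Sum>x\<in>UNIV. \<Sum>x'\<in>UNIV. R i j $ x $ x' * e (x, x', a, a') * v j $ a' * cnj (v i $ a))"
          by (rule sum.swap)
        finally show ?thesis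
          by (simp add: cinner_def matrix_vector_mult_def char_channel_def sum_distrib_right)
      qed
      have "(\<Sum>i<n. \<Sum>j<n. cinner (char_channel e (R i j) *v v j) (v i)) = (\<Sum>i<n. \<Sum>z\<in>UNIV. \<Sum>j<n. cinner (R i j *v w z j) (w z i))"
        unfolding ci by (intro sum.cong refl sum.swap)
      also have "\<dots> = (\<Sum>z\<in>UNIV. \<Sum>i<n. \<Sum>j<n. cinner (R i j *v w z j) (w z i))" by (rule sum.swap)
      finally have s: "(\<Sum>i<n. \<Sum>j<n. cinner (char_channel e (R i j) *v v j) (v i)) = (\<Sum>z\<in>UNIV. \<Sum>i<n. \<Sum>j<n. cinner (R i j *v w z j) (w z i))" .
      define r where "r z = (\<Sum>i<n. \<Sum>j<n. cinner (R i j *v w z j) (w z i))" for z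
      have "r z \<in> \<real>\<^sub>\<ge>\<^sub>0" for z using R unfolding block_psd_def r_def by (rule spec[of _ "w z"])
      then show "(\<Sum>i<n. \<Sum>j<n. cinner (char_channel e (R i j) *v v j) (v i)) \<in> \<real>\<^sub>\<ge>\<^sub>0"
        unfolding s r_def[symmetric] by (auto simp: complex_nonneg_Reals_iff intro!: sum_nonneg)
    qed
  qed
qed

lemma char_channel_unit: "char_channel e (mat_unit p p') $ a $ a' = e (p, p', a, a')"
proof -
  have "mat_unit p p' $ x $ x' * e (x, x', a, a') = (if x' = p' then if x = p then e (p, p', a, a') else 0 else 0)" for x x'
    by (auto simp: mat_unit_def)
  then show ?thesis by (simp add: char_channel_def)
qed

lemma character_cnj: assumes "character e" shows "character (%g. cnj (e g))"
proof -
  have "(\<Sum>a\<in>UNIV. cnj (e (x, x', a, a))) = (if x = x' then 1 else 0)" for x x'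
    using arg_cong[where f = cnj, OF characterD(3)[OF assms, of x x']] by simp
  moreover have "(\<Sum>x\<in>UNIV. cnj (e (y, x, b, c)) * cnj (e (x, y', a, b'))) = (if c = a then cnj (e (y, y', b, b')) else 0)" for y b c y' a b'
    using arg_cong[where f = cnj, OF characterD(4)[OF assms, of y b c y' a b']] by simp
  moreover have "cnj (e (gstar g)) = cnj (cnj (e g))" for g by (rule arg_cong[OF characterD(1)[OF assms]])
  ultimately show ?thesis unfolding character_def by blast
qed

text \<open>The second moments are a convex combination of moments of characters, and each such
  moment splits into a product of channels. The second letter is (y', y, b', b), the adjoint of (y,
  y', b, b'), which is why \<open>\<Psi>\<close> is built from the conjugate character.\<close>

lemma local_of_comm_trace:
  fixes \<Gamma> :: "('x::finite \<times> 'x) cmat => ('x \<times> 'x) cmat"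
  assumes t: "word_trace t" "comm_trace t" "word_represents t \<Gamma>" and lin: "clinear_mat \<Gamma>"
  shows "local_correlation \<Gamma>"
proof -
  have "comm_word_trace t" using t by (simp add: comm_word_trace_def comm_word_trace_axioms_def)
  then have "(\<chi> g h. t [g, h]) \<in> convex hull (moment ` character_set)" by (rule comm_word_trace_moments)
  then obtain n :: nat and w f where w: "\<forall>i\<in>{1..n}. 0 <= w i & f i \<in> moment ` (character_set :: (complex ^ 'x letter) set)"
    "sum w {1..n} = 1" "(\<Sum>i = 1..n. w i *\<^sub>R f i) = (\<chi> g h. t [g, h])"
    unfolding convex_hull_indexed by blast
  have "\<forall>i\<in>{1..n}. EX e. character e & (ALL g h. f i $ g $ h = e g * e h)"
  proof
    fix i assume "i \<in> {1..n}"
    then obtain e where "e \<in> character_set" "f i = moment e" using w(1) by blast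
    then show "EX e. character e & (ALL g h. f i $ g $ h = e g * e h)"
      by (intro exI[of _ "($) e"]) (simp add: character_set_def moment_def)
  qed
  then obtain e where e: "!!i. i \<in> {1..n} ==> character (e i)" "!!i g h. i \<in> {1..n} ==> f i $ g $ h = e i g * e i h" by metis
  \<comment> \<open>The convex combination is indexed from 1 and \<open>local_correlation\<close>
    from 0, hence \<open>Suc\<close>.\<close>
  have val: "t [g, h] = (\<Sum>i<n. of_real (w (Suc i)) * (e (Suc i) g * e (Suc i) h))" for g h
  proof -
    have "t [g, h] = (\<Sum>i = 1..n. w i *\<^sub>R f i) $ g $ h" unfolding w(3) by simp
    also have "\<dots> = (\<Sum>i = 1..n. of_real (w i) * (e i g * e i h))" using e(2) by (simp add: scaleR_conv_of_real[where 'a = complex])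
    also have "\<dots> = (\<Sum>i<n. of_real (w (Suc i)) * (e (Suc i) g * e (Suc i) h))"
      by (rule sum.reindex_bij_witness[of _ Suc "%i. i - 1"]) auto
    finally show ?thesis .
  qed
  define \<Phi> where "\<Phi> i = char_channel (e (Suc i))" for i
  define \<Psi> where "\<Psi> i = char_channel (%g. cnj (e (Suc i) g))" for i
  have ch: "quantum_channel (\<Phi> i)" "quantum_channel (\<Psi> i)" if "i < n" for i
    using that e(1)[of "Suc i"] by (auto simp: \<Phi>_def \<Psi>_def intro!: quantum_channel_character character_cnj)
  have unit: "\<Gamma> (kron (mat_unit x x') (mat_unit y y')) = (\<Sum>i<n. cscale (of_real (w (Suc i))) (kron (\<Phi> i (mat_unit x x')) (\<Psi> i (mat_unit y y'))))" for x x' y y'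
  proof -
    have cn: "e (Suc i) (y', y, b', b) = cnj (e (Suc i) (y, y', b, b'))" if "i < n" for i b b'
      by (rule characterD(2)[OF e(1)]) (use that in simp)
    have "\<Gamma> (kron (mat_unit x x') (mat_unit y y')) $ (a, b) $ (a', b') =
        (\<Sum>i<n. cscale (of_real (w (Suc i))) (kron (\<Phi> i (mat_unit x x')) (\<Psi> i (mat_unit y y')))) $ (a, b) $ (a', b')" for a b a' b'
      using t(3) unfolding word_represents_iff by (simp add: val cn cscale_def kron_def \<Phi>_def \<Psi>_def char_channel_unit)
    then show ?thesis by (simp add: vec_eq_iff)
  qed
  have sc: "\<Gamma> (cscale c A) = cscale c (\<Gamma> A)" for c A using lin by (auto simp: clinear_mat_def)
  have csum: "cscale c (\<Sum>i\<in>I. A i) = (\<Sum>i\<in>I. cscale c (A i))" for c I and A :: "nat => ('x \<times> 'x) cmat"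
    by (simp add: cscale_def vec_eq_iff sum_distrib_left)
  have csum4: "cscale c (\<Sum>i\<in>I. A i) = (\<Sum>i\<in>I. cscale c (A i))" for c and I :: "'x set" and A :: "'x => ('x \<times> 'x) cmat"
    by (simp add: cscale_def vec_eq_iff sum_distrib_left)
  have cc: "cscale c (cscale d A) = cscale d (cscale c A)" for c d and A :: "('x \<times> 'x) cmat" by (simp add: cscale_def vec_eq_iff)
  have "\<Gamma> W = (\<Sum>i<n. cscale (of_real (w (Suc i))) (channel_tensor (\<Phi> i) (\<Psi> i) W))" for W
  proof -
    have "\<Gamma> W = (\<Sum>x\<in>UNIV. \<Sum>x'\<in>UNIV. \<Sum>y\<in>UNIV. \<Sum>y'\<in>UNIV. cscale (W $ (x, y) $ (x', y')) (\<Gamma> (kron (mat_unit x x') (mat_unit y y'))))"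
      by (subst expand_mat_units[of W]) (simp add: clinear_mat_sum[OF lin] sc)
    also have "\<dots> = (\<Sum>p\<in>UNIV. \<Sum>i<n. cscale (of_real (w (Suc i))) (cscale (W $ (fst p, fst (snd (snd p))) $ (fst (snd p), snd (snd (snd p))))
        (kron (\<Phi> i (mat_unit (fst p) (fst (snd p)))) (\<Psi> i (mat_unit (fst (snd (snd p))) (snd (snd (snd p))))))))"
      by (simp add: sum_UNIV_pair unit csum cc)
    also have "\<dots> = (\<Sum>i<n. \<Sum>p\<in>UNIV. cscale (of_real (w (Suc i))) (cscale (W $ (fst p, fst (snd (snd p))) $ (fst (snd p), snd (snd (snd p))))
        (kron (\<Phi> i (mat_unit (fst p) (fst (snd p)))) (\<Psi> i (mat_unit (fst (snd (snd p))) (snd (snd (snd p))))))))"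
      by (rule sum.swap)
    finally show ?thesis by (simp add: sum_UNIV_pair channel_tensor_def csum4)
  qed
  moreover have "0 <= w (Suc i)" if "i < n" for i using w(1) that by simp
  moreover have "(\<Sum>i<n. w (Suc i)) = 1"
    unfolding w(2)[symmetric] by (rule sum.reindex_bij_witness[of _ "%i. i - 1" Suc]) auto
  ultimately show ?thesis unfolding local_correlation_def using ch
    by (intro exI[of _ n] exI[of _ "%i. w (Suc i)"] exI[of _ \<Phi>] exI[of _ \<Psi>]) blast
qed

section \<open>The equivalences for the three classes of strategies\<close>

theorem corollary4p4:
  fixes \<phi> \<Gamma> :: "('x::finite \<times> 'x) cmat \<Rightarrow> ('x \<times> 'x) cmat"
    and B :: "'c cstar" and u :: "'x \<Rightarrow> 'x \<Rightarrow> 'c"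
    and emb :: "(nat \<Rightarrow> complex) \<Rightarrow> 'h"
  assumes "inj emb"
    and "brown_algebra TYPE('h \<Rightarrow> 'h) B u"
    and "quantum_game \<phi>" and "concurrent \<phi>"
    and "qns_correlation \<Gamma>"
  defines "C \<equiv> brown_sub B u" and "p \<equiv> brown_p B u"
  shows "(perfect_strategy \<phi> \<Gamma> \<and> quantum_commuting TYPE('h) \<Gamma> \<longleftrightarrow>
           (\<exists>\<tau>. tracial_state C \<tau> \<and> trace_represents C p \<tau> \<Gamma> \<and> trace_perfect C p \<tau> \<phi>))
       \<and> (perfect_strategy \<phi> \<Gamma> \<and> quantum_correlation TYPE('h) \<Gamma> \<longleftrightarrow>
           (\<exists>\<tau>. tracial_state C \<tau> \<and> factors_finite_dim TYPE('h \<Rightarrow> 'h) C \<tau>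
              \<and> trace_represents C p \<tau> \<Gamma> \<and> trace_perfect C p \<tau> \<phi>))
       \<and> (perfect_strategy \<phi> \<Gamma> \<and> local_correlation \<Gamma> \<longleftrightarrow>
           (\<exists>\<tau>. tracial_state C \<tau> \<and> factors_abelian TYPE('h \<Rightarrow> 'h) C \<tau>
              \<and> trace_represents C p \<tau> \<Gamma> \<and> trace_perfect C p \<tau> \<phi>))"
proof -
  interpret W: brown B u using assms(2) by (simp add: brown_def brown_algebra_def)
  have lin: "clinear_mat \<Gamma>" using assms(5) by (simp add: qns_correlation_def quantum_channel_def)
  \<comment> \<open>For a trace that represents \<Gamma> the two notions of perfectness agree by
    \<open>state_gamma_map_transpose\<close>, so only the representation of \<Gamma> remains to be
    compared.\<close>
  have perf: "trace_perfect C p \<tau> \<phi> \<longleftrightarrow> perfect_strategy \<phi> \<Gamma>"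
    if "tracial_state C \<tau>" "trace_represents C p \<tau> \<Gamma>" for \<tau>
    using state_gamma_map_transpose[OF W.cstar_C, of \<tau> "brown_p B u" \<Gamma>] that lin
    unfolding trace_perfect_def perfect_strategy_def C_def p_def by simp
  \<comment> \<open>Concurrence enters here, as the maximality that \<open>commuting_pair\<close>
    requires.\<close>
  have total: "(\<Sum>(x, x', a, a')\<in>UNIV. \<Gamma> (kron (mat_unit x x') (mat_unit x x')) $ (a, a) $ (a', a')) = (of_nat CARD('x))\<^sup>2"
    if "perfect_strategy \<phi> \<Gamma>" by (rule total_of_perfect[OF that assms(4,5)])
  have W1: "word_trace (%w. \<tau> (W.pword w))" "word_represents (%w. \<tau> (W.pword w)) \<Gamma>"
    if "tracial_state C \<tau>" "trace_represents C p \<tau> \<Gamma>" for \<tau>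
    using that W.word_trace_tau W.word_represents_tau by (auto simp: C_def p_def)
  have T: "\<exists>\<tau>. tracial_state C \<tau> & trace_represents C p \<tau> \<Gamma> & (finite_rank t --> factors_finite_dim TYPE('h => 'h) C \<tau>)
      & (comm_trace t --> factors_abelian TYPE('h => 'h) C \<tau>)"
    if "word_trace t" "word_represents t \<Gamma>" for t
    using trace_of_word_trace[OF assms(1,2) that] unfolding C_def p_def by metis
  show ?thesis
  proof (intro conjI iffI)
    assume a: "perfect_strategy \<phi> \<Gamma> & quantum_commuting TYPE('h) \<Gamma>"
    obtain t where "word_trace t" "word_represents t \<Gamma>"
      using word_trace_of_quantum_commuting[of \<Gamma>, OF _ total] a by blast
    then show "\<exists>\<tau>. tracial_state C \<tau> & trace_represents C p \<tau> \<Gamma> & trace_perfect C p \<tau> \<phi>" using T[of t] perf a by blast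
  next
    assume a: "perfect_strategy \<phi> \<Gamma> & quantum_correlation TYPE('h) \<Gamma>"
    obtain t where "word_trace t" "finite_rank t" "word_represents t \<Gamma>"
      using word_trace_of_quantum[of \<Gamma>, OF _ total] a by blast
    then show "\<exists>\<tau>. tracial_state C \<tau> & factors_finite_dim TYPE('h => 'h) C \<tau> & trace_represents C p \<tau> \<Gamma> & trace_perfect C p \<tau> \<phi>"
      using T[of t] perf a by blast
  next
    assume a: "perfect_strategy \<phi> \<Gamma> & local_correlation \<Gamma>"
    obtain t where "word_trace t" "comm_trace t" "word_represents t \<Gamma>"
      using word_trace_of_local[of \<Gamma>, OF _ total] a by blast
    then show "\<exists>\<tau>. tracial_state C \<tau> & factors_abelian TYPE('h => 'h) C \<tau> & trace_represents C p \<tau> \<Gamma> & trace_perfect C p \<tau> \<phi>"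
      using T[of t] perf a by blast
  next
    assume "\<exists>\<tau>. tracial_state C \<tau> & trace_represents C p \<tau> \<Gamma> & trace_perfect C p \<tau> \<phi>"
    then obtain \<tau> where t: "tracial_state C \<tau>" "trace_represents C p \<tau> \<Gamma>" "trace_perfect C p \<tau> \<phi>" by blast
    show "perfect_strategy \<phi> \<Gamma>" using perf[OF t(1,2)] t(3) by simp
    show "quantum_commuting TYPE('h) \<Gamma>" by (rule quantum_commuting_of_word_trace[OF assms(1) W1[OF t(1,2)]])
  next
    assume "\<exists>\<tau>. tracial_state C \<tau> & factors_finite_dim TYPE('h => 'h) C \<tau> & trace_represents C p \<tau> \<Gamma> & trace_perfect C p \<tau> \<phi>"
    then obtain \<tau> where t: "tracial_state C \<tau>" "trace_represents C p \<tau> \<Gamma>" "trace_perfect C p \<tau> \<phi>"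
      and f: "factors_finite_dim TYPE('h => 'h) C \<tau>" by blast
    show "perfect_strategy \<phi> \<Gamma>" using perf[OF t(1,2)] t(3) by simp
    show "quantum_correlation TYPE('h) \<Gamma>"
      by (rule quantum_of_finite_rank[OF assms(1) W1(1)[OF t(1,2)] W.finite_rank_tau W1(2)[OF t(1,2)]]) (use t f in \<open>simp_all add: C_def\<close>)
  next
    assume "\<exists>\<tau>. tracial_state C \<tau> & factors_abelian TYPE('h => 'h) C \<tau> & trace_represents C p \<tau> \<Gamma> & trace_perfect C p \<tau> \<phi>"
    then obtain \<tau> where t: "tracial_state C \<tau>" "trace_represents C p \<tau> \<Gamma>" "trace_perfect C p \<tau> \<phi>"
      and f: "factors_abelian TYPE('h => 'h) C \<tau>" by blast
    show "perfect_strategy \<phi> \<Gamma>" using perf[OF t(1,2)] t(3) by simp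
    show "local_correlation \<Gamma>"
      by (rule local_of_comm_trace[OF W1(1)[OF t(1,2)] W.comm_trace_tau W1(2)[OF t(1,2)] lin]) (use t f in \<open>simp_all add: C_def\<close>)
  qed
qed

end
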